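(* Let $\alpha>0$, and let $\mathbb{B}\subset\mathbb{C}^n$ be the unit ball with the complex hyperbolic metric $h_{j\bar k}=-\partial_j\partial_{\bar k}\log(1-|z|^2)$ and the weight function $\psi(z)=\frac{\alpha}{1-|z|^2}$. Then $\widetilde\Box_1$ has a bounded inverse $\widetilde N_1$, which is a compact operator on $A^2_{(1,0)}(\mathbb{B},h,e^{-\psi})$; the spectrum of $\widetilde\Box_1$ is $\{\alpha k: k=1,2,3,\dots\}$, where each eigenvalue $\alpha k$ has multiplicity $n\binom{n+k-2}{n-1}$. In addition, $$\|\widetilde N_1u\|\leqslant\frac1\alpha\|u\|$$ for each $u\in A^2_{(1,0)}(\mathbb{B},h,e^{-\psi})$. Consequently, if $\eta=\sum_j\eta_j\,dz^j\in A^2_{(1,0)}(\mathbb{B},h,e^{-\psi})$ with $\partial\eta=0$, then $f:=\partial^{\ast}\widetilde N_1\eta$ is the canonical solution of $\partial f=\eta$, i.e. $\partial f=\eta$ and $f\in(\ker\partial)^\perp$. Moreover, $$\int_{\mathbb{B}}|f|^2(1-|z|^2)^{-n-1}\exp\Bigl(-\frac{\alpha}{1-|z|^2}\Bigr)d\lambda\leqslant\frac1\alpha\int_{\mathbb{B}}\Bigl[\sum_{j=1}^n|\eta_j|^2-\sum_{j,k=1}^n\eta_j\overline{\eta_k}z^j\bar z^k\Bigr](1-|z|^2)^{-n}\exp\Bigl(-\frac{\alpha}{1-|z|^2}\Bigr)d\lambda.$$ The constant $\alpha^{-1}$ on the right-hand side is sharp. Equality occurs if and only if the $\eta_j$'s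 are constants.
   Context: Explicitly $h_{j\bar k}=(1-|z|^2)^{-1}\delta_{jk}+(1-|z|^2)^{-2}\bar z^jz^k$ on $\mathbb{B}=\{z\in\mathbb{C}^n:|z|<1\}$; with $[h^{j\bar k}]$ the transpose of the inverse of $[h_{j\bar k}]$, $h^{j\bar k}=(1-|z|^2)(\delta_{jk}-z^j\bar z^k)$. The pointwise inner product on $(1,0)$-forms is $\langle u,v\rangle_h=h^{j\bar k}u_j\overline{v_k}$, and it is extended to $(p,0)$-forms in the usual way. $d\lambda$ is Lebesgue measure and $e^{-\psi}d\mathrm{vol}_h=(1-|z|^2)^{-n-1}\exp(-\frac{\alpha}{1-|z|^2})\,d\lambda$. $A^2_{(p,0)}(\mathbb{B},h,e^{-\psi})$ is the Hilbert space of $(p,0)$-forms $u=\sum'_{|J|=p}u_Jdz^J$ with holomorphic coefficients and $\|u\|^2=\int_{\mathbb{B}}|u|_h^2e^{-\psi}d\mathrm{vol}_h<\infty$ (for $p=0$, functions). The operator $\partial=\partial_p$, $\partial u=\sum'_{J}\sum_j\frac{\partial u_J}{\partial z_j}dz^j\wedge dz^J$, is the (densely defined) operator $A^2_{(p,0)}\to A^2_{(p+1,0)}$ with domain $\{u\in A^2_{(p,0)}:\partial u\in A^2_{(p+1,0)}\}$, and $\partial^{\ast}$ denotes its Hilbert space adjoint $A^2_{(p+1,0)}\to A^2_{(p,0)}$. The complex Laplacian on $(1,0)$-forms is $\widetilde\Box_1=\partial\partial^{\ast}+\partial^{\ast}\partial$, acting on $A^2_{(1,0)}(\mathbb{B},h,e^{-\psi})$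 with domain $\{u\in\operatorname{dom}(\partial)\cap\operatorname{dom}(\partial^{\ast}):\partial u\in\operatorname{dom}(\partial^{\ast}),\ \partial^{\ast}u\in\operatorname{dom}(\partial)\}$. In "$f\in(\ker\partial)^\perp$", $\partial$ is the operator $\partial_0$ on functions and the orthogonal complement is in $A^2_{(0,0)}(\mathbb{B},h,e^{-\psi})$. *)

theory Defs
  imports
    "HOL-Analysis.Analysis"
    "HOL-Combinatorics.Permutations"
    "HOL-Library.Function_Algebras"
begin

section \<open>Wirtinger derivatives and holomorphic functions on complex n-space\<close>

definition dz :: "'n::finite \<Rightarrow> (complex^'n \<Rightarrow> complex) \<Rightarrow> complex^'n \<Rightarrow> complex" where
  "dz j f z = (frechet_derivative f (at z) (axis j 1) - \<i> * frechet_derivative f (at z) (axis j \<i>)) / 2"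

definition dzbar :: "'n::finite \<Rightarrow> (complex^'n \<Rightarrow> complex) \<Rightarrow> complex^'n \<Rightarrow> complex" where
  "dzbar j f z = (frechet_derivative f (at z) (axis j 1) + \<i> * frechet_derivative f (at z) (axis j \<i>)) / 2"

definition holomorphic_cn :: "(complex^'n::finite \<Rightarrow> complex) \<Rightarrow> (complex^'n) set \<Rightarrow> bool" where
  "holomorphic_cn f S \<longleftrightarrow>
     (\<forall>z\<in>S. \<exists>D. (f has_derivative D) (at z) \<and> (\<forall>c v. D (c *s v) = c * D v))"

section \<open>The complex hyperbolic metric\<close>

definition hyp_metric :: "complex^'n::finite \<Rightarrow> complex^'n^'n" where
  "hyp_metric z = (\<chi> j k. - dz j (dzbar k (\<lambda>w. complex_of_real (ln (1 - (norm w)\<^sup>2)))) z)"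

definition hyp_cometric :: "complex^'n::finite \<Rightarrow> complex^'n^'n" where
  "hyp_cometric z = transpose (matrix_inv (hyp_metric z))"

lemma dz_dzbar_eqI:
  assumes "(f has_derivative D) (at z)"
  shows "dz j f z = (D (axis j 1) - \<i> * D (axis j \<i>)) / 2"
    and "dzbar j f z = (D (axis j 1) + \<i> * D (axis j \<i>)) / 2"
  using frechet_derivative_at[OF assms] by (simp_all add: dz_def dzbar_def)

lemma dzbar_ln_potential:
  fixes z :: "complex^'n::finite"
  assumes "z \<in> ball 0 1"
  shows "dzbar k (\<lambda>w. complex_of_real (ln (1 - (norm w)\<^sup>2))) z
           = - (z $ k) / complex_of_real (1 - (norm z)\<^sup>2)"
proof -
  have pos: "1 - z \<bullet> z > 0"
    using assms by (simp add: dot_square_norm abs_square_less_1)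
  have "((\<lambda>w. complex_of_real (ln (1 - w \<bullet> w))) has_derivative
          (\<lambda>v. complex_of_real (- (2 * (z \<bullet> v)) / (1 - z \<bullet> z)))) (at z)"
    by (rule derivative_eq_intros refl pos | simp add: pos)+
       (auto simp: fun_eq_iff inner_commute field_simps)
  from dz_dzbar_eqI(2)[OF this, of k] show ?thesis
    using pos
    by (simp add: inner_axis dot_square_norm[symmetric] inner_complex_def complex_eq_iff)
       (simp add: field_simps)
qed

lemma hyp_metric_explicit:
  fixes z :: "complex^'n::finite"
  assumes z: "z \<in> ball 0 1"
  shows "hyp_metric z $ j $ k =
           (if j = k then 1 else 0) / complex_of_real (1 - (norm z)\<^sup>2)
           + cnj (z $ j) * (z $ k) / (complex_of_real (1 - (norm z)\<^sup>2))\<^sup>2"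
proof -
  let ?s = "complex_of_real (1 - z \<bullet> z)"
  have pos: "1 - z \<bullet> z > 0"
    using assms by (simp add: dot_square_norm abs_square_less_1)
  then have s0: "?s \<noteq> 0" by (metis of_real_eq_0_iff less_irrefl)
  let ?D = "\<lambda>v. (- (v $ k) * ?s - (z $ k) * complex_of_real (2 * (z \<bullet> v))) / ?s\<^sup>2"
  have 1: "((\<lambda>w. - (w $ k) / complex_of_real (1 - w \<bullet> w)) has_derivative ?D) (at z)"
    using s0
    by (auto intro!: derivative_eq_intros bounded_linear.has_derivative[OF bounded_linear_vec_nth]
        simp: fun_eq_iff inner_commute field_simps power2_eq_square)
       (metis minus_diff_eq minus_divide_left)
  have 2: "(dzbar k (\<lambda>w. complex_of_real (ln (1 - (norm w)\<^sup>2))) has_derivative ?D) (at z)"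
    by (rule has_derivative_transform_within_open[OF 1 open_ball z])
       (simp only: dzbar_ln_potential dot_square_norm)
  have h: "hyp_metric z $ j $ k = - (?D (axis j 1) - \<i> * ?D (axis j \<i>)) / 2"
    unfolding hyp_metric_def using dz_dzbar_eqI(1)[OF 2, of j] by simp
  have ax: "complex_of_real (2 * (z \<bullet> axis j 1)) - \<i> * complex_of_real (2 * (z \<bullet> axis j \<i>)) = 2 * cnj (z $ j)"
    by (simp add: inner_axis inner_complex_def complex_eq_iff)
  have "?D (axis j 1) - \<i> * ?D (axis j \<i>) =
      (- (axis j 1 $ k - \<i> * axis j \<i> $ k) * ?s - (z $ k) *
        (complex_of_real (2 * (z \<bullet> axis j 1)) - \<i> * complex_of_real (2 * (z \<bullet> axis j \<i>)))) / ?s\<^sup>2"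
    by (simp add: field_simps diff_divide_distrib add_divide_distrib)
  also have "\<dots> = (- (if j = k then 2 else 0) * ?s - (z $ k) * (2 * cnj (z $ j))) / ?s\<^sup>2"
    unfolding ax by (simp add: axis_def)
  finally have D: "?D (axis j 1) - \<i> * ?D (axis j \<i>) =
      (- (if j = k then 2 else 0) * ?s - (z $ k) * (2 * cnj (z $ j))) / ?s\<^sup>2" .
  have alg: "- ((- (2 * d) * s - b * (2 * a)) / s\<^sup>2) / 2 = d / s + a * b / s\<^sup>2"
    if "s \<noteq> 0" for a b d s :: complex
    using that by (simp add: divide_simps power2_eq_square)
  have if2: "(if j = k then 2 else 0) = (2 :: complex) * (if j = k then 1 else 0)"
    by simp
  have "hyp_metric z $ j $ k = (if j = k then 1 else 0) / ?s + cnj (z $ j) * z $ k / ?s\<^sup>2"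
    unfolding h unfolding D unfolding if2 by (rule alg[OF s0])
  then show ?thesis
    by (simp only: dot_square_norm)
qed

lemma hyp_cometric_explicit:
  fixes z :: "complex^'n::finite"
  assumes z: "z \<in> ball 0 1"
  shows "hyp_cometric z $ j $ k =
           complex_of_real (1 - (norm z)\<^sup>2) * ((if j = k then 1 else 0) - (z $ j) * cnj (z $ k))"
proof -
  let ?s = "complex_of_real (1 - (norm z)\<^sup>2)"
  have "(norm z)\<^sup>2 < 1" using z by (simp add: abs_square_less_1)
  then have s0: "?s \<noteq> 0" by (metis of_real_eq_0_iff less_irrefl diff_gt_0_iff_gt)
  define B :: "complex^'n^'n" where
    "B = (\<chi> j k. ?s * ((if j = k then 1 else 0) - cnj (z $ j) * (z $ k)))"
  have zz: "(\<Sum>i\<in>UNIV. z $ i * cnj (z $ i)) = 1 - ?s"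
    by (simp add: norm_vec_def L2_set_def sum_nonneg complex_norm_square[symmetric]
        del: of_real_power)
  have alg: "(a / s + p / s\<^sup>2) * (s * (b - q)) = a * b - a * q + p * b / s - p * q / s"
    if "s \<noteq> 0" for a b p q s :: complex
    using that by (simp add: field_simps power2_eq_square)
  have alg2: "a - c + c / s - c / s * (1 - s) = a" if "s \<noteq> 0" for a c s :: complex
    using that by (simp add: field_simps)
  have "hyp_metric z ** B = mat 1"
  proof -
    have "(\<Sum>i\<in>UNIV. hyp_metric z $ j $ i * B $ i $ k) = (if j = k then 1 else 0)" for j k
    proof -
      have "(\<Sum>i\<in>UNIV. hyp_metric z $ j $ i * B $ i $ k) =
        (\<Sum>i\<in>UNIV. (if j = i then (if i = k then 1 else 0) else 0)
          - (if j = i then cnj (z $ i) * z $ k else 0)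
          + (if i = k then cnj (z $ j) * z $ i / ?s else 0)
          - cnj (z $ j) * z $ k / ?s * (z $ i * cnj (z $ i)))"
        by (rule sum.cong[OF refl])
           (simp add: hyp_metric_explicit[OF z] B_def alg[OF s0] del: of_real_diff of_real_power)
      also have "\<dots> = (if j = k then 1 else 0) - cnj (z $ j) * z $ k + cnj (z $ j) * z $ k / ?s
          - cnj (z $ j) * z $ k / ?s * (1 - ?s)"
        by (simp only: sum.distrib sum_subtractf sum_distrib_left[symmetric] zz) simp
      also have "\<dots> = (if j = k then 1 else 0)"
        using alg2[OF s0] .
      finally show ?thesis .
    qed
    then show ?thesis by (simp add: matrix_matrix_mult_def mat_def vec_eq_iff)
  qed
  then have hB: "hyp_metric z ** B = mat 1" and Bh: "B ** hyp_metric z = mat 1"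
    by (rule asm_rl, rule matrix_left_right_inverse[THEN iffD1])
  have uniq: "C = B" if "hyp_metric z ** C = mat 1 \<and> C ** hyp_metric z = mat 1" for C
  proof -
    have "C = (B ** hyp_metric z) ** C" by (simp only: Bh matrix_mul_lid)
    also have "\<dots> = B ** (hyp_metric z ** C)" by (simp only: matrix_mul_assoc)
    also have "\<dots> = B" using that by (simp only: matrix_mul_rid)
    finally show ?thesis .
  qed
  have "matrix_inv (hyp_metric z) = B"
    unfolding matrix_inv_def by (rule some_equality, rule conjI[OF hB Bh], rule uniq)
  then show ?thesis
    by (auto simp: hyp_cometric_def transpose_def B_def)
qed

section \<open>Forms of type (p,0)\<close>

text \<open>A form is given by its coefficients: \<open>u J\<close> is the coefficient of
  \<open>dz\<^bsup>j1\<^esup> \<and> \<dots> \<and> dz\<^bsup>jp\<^esup>\<close> where \<open>j1 < \<dots> < jp\<close> are the elements of \<open>J\<close>. In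
  particular \<open>u {}\<close> is a function and \<open>u {j}\<close> is the coefficient of \<open>dz\<^bsup>j\<^esup>\<close>.\<close>

type_synonym 'n form = "'n set \<Rightarrow> complex^'n \<Rightarrow> complex"

definition form_scale :: "complex \<Rightarrow> 'n::finite form \<Rightarrow> 'n form" where
  "form_scale c u = (\<lambda>J z. c * u J z)"

text \<open>The inner product of \<open>dz\<^sup>J\<close> and \<open>dz\<^sup>K\<close> is the determinant of the matrix of inner
  products of their factors.\<close>

definition gram :: "complex^'n::{finite,linorder} \<Rightarrow> 'n set \<Rightarrow> 'n set \<Rightarrow> complex" where
  "gram z J K = (\<Sum>\<sigma> | \<sigma> permutes {..<card J}. of_int (sign \<sigma>) *
     (\<Prod>a<card J. hyp_cometric z $ (sorted_list_of_set J ! a) $ (sorted_list_of_set K ! \<sigma> a)))"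

definition pointwise_inner :: "'n::{finite,linorder} form \<Rightarrow> 'n form \<Rightarrow> complex^'n::{finite,linorder} \<Rightarrow> complex" where
  "pointwise_inner u v z =
     (\<Sum>J\<in>UNIV. \<Sum>K | card K = card J. gram z J K * u J z * cnj (v K z))"

text \<open>The density of \<open>e\<^bsup>-\<psi>\<^esup> dvol\<^sub>h\<close> with respect to Lebesgue measure, where
  \<open>\<psi> z = \<alpha> / (1 - |z|\<^sup>2)\<close> and \<open>dvol\<^sub>h\<close> has density \<open>det h = (1 - |z|\<^sup>2)\<^bsup>-n-1\<^esup>\<close>.\<close>

definition weight :: "real \<Rightarrow> complex^'n::finite \<Rightarrow> real" where
  "weight \<alpha> z = exp (- (\<alpha> / (1 - (norm z)\<^sup>2))) / (1 - (norm z)\<^sup>2) ^ (CARD('n) + 1)"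

definition form_inner :: "real \<Rightarrow> 'n::{finite,linorder} form \<Rightarrow> 'n form \<Rightarrow> complex" where
  "form_inner \<alpha> u v = (LINT z:ball 0 1|lborel. complex_of_real (weight \<alpha> z) * pointwise_inner u v z)"

definition form_norm :: "real \<Rightarrow> 'n::{finite,linorder} form \<Rightarrow> real" where
  "form_norm \<alpha> u = sqrt (Re (form_inner \<alpha> u u))"

text \<open>Coefficients are normalised to vanish outside the ball, so that equality in \<open>A2\<close> is
  equality of functions.\<close>

definition A2 :: "real \<Rightarrow> nat \<Rightarrow> 'n::{finite,linorder} form set" where
  "A2 \<alpha> p = {u. (\<forall>J z. card J \<noteq> p \<or> z \<notin> ball 0 1 \<longrightarrow> u J z = 0)
     \<and> (\<forall>J. holomorphic_cn (u J) (ball 0 1))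
     \<and> set_integrable lborel (ball 0 1) (\<lambda>z. complex_of_real (weight \<alpha> z) * pointwise_inner u u z)}"

text \<open>The sign comes from \<open>dz\<^sup>j \<and> dz\<^bsup>K - {j}\<^esup> = (-1)\<^sup>m dz\<^sup>K\<close>, where \<open>m\<close> is the number
  of elements of \<open>K\<close> below \<open>j\<close>.\<close>

definition del :: "'n::{finite,linorder} form \<Rightarrow> 'n form" where
  "del u = (\<lambda>K z. if z \<in> ball 0 1
     then \<Sum>j\<in>K. (- 1) ^ card {i \<in> K. i < j} * dz j (u (K - {j})) z else 0)"

section \<open>Operators\<close>

text \<open>Throughout, \<open>H\<close>, \<open>H1\<close>, \<open>H2\<close> are spaces \<open>A2 \<alpha> p\<close>, and an operator is a function
  together with its domain.\<close>

definition adjoint_dom ::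
  "real \<Rightarrow> 'n::{finite,linorder} form set \<Rightarrow> 'n form set \<Rightarrow> 'n form set \<Rightarrow> ('n form \<Rightarrow> 'n form) \<Rightarrow> 'n form set" where
  "adjoint_dom \<alpha> H1 H2 D T =
     {v \<in> H2. \<exists>w\<in>H1. \<forall>u\<in>D. form_inner \<alpha> (T u) v = form_inner \<alpha> u w}"

definition adjoint ::
  "real \<Rightarrow> 'n::{finite,linorder} form set \<Rightarrow> 'n form set \<Rightarrow> ('n form \<Rightarrow> 'n form) \<Rightarrow> 'n form \<Rightarrow> 'n form" where
  "adjoint \<alpha> H1 D T v = (THE w. w \<in> H1 \<and> (\<forall>u\<in>D. form_inner \<alpha> (T u) v = form_inner \<alpha> u w))"

definition bounded_operator_on ::
  "real \<Rightarrow> 'n::{finite,linorder} form set \<Rightarrow> ('n form \<Rightarrow> 'n form) \<Rightarrow> bool" where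
  "bounded_operator_on \<alpha> H T \<longleftrightarrow>
     (\<forall>u\<in>H. T u \<in> H)
     \<and> (\<forall>u\<in>H. \<forall>v\<in>H. T (u + v) = T u + T v)
     \<and> (\<forall>c. \<forall>u\<in>H. T (form_scale c u) = form_scale c (T u))
     \<and> (\<exists>C. \<forall>u\<in>H. form_norm \<alpha> (T u) \<le> C * form_norm \<alpha> u)"

definition compact_operator_on ::
  "real \<Rightarrow> 'n::{finite,linorder} form set \<Rightarrow> ('n form \<Rightarrow> 'n form) \<Rightarrow> bool" where
  "compact_operator_on \<alpha> H T \<longleftrightarrow> bounded_operator_on \<alpha> H T \<and>
     (\<forall>u. (\<forall>i. u i \<in> H) \<and> (\<exists>C. \<forall>i. form_norm \<alpha> (u i) \<le> C) \<longrightarrow>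
       (\<exists>v\<in>H. \<exists>r. strict_mono (r :: nat \<Rightarrow> nat) \<and>
         (\<lambda>i. form_norm \<alpha> (T (u (r i)) - v)) \<longlonglongrightarrow> 0))"

definition resolvent_set ::
  "real \<Rightarrow> 'n::{finite,linorder} form set \<Rightarrow> 'n form set \<Rightarrow> ('n form \<Rightarrow> 'n form) \<Rightarrow> complex set" where
  "resolvent_set \<alpha> H D T = {\<mu>. bij_betw (\<lambda>u. T u - form_scale \<mu> u) D H
     \<and> bounded_operator_on \<alpha> H (the_inv_into D (\<lambda>u. T u - form_scale \<mu> u))}"

definition op_spectrum ::
  "real \<Rightarrow> 'n::{finite,linorder} form set \<Rightarrow> 'n form set \<Rightarrow> ('n form \<Rightarrow> 'n form) \<Rightarrow> complex set" where
  "op_spectrum \<alpha> H D T = - resolvent_set \<alpha> H D T"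

definition eigenspace ::
  "'n::finite form set \<Rightarrow> ('n form \<Rightarrow> 'n form) \<Rightarrow> complex \<Rightarrow> 'n form set" where
  "eigenspace D T \<mu> = {u \<in> D. T u = form_scale \<mu> u}"

lemma vector_space_form_scale: "vector_space (form_scale :: complex \<Rightarrow> 'n::finite form \<Rightarrow> 'n form)"
  by unfold_locales (auto simp: form_scale_def fun_eq_iff algebra_simps)

section \<open>The complex Laplacian\<close>

definition dom_del :: "real \<Rightarrow> nat \<Rightarrow> 'n::{finite,linorder} form set" where
  "dom_del \<alpha> p = {u \<in> A2 \<alpha> p. del u \<in> A2 \<alpha> (p + 1)}"

definition dom_del_adj :: "real \<Rightarrow> nat \<Rightarrow> 'n::{finite,linorder} form set" where
  "dom_del_adj \<alpha> p = adjoint_dom \<alpha> (A2 \<alpha> p) (A2 \<alpha> (p + 1)) (dom_del \<alpha> p) del"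

definition del_adj :: "real \<Rightarrow> nat \<Rightarrow> 'n::{finite,linorder} form \<Rightarrow> 'n form" where
  "del_adj \<alpha> p = adjoint \<alpha> (A2 \<alpha> p) (dom_del \<alpha> p) del"

definition dom_box1 :: "real \<Rightarrow> 'n::{finite,linorder} form set" where
  "dom_box1 \<alpha> = {u \<in> dom_del \<alpha> 1 \<inter> dom_del_adj \<alpha> 0.
     del u \<in> dom_del_adj \<alpha> 1 \<and> del_adj \<alpha> 0 u \<in> dom_del \<alpha> 0}"

definition box1 :: "real \<Rightarrow> 'n::{finite,linorder} form \<Rightarrow> 'n form" where
  "box1 \<alpha> u = del (del_adj \<alpha> 0 u) + del_adj \<alpha> 1 (del u)"

definition N1 :: "real \<Rightarrow> 'n::{finite,linorder} form \<Rightarrow> 'n form" where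
  "N1 \<alpha> = the_inv_into (dom_box1 \<alpha>) (box1 \<alpha>)"

end

theory Submission
  imports Defs "HOL-Complex_Analysis.Great_Picard"
begin

text \<open>A holomorphic form expands into the forms \<open>u\<^sub>m\<close> whose coefficients are homogeneous polynomials of
  degree \<open>m\<close>; these are orthogonal, because the weighted metric is invariant under \<open>z \<mapsto> e\<^bsup>it\<^esup> z\<close>,
  and so \<open>\<parallel>u\<parallel>\<^sup>2 = \<Sum>\<^sub>m \<parallel>u\<^sub>m\<parallel>\<^sup>2\<close>. Integrating by parts on polynomial forms shows that \<open>\<partial>\<^sup>*\<close> is \<open>\<alpha> \<iota>\<close>, where
  \<open>\<iota>\<close> is contraction with the Euler field \<open>E = \<Sum>\<^sub>j z\<^sub>j \<partial>\<^sub>j\<close>. By Cartan's formula the Laplacian is \<open>\<alpha>\<close>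
  times the Lie derivative along \<open>E\<close>, which multiplies a \<open>(1,0)\<close>-form \<open>u\<^sub>m\<close> by \<open>m + 1\<close>. Hence it is
  diagonal with eigenvalues \<open>\<alpha> (m + 1)\<close>, and its resolvents are the multipliers
  \<open>u\<^sub>m \<mapsto> (\<alpha> (m + 1) - \<mu>)\<^bsup>-1\<^esup> u\<^sub>m\<close>. The inverse is compact since bounded sequences of forms have subsequences
  whose Taylor coefficients converge and the multipliers tend to \<open>0\<close>. For closed \<open>\<eta>\<close> the canonical
  solution satisfies \<open>\<parallel>f\<parallel>\<^sup>2 = \<Sum>\<^sub>m \<parallel>\<eta>\<^sub>m\<parallel>\<^sup>2 / (\<alpha> (m + 1))\<close>, so equality in the estimate means \<open>\<eta> = \<eta>\<^sub>0\<close>.\<close>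

section \<open>Holomorphic functions of several variables\<close>

text \<open>The shape of the adjoint comes from the weight: raising the index of the antiholomorphic
  derivative of \<open>\<psi>\<close>, which is \<open>\<alpha> * z $ k / (1 - |z|^2)^2\<close>,
  with the cometric gives exactly \<open>\<alpha> * z $ j\<close>, so the gradient of the weight is
  the holomorphic field \<open>\<alpha>\<close> times \<open>E\<close>. On a Kaehler manifold the
  formal adjoint, applied to a holomorphic form, reduces to contraction with this gradient. The
  obstacle is domains: the operators are unbounded and the adjoint is defined by testing against a
  whole domain. It is met by turning domain conditions into summability conditions: a holomorphic
  form of degree at most 2 lies in \<open>A2\<close> exactly if the squared norms of its homogeneous
  parts are summable, each part lies in every domain concerned, and the parts determine the form.
  New forms (resolvents, limits of subsequences) are not obtained from completeness but assembled
  from homogeneous polynomials with geometric bounds on smaller balls.\<close>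

lemma axis_eq_scale: "axis j c = c *s axis j (1::complex)"
  by (auto simp: axis_def vec_eq_iff)

lemma vec_eq_sum_axis: "(v :: complex^'n::finite) = (\<Sum>j\<in>UNIV. axis j (v $ j))"
  by (simp add: vec_eq_iff axis_def if_distrib cong: if_cong)

lemma norm_vector_scale: "norm (c *s v) = cmod c * norm (v :: complex^'n::finite)"
proof -
  have "norm (c *s v) = L2_set (\<lambda>i. cmod c * norm (v $ i)) UNIV"
    by (simp add: norm_vec_def norm_mult)
  then show ?thesis
    by (simp add: L2_set_right_distrib norm_vec_def)
qed

lemma norm_axis_complex: "norm (axis j c :: complex^'n::finite) = cmod c"
proof -
  have "norm (axis j c :: complex^'n) = sqrt (\<Sum>i\<in>UNIV. if i = j then (cmod c)\<^sup>2 else 0)"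
    unfolding norm_vec_def L2_set_def
    by (intro arg_cong[where f = sqrt] sum.cong) (auto simp: axis_def)
  then show ?thesis by simp
qed

lemma bounded_linear_axis: "bounded_linear (axis j :: complex \<Rightarrow> complex^'n::finite)"
  by (rule bounded_linear_intro[where K = 1]) (auto simp: axis_def vec_eq_iff norm_axis_complex[unfolded axis_def])

lemma bounded_linear_vector_scale: "bounded_linear (\<lambda>c. c *s (v :: complex^'n::finite))"
  by (rule bounded_linear_intro[where K = "norm v"])
     (auto simp: vec_eq_iff norm_vector_scale algebra_simps)

lemma continuous_on_axis [continuous_intros]:
  "continuous_on S f \<Longrightarrow> continuous_on S (\<lambda>x. axis j (f x) :: complex^'n::finite)"
  by (rule bounded_linear.continuous_on[OF bounded_linear_axis])

lemma continuous_on_vector_scale [continuous_intros]: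
  "continuous_on S f \<Longrightarrow> continuous_on S g \<Longrightarrow> continuous_on S (\<lambda>x. f x *s (g x :: complex^'n::finite))"
  unfolding vector_scalar_mult_def by (intro continuous_intros)

text \<open>Complex linearity gives \<open>D (axis j \<i>) = \<i> * D (axis j 1)\<close>, so
  \<open>dz j f z\<close> collapses to \<open>D (axis j 1)\<close> and these numbers alone determine
  the real derivative.\<close>

lemma holomorphic_cn_dz:
  fixes f :: "complex^'n::finite \<Rightarrow> complex"
  assumes "holomorphic_cn f S" "z \<in> S"
  shows "(f has_derivative (\<lambda>v. \<Sum>j\<in>UNIV. dz j f z * v $ j)) (at z)"
proof -
  obtain D where D: "(f has_derivative D) (at z)" and lin: "\<And>c v. D (c *s v) = c * D v"
    using assms unfolding holomorphic_cn_def by blast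
  have dzj: "dz j f z = D (axis j 1)" for j
    unfolding dz_dzbar_eqI(1)[OF D] axis_eq_scale[of j \<i>] lin by simp
  interpret bounded_linear D
    using D by (rule has_derivative_bounded_linear)
  have "D v = (\<Sum>j\<in>UNIV. dz j f z * v $ j)" for v
  proof -
    have "D v = D (\<Sum>j\<in>UNIV. axis j (v $ j))" by (subst vec_eq_sum_axis[of v]) simp
    also have "\<dots> = (\<Sum>j\<in>UNIV. D (axis j (v $ j)))" by (rule sum)
    also have "\<dots> = (\<Sum>j\<in>UNIV. dz j f z * v $ j)"
      by (subst axis_eq_scale) (simp add: lin dzj mult.commute)
    finally show ?thesis .
  qed
  then have "D = (\<lambda>v. \<Sum>j\<in>UNIV. dz j f z * v $ j)" by blast
  with D show ?thesis by simp
qed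

lemma dz_eqI:
  fixes f :: "complex^'n::finite \<Rightarrow> complex"
  assumes "(f has_derivative (\<lambda>v. \<Sum>j\<in>UNIV. c j * v $ j)) (at z)"
  shows "dz j f z = c j"
  using dz_dzbar_eqI(1)[OF assms, of j]
  by (simp add: axis_def if_distrib[where f = "\<lambda>x. _ * x"] mult.commute[of "c j" \<i>] mult.assoc[symmetric] cong: if_cong)

lemma holomorphic_cnI:
  fixes f :: "complex^'n::finite \<Rightarrow> complex"
  assumes "\<And>z. z \<in> S \<Longrightarrow> (f has_derivative (\<lambda>v. \<Sum>j\<in>UNIV. c j z * v $ j)) (at z)"
  shows "holomorphic_cn f S"
  unfolding holomorphic_cn_def
proof
  fix z assume "z \<in> S"
  from assms[OF this] show "\<exists>D. (f has_derivative D) (at z) \<and> (\<forall>c v. D (c *s v) = c * D v)"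
    by (intro exI[of _ "\<lambda>v. \<Sum>j\<in>UNIV. c j z * v $ j"]) (auto simp: sum_distrib_left mult_ac)
qed

lemma holomorphic_cn_imp_continuous_on:
  "holomorphic_cn f S \<Longrightarrow> continuous_on S f"
  unfolding continuous_on_eq_continuous_within
  by (meson continuous_at_imp_continuous_within has_derivative_continuous holomorphic_cn_def)

text \<open>Slices along complex lines bring in the theory of one variable: Cauchy's formula, Taylor
  series and Cauchy's inequality are all applied to such a slice.\<close>

lemma holomorphic_cn_line:
  fixes f :: "complex^'n::finite \<Rightarrow> complex"
  assumes "holomorphic_cn f S" "z + \<zeta> *s w \<in> S"
  shows "((\<lambda>\<zeta>. f (z + \<zeta> *s w)) has_field_derivative (\<Sum>j\<in>UNIV. dz j f (z + \<zeta> *s w) * w $ j)) (at \<zeta>)"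
proof -
  have 1: "((\<lambda>\<zeta>. z + \<zeta> *s w) has_derivative (\<lambda>\<zeta>. \<zeta> *s w)) (at \<zeta>)"
    using has_derivative_add[OF has_derivative_const
        bounded_linear_imp_has_derivative[OF bounded_linear_vector_scale]] by simp
  from has_derivative_compose[OF 1 holomorphic_cn_dz[OF assms]]
  have "((\<lambda>\<zeta>. f (z + \<zeta> *s w)) has_derivative
      (\<lambda>x. \<Sum>j\<in>UNIV. dz j f (z + \<zeta> *s w) * (x *s w) $ j)) (at \<zeta>)" .
  then show ?thesis
    unfolding has_field_derivative_def
    by (rule has_derivative_eq_rhs) (simp add: fun_eq_iff sum_distrib_left mult_ac)
qed

section \<open>Cauchy's formula along a coordinate direction and the regularity of
  derivatives\<close>

text \<open>This is Cauchy's formula for the first derivative of the slice in direction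
  \<open>j\<close>, with the circle parametrised by the unit interval. As a parameter integral of
  \<open>f\<close>, the function \<open>dz j f\<close> inherits continuity and differentiability
  from \<open>f\<close>.\<close>

lemma dz_cauchy:
  fixes f :: "complex^'n::finite \<Rightarrow> complex"
  assumes f: "holomorphic_cn f S" and d: "d > 0" and sub: "cball z d \<subseteq> S"
  shows "dz j f z = integral (cbox 0 1) (\<lambda>t. f (z + axis j (of_real d * cis (2 * pi * t))) * cis (- (2 * pi * t))) / of_real d"
proof -
  define g where "g \<zeta> = f (z + \<zeta> *s axis j 1)" for \<zeta>
  have inS: "z + \<zeta> *s axis j 1 \<in> S" if "\<zeta> \<in> cball 0 d" for \<zeta>
  proof -
    have "dist z (z + \<zeta> *s axis j 1) \<le> d"
      using that by (simp add: dist_norm norm_vector_scale norm_axis_complex)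
    then show ?thesis using sub by auto
  qed
  have g': "(g has_field_derivative dz j f (z + \<zeta> *s axis j 1)) (at \<zeta>)" if "\<zeta> \<in> cball 0 d" for \<zeta>
    using holomorphic_cn_line[OF f inS[OF that]] unfolding g_def
    by (simp add: axis_def if_distrib[where f = "\<lambda>x. _ * x"] cong: if_cong)
  have "g holomorphic_on cball 0 d"
    unfolding holomorphic_on_def field_differentiable_def
    using g' has_field_derivative_at_within by blast
  then have "((\<lambda>u. g u / (u - 0) ^ Suc 1) has_contour_integral (2 * pi * \<i>) / fact 1 * (deriv ^^ 1) g 0) (circlepath 0 d)"
    using d by (intro Cauchy_has_contour_integral_higher_derivative_circlepath)
      (auto intro: holomorphic_on_imp_continuous_on holomorphic_on_subset)
  moreover have "deriv g 0 = dz j f z"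
    using g'[of 0] d by (auto intro!: DERIV_imp_deriv)
  ultimately have "((\<lambda>u. g u / u\<^sup>2) has_contour_integral (2 * pi * \<i>) * dz j f z) (circlepath 0 d)"
    by (simp add: power2_eq_square)
  then have "((\<lambda>t. g (circlepath 0 d t) / (circlepath 0 d t)\<^sup>2 * vector_derivative (circlepath 0 d) (at t))
      has_integral (2 * pi * \<i>) * dz j f z) {0..1}"
    unfolding has_contour_integral_def
    by (rule has_integral_eq[rotated])
       (auto simp: vector_derivative_at_within_ivl[OF has_vector_derivative_circlepath] vector_derivative_circlepath)
  then have "((\<lambda>t. (2 * pi * \<i> / d) * (f (z + axis j (of_real d * cis (2 * pi * t))) * cis (- (2 * pi * t))))
      has_integral (2 * pi * \<i>) * dz j f z) {0..1}"
  proof (rule has_integral_eq[rotated])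
    fix t :: real
    have e: "exp (2 * of_real pi * \<i> * of_real t) = cis (2 * pi * t)"
      by (simp add: cis_conv_exp mult_ac)
    have ne: "cis (2 * pi * t) \<noteq> 0" by simp
    have cp: "circlepath 0 d t = of_real d * cis (2 * pi * t)"
      by (simp add: circlepath e)
    have vd: "vector_derivative (circlepath 0 d) (at t) = 2 * of_real pi * \<i> * of_real d * cis (2 * pi * t)"
      by (simp only: vector_derivative_circlepath e of_real_mult of_real_numeral)
    have inv: "cis (- (2 * pi * t)) = 1 / cis (2 * pi * t)"
      by (metis cis_inverse inverse_eq_divide)
    have alg: "F / (d' * c)\<^sup>2 * (2 * p * \<i> * d' * c) = (2 * p * \<i> / d') * (F * (1 / c))"
      if "c \<noteq> 0" "d' \<noteq> 0" for F c d' p :: complex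
      using that by (simp add: field_simps power2_eq_square)
    show "g (circlepath 0 d t) / (circlepath 0 d t)\<^sup>2 * vector_derivative (circlepath 0 d) (at t) =
      (2 * pi * \<i> / d) * (f (z + axis j (of_real d * cis (2 * pi * t))) * cis (- (2 * pi * t)))"
      unfolding cp vd inv g_def axis_eq_scale[of j "_ * _"] using d by (simp only: of_real_mult of_real_numeral alg[OF ne] of_real_eq_0_iff)
  qed
  then have "((\<lambda>t. f (z + axis j (of_real d * cis (2 * pi * t))) * cis (- (2 * pi * t)))
      has_integral (2 * pi * \<i>) * dz j f z / (2 * pi * \<i> / d)) {0..1}"
    using d by (subst (asm) has_integral_mult_right_iff) auto
  then show ?thesis
    using d by (auto simp: integral_unique field_simps)
qed

text \<open>The Leibniz rule applied in \<open>dz_leibniz\<close> requires a jointly continuous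
  derivative of the integrand, so continuity of the partial derivatives comes first. The radius
  \<open>2 * d\<close> keeps the circle of radius \<open>d\<close> about each point of
  \<open>ball z d\<close> inside \<open>S\<close>.\<close>

lemma continuous_on_dz_ball:
  fixes f :: "complex^'n::finite \<Rightarrow> complex"
  assumes f: "holomorphic_cn f S" and d: "d > 0" and sub: "cball z (2 * d) \<subseteq> S"
  shows "continuous_on (ball z d) (dz j f)"
proof -
  have in_S: "x + axis j (of_real d * cis t) \<in> S" if "x \<in> ball z d" for x t
  proof -
    have "dist z (x + axis j (of_real d * cis t)) \<le> dist z x + norm (axis j (of_real d * cis t))"
      using dist_triangle[of z "x + axis j (of_real d * cis t)" x] by (simp add: dist_norm)
    also have "\<dots> \<le> 2 * d" using that d by (simp add: norm_axis_complex norm_mult)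
    finally show ?thesis using sub by auto
  qed
  have cf: "continuous_on S f" by (rule holomorphic_cn_imp_continuous_on[OF f])
  have "continuous_on (ball z d) (\<lambda>x. integral (cbox 0 1)
      (\<lambda>t. f (x + axis j (of_real d * cis (2 * pi * t))) * cis (- (2 * pi * t))) / of_real d)"
    using d
    apply (intro continuous_intros integral_continuous_on_param)
     apply (auto simp: split_beta intro!: continuous_intros continuous_on_compose2[OF cf] in_S)
    done
  then show ?thesis
  proof (rule continuous_on_eq)
    fix x assume "x \<in> ball z d"
    then have "cball x d \<subseteq> S"
      using sub by (force intro: subsetD[OF sub] order_trans[OF dist_triangle[of z _ x]])
    then show "integral (cbox 0 1)
      (\<lambda>t. f (x + axis j (of_real d * cis (2 * pi * t))) * cis (- (2 * pi * t))) / of_real d = dz j f x"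
      by (rule dz_cauchy[OF f d, symmetric])
  qed
qed

text \<open>\<open>leibniz_rule\<close> expects the derivative of the integrand as a bounded linear
  function depending continuously on the parameter. \<open>lin_form\<close> packs a row of partial
  derivatives into that type and is itself bounded linear, so continuity passes through it.\<close>

definition lin_form :: "(complex^'n::finite) \<Rightarrow> ((complex^'n) \<Rightarrow>\<^sub>L complex)" where
  "lin_form c = Blinfun (\<lambda>v. \<Sum>j\<in>UNIV. c $ j * v $ j)"

lemma bounded_linear_lin_form: "bounded_linear (\<lambda>v. \<Sum>j\<in>UNIV. c $ j * (v :: complex^'n::finite) $ j)"
  by (intro bounded_linear_sum bounded_linear_const_mult bounded_linear_vec_nth)

lemma lin_form_apply: "blinfun_apply (lin_form c) v = (\<Sum>j\<in>UNIV. c $ j * v $ j)"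
  unfolding lin_form_def by (subst bounded_linear_Blinfun_apply[OF bounded_linear_lin_form]) simp

lemma bounded_linear_lin_form': "bounded_linear (lin_form :: complex^'n::finite \<Rightarrow> _)"
proof (rule bounded_linear_intro[where K = "real CARD('n)"])
  fix x y :: "complex^'n" and r :: real
  show "lin_form (x + y) = lin_form x + lin_form y"
    by (rule blinfun_eqI) (simp add: lin_form_apply blinfun.add_left sum.distrib algebra_simps)
  show "lin_form (r *\<^sub>R x) = r *\<^sub>R lin_form x"
    by (rule blinfun_eqI) (simp add: lin_form_apply blinfun.scaleR_left scaleR_sum_right)
  show "norm (lin_form x) \<le> norm x * real CARD('n)"
  proof (rule norm_blinfun_bound)
    fix v :: "complex^'n"
    have "norm (\<Sum>j\<in>UNIV. x $ j * v $ j) \<le> (\<Sum>j\<in>(UNIV::'n set). norm x * norm v)"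
      by (rule sum_norm_le) (auto simp: norm_mult intro!: mult_mono Finite_Cartesian_Product.norm_nth_le)
    then show "norm (blinfun_apply (lin_form x) v) \<le> norm x * real CARD('n) * norm v"
      by (simp add: lin_form_apply mult_ac)
  qed simp
qed

text \<open>Differentiation under the integral sign in \<open>dz_cauchy\<close>. The coefficients
  are left as Cauchy integrals of \<open>dz k f\<close> over the same circle: in this form they
  yield both the holomorphy of \<open>dz j f\<close> and the symmetry of second derivatives.\<close>

lemma dz_leibniz:
  fixes f :: "complex^'n::finite \<Rightarrow> complex"
  assumes f: "holomorphic_cn f S" and S: "open S" and z: "z \<in> S"
  shows "\<exists>d>0. cball z d \<subseteq> S \<and> (dz j f has_derivative (\<lambda>v. \<Sum>k\<in>UNIV. 
     (integral (cbox 0 1) (\<lambda>t. dz k f (z + axis j (of_real d * cis (2 * pi * t))) * cis (- (2 * pi * t))) / of_real d) * v $ k)) (at z)"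
proof -
  obtain e where e: "e > 0" "cball z e \<subseteq> S"
    using open_contains_cball[of S] S z by blast
  define d where "d = e / 2"
  have d: "d > 0" "cball z (2 * d) \<subseteq> S" using e by (auto simp: d_def)
  have in_S: "x + axis j (of_real d * cis t) \<in> S" if "x \<in> ball z d" for x t
  proof -
    have "dist z (x + axis j (of_real d * cis t)) \<le> dist z x + norm (axis j (of_real d * cis t))"
      using dist_triangle[of z "x + axis j (of_real d * cis t)" x] by (simp add: dist_norm)
    also have "\<dots> \<le> 2 * d" using that d by (simp add: norm_axis_complex norm_mult)
    finally show ?thesis using d by auto
  qed
  have cdz: "continuous_on S (dz k f)" for k
  proof (rule continuous_at_imp_continuous_on, rule)
    fix x assume "x \<in> S"
    obtain e where e: "e > 0" "cball x e \<subseteq> S"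
      using open_contains_cball[of S] S \<open>x \<in> S\<close> by blast
    have "continuous_on (ball x (e/2)) (dz k f)"
      by (rule continuous_on_dz_ball[OF f]) (use e in auto)
    then show "continuous (at x) (dz k f)"
      using e by (simp add: continuous_on_eq_continuous_at)
  qed
  have cf: "continuous_on S f" by (rule holomorphic_cn_imp_continuous_on[OF f])
  define h where "h x t = f (x + axis j (of_real d * cis (2 * pi * t))) * cis (- (2 * pi * t))" for x t
  define h' where "h' x t = lin_form (\<chi> k. dz k f (x + axis j (of_real d * cis (2 * pi * t))) * cis (- (2 * pi * t)))" for x t
  have cont_h': "continuous_on (ball z d \<times> cbox 0 1) (\<lambda>(x, t). h' x t)"
    unfolding h'_def split_beta
    by (intro bounded_linear.continuous_on[OF bounded_linear_lin_form'] continuous_intros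
        continuous_on_compose2[OF cdz]) (auto intro!: in_S)
  have L: "((\<lambda>x. integral (cbox 0 1) (h x)) has_derivative blinfun_apply (integral (cbox 0 1) (h' z))) (at z within ball z d)"
  proof (rule leibniz_rule[OF _ _ cont_h'])
    fix x t assume x: "x \<in> ball z d"
    have 1: "((\<lambda>x. x + axis j (of_real d * cis (2 * pi * t))) has_derivative (\<lambda>v. v)) (at x)"
      by (auto intro!: derivative_eq_intros)
    from has_derivative_compose[OF 1 holomorphic_cn_dz[OF f in_S[OF x]]]
    have "((\<lambda>x. f (x + axis j (of_real d * cis (2 * pi * t))) * cis (- (2 * pi * t))) has_derivative
       (\<lambda>v. (\<Sum>k\<in>UNIV. dz k f (x + axis j (of_real d * cis (2 * pi * t))) * v $ k) * cis (- (2 * pi * t)))) (at x)"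
      by (rule has_derivative_mult_left)
    then show "((\<lambda>x. h x t) has_derivative blinfun_apply (h' x t)) (at x within ball z d)"
      unfolding h_def
      by (rule has_derivative_eq_rhs[OF has_derivative_at_withinI])
         (simp add: fun_eq_iff h'_def lin_form_apply sum_distrib_left mult_ac)
  next
    fix x assume x: "x \<in> ball z d"
    show "h x integrable_on cbox 0 1"
      unfolding h_def
      by (intro integrable_continuous continuous_intros continuous_on_compose2[OF cf]) (auto intro!: in_S x)
  qed (use d in auto)
  have int_h': "h' z integrable_on cbox 0 1"
    unfolding h'_def
    by (intro integrable_continuous bounded_linear.continuous_on[OF bounded_linear_lin_form'] continuous_intros
        continuous_on_compose2[OF cdz]) (auto intro!: in_S d)
  have eq: "blinfun_apply (integral (cbox 0 1) (h' z)) v = (\<Sum>k\<in>UNIV. 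
     integral (cbox 0 1) (\<lambda>t. dz k f (z + axis j (of_real d * cis (2 * pi * t))) * cis (- (2 * pi * t))) * v $ k)" for v
  proof -
    have "blinfun_apply (integral (cbox 0 1) (h' z)) v = integral (cbox 0 1) (\<lambda>t. blinfun_apply (h' z t) v)"
      using integral_linear[OF int_h' blinfun.bounded_linear_left[of v]] by (simp add: o_def)
    also have "\<dots> = (\<Sum>k\<in>UNIV. integral (cbox 0 1) (\<lambda>t. dz k f (z + axis j (of_real d * cis (2 * pi * t))) * cis (- (2 * pi * t)) * v $ k))"
      unfolding h'_def lin_form_apply vec_lambda_beta
    proof (rule integral_sum)
      fix k
      show "(\<lambda>t. dz k f (z + axis j (of_real d * cis (2 * pi * t))) * cis (- (2 * pi * t)) * v $ k) integrable_on cbox 0 1"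
        by (intro integrable_continuous continuous_intros continuous_on_compose2[OF cdz]) (auto intro!: in_S d)
    qed simp
    finally show ?thesis by simp
  qed
  have "((\<lambda>x. integral (cbox 0 1) (h x) / of_real d) has_derivative (\<lambda>v. blinfun_apply (integral (cbox 0 1) (h' z)) v / of_real d)) (at z)"
    using L[unfolded at_within_open[OF centre_in_ball[THEN iffD2, OF d(1)] open_ball]]
    unfolding divide_inverse by (rule has_derivative_mult_left)
  then have "(dz j f has_derivative (\<lambda>v. blinfun_apply (integral (cbox 0 1) (h' z)) v / of_real d)) (at z)"
  proof (rule has_derivative_transform_within_open[OF _ open_ball[of z d]])
    fix x assume "x \<in> ball z d"
    then have "cball x d \<subseteq> S"
      by (force intro: subsetD[OF d(2)] order_trans[OF dist_triangle[of z _ x]])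
    then show "integral (cbox 0 1) (h x) / of_real d = dz j f x"
      unfolding h_def by (rule dz_cauchy[OF f d(1), symmetric])
  qed (use d in auto)
  then have "(dz j f has_derivative (\<lambda>v. \<Sum>k\<in>UNIV. 
     (integral (cbox 0 1) (\<lambda>t. dz k f (z + axis j (of_real d * cis (2 * pi * t))) * cis (- (2 * pi * t))) / of_real d) * v $ k)) (at z)"
    unfolding eq by (rule has_derivative_eq_rhs) (simp add: sum_divide_distrib)
  moreover have "cball z d \<subseteq> S"
    using d subset_cball[of d "2 * d" z] by simp
  ultimately show ?thesis
    using d(1) by blast
qed

lemma holomorphic_cn_dz_holomorphic:
  fixes f :: "complex^'n::finite \<Rightarrow> complex"
  assumes f: "holomorphic_cn f S" and S: "open S"
  shows "holomorphic_cn (dz j f) S"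
  unfolding holomorphic_cn_def
proof
  fix z assume z: "z \<in> S"
  from dz_leibniz[OF f S z, of j]
  have "\<exists>c. (dz j f has_derivative (\<lambda>v. \<Sum>k\<in>UNIV. c k * v $ k)) (at z)"
    by (elim exE conjE) (rule exI, assumption)
  then obtain c where "(dz j f has_derivative (\<lambda>v. \<Sum>k\<in>UNIV. c k * v $ k)) (at z)" by blast
  then show "\<exists>D. (dz j f has_derivative D) (at z) \<and> (\<forall>c v. D (c *s v) = c * D v)"
    by (intro exI[of _ "\<lambda>v. \<Sum>k\<in>UNIV. c k * v $ k"]) (auto simp: sum_distrib_left mult_ac)
qed

text \<open>By \<open>dz_leibniz\<close> the left-hand side is the very integral that
  \<open>dz_cauchy\<close> assigns to \<open>dz j (dz k f)\<close>.\<close>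

lemma dz_commute:
  fixes f :: "complex^'n::finite \<Rightarrow> complex"
  assumes f: "holomorphic_cn f S" and S: "open S" and z: "z \<in> S"
  shows "dz k (dz j f) z = dz j (dz k f) z"
proof -
  from dz_leibniz[OF f S z, of j] obtain d where d: "d > 0" "cball z d \<subseteq> S"
    and D: "(dz j f has_derivative (\<lambda>v. \<Sum>k\<in>UNIV. 
     (integral (cbox 0 1) (\<lambda>t. dz k f (z + axis j (of_real d * cis (2 * pi * t))) * cis (- (2 * pi * t))) / of_real d) * v $ k)) (at z)"
    by blast
  show ?thesis
    using dz_eqI[OF D, of k] dz_cauchy[OF holomorphic_cn_dz_holomorphic[OF f S] d, of j k] by simp
qed

section \<open>Locality and the rules of differentiation\<close>

text \<open>Coefficients of forms are cut off outside the ball, whereas the polynomials that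
  represent them are not; locality allows one to be replaced by the other under
  \<open>dz\<close>.\<close>

lemma dz_cong_ball:
  assumes "open S" "z \<in> S" "\<And>w. w \<in> S \<Longrightarrow> f w = g w"
  shows "dz j f z = dz j g z"
proof -
  have "(f has_derivative D) (at z) \<longleftrightarrow> (g has_derivative D) (at z)" for D
    using has_derivative_transform_within_open[of f D z UNIV S g]
      has_derivative_transform_within_open[of g D z UNIV S f] assms by auto
  then show ?thesis
    by (simp add: dz_def frechet_derivative_def)
qed

lemma holomorphic_cn_cong:
  assumes "open S" "\<And>w. w \<in> S \<Longrightarrow> f w = g w"
  shows "holomorphic_cn f S \<longleftrightarrow> holomorphic_cn g S"
  using assms has_derivative_transform_within_open[of f _ _ UNIV S g]
    has_derivative_transform_within_open[of g _ _ UNIV S f]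
  unfolding holomorphic_cn_def by (metis (no_types, lifting))

lemma holomorphic_cn_const: "holomorphic_cn (\<lambda>z. c) S"
  by (rule holomorphic_cnI[where c = "\<lambda>_ _. 0"]) simp

lemma dz_const: "dz j (\<lambda>z. c) z = 0"
  by (rule dz_eqI) simp

lemma has_derivative_nth:
  "((\<lambda>z. z $ k) has_derivative (\<lambda>v. \<Sum>j\<in>UNIV. (if j = k then 1 else 0) * v $ j)) (at (z :: complex^'n::finite))"
proof -
  have "(\<lambda>v :: complex^'n. \<Sum>j\<in>UNIV. (if j = k then 1 else 0) * v $ j) = (\<lambda>v. v $ k)"
    by (simp add: if_distrib[where f = "\<lambda>x. x * _"] cong: if_cong)
  then show ?thesis
    using bounded_linear_imp_has_derivative[OF bounded_linear_vec_nth] by simp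
qed

lemma holomorphic_cn_nth: "holomorphic_cn (\<lambda>z. z $ k) S"
  by (rule holomorphic_cnI[OF has_derivative_nth])

lemma dz_nth: "dz j (\<lambda>z. z $ k) z = (if j = k then 1 else 0)"
  by (rule dz_eqI[OF has_derivative_nth])

lemma has_derivative_add_cn:
  fixes f g :: "complex^'n::finite \<Rightarrow> complex"
  assumes "holomorphic_cn f S" "holomorphic_cn g S" "z \<in> S"
  shows "((\<lambda>z. f z + g z) has_derivative (\<lambda>v. \<Sum>j\<in>UNIV. (dz j f z + dz j g z) * v $ j)) (at z)"
  by (rule has_derivative_eq_rhs[OF has_derivative_add[OF holomorphic_cn_dz[OF assms(1,3)] holomorphic_cn_dz[OF assms(2,3)]]])
     (simp add: sum.distrib distrib_right)

lemma has_derivative_mult_cn: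
  fixes f g :: "complex^'n::finite \<Rightarrow> complex"
  assumes "holomorphic_cn f S" "holomorphic_cn g S" "z \<in> S"
  shows "((\<lambda>z. f z * g z) has_derivative (\<lambda>v. \<Sum>j\<in>UNIV. (dz j f z * g z + f z * dz j g z) * v $ j)) (at z)"
  by (rule has_derivative_eq_rhs[OF has_derivative_mult[OF holomorphic_cn_dz[OF assms(1,3)] holomorphic_cn_dz[OF assms(2,3)]]])
     (simp add: fun_eq_iff sum.distrib algebra_simps sum_distrib_left)

lemma holomorphic_cn_add:
  "holomorphic_cn f S \<Longrightarrow> holomorphic_cn g S \<Longrightarrow> holomorphic_cn (\<lambda>z. f z + g z) S"
  by (rule holomorphic_cnI[OF has_derivative_add_cn])

lemma holomorphic_cn_mult:
  "holomorphic_cn f S \<Longrightarrow> holomorphic_cn g S \<Longrightarrow> holomorphic_cn (\<lambda>z. f z * g z) S"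
  by (rule holomorphic_cnI[OF has_derivative_mult_cn])

lemma holomorphic_cn_cmult: "holomorphic_cn f S \<Longrightarrow> holomorphic_cn (\<lambda>z. c * f z) S"
  by (intro holomorphic_cn_mult holomorphic_cn_const)

lemma holomorphic_cn_diff:
  "holomorphic_cn f S \<Longrightarrow> holomorphic_cn g S \<Longrightarrow> holomorphic_cn (\<lambda>z. f z - g z) S"
  using holomorphic_cn_add[OF _ holomorphic_cn_cmult, of f S g "-1"] by simp

lemma holomorphic_cn_sum:
  "(\<And>i. i \<in> I \<Longrightarrow> holomorphic_cn (f i) S) \<Longrightarrow> holomorphic_cn (\<lambda>z. \<Sum>i\<in>I. f i z) S"
  by (induction I rule: infinite_finite_induct) (auto intro: holomorphic_cn_const holomorphic_cn_add)

lemma holomorphic_cn_prod: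
  "(\<And>i. i \<in> I \<Longrightarrow> holomorphic_cn (f i) S) \<Longrightarrow> holomorphic_cn (\<lambda>z. \<Prod>i\<in>I. f i z) S"
  by (induction I rule: infinite_finite_induct) (auto intro: holomorphic_cn_const holomorphic_cn_mult)

lemma holomorphic_cn_power: "holomorphic_cn f S \<Longrightarrow> holomorphic_cn (\<lambda>z. f z ^ k) S"
  by (induction k) (auto intro: holomorphic_cn_const holomorphic_cn_mult)

lemma dz_add:
  "holomorphic_cn f S \<Longrightarrow> holomorphic_cn g S \<Longrightarrow> z \<in> S \<Longrightarrow> dz j (\<lambda>z. f z + g z) z = dz j f z + dz j g z"
  by (rule dz_eqI[OF has_derivative_add_cn])

lemma dz_mult:
  "holomorphic_cn f S \<Longrightarrow> holomorphic_cn g S \<Longrightarrow> z \<in> S \<Longrightarrow> dz j (\<lambda>z. f z * g z) z = dz j f z * g z + f z * dz j g z"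
  by (rule dz_eqI[OF has_derivative_mult_cn])

lemma dz_cmult: "holomorphic_cn f S \<Longrightarrow> z \<in> S \<Longrightarrow> dz j (\<lambda>z. c * f z) z = c * dz j f z"
  by (simp add: dz_mult[OF holomorphic_cn_const] dz_const)

lemma dz_sum:
  "(\<And>i. i \<in> I \<Longrightarrow> holomorphic_cn (f i) S) \<Longrightarrow> z \<in> S \<Longrightarrow>
    dz j (\<lambda>z. \<Sum>i\<in>I. f i z) z = (\<Sum>i\<in>I. dz j (f i) z)"
  by (induction I rule: infinite_finite_induct) (simp_all add: dz_const dz_add[of _ S] holomorphic_cn_sum)

section \<open>Homogeneous polynomials\<close>

definition multi :: "nat \<Rightarrow> ('n::finite \<Rightarrow> nat) set" where
  "multi m = {\<beta>. (\<Sum>j\<in>UNIV. \<beta> j) = m}"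

definition cmonom :: "('n::finite \<Rightarrow> nat) \<Rightarrow> complex^'n \<Rightarrow> complex" where
  "cmonom \<beta> z = (\<Prod>j\<in>UNIV. z $ j ^ \<beta> j)"

text \<open>Homogeneity is encoded by coefficients instead of the scaling identity, because the
  coefficients serve as coordinates in the dimension count and in the diagonal argument for
  compactness.\<close>

definition hpoly :: "nat \<Rightarrow> (complex^'n::finite \<Rightarrow> complex) \<Rightarrow> bool" where
  "hpoly m F \<longleftrightarrow> (\<exists>c. \<forall>z. F z = (\<Sum>\<beta>\<in>multi m. c \<beta> * cmonom \<beta> z))"

lemma finite_multi: "finite (multi m :: ('n::finite \<Rightarrow> nat) set)"
proof (rule finite_subset)
  show "multi m \<subseteq> (UNIV :: 'n set) \<rightarrow>\<^sub>E {..m}"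
    by (auto simp: multi_def intro: member_le_sum)
qed (auto intro: finite_PiE)

text \<open>Stars and bars: an enumeration of the index type turns multi-indices into lists of
  naturals with prescribed length and sum.\<close>

lemma card_multi:
  "card (multi m :: ('n::finite \<Rightarrow> nat) set) = (CARD('n) + m - 1) choose (CARD('n) - 1)"
proof -
  obtain xs :: "'n list" where xs: "set xs = UNIV" "distinct xs"
    using finite_distinct_list[OF finite] by blast
  have len: "length xs = CARD('n)"
    using distinct_card[OF xs(2)] xs(1) by simp
  have "bij_betw (\<lambda>\<beta>. map \<beta> xs) (multi m) {l::nat list. size l = CARD('n) \<and> sum_list l = m}"
  proof (rule bij_betw_byWitness[where f' = "\<lambda>l j. l ! (THE i. i < length xs \<and> xs ! i = j)"])
    have the: "(THE i. i < length xs \<and> xs ! i = xs ! k) = k" if "k < length xs" for k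
      using that xs(2) by (auto intro!: the_equality simp: nth_eq_iff_index_eq)
    have sum: "(\<Sum>j\<in>UNIV. \<beta> j) = sum_list (map \<beta> xs)" for \<beta> :: "'n \<Rightarrow> nat"
      by (rule sum_list_distinct_conv_sum_set[OF xs(2), of \<beta>, unfolded xs(1), symmetric])
    show "\<forall>\<beta>\<in>multi m. (\<lambda>j. map \<beta> xs ! (THE i. i < length xs \<and> xs ! i = j)) = \<beta>"
    proof (intro ballI ext)
      fix \<beta> :: "'n \<Rightarrow> nat" and j
      obtain k where "k < length xs" "j = xs ! k"
        using xs(1) by (metis UNIV_I in_set_conv_nth)
      then show "map \<beta> xs ! (THE i. i < length xs \<and> xs ! i = j) = \<beta> j" by (simp add: the)
    qed
    have inv: "map (\<lambda>j. l ! (THE i. i < length xs \<and> xs ! i = j)) xs = l" if "length l = CARD('n)" for l :: "nat list"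
      using that len by (auto intro!: nth_equalityI simp: the[unfolded len])
    then show "\<forall>l\<in>{l. length l = CARD('n) \<and> sum_list l = m}.
       map (\<lambda>j. l ! (THE i. i < length xs \<and> xs ! i = j)) xs = l" by simp
    show "(\<lambda>\<beta>. map \<beta> xs) ` multi m \<subseteq> {l. length l = CARD('n) \<and> sum_list l = m}"
      using len by (auto simp: multi_def sum)
    show "(\<lambda>l j. l ! (THE i. i < length xs \<and> xs ! i = j)) ` {l. length l = CARD('n) \<and> sum_list l = m} \<subseteq> multi m"
      using inv by (auto simp: multi_def sum)
  qed
  then have "card (multi m :: ('n::finite \<Rightarrow> nat) set) = (m + CARD('n) - 1) choose m"
    using card_length_sum_list bij_betw_same_card by fastforce
  also have "\<dots> = (CARD('n) + m - 1) choose (CARD('n) - 1)"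
  proof -
    \<comment> \<open>Positivity of \<open>CARD('n)\<close> keeps the truncated subtractions exact,
      so that the symmetry of binomial coefficients applies.\<close>
    obtain k where "CARD('n) = Suc k"
      using zero_less_card_finite[where 'a='n] gr0_implies_Suc by blast
    then show ?thesis
      using binomial_symmetric[of m "m + k"] by (simp add: add.commute)
  qed
  finally show ?thesis .
qed

lemma cmonom_scale: "\<beta> \<in> multi m \<Longrightarrow> cmonom \<beta> (c *s z) = c ^ m * cmonom \<beta> z"
  by (auto simp: cmonom_def multi_def power_mult_distrib prod.distrib power_sum)

lemma hpoly_scale: "hpoly m F \<Longrightarrow> F (c *s z) = c ^ m * F z"
  unfolding hpoly_def by (auto simp: cmonom_scale sum_distrib_left mult_ac intro!: sum.cong)

lemma hpoly_add: "hpoly m F \<Longrightarrow> hpoly m G \<Longrightarrow> hpoly m (\<lambda>z. F z + G z)"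
proof -
  assume "hpoly m F" "hpoly m G"
  then obtain c d where "\<forall>z. F z = (\<Sum>\<beta>\<in>multi m. c \<beta> * cmonom \<beta> z)" "\<forall>z. G z = (\<Sum>\<beta>\<in>multi m. d \<beta> * cmonom \<beta> z)"
    unfolding hpoly_def by auto
  then show ?thesis
    unfolding hpoly_def by (intro exI[of _ "\<lambda>\<beta>. c \<beta> + d \<beta>"]) (simp add: sum.distrib distrib_right)
qed

lemma hpoly_cmult: "hpoly m F \<Longrightarrow> hpoly m (\<lambda>z. a * F z)"
proof -
  assume "hpoly m F"
  then obtain c where "\<forall>z. F z = (\<Sum>\<beta>\<in>multi m. c \<beta> * cmonom \<beta> z)"
    unfolding hpoly_def by auto
  then show ?thesis
    unfolding hpoly_def by (intro exI[of _ "\<lambda>\<beta>. a * c \<beta>"]) (simp add: sum_distrib_left mult_ac)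
qed

lemma hpoly_zero: "hpoly m (\<lambda>z. 0)"
  unfolding hpoly_def by (intro exI[of _ "\<lambda>\<beta>. 0"]) simp

lemma hpoly_sum: "(\<And>i. i \<in> I \<Longrightarrow> hpoly m (F i)) \<Longrightarrow> hpoly m (\<lambda>z. \<Sum>i\<in>I. F i z)"
  by (induction I rule: infinite_finite_induct) (auto intro: hpoly_zero hpoly_add)

lemma multi_0: "multi 0 = {\<lambda>_::'n::finite. 0::nat}"
  by (auto simp: multi_def)

lemma hpoly_const: "hpoly 0 (\<lambda>z. c)"
  unfolding hpoly_def
  by (intro exI[of _ "\<lambda>\<beta>. c"]) (simp add: multi_0 cmonom_def)

lemma hpoly_cmonom: "\<beta> \<in> multi m \<Longrightarrow> hpoly m (cmonom \<beta>)"
  unfolding hpoly_def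
  by (rule exI[of _ "\<lambda>\<gamma>. if \<gamma> = \<beta> then 1 else 0"])
     (simp add: finite_multi if_distrib[where f = "\<lambda>x. x * _"] cong: if_cong)

lemma sum_multi_upd: "(\<Sum>i\<in>UNIV. (\<beta>(j := v)) i) + \<beta> j = (\<Sum>i\<in>UNIV. \<beta> i) + (v :: nat)" for \<beta> :: "'n::finite \<Rightarrow> nat"
proof -
  have "(\<Sum>i\<in>UNIV. (\<beta>(j := v)) i) = v + (\<Sum>i\<in>UNIV - {j}. \<beta> i)"
    by (subst sum.remove[of _ j]) (auto intro!: sum.cong)
  moreover have "(\<Sum>i\<in>UNIV. \<beta> i) = \<beta> j + (\<Sum>i\<in>UNIV - {j}. \<beta> i)"
    by (subst sum.remove[of _ j]) auto
  ultimately show ?thesis by simp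
qed

lemma cmonom_upd: "cmonom (\<beta>(j := v)) z = z $ j ^ v * (\<Prod>i\<in>UNIV - {j}. z $ i ^ \<beta> i)"
  unfolding cmonom_def by (subst prod.remove[of _ j]) (auto intro!: prod.cong)

lemma cmonom_Suc: "z $ j * cmonom \<beta> z = cmonom (\<beta>(j := Suc (\<beta> j))) z"
  using cmonom_upd[of \<beta> j "\<beta> j" z] cmonom_upd[of \<beta> j "Suc (\<beta> j)" z] by simp

lemma hpoly_times_nth: "hpoly m F \<Longrightarrow> hpoly (Suc m) (\<lambda>z. z $ j * F z)"
proof -
  assume "hpoly m F"
  then obtain c where c: "\<And>z. F z = (\<Sum>\<beta>\<in>multi m. c \<beta> * cmonom \<beta> z)"
    unfolding hpoly_def by auto
  have "z $ j * F z = (\<Sum>\<beta>\<in>multi m. c \<beta> * cmonom (\<beta>(j := Suc (\<beta> j))) z)" for z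
    unfolding c cmonom_Suc[symmetric] by (simp add: sum_distrib_left mult_ac)
  moreover have "hpoly (Suc m) (\<lambda>z. \<Sum>\<beta>\<in>multi m. c \<beta> * cmonom (\<beta>(j := Suc (\<beta> j))) z)"
  proof (intro hpoly_sum hpoly_cmult hpoly_cmonom)
    fix \<beta> :: "'a \<Rightarrow> nat" assume "\<beta> \<in> multi m"
    then show "\<beta>(j := Suc (\<beta> j)) \<in> multi (Suc m)"
      using sum_multi_upd[of \<beta> j "Suc (\<beta> j)"] by (simp add: multi_def)
  qed
  ultimately show ?thesis by simp
qed

lemma holomorphic_cn_cmonom: "holomorphic_cn (cmonom \<beta>) S"
  unfolding cmonom_def[abs_def] by (intro holomorphic_cn_prod holomorphic_cn_power holomorphic_cn_nth)

lemma hpoly_holomorphic: "hpoly m F \<Longrightarrow> holomorphic_cn F S"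
proof -
  assume "hpoly m F"
  then obtain c where "F = (\<lambda>z. \<Sum>\<beta>\<in>multi m. c \<beta> * cmonom \<beta> z)"
    unfolding hpoly_def by auto
  then show ?thesis by (auto intro!: holomorphic_cn_sum holomorphic_cn_cmult holomorphic_cn_cmonom)
qed

text \<open>Where \<open>\<beta> j = 0\<close> the truncated exponent is multiplied by
  \<open>0\<close>, so the formula covers this case as well.\<close>

lemma dz_cmonom: "dz j (cmonom \<beta>) z = of_nat (\<beta> j) * cmonom (\<beta>(j := \<beta> j - 1)) z"
proof -
  let ?P = "\<Prod>i\<in>UNIV - {j}. z $ i ^ \<beta> i"
  have "((\<lambda>\<zeta>. cmonom \<beta> (z + \<zeta> *s axis j 1)) has_field_derivative dz j (cmonom \<beta>) z) (at 0)"
    using holomorphic_cn_line[OF holomorphic_cn_cmonom[of \<beta> UNIV], of z 0 "axis j 1"]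
    by (simp add: axis_def if_distrib[where f = "\<lambda>x. _ * x"] cong: if_cong)
  moreover have "cmonom \<beta> (z + \<zeta> *s axis j 1) = (z $ j + \<zeta>) ^ \<beta> j * ?P" for \<zeta>
    unfolding cmonom_def by (subst prod.remove[of _ j]) (auto simp: axis_def intro!: prod.cong)
  ultimately have "((\<lambda>\<zeta>. (z $ j + \<zeta>) ^ \<beta> j * ?P) has_field_derivative dz j (cmonom \<beta>) z) (at 0)"
    by simp
  moreover have "((\<lambda>\<zeta>. (z $ j + \<zeta>) ^ \<beta> j * ?P) has_field_derivative of_nat (\<beta> j) * z $ j ^ (\<beta> j - 1) * ?P) (at 0)"
    by (auto intro!: derivative_eq_intros)
  ultimately have "dz j (cmonom \<beta>) z = of_nat (\<beta> j) * z $ j ^ (\<beta> j - 1) * ?P"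
    by (rule DERIV_unique)
  then show ?thesis by (simp add: cmonom_upd)
qed

text \<open>A derivative shifts coefficients down one degree and multiplies them by positive
  integers. Every coefficient of degree \<open>Suc m\<close> can thus be read off from some first
  derivative, which drives the induction in \<open>hpoly_coeff_bound\<close>.\<close>

lemma dz_hpoly_coeffs:
  assumes F: "\<And>z. F z = (\<Sum>\<beta>\<in>multi (Suc m). c \<beta> * cmonom \<beta> z)"
  shows "dz j F z = (\<Sum>\<gamma>\<in>multi m. (of_nat (Suc (\<gamma> j)) * c (\<gamma>(j := Suc (\<gamma> j)))) * cmonom \<gamma> z)"
proof -
  have "dz j F z = (\<Sum>\<beta>\<in>multi (Suc m). c \<beta> * (of_nat (\<beta> j) * cmonom (\<beta>(j := \<beta> j - 1)) z))"
    unfolding F[abs_def]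
    by (subst dz_sum[where S = UNIV]) (auto intro!: holomorphic_cn_cmult holomorphic_cn_cmonom simp: dz_cmult[OF holomorphic_cn_cmonom[of _ UNIV]] dz_cmonom)
  also have "\<dots> = (\<Sum>\<beta>\<in>{\<beta>\<in>multi (Suc m). \<beta> j \<noteq> 0}. c \<beta> * (of_nat (\<beta> j) * cmonom (\<beta>(j := \<beta> j - 1)) z))"
    by (rule sum.mono_neutral_right) (auto simp: finite_multi)
  also have "\<dots> = (\<Sum>\<gamma>\<in>multi m. (of_nat (Suc (\<gamma> j)) * c (\<gamma>(j := Suc (\<gamma> j)))) * cmonom \<gamma> z)"
  proof (rule sum.reindex_bij_witness[where i = "\<lambda>\<gamma>. \<gamma>(j := Suc (\<gamma> j))" and j = "\<lambda>\<beta>. \<beta>(j := \<beta> j - 1)"])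
    fix \<beta> :: "'a \<Rightarrow> nat" assume \<beta>: "\<beta> \<in> {\<beta> \<in> multi (Suc m). \<beta> j \<noteq> 0}"
    then show "\<beta>(j := \<beta> j - 1) \<in> multi m"
      using sum_multi_upd[of \<beta> j "\<beta> j - 1"] by (simp add: multi_def)
    show "(\<beta>(j := \<beta> j - 1))(j := Suc ((\<beta>(j := \<beta> j - 1)) j)) = \<beta>"
      using \<beta> by (auto simp: fun_eq_iff)
    then show "of_nat (Suc ((\<beta>(j := \<beta> j - 1)) j)) * c ((\<beta>(j := \<beta> j - 1))(j := Suc ((\<beta>(j := \<beta> j - 1)) j))) *
        cmonom (\<beta>(j := \<beta> j - 1)) z = c \<beta> * (of_nat (\<beta> j) * cmonom (\<beta>(j := \<beta> j - 1)) z)"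
      using \<beta> by simp
  next
    fix \<gamma> :: "'a \<Rightarrow> nat" assume \<gamma>: "\<gamma> \<in> multi m"
    then show "\<gamma>(j := Suc (\<gamma> j)) \<in> {\<beta> \<in> multi (Suc m). \<beta> j \<noteq> 0}"
      using sum_multi_upd[of \<gamma> j "Suc (\<gamma> j)"] by (simp add: multi_def)
  qed auto
  finally show ?thesis .
qed

section \<open>Cauchy estimates and bounds for coefficients\<close>

lemma cauchy_estimate:
  fixes f :: "complex^'n::finite \<Rightarrow> complex"
  assumes f: "holomorphic_cn f S" and d: "d > 0" and sub: "cball z d \<subseteq> S"
    and M: "\<And>w. w \<in> cball z d \<Longrightarrow> cmod (f w) \<le> M"
  shows "cmod (dz j f z) \<le> M / d"
proof -
  have inb: "z + axis j (of_real d * cis t) \<in> cball z d" for t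
    using d by (simp add: dist_norm norm_axis_complex norm_mult)
  have cf: "continuous_on (cball z d) f"
    using holomorphic_cn_imp_continuous_on[OF f] sub continuous_on_subset by blast
  have "(\<lambda>t. f (z + axis j (of_real d * cis (2 * pi * t))) * cis (- (2 * pi * t))) integrable_on cbox 0 1"
    by (intro integrable_continuous continuous_intros continuous_on_compose2[OF cf]) (auto intro!: inb)
  moreover have "0 \<le> M"
    using M[of z] d order_trans[OF norm_ge_zero] by auto
  ultimately have "norm (integral (cbox 0 1) (\<lambda>t. f (z + axis j (of_real d * cis (2 * pi * t))) * cis (- (2 * pi * t))))
      \<le> M * measure lborel (cbox 0 (1::real))"
    by (intro integrable_bound) (auto simp: norm_mult intro!: M inb)
  then show ?thesis
    unfolding dz_cauchy[OF f d sub] norm_divide using d by (simp add: divide_right_mono)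
qed

text \<open>Induction on the degree: a multi-index of positive degree has some
  \<open>\<beta> j \<noteq> 0\<close>, and its coefficient appears in the derivative in direction
  \<open>j\<close>, which Cauchy's estimate controls on half the radius. What matters is that
  \<open>K\<close> depends on the degree and the radius only; with \<open>M = 0\<close> the
  statement is the linear independence of monomials.\<close>

lemma hpoly_coeff_bound:
  fixes m :: nat
  assumes "\<rho> > 0"
  shows "\<exists>K. \<forall>(c :: ('n::finite \<Rightarrow> nat) \<Rightarrow> complex) M.
      (\<forall>z\<in>cball 0 \<rho>. cmod (\<Sum>\<beta>\<in>multi m. c \<beta> * cmonom \<beta> z) \<le> M) \<longrightarrow> (\<forall>\<beta>\<in>multi m. cmod (c \<beta>) \<le> K * M)"
  using assms
proof (induction m arbitrary: \<rho>)
  case 0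
  then have "(0 :: complex^'n) \<in> cball 0 \<rho>" by simp
  then show ?case
    by (intro exI[of _ 1]) (fastforce simp: multi_0 cmonom_def)
next
  case (Suc m)
  obtain K where
    K: "\<And>(c :: ('n \<Rightarrow> nat) \<Rightarrow> complex) M. (\<forall>z\<in>cball 0 (\<rho>/2). cmod (\<Sum>\<beta>\<in>multi m. c \<beta> * cmonom \<beta> z) \<le> M) \<Longrightarrow>
      (\<forall>\<beta>\<in>multi m. cmod (c \<beta>) \<le> K * M)"
    using Suc.IH[OF half_gt_zero[OF Suc.prems]] by blast
  show ?case
  \<comment> \<open>\<open>K\<close> belongs to the radius \<open>\<rho> / 2\<close> and the degree
    \<open>m\<close>; the factor \<open>2 / \<rho>\<close> is the loss in Cauchy's estimate with
    circles of radius \<open>\<rho> / 2\<close>. The integer \<open>\<beta> j \<ge> 1\<close>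
    multiplying the coefficient only helps.\<close>
  proof (intro exI[of _ "K * (2 / \<rho>)"] allI impI ballI)
    fix c :: "('n \<Rightarrow> nat) \<Rightarrow> complex" and M and \<beta> :: "'n \<Rightarrow> nat"
    assume M: "\<forall>z\<in>cball 0 \<rho>. cmod (\<Sum>\<beta>\<in>multi (Suc m). c \<beta> * cmonom \<beta> z) \<le> M"
      and \<beta>: "\<beta> \<in> multi (Suc m)"
    then obtain j where j: "\<beta> j \<noteq> 0"
      unfolding multi_def using sum.neutral by fastforce
    define F where "F z = (\<Sum>\<beta>\<in>multi (Suc m). c \<beta> * cmonom \<beta> z)" for z :: "complex^'n"
    have F: "holomorphic_cn F UNIV"
      by (rule hpoly_holomorphic[where m = "Suc m"]) (auto simp: hpoly_def F_def)
    have "cmod (dz j F z) \<le> M / (\<rho> / 2)" if "z \<in> cball 0 (\<rho> / 2)" for z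
    proof (rule cauchy_estimate[OF F])
      fix w assume "w \<in> cball z (\<rho> / 2)"
      then have "norm w \<le> \<rho>"
        using that norm_triangle_ineq[of z "w - z"] by (simp add: dist_norm norm_minus_commute)
      then show "cmod (F w) \<le> M" using M by (simp add: F_def)
    qed (use Suc.prems in auto)
    then have "\<forall>\<gamma>\<in>multi m. cmod (of_nat (Suc (\<gamma> j)) * c (\<gamma>(j := Suc (\<gamma> j)))) \<le> K * (M / (\<rho> / 2))"
      by (intro K) (auto simp: dz_hpoly_coeffs[OF F_def])
    moreover have "\<beta>(j := \<beta> j - 1) \<in> multi m"
      using sum_multi_upd[of \<beta> j "\<beta> j - 1"] \<beta> j by (simp add: multi_def)
    moreover have "(\<beta>(j := \<beta> j - 1))(j := Suc ((\<beta>(j := \<beta> j - 1)) j)) = \<beta>"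
      using j by (auto simp: fun_eq_iff)
    ultimately have "cmod (of_nat (\<beta> j) * c \<beta>) \<le> K * (M / (\<rho> / 2))"
      using j by (metis One_nat_def Suc_pred fun_upd_same not_gr0)
    moreover have "cmod (c \<beta>) \<le> cmod (of_nat (\<beta> j) * c \<beta>)"
      using j by (simp add: norm_mult mult_le_cancel_right1)
    ultimately show "cmod (c \<beta>) \<le> K * (2 / \<rho>) * M" by (simp add: mult_ac)
  qed
qed

section \<open>The expansion into homogeneous polynomials\<close>

text \<open>The recursion is Euler's identity \<open>\<Sum>\<^sub>j z\<^sub>j \<partial>\<^sub>j F = (m + 1) F\<close> for \<open>F\<close> homogeneous of degree \<open>m + 1\<close>.\<close>

primrec hpart :: "nat \<Rightarrow> (complex^'n::finite \<Rightarrow> complex) \<Rightarrow> complex^'n \<Rightarrow> complex" where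
  "hpart 0 f = (\<lambda>z. f 0)"
| "hpart (Suc m) f = (\<lambda>z. 1 / of_nat (Suc m) * (\<Sum>j\<in>UNIV. z $ j * hpart m (dz j f) z))"

lemma hpart_hpoly: "hpoly m (hpart m f)"
  by (induction m arbitrary: f)
     (simp_all only: hpart.simps hpoly_const hpoly_cmult hpoly_sum hpoly_times_nth)

lemmas hpart_holomorphic = hpoly_holomorphic[OF hpart_hpoly]

lemma hpart_cong:
  assumes "\<And>w. w \<in> ball 0 1 \<Longrightarrow> f w = g w"
  shows "hpart m f = hpart m g"
  using assms
proof (induction m arbitrary: f g)
  case (Suc m)
  have "hpart m (dz j f) = hpart m (dz j g)" for j
    by (intro Suc.IH dz_cong_ball[of "ball 0 1"] open_ball Suc.prems)
  then show ?case by simp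
qed simp

lemma higher_deriv_lincomb:
  assumes "\<And>i. i \<in> I \<Longrightarrow> h i holomorphic_on T" "open T" "x \<in> T"
  shows "(deriv ^^ m) (\<lambda>\<zeta>. \<Sum>i\<in>I. a i * h i \<zeta>) x = (\<Sum>i\<in>I. a i * (deriv ^^ m) (h i) x)"
  using assms
proof (induction I rule: infinite_finite_induct)
  case (insert i I)
  have "(deriv ^^ m) (\<lambda>\<zeta>. a i * h i \<zeta> + (\<Sum>i\<in>I. a i * h i \<zeta>)) x
      = (deriv ^^ m) (\<lambda>\<zeta>. a i * h i \<zeta>) x + (deriv ^^ m) (\<lambda>\<zeta>. \<Sum>i\<in>I. a i * h i \<zeta>) x"
    using insert.prems by (intro higher_deriv_add[where S = T] holomorphic_intros) auto
  then show ?case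
    using insert by (simp add: higher_deriv_cmult[where A = T])
qed (simp_all add: higher_deriv_const)

lemma open_line_ball: "open {\<zeta>. \<zeta> *s z \<in> ball 0 (r::real)}" for z :: "complex^'n::finite"
proof -
  have "open ((\<lambda>\<zeta>. \<zeta> *s z) -` ball 0 r)"
    by (intro open_vimage open_ball continuous_intros)
  then show ?thesis by (simp add: vimage_def)
qed

lemma holomorphic_line_ball:
  assumes "holomorphic_cn f (ball 0 1)"
  shows "((\<lambda>\<zeta>. f (\<zeta> *s z)) holomorphic_on {\<zeta>. \<zeta> *s z \<in> ball 0 1})"
    and "\<zeta> *s z \<in> ball 0 1 \<Longrightarrow> deriv (\<lambda>\<zeta>. f (\<zeta> *s z)) \<zeta> = (\<Sum>j\<in>UNIV. z $ j * dz j f (\<zeta> *s z))"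
proof -
  have *: "((\<lambda>\<zeta>. f (\<zeta> *s z)) has_field_derivative (\<Sum>j\<in>UNIV. z $ j * dz j f (\<zeta> *s z))) (at \<zeta>)"
    if "\<zeta> *s z \<in> ball 0 1" for \<zeta>
    using holomorphic_cn_line[OF assms, of 0 \<zeta> z] that by (simp add: mult.commute)
  show "((\<lambda>\<zeta>. f (\<zeta> *s z)) holomorphic_on {\<zeta>. \<zeta> *s z \<in> ball 0 1})"
    unfolding holomorphic_on_def field_differentiable_def
    using * has_field_derivative_at_within by blast
  show "\<zeta> *s z \<in> ball 0 1 \<Longrightarrow> deriv (\<lambda>\<zeta>. f (\<zeta> *s z)) \<zeta> = (\<Sum>j\<in>UNIV. z $ j * dz j f (\<zeta> *s z))"
    by (rule DERIV_imp_deriv[OF *])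
qed

text \<open>The derivative of the slice is the sum over \<open>j\<close> of \<open>z $ j\<close>
  times the slice of \<open>dz j f\<close>. This is the recursion of \<open>hpart\<close> up to the
  factor \<open>Suc m\<close>, which the factorial absorbs.\<close>

lemma hpart_taylor:
  assumes "holomorphic_cn f (ball 0 1)"
  shows "(deriv ^^ m) (\<lambda>\<zeta>. f (\<zeta> *s z)) 0 = fact m * hpart m f z"
  using assms
proof (induction m arbitrary: f)
  case (Suc m)
  define T where "T = {\<zeta>. \<zeta> *s z \<in> ball 0 1}"
  have T: "open T" "0 \<in> T" using open_line_ball[of z 1] by (auto simp: T_def)
  have hol: "holomorphic_cn (dz j f) (ball 0 1)" for j
    by (rule holomorphic_cn_dz_holomorphic[OF Suc.prems open_ball])
  have holT: "(\<lambda>\<zeta>. dz j f (\<zeta> *s z)) holomorphic_on T" for j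
    unfolding T_def by (rule holomorphic_line_ball(1)[OF hol])
  have "(deriv ^^ Suc m) (\<lambda>\<zeta>. f (\<zeta> *s z)) 0 = (deriv ^^ m) (deriv (\<lambda>\<zeta>. f (\<zeta> *s z))) 0"
    by (simp only: funpow_Suc_right o_def)
  also have "\<dots> = (deriv ^^ m) (\<lambda>\<zeta>. \<Sum>j\<in>UNIV. z $ j * dz j f (\<zeta> *s z)) 0"
  proof (rule higher_deriv_transform_within_open[OF _ _ T])
    show "deriv (\<lambda>\<zeta>. f (\<zeta> *s z)) holomorphic_on T"
      unfolding T_def by (intro holomorphic_deriv holomorphic_line_ball(1) Suc.prems open_line_ball)
    show "(\<lambda>\<zeta>. \<Sum>j\<in>UNIV. z $ j * dz j f (\<zeta> *s z)) holomorphic_on T"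
      by (intro holomorphic_intros holT)
    show "deriv (\<lambda>\<zeta>. f (\<zeta> *s z)) w = (\<Sum>j\<in>UNIV. z $ j * dz j f (w *s z))" if "w \<in> T" for w
      using that unfolding T_def by (intro holomorphic_line_ball(2) Suc.prems) auto
  qed
  also have "\<dots> = (\<Sum>j\<in>UNIV. z $ j * (fact m * hpart m (dz j f) z))"
    by (subst higher_deriv_lincomb[OF holT T]) (simp add: Suc.IH[OF hol])
  also have "\<dots> = fact (Suc m) * hpart (Suc m) f z"
    by (simp add: sum_distrib_left mult_ac del: of_nat_Suc)
  finally show ?case .
qed simp

lemma hpart_sums:
  assumes "holomorphic_cn f (ball 0 1)" "z \<in> ball 0 1"
  shows "(\<lambda>m. hpart m f z) sums f z"
proof -
  \<comment> \<open>On this disc \<open>\<zeta> *s z\<close> stays in the unit ball. Its radius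
    exceeds \<open>1\<close>, so the Taylor series of the slice may be evaluated at
    \<open>\<zeta> = 1\<close>; for \<open>z = 0\<close> any radius above \<open>1\<close> would
    do.\<close>
  define r where "r = (if z = 0 then 2 else 1 / norm z)"
  have r: "1 < r" using assms(2) by (auto simp: r_def)
  have "ball 0 r \<subseteq> {\<zeta>. \<zeta> *s z \<in> ball 0 1}"
    by (auto simp: r_def norm_vector_scale field_simps)
  then have "(\<lambda>\<zeta>. f (\<zeta> *s z)) holomorphic_on ball 0 r"
    using holomorphic_line_ball(1)[OF assms(1)] holomorphic_on_subset by blast
  from holomorphic_power_series[OF this, of 1] r
  show ?thesis by (simp add: hpart_taylor[OF assms(1)])
qed

text \<open>Cauchy's inequality for the slice through \<open>z\<close>, on the circle whose points
  \<open>\<zeta> *s z\<close> have norm \<open>\<rho>\<close>. The bound holds for every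
  \<open>z\<close> because the homogeneous parts are polynomials on the whole space.\<close>

lemma hpart_bound:
  assumes f: "holomorphic_cn f (ball 0 1)" and \<rho>: "0 < \<rho>" "\<rho> < 1"
    and M: "\<And>w. w \<in> cball 0 \<rho> \<Longrightarrow> cmod (f w) \<le> M"
  shows "cmod (hpart m f z) \<le> M * (norm z / \<rho>) ^ m"
proof (cases "z = 0")
  case True
  have "cmod (f 0) \<le> M" using M[of 0] \<rho> by simp
  then show ?thesis using True by (cases m) auto
next
  case False
  define R where "R = \<rho> / norm z"
  have R: "R > 0" using False \<rho> by (simp add: R_def)
  have "cball 0 R \<subseteq> {\<zeta>. \<zeta> *s z \<in> ball 0 1}"
  proof
    fix \<zeta> :: complex assume "\<zeta> \<in> cball 0 R"
    then have "cmod \<zeta> * norm z \<le> \<rho>" using False by (simp add: R_def field_simps)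
    then show "\<zeta> \<in> {\<zeta>. \<zeta> *s z \<in> ball 0 1}" using \<rho> by (simp add: norm_vector_scale)
  qed
  then have hol: "(\<lambda>\<zeta>. f (\<zeta> *s z)) holomorphic_on cball 0 R"
    using holomorphic_line_ball(1)[OF f] holomorphic_on_subset by blast
  have "norm ((deriv ^^ m) (\<lambda>\<zeta>. f (\<zeta> *s z)) 0) \<le> fact m * M / R ^ m"
  proof (rule Cauchy_inequality)
    show "norm (f (x *s z)) \<le> M" if "cmod (0 - x) = R" for x
      using that False by (intro M) (simp add: norm_vector_scale R_def)
  qed (use R hol in \<open>auto intro: holomorphic_on_imp_continuous_on holomorphic_on_subset\<close>)
  then have "fact m * cmod (hpart m f z) \<le> fact m * (M / R ^ m)"
    by (simp add: hpart_taylor[OF f] norm_mult)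
  then have "cmod (hpart m f z) \<le> M / R ^ m"
    by (rule mult_left_le_imp_le) simp
  then show ?thesis
    by (simp add: R_def power_divide field_simps)
qed

text \<open>For a radius \<open>\<rho>\<close> strictly between \<open>r\<close> and
  \<open>1\<close> the ratio \<open>r / \<rho>\<close> is below \<open>1\<close>. Such decay on
  smaller balls survives bounded modification of the parts and coefficientwise limits, so it is the
  condition under which series are reassembled.\<close>

lemma hpart_geometric:
  assumes f: "holomorphic_cn f (ball 0 1)" and r: "0 \<le> r" "r < 1"
  shows "\<exists>C q. 0 \<le> C \<and> 0 \<le> q \<and> q < 1 \<and> (\<forall>m. \<forall>z\<in>cball 0 r. cmod (hpart m f z) \<le> C * q ^ m)"
proof -
  define \<rho> where "\<rho> = (1 + r) / 2"
  have \<rho>: "0 < \<rho>" "\<rho> < 1" "r < \<rho>" using r by (auto simp: \<rho>_def)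
  have "cball (0 :: complex^'a) \<rho> \<subseteq> ball 0 1" using \<rho> by auto
  then have "compact (f ` cball 0 \<rho>)"
    by (intro compact_continuous_image compact_cball continuous_on_subset[OF holomorphic_cn_imp_continuous_on[OF f]])
  then obtain M where M: "\<And>w. w \<in> cball 0 \<rho> \<Longrightarrow> cmod (f w) \<le> M"
    using compact_imp_bounded[of "f ` cball 0 \<rho>"] unfolding bounded_iff by blast
  have M0: "0 \<le> M" using M[of 0] \<rho> order_trans[OF norm_ge_zero] by auto
  have "cmod (hpart m f z) \<le> M * (r / \<rho>) ^ m" if "z \<in> cball 0 r" for m z
  proof -
    have "cmod (hpart m f z) \<le> M * (norm z / \<rho>) ^ m"
      by (rule hpart_bound[OF f \<rho>(1,2) M])
    also have "\<dots> \<le> M * (r / \<rho>) ^ m"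
      using that M0 \<rho> by (intro mult_left_mono power_mono divide_right_mono) auto
    finally show ?thesis .
  qed
  then show ?thesis
    using M0 \<rho> r by (intro exI[of _ M] exI[of _ "r / \<rho>"]) auto
qed

text \<open>Applied to the recursion, the product rule gives one copy of
  \<open>hpart (Suc m) (dz j f)\<close>; commuting the derivatives in the other sum gives
  \<open>Suc m\<close> further copies. Together they cancel the factor
  \<open>1 / of_nat (Suc (Suc m))\<close>.\<close>

lemma dz_hpart:
  fixes f :: "complex^'n::finite \<Rightarrow> complex"
  assumes "holomorphic_cn f (ball 0 1)"
  shows "dz j (hpart (Suc m) f) z = hpart m (dz j f) z"
  using assms
proof (induction m arbitrary: f)
  case 0
  have "dz j (\<lambda>z. \<Sum>k\<in>UNIV. z $ k * dz k f 0) z = (\<Sum>k\<in>UNIV. dz j (\<lambda>z. z $ k * dz k f 0) z)"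
    by (rule dz_sum[where S = UNIV]) (auto intro!: holomorphic_cn_mult holomorphic_cn_nth holomorphic_cn_const)
  also have "\<dots> = dz j f 0"
    by (simp add: dz_mult[OF holomorphic_cn_nth holomorphic_cn_const, of z UNIV] dz_const dz_nth
        if_distrib[where f = "\<lambda>x. x * _"] cong: if_cong)
  finally show ?case by simp
next
  case (Suc m)
  let ?a = "1 / of_nat (Suc (Suc m)) :: complex"
  have hol: "holomorphic_cn (dz j f) (ball 0 1)" for j
    by (rule holomorphic_cn_dz_holomorphic[OF Suc.prems open_ball])
  have comm: "hpart m (dz j (dz k f)) = hpart m (dz k (dz j f))" for k
    by (rule hpart_cong) (rule dz_commute[OF Suc.prems open_ball])
  have Suc_eq: "of_nat (Suc m) * hpart (Suc m) (dz j f) z = (\<Sum>k\<in>UNIV. z $ k * hpart m (dz k (dz j f)) z)"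
    by (simp del: of_nat_Suc)
  have "dz j (hpart (Suc (Suc m)) f) z
      = ?a * dz j (\<lambda>z. \<Sum>k\<in>UNIV. z $ k * hpart (Suc m) (dz k f) z) z"
    by (subst hpart.simps(2), rule dz_cmult[where S = UNIV])
       (auto intro!: holomorphic_cn_sum holomorphic_cn_mult holomorphic_cn_nth hpart_holomorphic simp del: hpart.simps)
  also have "dz j (\<lambda>z. \<Sum>k\<in>UNIV. z $ k * hpart (Suc m) (dz k f) z) z
      = (\<Sum>k\<in>UNIV. dz j (\<lambda>z. z $ k * hpart (Suc m) (dz k f) z) z)"
    by (rule dz_sum[where S = UNIV]) 
       (auto intro!: holomorphic_cn_mult holomorphic_cn_nth hpart_holomorphic simp del: hpart.simps)
  also have "\<dots> = (\<Sum>k\<in>UNIV. (if j = k then 1 else 0) * hpart (Suc m) (dz k f) z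
      + z $ k * hpart m (dz k (dz j f)) z)"
    by (intro sum.cong refl, subst dz_mult[OF holomorphic_cn_nth hpart_holomorphic, of _ UNIV])
       (auto simp: dz_nth Suc.IH[OF hol] comm simp del: hpart.simps)
  also have "\<dots> = hpart (Suc m) (dz j f) z + of_nat (Suc m) * hpart (Suc m) (dz j f) z"
    by (simp only: sum.distrib Suc_eq)
       (simp add: if_distrib[where f = "\<lambda>x. x * _"] del: of_nat_Suc hpart.simps cong: if_cong)
  also have "\<dots> = of_nat (Suc (Suc m)) * hpart (Suc m) (dz j f) z"
    by (simp only: of_nat_Suc[of "Suc m"] distrib_right mult_1_left)
  also have "?a * \<dots> = hpart (Suc m) (dz j f) z"
    by (simp del: of_nat_Suc hpart.simps)
  finally show ?case .
qed

lemma euler_hpart: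
  assumes "holomorphic_cn f (ball 0 1)"
  shows "(\<Sum>j\<in>UNIV. z $ j * dz j (hpart m f) z) = of_nat m * hpart m f z"
proof (cases m)
  case (Suc k)
  then show ?thesis
    by (simp only: dz_hpart[OF assms]) (simp add: field_simps del: of_nat_Suc)
qed (simp add: dz_const)

lemma powser_coeff_zero:
  fixes a :: "nat \<Rightarrow> complex"
  assumes "r > 0" "\<And>x. norm x < r \<Longrightarrow> (\<lambda>n. a n * x ^ n) sums 0"
  shows "a m = 0"
proof (cases "m = 0")
  case True
  have "(\<lambda>n. a n * 0 ^ n) sums 0" using assms(2)[of 0] assms(1) by simp
  then show ?thesis using sums_unique2[OF powser_sums_zero[of a]] True by blast
next
  case False
  show ?thesis
  proof (rule ccontr)
    assume "a m \<noteq> 0"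
    show False
    proof (rule powser_0_nonzero[of r 0 a "\<lambda>_. 0" m])
      show "(\<lambda>n. a n * (x - 0) ^ n) sums 0" if "norm (x - 0) < r" for x
        using assms(2)[of x] that by simp
      show "0 < r" "a m \<noteq> 0" by fact+
      show "0 < m" using False by simp
      fix s :: real assume s: "0 < s" "\<And>z :: complex. z \<in> cball 0 s - {0} \<Longrightarrow> (0::complex) \<noteq> 0"
      from s(2)[of "of_real s"] s(1) show False by auto
    qed simp
  qed
qed

section \<open>Uniqueness of the expansion and algebraic rules for the parts\<close>

text \<open>On a complex line through the origin both expansions are power series in the scaling
  parameter, so their coefficients agree. The rules for sums, scalar multiples and coordinate
  factors below are obtained by exhibiting an expansion.\<close>

lemma hpart_unique:
  assumes f: "holomorphic_cn f (ball 0 1)" and r: "r > 0" and F: "\<And>m. hpoly m (F m)"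
    and sums: "\<And>z. z \<in> ball 0 r \<Longrightarrow> (\<lambda>m. F m z) sums f z"
  shows "hpart m f = F m"
proof
  fix z :: "complex^'a"
  \<comment> \<open>The minimum keeps \<open>x *s z\<close> in both balls of convergence, and the
    summand \<open>1\<close> keeps the quotient meaningful for \<open>z = 0\<close>.\<close>
  define \<delta> where "\<delta> = min r 1 / (norm z + 1)"
  have \<delta>: "\<delta> > 0" using r by (simp add: \<delta>_def add_nonneg_pos)
  have "(\<lambda>n. (hpart n f z - F n z) * x ^ n) sums 0" if "norm x < \<delta>" for x :: complex
  proof -
    have "norm (x *s z) \<le> norm x * (norm z + 1)"
      by (simp add: norm_vector_scale mult_left_mono)
    also have "\<dots> < min r 1"
      using that unfolding \<delta>_def by (subst (asm) pos_less_divide_eq) (auto intro: add_nonneg_pos)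
    finally have n: "norm (x *s z) < min r 1" .
    from sums_diff[OF hpart_sums[OF f, of "x *s z"] sums[of "x *s z"]] n
    have "(\<lambda>n. hpart n f (x *s z) - F n (x *s z)) sums 0" by simp
    then show ?thesis
      by (simp add: hpoly_scale[OF hpart_hpoly] hpoly_scale[OF F] algebra_simps)
  qed
  from powser_coeff_zero[OF \<delta> this] show "hpart m f z = F m z" by simp
qed

lemma hpart_add:
  assumes "holomorphic_cn f (ball 0 1)" "holomorphic_cn g (ball 0 1)"
  shows "hpart m (\<lambda>z. f z + g z) = (\<lambda>z. hpart m f z + hpart m g z)"
  by (rule hpart_unique[where r = 1 and F = "\<lambda>m z. hpart m f z + hpart m g z"])
     (auto intro!: holomorphic_cn_add assms hpoly_add hpart_hpoly sums_add hpart_sums)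

lemma hpart_cmult:
  assumes "holomorphic_cn f (ball 0 1)"
  shows "hpart m (\<lambda>z. c * f z) = (\<lambda>z. c * hpart m f z)"
  by (rule hpart_unique[where r = 1 and F = "\<lambda>m z. c * hpart m f z"])
     (auto intro!: holomorphic_cn_cmult assms hpoly_cmult hpart_hpoly sums_mult hpart_sums)

lemma hpart_zero: "hpart m (\<lambda>z. 0) = (\<lambda>z. 0)"
  by (rule hpart_unique[where r = 1 and F = "\<lambda>m z. 0"]) (auto intro: holomorphic_cn_const hpoly_zero)

lemma hpart_sum:
  assumes "\<And>i. i \<in> I \<Longrightarrow> holomorphic_cn (f i) (ball 0 1)"
  shows "hpart m (\<lambda>z. \<Sum>i\<in>I. f i z) = (\<lambda>z. \<Sum>i\<in>I. hpart m (f i) z)"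
  using assms
  by (induction I rule: infinite_finite_induct) (simp_all add: hpart_zero hpart_add holomorphic_cn_sum)

lemma hpart_times_nth:
  assumes "holomorphic_cn f (ball 0 1)"
  shows "hpart m (\<lambda>z. z $ j * f z) = (case m of 0 \<Rightarrow> \<lambda>z. 0 | Suc k \<Rightarrow> (\<lambda>z. z $ j * hpart k f z))"
proof (rule hpart_unique[where r = 1])
  show "hpoly m (case m of 0 \<Rightarrow> \<lambda>z. 0 | Suc k \<Rightarrow> (\<lambda>z. z $ j * hpart k f z))" for m
    by (auto split: nat.split intro: hpoly_zero hpoly_times_nth hpart_hpoly)
  fix z :: "complex^'a" assume "z \<in> ball 0 1"
  from sums_mult[OF hpart_sums[OF assms this], of "z $ j"]
  have "(\<lambda>m. (case Suc m of 0 \<Rightarrow> \<lambda>z. 0 | Suc k \<Rightarrow> (\<lambda>z. z $ j * hpart k f z)) z) sums (z $ j * f z)" by simp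
  then show "(\<lambda>m. (case m of 0 \<Rightarrow> \<lambda>z. 0 | Suc k \<Rightarrow> (\<lambda>z. z $ j * hpart k f z)) z) sums (z $ j * f z)"
    by (subst (asm) sums_Suc_iff) simp
qed (auto intro: holomorphic_cn_mult holomorphic_cn_nth assms)

lemma hpart_of_hpoly:
  assumes "hpoly k F"
  shows "hpart m F = (if m = k then F else (\<lambda>z. 0))"
  by (rule hpart_unique[where r = 1 and F = "\<lambda>m. if m = k then F else (\<lambda>z. 0)"])
     (use assms sums_single[of k "\<lambda>_. F _"] in \<open>auto intro: hpoly_holomorphic hpoly_zero simp: if_distrib[where f = "\<lambda>f. f _"] cong: if_cong\<close>)

section \<open>Holomorphic functions assembled from homogeneous polynomials\<close>

lemma suminf_tail_bound:
  fixes a :: "nat \<Rightarrow> complex"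
  assumes "\<And>m. cmod (a m) \<le> C * q ^ m" "0 \<le> q" "q < 1"
  shows "summable a" "cmod ((\<Sum>i<n. a i) - suminf a) \<le> C / (1 - q) * q ^ n"
proof -
  have sg: "summable (\<lambda>m. C * q ^ m)" using assms by (intro summable_mult summable_geometric) auto
  show sa: "summable a" by (rule summable_comparison_test'[OF sg]) (use assms in auto)
  have "suminf a - (\<Sum>i<n. a i) = (\<Sum>i. a (i + n))" by (simp add: suminf_minus_initial_segment[OF sa])
  moreover have "cmod (\<Sum>i. a (i + n)) \<le> (\<Sum>i. (C * q ^ n) * q ^ i)"
  proof (rule norm_suminf_le)
    show "cmod (a (i + n)) \<le> C * q ^ n * q ^ i" for i
      using assms(1)[of "i + n"] by (simp add: power_add mult_ac)
    show "summable (\<lambda>i. C * q ^ n * q ^ i)" using assms by (intro summable_mult summable_geometric) auto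
  qed
  moreover have "(\<Sum>i. (C * q ^ n) * q ^ i) = C / (1 - q) * q ^ n"
    using assms by (subst suminf_mult) (auto simp: suminf_geometric)
  ultimately show "cmod ((\<Sum>i<n. a i) - suminf a) \<le> C / (1 - q) * q ^ n"
    by (metis norm_minus_commute)
qed

text \<open>The converse of the expansion, by termwise differentiation: Cauchy's estimate turns the
  geometric bounds for the polynomials into geometric bounds for their derivatives on a slightly
  smaller ball. It constructs both the spectral multipliers and the limits of subsequences.\<close>

lemma hpoly_assemble:
  fixes F :: "nat \<Rightarrow> complex^'n::finite \<Rightarrow> complex"
  assumes F: "\<And>m. hpoly m (F m)"
    and bd: "\<And>r. 0 \<le> r \<Longrightarrow> r < 1 \<Longrightarrow> \<exists>C q. 0 \<le> q \<and> q < 1 \<and> (\<forall>m. \<forall>z\<in>cball 0 r. cmod (F m z) \<le> C * q ^ m)"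
  shows "holomorphic_cn (\<lambda>z. \<Sum>m. F m z) (ball 0 1)"
    and "hpart m (\<lambda>z. \<Sum>m. F m z) = F m"
    and "z \<in> ball 0 1 \<Longrightarrow> (\<lambda>m. F m z) sums (\<Sum>m. F m z)"
proof -
  have "summable (\<lambda>m. F m z)" if "z \<in> ball 0 1" for z
  proof -
    from bd[of "norm z"] that obtain C q where "0 \<le> q" "q < 1" "\<And>m. cmod (F m z) \<le> C * q ^ m" by force
    then show ?thesis by (intro suminf_tail_bound(1))
  qed
  then show s: "z \<in> ball 0 1 \<Longrightarrow> (\<lambda>m. F m z) sums (\<Sum>m. F m z)" for z by (simp add: summable_sums)
  show hol: "holomorphic_cn (\<lambda>z. \<Sum>m. F m z) (ball 0 1)"
  proof (rule holomorphic_cnI)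
    fix z :: "complex^'n" assume z: "z \<in> ball 0 1"
    define r where "r = (1 + norm z) / 2"
    \<comment> \<open>The polynomials are bounded on the ball of radius \<open>r + d < 1\<close>;
      the margin \<open>d\<close> is the radius of the circles in Cauchy's estimate at points of
      \<open>ball 0 r\<close>.\<close>
    define d where "d = (1 - r) / 2"
    have r: "norm z < r" "0 \<le> r" "r < 1" "d > 0" "r + d < 1" "0 \<le> r + d"
      using z by (auto simp: r_def d_def field_simps)
    from bd[of "r + d"] r obtain C q where q: "0 \<le> q" "q < 1"
      and C: "\<And>m z. z \<in> cball 0 (r + d) \<Longrightarrow> cmod (F m z) \<le> C * q ^ m" by blast
    have dzb: "cmod (dz j (F m) x) \<le> C / d * q ^ m" if "x \<in> ball 0 r" for j m x
    proof -
      have "cmod (dz j (F m) x) \<le> C * q ^ m / d"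
      proof (rule cauchy_estimate[OF hpoly_holomorphic[OF F, where S = UNIV]])
        fix w assume "w \<in> cball x d"
        then show "cmod (F m w) \<le> C * q ^ m"
          using that norm_triangle_ineq[of x "w - x"] by (intro C) (simp add: dist_norm norm_minus_commute)
      qed (use r in auto)
      then show ?thesis by simp
    qed
    define D where "D x j = (\<Sum>m. dz j (F m) x)" for x j
    define K where "K = real CARD('n) * (C / d / (1 - q))"
    have tail: "norm ((\<Sum>i<n. \<Sum>j\<in>UNIV. dz j (F i) x * h $ j) - (\<Sum>j\<in>UNIV. D x j * h $ j)) \<le> (K * q ^ n) * norm h"
      if x: "x \<in> ball 0 r" for x n and h :: "complex^'n"
    proof -
      have "(\<Sum>i<n. \<Sum>j\<in>UNIV. dz j (F i) x * h $ j) - (\<Sum>j\<in>UNIV. D x j * h $ j)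
          = (\<Sum>j\<in>UNIV. ((\<Sum>i<n. dz j (F i) x) - D x j) * h $ j)"
        by (subst sum.swap) (simp add: sum_distrib_right left_diff_distrib sum_subtractf)
      also have "norm \<dots> \<le> (\<Sum>j\<in>(UNIV::'n set). (C / d / (1 - q) * q ^ n) * norm h)"
      proof (rule sum_norm_le)
        fix j
        have "norm ((\<Sum>i<n. dz j (F i) x) - D x j) \<le> C / d / (1 - q) * q ^ n"
          unfolding D_def by (rule suminf_tail_bound(2)[OF dzb[OF x] q])
        then show "norm (((\<Sum>i<n. dz j (F i) x) - D x j) * h $ j) \<le> C / d / (1 - q) * q ^ n * norm h"
          unfolding norm_mult using order_trans[OF norm_ge_zero]
          by (intro mult_mono Finite_Cartesian_Product.norm_nth_le) auto
      qed
      finally show ?thesis by (simp add: K_def mult_ac)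
    qed
    have "\<exists>g. \<forall>x\<in>ball 0 r. (\<lambda>n. F n x) sums (g x) \<and> (g has_derivative (\<lambda>h. \<Sum>j\<in>UNIV. D x j * h $ j)) (at x within ball 0 r)"
    proof (rule has_derivative_series[where f' = "\<lambda>m x h. \<Sum>j\<in>UNIV. dz j (F m) x * h $ j" and x = z])
      show "(F n has_derivative (\<lambda>h. \<Sum>j\<in>UNIV. dz j (F n) x * h $ j)) (at x within ball 0 r)" for n and x :: "complex^'n"
        by (rule has_derivative_at_withinI[OF holomorphic_cn_dz[OF hpoly_holomorphic[OF F, where S = UNIV]]]) simp
      fix e :: real assume "e > 0"
      have "(\<lambda>n. K * q ^ n) \<longlonglongrightarrow> 0"
        using q by (intro tendsto_mult_right_zero LIMSEQ_power_zero) auto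
      then have "\<forall>\<^sub>F n in sequentially. K * q ^ n < e"
        using \<open>e > 0\<close> by (rule order_tendstoD(2))
      then show "\<forall>\<^sub>F n in sequentially. \<forall>x\<in>ball 0 r. \<forall>h. norm ((\<Sum>i<n. \<Sum>j\<in>UNIV. dz j (F i) x * h $ j) - (\<Sum>j\<in>UNIV. D x j * h $ j)) \<le> e * norm h"
      proof (rule eventually_mono, intro ballI allI)
        fix n and x h :: "complex^'n" assume "K * q ^ n < e" "x \<in> ball 0 r"
        then show "norm ((\<Sum>i<n. \<Sum>j\<in>UNIV. dz j (F i) x * h $ j) - (\<Sum>j\<in>UNIV. D x j * h $ j)) \<le> e * norm h"
          by (intro order_trans[OF tail] mult_right_mono) auto
      qed
    next
      show "z \<in> ball 0 r" using r by simp
      show "(\<lambda>n. F n z) sums (\<Sum>m. F m z)" by (rule s[OF z])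
    qed simp
    then obtain g where g: "\<And>x. x \<in> ball 0 r \<Longrightarrow> (\<lambda>n. F n x) sums g x"
      "\<And>x. x \<in> ball 0 r \<Longrightarrow> (g has_derivative (\<lambda>h. \<Sum>j\<in>UNIV. D x j * h $ j)) (at x within ball 0 r)" by blast
    have "(g has_derivative (\<lambda>h. \<Sum>j\<in>UNIV. D z j * h $ j)) (at z)"
      using g(2)[of z] r at_within_open[of z "ball 0 r"] by simp
    then have "((\<lambda>z. \<Sum>m. F m z) has_derivative (\<lambda>h. \<Sum>j\<in>UNIV. D z j * h $ j)) (at z)"
      by (rule has_derivative_transform_within_open[OF _ open_ball[of 0 r]]) (use r g(1) sums_unique in auto)
    then show "((\<lambda>z. \<Sum>m. F m z) has_derivative (\<lambda>v. \<Sum>j\<in>UNIV. (\<Sum>m. dz j (F m) z) * v $ j)) (at z)"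
      by (simp add: D_def)
  qed
  show "hpart m (\<lambda>z. \<Sum>m. F m z) = F m"
    by (rule hpart_unique[OF hol _ F, of 1]) (use s in auto)
qed

section \<open>Rotation invariance of Lebesgue measure\<close>

text \<open>A translation-invariant measure \<open>M\<close> giving the unit ball \<open>B\<close> its Lebesgue measure is Lebesgue
  measure: by Fubini, \<open>vol(B) M(A) = vol(A) M(B)\<close> for every \<open>A\<close>.\<close>

lemma lborel_eqI_translation_invariant:
  fixes M :: "'a::euclidean_space measure"
  assumes sets [measurable_cong, simp]: "sets M = sets borel" and "sigma_finite_measure M"
    and inv: "\<And>c. distr M borel ((+) c) = M"
    and ball: "emeasure M (ball 0 1) = emeasure lborel (ball 0 1 :: 'a set)"
  shows "M = lborel"
proof (rule measure_eqI)
  interpret M: sigma_finite_measure M by fact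
  interpret P: pair_sigma_finite M lborel ..
  have invM: "(\<integral>\<^sup>+x. f (c + x) \<partial>M) = (\<integral>\<^sup>+x. f x \<partial>M)" if "f \<in> borel_measurable borel" for f c
    using that nn_integral_distr[of "(+) c" M borel f] by (simp add: inv)
  have invL: "(\<integral>\<^sup>+x. f (c + x) \<partial>lborel) = (\<integral>\<^sup>+x. f x \<partial>lborel)" if "f \<in> borel_measurable borel" for f and c :: 'a
    using that nn_integral_distr[of "(+) c" lborel borel f] by (simp add: lborel_distr_plus)
  let ?B = "ball 0 1 :: 'a set"
  fix A assume "A \<in> sets M"
  then have A [measurable]: "A \<in> sets borel" by simp
  have B [measurable]: "?B \<in> sets borel" by simp
  have "emeasure lborel ?B * emeasure M A = (\<integral>\<^sup>+y. indicator ?B y * (\<integral>\<^sup>+x. indicator A x \<partial>M) \<partial>lborel)"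
    by (subst nn_integral_multc) (auto simp: nn_integral_indicator)
  also have "\<dots> = (\<integral>\<^sup>+y. (\<integral>\<^sup>+x. indicator ?B y * indicator A (y + x) \<partial>M) \<partial>lborel)"
    by (intro nn_integral_cong) (simp add: invM nn_integral_cmult)
  also have "\<dots> = (\<integral>\<^sup>+x. (\<integral>\<^sup>+y. indicator ?B y * indicator A (y + x) \<partial>lborel) \<partial>M)"
    by (rule P.Fubini') measurable
  also have "\<dots> = (\<integral>\<^sup>+x. (\<integral>\<^sup>+y. indicator ?B (y - x) * indicator A y \<partial>lborel) \<partial>M)"
  proof (rule nn_integral_cong)
    fix x
    show "(\<integral>\<^sup>+y. indicator ?B y * indicator A (y + x) \<partial>lborel) = (\<integral>\<^sup>+y. indicator ?B (y - x) * indicator A y \<partial>lborel)"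
      using invL[of "\<lambda>y. indicator ?B (y - x) * indicator A y" x] by (simp add: add.commute)
  qed
  also have "\<dots> = (\<integral>\<^sup>+y. (\<integral>\<^sup>+x. indicator ?B (y - x) * indicator A y \<partial>M) \<partial>lborel)"
    by (rule P.Fubini'[symmetric]) measurable
  also have "\<dots> = (\<integral>\<^sup>+y. emeasure M ?B * indicator A y \<partial>lborel)"
  proof (rule nn_integral_cong)
    \<comment> \<open>Translating by \<open>y\<close> turns the indicator at \<open>y - x\<close>
      into the one at \<open>- x\<close>, and the ball is symmetric about the origin.\<close>
    fix y
    have "(\<integral>\<^sup>+x. indicator ?B (y - x) \<partial>M) = (\<integral>\<^sup>+x. indicator ?B (y - (y + x)) \<partial>M)"
      using invM[of "\<lambda>x. indicator ?B (y - x)" y] by simp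
    also have "\<dots> = (\<integral>\<^sup>+x. indicator ?B x \<partial>M)"
      by (intro nn_integral_cong) (simp add: indicator_def)
    finally show "(\<integral>\<^sup>+x. indicator ?B (y - x) * indicator A y \<partial>M) = emeasure M ?B * indicator A y"
      by (simp add: nn_integral_multc)
  qed
  also have "\<dots> = emeasure lborel ?B * emeasure lborel A"
    by (simp add: nn_integral_cmult ball)
  finally have "emeasure lborel ?B * emeasure M A = emeasure lborel ?B * emeasure lborel A" .
  moreover have "emeasure lborel ?B \<noteq> 0" "emeasure lborel ?B \<noteq> \<infinity>"
    using unit_ball_vol_pos[of "real DIM('a)"] by (auto simp: emeasure_ball less_le)
  ultimately show "emeasure M A = emeasure lborel A"
    by (simp add: ennreal_mult_cancel_left)
qed simp

text \<open>The image measure inherits translation invariance because multiplication by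
  \<open>c\<close> is linear and invertible, and it gives balls about the origin their Lebesgue
  measure because \<open>c\<close> is unimodular; \<open>lborel_eqI_translation_invariant\<close>
  then identifies it.\<close>

lemma lborel_distr_vector_scale:
  assumes "cmod c = 1"
  shows "distr lborel borel (\<lambda>z. c *s (z :: complex^'n::finite)) = lborel"
proof -
  define M where "M = distr lborel borel (\<lambda>z. c *s (z :: complex^'n))"
  have [measurable]: "(\<lambda>z. a *s (z :: complex^'n)) \<in> borel_measurable borel" for a
    by (intro borel_measurable_continuous_onI continuous_intros)
  have vball: "(\<lambda>z. c *s (z :: complex^'n)) -` ball 0 r = ball 0 r" for r
    using assms by (auto simp: norm_vector_scale)
  have eM: "emeasure M (ball 0 r) = emeasure lborel (ball 0 r :: (complex^'n) set)" for r
    unfolding M_def by (subst emeasure_distr) (auto simp: vball)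
  have "M = lborel"
  proof (rule lborel_eqI_translation_invariant)
    show "sets M = sets borel" by (simp add: M_def)
    show "sigma_finite_measure M"
    proof
      have U: "(\<Union>n::nat. ball 0 (real n)) = (UNIV :: (complex^'n) set)"
        by (auto simp: reals_Archimedean2)
      show "\<exists>A. countable A \<and> A \<subseteq> sets M \<and> \<Union> A = space M \<and> (\<forall>a\<in>A. emeasure M a \<noteq> \<infinity>)"
        using U eM emeasure_lborel_ball_finite
        by (intro exI[of _ "range (\<lambda>n::nat. ball 0 (real n))"]) (auto simp: M_def less_top)
    qed
    show "emeasure M (ball 0 1) = emeasure lborel (ball 0 1 :: (complex^'n) set)" by (rule eM)
    fix b :: "complex^'n"
    have ne: "c \<noteq> 0" using assms by auto
    have eq: "b + c *s z = c *s (inverse c *s b + z)" for z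
      using ne by (simp add: vector_add_ldistrib vector_smult_assoc)
    have "distr M borel ((+) b) = distr lborel borel (\<lambda>z. c *s (inverse c *s b + z))"
      unfolding M_def by (subst distr_distr) (auto simp: o_def eq)
    also have "\<dots> = distr (distr lborel borel ((+) (inverse c *s b))) borel (\<lambda>z. c *s z)"
      by (subst distr_distr) (auto simp: o_def)
    also have "\<dots> = M" by (simp add: lborel_distr_plus M_def)
    finally show "distr M borel ((+) b) = M" .
  qed
  then show ?thesis by (simp add: M_def)
qed

lemma set_lebesgue_integral_rotate:
  fixes F :: "complex^'n::finite \<Rightarrow> 'b::{banach, second_countable_topology}"
  assumes "cmod c = 1" and "continuous_on (ball 0 r) F"
  shows "(LINT z:ball 0 r|lborel. F (c *s z)) = (LINT z:ball 0 r|lborel. F z)"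
proof -
  have m: "(\<lambda>z. indicator (ball 0 r) z *\<^sub>R F z) \<in> borel_measurable borel"
    by (rule borel_measurable_continuous_on_indicator) (use assms in auto)
  have [measurable]: "(\<lambda>z. c *s (z :: complex^'n)) \<in> borel_measurable borel"
    by (intro borel_measurable_continuous_onI continuous_intros)
  have "(LINT z:ball 0 r|lborel. F z) = (LINT z|distr lborel borel (\<lambda>z. c *s z). indicator (ball 0 r) z *\<^sub>R F z)"
    by (simp add: lborel_distr_vector_scale[OF assms(1)] set_lebesgue_integral_def)
  also have "\<dots> = (LINT z|lborel. indicator (ball 0 r) (c *s z) *\<^sub>R F (c *s z))"
    by (rule integral_distr[OF _ m]) simp
  also have "\<dots> = (LINT z:ball 0 r|lborel. F (c *s z))"
    using assms(1) by (simp add: set_lebesgue_integral_def indicator_def norm_vector_scale)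
  finally show ?thesis by simp
qed

section \<open>Integration by parts\<close>

text \<open>Translation invariance makes the integral of every difference quotient vanish, and
  dominated convergence passes this to the derivative.\<close>

lemma integral_directional_derivative_zero:
  fixes F :: "'a::euclidean_space \<Rightarrow> complex"
  assumes F: "\<And>x. (F has_derivative D x) (at x)"
    and K: "\<And>x v. norm (D x v) \<le> K * norm v"
    and supp: "\<And>x. norm x > R \<Longrightarrow> F x = 0"
  shows "integrable lborel (\<lambda>x. D x b)" "integral\<^sup>L lborel (\<lambda>x. D x b) = 0"
proof -
  have cF: "continuous_on UNIV F"
    by (rule continuous_at_imp_continuous_on) (use has_derivative_continuous[OF F] in blast)
  then have [measurable]: "F \<in> borel_measurable borel" by (rule borel_measurable_continuous_onI)
  have K0: "K \<ge> 0"
    using order_trans[OF norm_ge_zero K[of 0 "SOME b. b \<in> Basis"]] by (simp add: some_in_eq norm_Basis)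
  define G where "G n x = of_nat (Suc n) * (F (x + (1 / real (Suc n)) *\<^sub>R b) - F x)" for n x
  have lip: "norm (F y - F x) \<le> K * norm (y - x)" for x y
  proof (rule differentiable_bound[of UNIV F D])
    show "onorm (D x) \<le> K" for x
      by (rule onorm_bound[OF K0 K])
  qed (auto intro: F)
  have intF: "integrable lborel F"
  proof -
    have "compact (F ` cball 0 R)"
      using cF by (intro compact_continuous_image) (auto intro: continuous_on_subset)
    then obtain B where B: "\<And>x. x \<in> cball 0 R \<Longrightarrow> norm (F x) \<le> B"
      using compact_imp_bounded[of "F ` cball 0 R"] unfolding bounded_iff by blast
    show ?thesis
    proof (rule integrableI_bounded_set[of "cball 0 R" _ F B])
      show "AE x in lborel. x \<in> cball 0 R \<longrightarrow> norm (F x) \<le> B" using B by simp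
      show "AE x in lborel. x \<notin> cball 0 R \<longrightarrow> F x = 0" using supp by auto
      show "emeasure lborel (cball (0::'a) R) < \<infinity>" by (rule emeasure_lborel_cball_finite)
    qed auto
  qed
  have shift: "integral\<^sup>L lborel (\<lambda>x. F (x + c)) = integral\<^sup>L lborel F" "integrable lborel (\<lambda>x. F (x + c))" for c
    using integral_distr[of "(+) c" lborel borel F] integrable_distr[of "(+) c" lborel borel F] intF
    by (simp_all add: lborel_distr_plus add.commute)
  have intG: "integral\<^sup>L lborel (G n) = 0" for n
    unfolding G_def using shift intF by simp
  \<comment> \<open>The quotients \<open>G n\<close> vanish off the support of \<open>F\<close>
    enlarged by \<open>norm b\<close>, and the Lipschitz bound controls them independently of
    \<open>n\<close>.\<close>
  let ?w = "\<lambda>x :: 'a. indicator (cball 0 (R + norm b)) x *\<^sub>R (K * norm b)"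
  have lim: "(\<lambda>n. G n x) \<longlonglongrightarrow> D x b" for x
  proof -
    have 1: "((\<lambda>t. F (x + t *\<^sub>R b)) has_derivative (\<lambda>t. D x (t *\<^sub>R b))) (at 0)"
      by (rule has_derivative_compose[of "\<lambda>t. x + t *\<^sub>R b" "\<lambda>t. t *\<^sub>R b" 0 UNIV F "D x", simplified])
         (auto intro!: derivative_eq_intros F)
    have lin: "D x (c *\<^sub>R b) = c *\<^sub>R D x b" for c
      using linear_cmul[OF has_derivative_linear[OF F]] .
    have L: "((\<lambda>h. norm (F (x + h *\<^sub>R b) - F x - h *\<^sub>R D x b) / norm h) \<longlongrightarrow> 0) (at 0)"
      using 1 unfolding has_derivative_at by (simp add: lin)
    have "filterlim (\<lambda>n. 1 / real (Suc n)) (at 0) sequentially"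
      unfolding filterlim_at using LIMSEQ_inverse_real_of_nat by (auto simp: inverse_eq_divide)
    from filterlim_compose[OF L this]
    have "(\<lambda>n. norm (F (x + (1 / real (Suc n)) *\<^sub>R b) - F x - (1 / real (Suc n)) *\<^sub>R D x b) / norm (1 / real (Suc n))) \<longlonglongrightarrow> 0" .
    moreover have "norm (F (x + (1 / real (Suc n)) *\<^sub>R b) - F x - (1 / real (Suc n)) *\<^sub>R D x b) / norm (1 / real (Suc n)) = norm (G n x - D x b)" for n
    proof -
      define N where "N = real (Suc n)"
      have N: "N > 0" by (simp add: N_def)
      have "norm (F (x + (1 / N) *\<^sub>R b) - F x - (1 / N) *\<^sub>R D x b) / norm (1 / N)
        = norm (of_real N * (F (x + (1 / N) *\<^sub>R b) - F x - (1 / N) *\<^sub>R D x b))"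
        using N by (simp add: norm_mult)
      also have "of_real N * (F (x + (1 / N) *\<^sub>R b) - F x - (1 / N) *\<^sub>R D x b) = G n x - D x b"
        using N by (simp add: G_def N_def[symmetric] scaleR_conv_of_real right_diff_distrib)
          (simp add: N_def)
      finally show ?thesis by (simp only: N_def)
    qed
    ultimately have "(\<lambda>n. norm (G n x - D x b)) \<longlonglongrightarrow> 0" by simp
    then show ?thesis
      using Lim_null tendsto_norm_zero_iff by blast
  qed
  have lim_AE: "AE x in lborel. (\<lambda>n. G n x) \<longlonglongrightarrow> D x b" using lim by simp
  have Gm: "G n \<in> borel_measurable lborel" for n unfolding G_def by measurable
  have Dm: "(\<lambda>x. D x b) \<in> borel_measurable lborel"
    by (rule borel_measurable_LIMSEQ_metric[OF Gm]) (rule lim)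
  have int_w: "integrable lborel ?w"
    using emeasure_lborel_cball_finite[of "0::'a" "R + norm b"]
    by (intro integrable_scaleR_left) (simp add: integrable_indicator_iff)
  have dom: "AE x in lborel. norm (G n x) \<le> ?w x" for n
  proof (rule AE_I2)
    fix x :: 'a
    have sm: "norm ((1 / real (Suc n)) *\<^sub>R b) \<le> norm b"
      by (simp add: field_simps mult_le_cancel_right1)
    show "norm (G n x) \<le> indicator (cball 0 (R + norm b)) x *\<^sub>R (K * norm b)"
    proof (cases "norm x \<le> R + norm b")
      case True
      have "norm (G n x) = real (Suc n) * norm (F (x + (1 / real (Suc n)) *\<^sub>R b) - F x)"
        by (simp add: G_def norm_mult del: of_nat_Suc)
      also have "\<dots> \<le> real (Suc n) * (K * norm ((1 / real (Suc n)) *\<^sub>R b))"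
        using lip[of "x + (1 / real (Suc n)) *\<^sub>R b" x] by (intro mult_left_mono) auto
      also have "\<dots> = K * norm b" by (simp del: of_nat_Suc)
      finally show ?thesis using True by simp
    next
      case False
      then have "norm x > R" using norm_ge_zero[of b] by linarith
      moreover have "norm (x + (1 / real (Suc n)) *\<^sub>R b) > R"
        using False sm norm_triangle_ineq4[of "x + (1 / real (Suc n)) *\<^sub>R b" "(1 / real (Suc n)) *\<^sub>R b"]
        by (simp only: add_diff_cancel_right')
      ultimately show ?thesis using K0 by (simp add: G_def supp)
    qed
  qed
  show "integrable lborel (\<lambda>x. D x b)"
    by (rule integrable_dominated_convergence[OF Dm Gm int_w lim_AE dom])
  show "integral\<^sup>L lborel (\<lambda>x. D x b) = 0"
    using integral_dominated_convergence[OF Dm Gm int_w lim_AE dom] by (simp add: intG LIMSEQ_const_iff)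
qed

text \<open>Extended by zero past \<open>s = 0\<close> the weight is continuously differentiable, so integration by
  parts over the ball produces no boundary terms.\<close>

definition bump :: "real \<Rightarrow> nat \<Rightarrow> real \<Rightarrow> real" where
  "bump \<alpha> m s = (if s > 0 then exp (- (\<alpha> / s)) / s ^ m else 0)"

lemma bump_nonneg: "bump \<alpha> m s \<ge> 0"
  by (simp add: bump_def)

lemma bump_Suc: "s * bump \<alpha> (Suc m) s = bump \<alpha> m s"
  by (simp add: bump_def)

lemma power_le_exp:
  assumes "x \<ge> 0"
  shows "x ^ m / fact m \<le> exp (x :: real)"
  using sum_le_suminf[OF summable_exp[of x], of "{m}"] assms
  by (simp add: exp_def divide_inverse mult.commute)

text \<open>The single term of degree \<open>m\<close> of the exponential series at
  \<open>\<alpha> / s\<close> already outweighs the pole \<open>1 / s ^ m\<close>.\<close>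

lemma bump_bounded:
  assumes "\<alpha> > 0"
  shows "bump \<alpha> m s \<le> fact m / \<alpha> ^ m"
proof (cases "s > 0")
  case True
  have "(\<alpha> / s) ^ m / fact m \<le> exp (\<alpha> / s)"
    using True assms by (intro power_le_exp) auto
  then have "\<alpha> ^ m \<le> fact m * (exp (\<alpha> / s) * s ^ m)"
    using True by (simp add: power_divide field_simps)
  then show ?thesis
    using True assms by (simp add: bump_def exp_minus field_simps)
qed (use assms in \<open>auto simp: bump_def\<close>)

lemma bump_derivative:
  assumes "\<alpha> > 0"
  shows "(bump \<alpha> m has_real_derivative \<alpha> * bump \<alpha> (m + 2) s - of_nat m * bump \<alpha> (m + 1) s) (at s)"
proof -
  consider "s > 0" | "s < 0" | "s = 0" by linarith
  then show ?thesis
  proof cases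
    case 1
    have "((\<lambda>s. exp (- (\<alpha> / s)) * inverse (s ^ m)) has_real_derivative
        \<alpha> * bump \<alpha> (m + 2) s - of_nat m * bump \<alpha> (m + 1) s) (at s)"
      using 1 by (auto intro!: derivative_eq_intros simp: bump_def field_simps power2_eq_square)
         (cases m; simp add: field_simps)
    then show ?thesis
      by (rule has_field_derivative_transform_within_open[of _ _ _ "{0<..}"]) (use 1 in \<open>auto simp: bump_def divide_inverse\<close>)
  next
    case 2
    have "((\<lambda>s. 0) has_real_derivative 0) (at s)" by simp
    then have "(bump \<alpha> m has_real_derivative 0) (at s)"
      by (rule has_field_derivative_transform_within_open[of _ _ _ "{..<0}"]) (use 2 in \<open>auto simp: bump_def\<close>)
    then show ?thesis using 2 by (simp add: bump_def)
  next
    case 3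
    \<comment> \<open>For \<open>h > 0\<close> the difference quotient at the origin is
      \<open>h * bump \<alpha> (m + 2) h\<close>. As \<open>?C\<close> bounds the bump with exponent
      \<open>m + 2\<close>, a factor \<open>h\<close> remains to force the limit.\<close>
    let ?C = "fact (m + 2) / \<alpha> ^ (m + 2)"
    have "(\<lambda>h. bump \<alpha> m h / h) \<midarrow>0\<rightarrow> 0"
    proof (rule Lim_null_comparison)
      have "norm (bump \<alpha> m h / h) \<le> \<bar>h\<bar> * ?C" for h
      proof (cases "h > 0")
        case True
        have "bump \<alpha> m h / h = h * bump \<alpha> (m + 2) h"
          using True by (simp add: bump_def)
        then show ?thesis
          using True mult_left_mono[OF bump_bounded[OF assms, of "m + 2" h], of h] bump_nonneg[of \<alpha> "m + 2" h]
          by (simp add: abs_mult del: fact_Suc)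
      next
        case False
        have "0 \<le> \<bar>h\<bar> * ?C" using assms by simp
        then show ?thesis using False by (simp only: bump_def if_False div_0 norm_zero)
      qed
      then show "\<forall>\<^sub>F h in at 0. norm (bump \<alpha> m h / h) \<le> \<bar>h\<bar> * ?C"
        by simp
      show "(\<lambda>h. \<bar>h\<bar> * ?C) \<midarrow>0\<rightarrow> 0"
        by (rule tendsto_eq_intros refl | simp)+
    qed
    then show ?thesis using 3 by (simp add: DERIV_def bump_def)
  qed
qed

lemma continuous_on_bump: "\<alpha> > 0 \<Longrightarrow> continuous_on S f \<Longrightarrow> continuous_on S (\<lambda>x. bump \<alpha> m (f x))"
  by (rule continuous_on_compose2[of UNIV])
     (auto intro: continuous_at_imp_continuous_on DERIV_isCont bump_derivative)

text \<open>The exponent is a parameter because each degree of a form contributes one factor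
  \<open>1 - |z|^2\<close> from the cometric: functions are paired with exponent
  \<open>CARD('n) + 1\<close>, 1-forms with \<open>CARD('n)\<close> and 2-forms with one less.
  Integration by parts raises the exponent by one or two.\<close>

definition wint :: "real \<Rightarrow> nat \<Rightarrow> (complex^'n::finite \<Rightarrow> complex) \<Rightarrow> (complex^'n \<Rightarrow> complex) \<Rightarrow> complex" where
  "wint \<alpha> m f g = (LINT z|lborel. f z * cnj (g z) * of_real (bump \<alpha> m (1 - (norm z)\<^sup>2)))"

lemma wint_integrable:
  fixes f g :: "complex^'n::finite \<Rightarrow> complex"
  assumes "\<alpha> > 0" "continuous_on UNIV f" "continuous_on UNIV g"
  shows "integrable lborel (\<lambda>z. f z * cnj (g z) * of_real (bump \<alpha> m (1 - (norm z)\<^sup>2)))"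
proof -
  let ?h = "\<lambda>z :: complex^'n. f z * cnj (g z) * of_real (bump \<alpha> m (1 - (norm z)\<^sup>2))"
  have c: "continuous_on UNIV ?h"
    by (intro continuous_intros assms continuous_on_bump)
  have "compact (?h ` cball 0 1)"
    using c by (intro compact_continuous_image) (auto intro: continuous_on_subset)
  then obtain B where B: "\<And>x. x \<in> cball 0 1 \<Longrightarrow> norm (?h x) \<le> B"
    using compact_imp_bounded[of "?h ` cball 0 1"] unfolding bounded_iff by blast
  show ?thesis
  proof (rule integrableI_bounded_set[of "cball 0 1" _ _ B])
    show "AE x in lborel. x \<in> cball 0 1 \<longrightarrow> norm (?h x) \<le> B" using B by simp
    show "AE x in lborel. x \<notin> cball 0 1 \<longrightarrow> ?h x = 0"
      by (auto simp: bump_def abs_square_less_1)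
    show "?h \<in> borel_measurable lborel" using borel_measurable_continuous_onI[OF c] by simp
    show "emeasure lborel (cball (0 :: complex^'n) 1) < \<infinity>" by (rule emeasure_lborel_cball_finite)
  qed simp
qed

lemma hpoly_continuous: "hpoly m F \<Longrightarrow> continuous_on S F"
  by (intro holomorphic_cn_imp_continuous_on hpoly_holomorphic)

text \<open>The conjugate of a holomorphic \<open>g\<close> is annihilated by the \<open>z\<close>
  derivative, so the derivative moves onto the weight only. There it produces the factor
  \<open>- cnj (z $ j)\<close>, which is absorbed into the second argument.\<close>

lemma wint_by_parts:
  fixes f g :: "complex^'n::finite \<Rightarrow> complex"
  assumes \<alpha>: "\<alpha> > 0" and f: "holomorphic_cn f UNIV" and g: "holomorphic_cn g UNIV"
  shows "wint \<alpha> m (dz j f) g = \<alpha> * wint \<alpha> (m + 2) f (\<lambda>z. z $ j * g z) - of_nat m * wint \<alpha> (m + 1) f (\<lambda>z. z $ j * g z)"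
proof -
  define s where "s z = 1 - z \<bullet> z" for z :: "complex^'n"
  define \<phi> where "\<phi> z = bump \<alpha> m (s z)" for z :: "complex^'n"
  define \<phi>' where "\<phi>' z = \<alpha> * bump \<alpha> (m + 2) (s z) - of_nat m * bump \<alpha> (m + 1) (s z)" for z :: "complex^'n"
  define Df where "Df z v = (\<Sum>k\<in>UNIV. dz k f z * v $ k)" for z v :: "complex^'n"
  define Dg where "Dg z v = (\<Sum>k\<in>UNIV. dz k g z * v $ k)" for z v :: "complex^'n"
  define D where "D z v = (Df z v * cnj (g z) + f z * cnj (Dg z v)) * of_real (\<phi> z)
      + f z * cnj (g z) * of_real (\<phi>' z * (- (2 * (z \<bullet> v))))" for z v
  define F where "F z = f z * cnj (g z) * of_real (\<phi> z)" for z
  have cs: "continuous_on S s" for S unfolding s_def by (intro continuous_intros)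
  have cf: "continuous_on UNIV f" "continuous_on UNIV g"
    using f g by (auto intro: holomorphic_cn_imp_continuous_on)
  have cdf: "continuous_on UNIV (dz k f)" "continuous_on UNIV (dz k g)" for k
    using f g by (auto intro: holomorphic_cn_imp_continuous_on holomorphic_cn_dz_holomorphic)
  have out: "\<phi> z = 0" "\<phi>' z = 0" if "norm z \<ge> 1" for z
    using that by (auto simp: \<phi>_def \<phi>'_def s_def bump_def dot_square_norm abs_square_less_1)
  have D: "(F has_derivative D z) (at z)" for z
  proof -
    have 1: "(f has_derivative Df z) (at z)" unfolding Df_def by (rule holomorphic_cn_dz[OF f]) simp
    have "(g has_derivative Dg z) (at z)" unfolding Dg_def by (rule holomorphic_cn_dz[OF g]) simp
    then have 2: "((\<lambda>z. cnj (g z)) has_derivative (\<lambda>v. cnj (Dg z v))) (at z)"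
      by (rule bounded_linear.has_derivative[OF bounded_linear_cnj])
    have "(s has_derivative (\<lambda>v. - (2 * (z \<bullet> v)))) (at z)"
      unfolding s_def by (auto intro!: derivative_eq_intros simp: inner_commute)
    from has_derivative_compose[OF this bump_derivative[OF \<alpha>, of m "s z", unfolded has_field_derivative_def]]
    have "(\<phi> has_derivative (\<lambda>v. \<phi>' z * (- (2 * (z \<bullet> v))))) (at z)"
      by (simp add: \<phi>_def[abs_def] \<phi>'_def)
    then have 3: "((\<lambda>z. of_real (\<phi> z) :: complex) has_derivative (\<lambda>v. of_real (\<phi>' z * (- (2 * (z \<bullet> v)))))) (at z)"
      by (rule bounded_linear.has_derivative[OF bounded_linear_of_real])
    show ?thesis
      unfolding F_def[abs_def]
      by (rule has_derivative_eq_rhs[OF has_derivative_mult[OF has_derivative_mult[OF 1 2] 3]])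
         (auto simp: D_def fun_eq_iff algebra_simps)
  qed
  define M where "M z = ((\<Sum>k\<in>UNIV. cmod (dz k f z)) * cmod (g z) + cmod (f z) * (\<Sum>k\<in>UNIV. cmod (dz k g z))) * \<bar>\<phi> z\<bar>
     + cmod (f z) * cmod (g z) * \<bar>\<phi>' z\<bar> * 2 * norm z" for z
  have DM: "norm (D z v) \<le> M z * norm v" for z v
  proof -
    have b: "cmod (Df z v) \<le> (\<Sum>k\<in>UNIV. cmod (dz k f z)) * norm v"
      "cmod (Dg z v) \<le> (\<Sum>k\<in>UNIV. cmod (dz k g z)) * norm v"
      unfolding Df_def Dg_def sum_distrib_right
      by (auto intro!: sum_norm_le simp: norm_mult mult_left_mono Finite_Cartesian_Product.norm_nth_le)
    have c: "\<bar>z \<bullet> v\<bar> \<le> norm z * norm v" by (rule Cauchy_Schwarz_ineq2)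
    have "norm (D z v) \<le> (cmod (Df z v) * cmod (g z) + cmod (f z) * cmod (Dg z v)) * \<bar>\<phi> z\<bar>
      + cmod (f z) * cmod (g z) * (\<bar>\<phi>' z\<bar> * (2 * \<bar>z \<bullet> v\<bar>))"
      unfolding D_def
      by (rule order_trans[OF norm_triangle_ineq], rule add_mono)
         (auto simp: norm_mult abs_mult simp del: of_real_mult of_real_minus intro!: mult_right_mono order_trans[OF norm_triangle_ineq])
    also have "\<dots> \<le> ((\<Sum>k\<in>UNIV. cmod (dz k f z)) * norm v * cmod (g z) + cmod (f z) * ((\<Sum>k\<in>UNIV. cmod (dz k g z)) * norm v)) * \<bar>\<phi> z\<bar>
      + cmod (f z) * cmod (g z) * (\<bar>\<phi>' z\<bar> * (2 * (norm z * norm v)))"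
      by (intro add_mono mult_mono b c order_refl mult_nonneg_nonneg add_nonneg_nonneg sum_nonneg) auto
    also have "\<dots> = M z * norm v" by (simp add: M_def algebra_simps)
    finally show ?thesis .
  qed
  have "continuous_on (cball 0 1) M"
    unfolding M_def \<phi>_def \<phi>'_def
    by (intro continuous_intros continuous_on_bump[OF \<alpha> cs] continuous_on_subset[OF cf(1)] continuous_on_subset[OF cf(2)] 
        continuous_on_subset[OF cdf(1)] continuous_on_subset[OF cdf(2)]) auto
  then have "compact (M ` cball 0 1)"
    by (rule compact_continuous_image) simp
  then obtain K where K: "\<And>z. z \<in> cball 0 1 \<Longrightarrow> norm (M z) \<le> K"
    using compact_imp_bounded[of "M ` cball 0 1"] unfolding bounded_iff by blast
  have "norm (D z v) \<le> K * norm v" for z v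
  proof (cases "norm z \<le> 1")
    case True
    then have "M z \<le> K" using K[of z] by simp
    then show ?thesis by (intro order_trans[OF DM] mult_right_mono) auto
  next
    case False
    moreover have "0 \<le> K" using K[of 0] order_trans[OF norm_ge_zero] by auto
    ultimately show ?thesis by (simp add: D_def out)
  qed
  from integral_directional_derivative_zero[OF D this, of 1]
  have intD: "integrable lborel (\<lambda>z. D z b)" and Dz: "integral\<^sup>L lborel (\<lambda>z. D z b) = 0" for b
    using out by (simp_all add: F_def)
  \<comment> \<open>The real directional derivatives along \<open>1\<close> and \<open>\<i>\<close>
    combine to twice the \<open>z\<close> derivative of the integrand; each of them integrates to
    zero by the preceding step.\<close>
  have Deq: "D z (axis j 1) - \<i> * D z (axis j \<i>) = 2 * (dz j f z * cnj (g z) * of_real (bump \<alpha> m (1 - (norm z)\<^sup>2))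
      - (of_real \<alpha> * (f z * cnj (z $ j * g z) * of_real (bump \<alpha> (m + 2) (1 - (norm z)\<^sup>2)))
        - of_nat m * (f z * cnj (z $ j * g z) * of_real (bump \<alpha> (m + 1) (1 - (norm z)\<^sup>2)))))" for z
  proof -
    have e: "Df z (axis j c) = dz j f z * c" "Dg z (axis j c) = dz j g z * c" for c
      by (auto simp: Df_def Dg_def axis_def if_distrib[where f = "\<lambda>x. _ * x"] cong: if_cong)
    have ax: "complex_of_real (z \<bullet> axis j 1) - \<i> * complex_of_real (z \<bullet> axis j \<i>) = cnj (z $ j)"
      by (simp add: inner_axis inner_complex_def complex_eq_iff)
    have "D z (axis j 1) - \<i> * D z (axis j \<i>) = 2 * (dz j f z * cnj (g z) * of_real (\<phi> z)
       - f z * cnj (g z) * of_real (\<phi>' z) * (complex_of_real (z \<bullet> axis j 1) - \<i> * complex_of_real (z \<bullet> axis j \<i>)))"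
      unfolding D_def e by (simp add: algebra_simps)
    then show ?thesis
      unfolding ax by (simp add: \<phi>_def \<phi>'_def s_def dot_square_norm algebra_simps)
  qed
  have half: "x = 0" if "0 = 2 * x" for x :: complex
    using that by simp
  have "0 = integral\<^sup>L lborel (\<lambda>z. D z (axis j 1) - \<i> * D z (axis j \<i>))"
    using intD Dz by simp
  also have "\<dots> = 2 * (wint \<alpha> m (dz j f) g - (of_real \<alpha> * wint \<alpha> (m + 2) f (\<lambda>z. z $ j * g z)
        - of_nat m * wint \<alpha> (m + 1) f (\<lambda>z. z $ j * g z)))"
    unfolding Deq wint_def
    by (subst Bochner_Integration.integral_diff Bochner_Integration.integral_mult_right_zero |
        intro Bochner_Integration.integrable_diff Bochner_Integration.integrable_mult_right wint_integrable \<alpha> cf cdf continuous_intros | simp only:)+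
  finally have "wint \<alpha> m (dz j f) g - (of_real \<alpha> * wint \<alpha> (m + 2) f (\<lambda>z. z $ j * g z)
        - of_nat m * wint \<alpha> (m + 1) f (\<lambda>z. z $ j * g z)) = 0"
    by (rule half)
  then show ?thesis by (simp only: right_minus_eq)
qed

text \<open>The sum inserts \<open>|z|^2 = 1 - s\<close> with \<open>s = 1 - |z|^2\<close>, and a
  factor \<open>s\<close> lowers the exponent of the bump by one.\<close>

lemma wint_sum_nth:
  fixes f g :: "complex^'n::finite \<Rightarrow> complex"
  assumes "\<alpha> > 0" "continuous_on UNIV f" "continuous_on UNIV g"
  shows "(\<Sum>j\<in>UNIV. wint \<alpha> (Suc m) (\<lambda>z. z $ j * f z) (\<lambda>z. z $ j * g z)) = wint \<alpha> (Suc m) f g - wint \<alpha> m f g"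
proof -
  have "(\<Sum>j\<in>UNIV. z $ j * f z * cnj (z $ j * g z) * of_real (bump \<alpha> (Suc m) (1 - (norm z)\<^sup>2)))
      = f z * cnj (g z) * of_real (bump \<alpha> (Suc m) (1 - (norm z)\<^sup>2)) - f z * cnj (g z) * of_real (bump \<alpha> m (1 - (norm z)\<^sup>2))" for z :: "complex^'n"
  proof -
    have zz: "(\<Sum>j\<in>UNIV. z $ j * cnj (z $ j)) = of_real ((norm z)\<^sup>2)"
      by (simp add: norm_vec_def L2_set_def sum_nonneg complex_norm_square[symmetric])
    have "(\<Sum>j\<in>UNIV. z $ j * f z * cnj (z $ j * g z) * of_real (bump \<alpha> (Suc m) (1 - (norm z)\<^sup>2)))
      = (\<Sum>j\<in>UNIV. z $ j * cnj (z $ j)) * (f z * cnj (g z) * of_real (bump \<alpha> (Suc m) (1 - (norm z)\<^sup>2)))"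
      unfolding sum_distrib_right by (simp add: mult_ac)
    also have "\<dots> = f z * cnj (g z) * of_real (bump \<alpha> (Suc m) (1 - (norm z)\<^sup>2))
       - f z * cnj (g z) * of_real ((1 - (norm z)\<^sup>2) * bump \<alpha> (Suc m) (1 - (norm z)\<^sup>2))"
      unfolding zz by (simp add: algebra_simps)
    finally show ?thesis by (simp only: bump_Suc)
  qed
  then show ?thesis
    unfolding wint_def
    by (subst Bochner_Integration.integral_sum[symmetric] | 
        subst Bochner_Integration.integral_diff[symmetric] | intro wint_integrable assms continuous_intros | simp only:)+
qed

section \<open>The pointwise inner product on forms of degree at most two\<close>

text \<open>The algebraic part of membership in \<open>A2\<close>: pure degree and the normalisation
  outside the ball, without holomorphy or integrability.\<close>

definition formal :: "nat \<Rightarrow> 'n::{finite,linorder} form \<Rightarrow> bool" where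
  "formal p u \<longleftrightarrow> (\<forall>J z. card J \<noteq> p \<or> z \<notin> ball 0 1 \<longrightarrow> u J z = 0)"

lemma sum_card_0: "(\<Sum>J | card J = 0. g J) = g ({} :: 'n::finite set)"
proof -
  have "{J :: 'n set. card J = 0} = {{}}" by auto
  then show ?thesis by simp
qed

lemma sum_card_1: "(\<Sum>J | card J = Suc 0. g J) = (\<Sum>j\<in>UNIV. g {j :: 'n::finite})"
proof -
  have "{J :: 'n set. card J = Suc 0} = range (\<lambda>j. {j})" by (auto simp: card_1_singleton_iff)
  then show ?thesis by (simp add: sum.reindex o_def)
qed

lemma sum_card_2:
  "(\<Sum>J | card J = 2. g J) = (\<Sum>(a, b) | a < b. g {a, b :: 'n::{finite, linorder}})"
proof -
  have "bij_betw (\<lambda>x. {fst x, snd x}) {x :: 'n \<times> 'n. fst x < snd x} {J. card J = 2}"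
  proof (rule bij_betw_imageI)
    show "inj_on (\<lambda>x. {fst x, snd x}) {x :: 'n \<times> 'n. fst x < snd x}"
      by (auto simp: inj_on_def doubleton_eq_iff)
    show "(\<lambda>x. {fst x, snd x}) ` {x :: 'n \<times> 'n. fst x < snd x} = {J. card J = 2}"
    proof (intro subset_antisym subsetI)
      fix J :: "'n set" assume "J \<in> {J. card J = 2}"
      then obtain a b where ab: "J = {a, b}" "a \<noteq> b" by (auto simp: card_2_iff)
      show "J \<in> (\<lambda>x. {fst x, snd x}) ` {x. fst x < snd x}"
      proof (cases "a < b")
        case True
        then show ?thesis using ab by (intro image_eqI[of _ _ "(a, b)"]) auto
      next
        case False
        then show ?thesis using ab by (intro image_eqI[of _ _ "(b, a)"]) auto
      qed
    qed auto
  qed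
  from sum.reindex_bij_betw[OF this, of g] show ?thesis
    by (simp add: case_prod_unfold)
qed

text \<open>Two-forms are indexed by increasing pairs, but contraction and the cometric are handled
  more easily in unrestricted double sums; this converts between them.\<close>

lemma sum_less_pairs:
  fixes h :: "'n::{finite, linorder} \<Rightarrow> 'n \<Rightarrow> complex"
  assumes sym: "\<And>a b. h a b = h b a" and diag: "\<And>a. h a a = 0"
  shows "(\<Sum>(a, b) | a < b. h a b) = (\<Sum>a\<in>UNIV. \<Sum>b\<in>UNIV. h a b) / 2"
proof -
  have "(\<Sum>a\<in>UNIV. \<Sum>b\<in>UNIV. h a b) = (\<Sum>(a, b)\<in>UNIV. h a b)"
    by (simp add: sum.cartesian_product)
  also have "\<dots> = (\<Sum>(a, b)\<in>{(a, b). a < b} \<union> {(a, b). b < a}. h a b)"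
    using diag by (intro sum.mono_neutral_right) (auto, metis linorder_neqE)
  also have "\<dots> = (\<Sum>(a, b) | a < b. h a b) + (\<Sum>(a, b) | b < a. h a b)"
    by (rule sum.union_disjoint) auto
  also have "(\<Sum>(a, b) | b < a. h a b) = (\<Sum>(a, b) | a < b. h a b)"
    by (rule sum.reindex_bij_witness[of _ prod.swap prod.swap]) (auto simp: sym)
  finally show ?thesis by simp
qed

lemma pointwise_inner_formal:
  assumes "formal p u" "formal p v"
  shows "pointwise_inner u v z = (\<Sum>J | card J = p. \<Sum>K | card K = p. gram z J K * u J z * cnj (v K z))"
proof -
  have "pointwise_inner u v z = (\<Sum>J | card J = p. \<Sum>K | card K = card J. gram z J K * u J z * cnj (v K z))"
    unfolding pointwise_inner_def using assms
    by (intro sum.mono_neutral_right) (auto simp: formal_def)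
  then show ?thesis by simp
qed

lemma pointwise_inner_0:
  assumes "formal 0 u" "formal 0 v"
  shows "pointwise_inner u v z = u {} z * cnj (v {} z)"
  using assms by (simp only: pointwise_inner_formal sum_card_0) (simp add: gram_def)

lemma gram_1: "gram z {j} {k} = hyp_cometric z $ j $ k"
proof -
  have "{\<sigma>. \<sigma> permutes {..<Suc 0}} = {id}"
    by (simp add: lessThan_Suc permutes_sing)
  then show ?thesis by (simp add: gram_def)
qed

lemma permutes_2: "{\<sigma>. \<sigma> permutes {..<2::nat}} = {id, Transposition.transpose 0 1}"
proof -
  have "{..<2::nat} = {0, 1}" by auto
  then show ?thesis by (auto simp: permutes_doubleton_iff)
qed

lemma gram_2:
  assumes "a < b" "c < d"
  shows "gram z {a, b} {c, d} = hyp_cometric z $ a $ c * hyp_cometric z $ b $ d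
    - hyp_cometric z $ a $ d * hyp_cometric z $ b $ c"
proof -
  have "sorted_list_of_set {a, b} = [a, b]" "sorted_list_of_set {c, d} = [c, d]"
    using assms by (auto intro!: sorted_list_of_set_unique[THEN iffD1])
  moreover have "card {a, b} = 2" using assms by auto
  moreover have "id \<noteq> Transposition.transpose 0 (1::nat)" by (metis id_apply transpose_apply_first zero_neq_one)
  moreover have "{..<2::nat} = {0, 1}" by auto
  ultimately show ?thesis
    unfolding gram_def \<open>card {a, b} = 2\<close> permutes_2 by (simp add: sign_swap_id)
qed

definition radial :: "complex^'n::finite \<Rightarrow> real" where
  "radial z = 1 - (norm z)\<^sup>2"

lemma radial_pos: "z \<in> ball 0 1 \<Longrightarrow> 0 < radial z"
  by (simp add: radial_def abs_square_less_1)

lemma pointwise_inner_1: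
  fixes u v :: "'n::{finite, linorder} form"
  assumes "formal 1 u" "formal 1 v" and z: "z \<in> ball 0 1"
  shows "pointwise_inner u v z = of_real (radial z) *
    ((\<Sum>j\<in>UNIV. u {j} z * cnj (v {j} z)) - (\<Sum>j\<in>UNIV. z $ j * u {j} z) * cnj (\<Sum>j\<in>UNIV. z $ j * v {j} z))"
proof -
  have "pointwise_inner u v z = (\<Sum>j\<in>UNIV. \<Sum>k\<in>UNIV. hyp_cometric z $ j $ k * u {j} z * cnj (v {k} z))"
    using assms by (simp only: pointwise_inner_formal One_nat_def sum_card_1 gram_1)
  also have "\<dots> = (\<Sum>j\<in>UNIV. \<Sum>k\<in>UNIV. of_real (radial z) * ((if j = k then u {j} z * cnj (v {k} z) else 0)
      - (z $ j * u {j} z) * cnj (z $ k * v {k} z)))"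
    unfolding hyp_cometric_explicit[OF z] radial_def
    by (intro sum.cong refl) (simp add: algebra_simps)
  also have "\<dots> = of_real (radial z) * ((\<Sum>j\<in>UNIV. u {j} z * cnj (v {j} z))
      - (\<Sum>j\<in>UNIV. \<Sum>k\<in>UNIV. (z $ j * u {j} z) * cnj (z $ k * v {k} z)))"
    by (simp add: sum_distrib_left[symmetric] sum_subtractf)
  also have "(\<Sum>j\<in>UNIV. \<Sum>k\<in>UNIV. (z $ j * u {j} z) * cnj (z $ k * v {k} z))
      = (\<Sum>j\<in>UNIV. z $ j * u {j} z) * cnj (\<Sum>j\<in>UNIV. z $ j * v {j} z)"
    by (simp only: cnj_sum sum_product)
  finally show ?thesis .
qed

text \<open>The full antisymmetric coefficient matrix of a 2-form, of which the form itself stores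
  only the entries above the diagonal.\<close>

definition anti :: "'n::{finite,linorder} form \<Rightarrow> complex^'n::{finite,linorder} \<Rightarrow> 'n \<Rightarrow> 'n \<Rightarrow> complex" where
  "anti u z j k = (if j < k then u {j, k} z else if k < j then - u {j, k} z else 0)"

lemma anti_swap: "anti u z k j = - anti u z j k"
  by (auto simp: anti_def insert_commute)

lemma anti_diag: "anti u z j j = 0"
  by (simp add: anti_def)

definition contr :: "complex^'n::finite \<Rightarrow> ('n \<Rightarrow> 'n \<Rightarrow> complex) \<Rightarrow> 'n \<Rightarrow> complex" where
  "contr z A k = (\<Sum>j\<in>UNIV. z $ j * A j k)"

text \<open>An antisymmetric matrix is paired with the symmetric matrix of the products
  \<open>z $ j * z $ k\<close>.\<close>

lemma contr_contr:
  assumes "\<And>j k. A k j = - A j k"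
  shows "(\<Sum>k\<in>UNIV. z $ k * contr z A k) = 0"
proof -
  have "(\<Sum>k\<in>UNIV. z $ k * contr z A k) = (\<Sum>k\<in>UNIV. \<Sum>j\<in>UNIV. z $ k * z $ j * A j k)"
    by (simp add: contr_def sum_distrib_left mult_ac)
  also have "\<dots> = (\<Sum>k\<in>UNIV. \<Sum>j\<in>UNIV. z $ j * z $ k * A k j)"
    by (rule sum.swap)
  also have "\<dots> = - (\<Sum>k\<in>UNIV. \<Sum>j\<in>UNIV. z $ k * z $ j * A j k)"
    unfolding sum_negf[symmetric] using assms by (intro sum.cong refl) (metis mult.commute mult_minus_right)
  also have "\<dots> = - (\<Sum>k\<in>UNIV. z $ k * contr z A k)"
    by (simp add: contr_def sum_distrib_left mult_ac)
  finally show ?thesis by (simp add: eq_neg_iff_add_eq_0 flip: mult_2)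
qed

text \<open>The cometric is \<open>radial z\<close> times the identity minus a rank-one term.
  Expanding two copies of it on antisymmetric matrices gives the full pairing and two equal
  contraction terms; the term with four factors from \<open>z\<close> vanishes since a double
  contraction does.\<close>

lemma pointwise_inner_2:
  fixes u v :: "'n::{finite, linorder} form"
  assumes "formal 2 u" "formal 2 v" and z: "z \<in> ball 0 1"
  shows "pointwise_inner u v z = of_real ((radial z)\<^sup>2) *
    ((\<Sum>j\<in>UNIV. \<Sum>k\<in>UNIV. anti u z j k * cnj (anti v z j k)) / 2
      - (\<Sum>k\<in>UNIV. contr z (anti u z) k * cnj (contr z (anti v z) k)))"
proof -
  let ?A = "anti u z" and ?B = "anti v z" and ?s = "of_real (radial z) :: complex"
  define G where "G a c = hyp_cometric z $ a $ c" for a c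
  have G: "G a c = ?s * ((if a = c then 1 else 0) - z $ a * cnj (z $ c))" for a c
    unfolding G_def radial_def by (rule hyp_cometric_explicit[OF z])
  define f where "f a b c d = (G a c * G b d - G a d * G b c) * ?A a b * cnj (?B c d)" for a b c d
  have fsym: "f a b c d = f b a c d" "f a b c d = f a b d c" "f a a c d = 0" "f a b c c = 0" for a b c d
    unfolding f_def anti_swap[of u z b a] anti_swap[of v z d c] by (auto simp: anti_diag algebra_simps)
  have "pointwise_inner u v z = (\<Sum>(a, b) | a < b. \<Sum>(c, d) | c < d. f a b c d)"
    using assms unfolding pointwise_inner_formal[OF assms(1,2)] sum_card_2
    by (intro sum.cong refl) (auto simp: f_def gram_2 anti_def G_def intro!: sum.cong)
  also have "\<dots> = (\<Sum>(a, b) | a < b. (\<Sum>c\<in>UNIV. \<Sum>d\<in>UNIV. f a b c d) / 2)"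
    by (intro sum.cong refl) (auto intro!: sum_less_pairs fsym)
  also have "\<dots> = (\<Sum>a\<in>UNIV. \<Sum>b\<in>UNIV. (\<Sum>c\<in>UNIV. \<Sum>d\<in>UNIV. f a b c d) / 2) / 2"
    using fsym(1,3) by (intro sum_less_pairs) (auto intro!: sum.cong)
  also have "\<dots> = (\<Sum>a\<in>UNIV. \<Sum>b\<in>UNIV. \<Sum>c\<in>UNIV. \<Sum>d\<in>UNIV. f a b c d) / 4"
    by (simp add: sum_divide_distrib)
  \<comment> \<open>Exchanging \<open>c\<close> and \<open>d\<close> reverses the sign of the second
    coefficient matrix, so both products in the determinant contribute equally.\<close>
  also have "(\<Sum>a\<in>UNIV. \<Sum>b\<in>UNIV. \<Sum>c\<in>UNIV. \<Sum>d\<in>UNIV. f a b c d)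
      = 2 * (\<Sum>a\<in>UNIV. \<Sum>b\<in>UNIV. \<Sum>c\<in>UNIV. \<Sum>d\<in>UNIV. G a c * G b d * ?A a b * cnj (?B c d))"
  proof -
    have "(\<Sum>a\<in>UNIV. \<Sum>b\<in>UNIV. \<Sum>c\<in>UNIV. \<Sum>d\<in>UNIV. G a d * G b c * ?A a b * cnj (?B c d))
      = (\<Sum>a\<in>UNIV. \<Sum>b\<in>UNIV. \<Sum>d\<in>UNIV. \<Sum>c\<in>UNIV. G a d * G b c * ?A a b * cnj (?B c d))"
      by (rule sum.cong[OF refl], rule sum.cong[OF refl], rule sum.swap)
    also have "\<dots> = - (\<Sum>a\<in>UNIV. \<Sum>b\<in>UNIV. \<Sum>c\<in>UNIV. \<Sum>d\<in>UNIV. G a c * G b d * ?A a b * cnj (?B c d))"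
      unfolding sum_negf[symmetric]
      by (intro sum.cong refl) (metis anti_swap complex_cnj_minus mult_minus_right)
    finally show ?thesis
      by (simp add: f_def left_diff_distrib sum_subtractf)
  qed
  also have "(\<Sum>a\<in>UNIV. \<Sum>b\<in>UNIV. \<Sum>c\<in>UNIV. \<Sum>d\<in>UNIV. G a c * G b d * ?A a b * cnj (?B c d))
      = ?s\<^sup>2 * ((\<Sum>a\<in>UNIV. \<Sum>b\<in>UNIV. ?A a b * cnj (?B a b))
         - 2 * (\<Sum>k\<in>UNIV. contr z ?A k * cnj (contr z ?B k)))"
  proof -
    have cB: "(\<Sum>d\<in>UNIV. cnj (z $ d) * cnj (?B c d)) = - cnj (contr z ?B c)" for c
    proof -
      have "(\<Sum>d\<in>UNIV. cnj (z $ d) * cnj (?B c d)) = (\<Sum>d\<in>UNIV. - cnj (z $ d * ?B d c))"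
        using anti_swap[of v z] by (intro sum.cong refl) (metis complex_cnj_minus complex_cnj_mult mult_minus_right)
      then show ?thesis by (simp add: contr_def sum_negf)
    qed
    have cA: "(\<Sum>b\<in>UNIV. z $ b * ?A a b) = - contr z ?A a" for a
    proof -
      have "(\<Sum>b\<in>UNIV. z $ b * ?A a b) = (\<Sum>b\<in>UNIV. - (z $ b * ?A b a))"
        using anti_swap[of u z] by (intro sum.cong refl) (metis mult_minus_right)
      then show ?thesis by (simp add: contr_def sum_negf)
    qed
    have ccB: "(\<Sum>c\<in>UNIV. cnj (z $ c) * cnj (contr z ?B c)) = 0"
    proof -
      have "(\<Sum>c\<in>UNIV. cnj (z $ c) * cnj (contr z ?B c)) = cnj (\<Sum>c\<in>UNIV. z $ c * contr z ?B c)" by simp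
      also have "\<dots> = 0" using contr_contr[of ?B z] anti_swap by fastforce
      finally show ?thesis .
    qed
    \<comment> \<open>Applying the cometric to a vector subtracts its pairing with
      \<open>cnj z\<close>, times \<open>z\<close>. For rows of \<open>?B\<close> this pairing is a
      contraction, which is how the contraction terms arise in \<open>step\<close>.\<close>
    have lin: "(\<Sum>d\<in>UNIV. G b d * X d) = ?s * (X b - z $ b * (\<Sum>d\<in>UNIV. cnj (z $ d) * X d))" for b X
      by (simp add: G right_diff_distrib left_diff_distrib sum_subtractf sum_distrib_left mult_ac
          if_distrib[where f = "\<lambda>x. x * _"] if_distrib[where f = "\<lambda>x. _ * x"] cong: if_cong)
    have step: "(\<Sum>c\<in>UNIV. G a c * (\<Sum>d\<in>UNIV. G b d * cnj (?B c d)))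
       = ?s\<^sup>2 * (cnj (?B a b) + z $ b * cnj (contr z ?B a) - z $ a * cnj (contr z ?B b))" for a b
    proof -
      have 1: "(\<Sum>d\<in>UNIV. G b d * cnj (?B c d)) = ?s * (cnj (?B c b) + z $ b * cnj (contr z ?B c))" for c
        unfolding lin cB by simp
      have 2: "(\<Sum>c\<in>UNIV. cnj (z $ c) * (?s * (cnj (?B c b) + z $ b * cnj (contr z ?B c)))) = ?s * cnj (contr z ?B b)"
      proof -
        have "(\<Sum>c\<in>UNIV. cnj (z $ c) * (?s * (cnj (?B c b) + z $ b * cnj (contr z ?B c))))
           = ?s * ((\<Sum>c\<in>UNIV. cnj (z $ c) * cnj (?B c b)) + z $ b * (\<Sum>c\<in>UNIV. cnj (z $ c) * cnj (contr z ?B c)))"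
          by (simp add: sum_distrib_left distrib_left sum.distrib mult_ac)
        also have "\<dots> = ?s * cnj (contr z ?B b)" unfolding ccB by (simp add: contr_def)
        finally show ?thesis .
      qed
      show ?thesis
        unfolding 1 lin 2 by (simp add: power2_eq_square algebra_simps)
    qed
    have "(\<Sum>a\<in>UNIV. \<Sum>b\<in>UNIV. \<Sum>c\<in>UNIV. \<Sum>d\<in>UNIV. G a c * G b d * ?A a b * cnj (?B c d))
      = (\<Sum>a\<in>UNIV. \<Sum>b\<in>UNIV. ?A a b * (\<Sum>c\<in>UNIV. G a c * (\<Sum>d\<in>UNIV. G b d * cnj (?B c d))))"
      by (simp add: sum_distrib_left mult_ac)
    also have "\<dots> = ?s\<^sup>2 * ((\<Sum>a\<in>UNIV. \<Sum>b\<in>UNIV. ?A a b * cnj (?B a b))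
       + (\<Sum>a\<in>UNIV. (\<Sum>b\<in>UNIV. z $ b * ?A a b) * cnj (contr z ?B a))
       - (\<Sum>a\<in>UNIV. \<Sum>b\<in>UNIV. z $ a * ?A a b * cnj (contr z ?B b)))"
      unfolding step
      by (simp add: sum_distrib_left sum_distrib_right distrib_left right_diff_distrib sum.distrib sum_subtractf mult_ac)
    also have "(\<Sum>a\<in>UNIV. \<Sum>b\<in>UNIV. z $ a * ?A a b * cnj (contr z ?B b))
       = (\<Sum>b\<in>UNIV. contr z ?A b * cnj (contr z ?B b))"
      by (subst sum.swap) (simp add: contr_def[of z ?A] sum_distrib_right)
    finally show ?thesis unfolding cA by (simp add: sum_negf)
  qed
  also have "2 * (?s\<^sup>2 * (P - 2 * Q)) / 4 = of_real ((radial z)\<^sup>2) * (P / 2 - Q)" for P Q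
    by (simp add: diff_divide_distrib right_diff_distrib)
  finally show ?thesis .
qed

section \<open>Symmetry and positivity of the pointwise inner product\<close>

lemma cmod_diff_squared: "(cmod (x - y))\<^sup>2 = (cmod x)\<^sup>2 + (cmod y)\<^sup>2 - 2 * Re (x * cnj y)"
  unfolding cmod_power2 by (simp add: power2_eq_square algebra_simps)

lemma norm_vec_sum: "(\<Sum>j\<in>UNIV. (cmod (z $ j))\<^sup>2) = (norm (z :: complex^'n::finite))\<^sup>2"
  by (simp add: norm_vec_def L2_set_def sum_nonneg)

lemma cauchy_schwarz_sum:
  fixes z :: "complex^'n::finite"
  shows "(cmod (\<Sum>j\<in>UNIV. z $ j * a j))\<^sup>2 \<le> (norm z)\<^sup>2 * (\<Sum>j\<in>UNIV. (cmod (a j))\<^sup>2)"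
proof -
  have "cmod (\<Sum>j\<in>UNIV. z $ j * a j) \<le> (\<Sum>j\<in>UNIV. cmod (z $ j) * cmod (a j))"
    by (rule order_trans[OF norm_sum]) (simp add: norm_mult)
  also have "\<dots> \<le> L2_set (\<lambda>j. cmod (z $ j)) UNIV * L2_set (\<lambda>j. cmod (a j)) UNIV"
    using L2_set_mult_ineq[of "\<lambda>j. cmod (z $ j)" "\<lambda>j. cmod (a j)" UNIV] by simp
  also have "\<dots> = norm z * sqrt (\<Sum>j\<in>UNIV. (cmod (a j))\<^sup>2)"
    by (simp add: norm_vec_def L2_set_def)
  finally have "(cmod (\<Sum>j\<in>UNIV. z $ j * a j))\<^sup>2 \<le> (norm z * sqrt (\<Sum>j\<in>UNIV. (cmod (a j))\<^sup>2))\<^sup>2"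
    by (rule power_mono) simp
  then show ?thesis by (simp add: power_mult_distrib sum_nonneg)
qed

lemma pointwise_inner_cnj:
  assumes "p \<le> 2" "formal p u" "formal p v" "z \<in> ball 0 1"
  shows "cnj (pointwise_inner u v z) = pointwise_inner v u z"
proof -
  consider "p = 0" | "p = 1" | "p = 2" using assms(1) by linarith
  then show ?thesis
    by cases (use assms in \<open>simp_all add: pointwise_inner_0 pointwise_inner_1 pointwise_inner_2 mult.commute\<close>)
qed

text \<open>By Cauchy-Schwarz the cometric is bounded below by \<open>(radial z)\<^sup>2\<close>,
  its eigenvalue in the direction of \<open>z\<close>. The explicit constant gives definiteness, and
  on smaller balls it compares the norm with the coefficients.\<close>

lemma Re_pointwise_inner_1_ge:
  fixes u :: "'n::{finite, linorder} form"
  assumes "formal 1 u" "z \<in> ball 0 1"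
  shows "(radial z)\<^sup>2 * (\<Sum>j\<in>UNIV. (cmod (u {j} z))\<^sup>2) \<le> Re (pointwise_inner u u z)"
proof -
  have "(\<Sum>j\<in>UNIV. (cmod (u {j} z))\<^sup>2) - (cmod (\<Sum>j\<in>UNIV. z $ j * u {j} z))\<^sup>2
      \<ge> radial z * (\<Sum>j\<in>UNIV. (cmod (u {j} z))\<^sup>2)"
    using cauchy_schwarz_sum[of z "\<lambda>j. u {j} z"] by (simp add: radial_def algebra_simps)
  from mult_left_mono[OF this, of "radial z"] radial_pos[OF assms(2)]
  have "(radial z)\<^sup>2 * (\<Sum>j\<in>UNIV. (cmod (u {j} z))\<^sup>2) \<le> radial z *
     ((\<Sum>j\<in>UNIV. (cmod (u {j} z))\<^sup>2) - (cmod (\<Sum>j\<in>UNIV. z $ j * u {j} z))\<^sup>2)"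
    by (simp add: power2_eq_square mult_ac)
  also have "\<dots> = Re (pointwise_inner u u z)"
    unfolding pointwise_inner_1[OF assms(1) assms] complex_norm_square[symmetric]
    by (simp flip: of_real_power of_real_sum of_real_diff of_real_mult)
  finally show ?thesis .
qed

text \<open>Completing the square with \<open>X\<close>, the alternation of \<open>cnj z \<otimes> b\<close> for the contraction \<open>b\<close>.\<close>

lemma contr_anti_bound:
  fixes A :: "'n::finite \<Rightarrow> 'n \<Rightarrow> complex"
  assumes A: "\<And>j k. A k j = - A j k" and z: "z \<in> ball 0 1"
  shows "2 * (\<Sum>k\<in>UNIV. (cmod (contr z A k))\<^sup>2) \<le> (\<Sum>j\<in>UNIV. \<Sum>k\<in>UNIV. (cmod (A j k))\<^sup>2)"
proof -
  define b where "b = contr z A"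
  define X where "X j k = cnj (z $ j) * b k - cnj (z $ k) * b j" for j k
  define B where "B = (\<Sum>k\<in>UNIV. (cmod (b k))\<^sup>2)"
  have B0: "0 \<le> B" by (simp add: B_def sum_nonneg)
  have zb: "(\<Sum>k\<in>UNIV. z $ k * b k) = 0" unfolding b_def by (rule contr_contr[OF A])
  have bb: "(\<Sum>k\<in>UNIV. b k * cnj (b k)) = of_real B"
    by (simp add: B_def complex_norm_square[symmetric])
  have AX: "(\<Sum>j\<in>UNIV. \<Sum>k\<in>UNIV. A j k * cnj (X j k)) = 2 * of_real B"
  proof -
    have "(\<Sum>j\<in>UNIV. \<Sum>k\<in>UNIV. z $ j * A j k * cnj (b k)) = (\<Sum>k\<in>UNIV. b k * cnj (b k))"
      by (subst sum.swap) (simp add: b_def contr_def sum_distrib_right)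
    moreover have "(\<Sum>j\<in>UNIV. \<Sum>k\<in>UNIV. z $ k * A j k * cnj (b j)) = - (\<Sum>j\<in>UNIV. b j * cnj (b j))"
      unfolding sum_negf[symmetric]
    proof (intro sum.cong refl)
      fix j
      have "(\<Sum>k\<in>UNIV. z $ k * A j k) = - b j"
        unfolding b_def contr_def sum_negf[symmetric] by (subst A) simp
      then show "(\<Sum>k\<in>UNIV. z $ k * A j k * cnj (b j)) = - (b j * cnj (b j))"
        by (simp add: sum_distrib_right[symmetric])
    qed
    moreover have "A j k * cnj (X j k) = z $ j * A j k * cnj (b k) - z $ k * A j k * cnj (b j)" for j k
      by (simp add: X_def algebra_simps)
    ultimately show ?thesis by (simp add: sum_subtractf bb)
  qed
  have XX: "(\<Sum>j\<in>UNIV. \<Sum>k\<in>UNIV. (cmod (X j k))\<^sup>2) = 2 * (norm z)\<^sup>2 * B"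
  proof -
    have "(cmod (X j k))\<^sup>2 = (cmod (z $ j))\<^sup>2 * (cmod (b k))\<^sup>2 + (cmod (b j))\<^sup>2 * (cmod (z $ k))\<^sup>2
        - 2 * Re ((cnj (z $ j) * cnj (b j)) * (z $ k * b k))" for j k
      unfolding X_def cmod_diff_squared by (simp add: norm_mult power_mult_distrib mult_ac)
    then have "(\<Sum>j\<in>UNIV. \<Sum>k\<in>UNIV. (cmod (X j k))\<^sup>2)
        = (\<Sum>j\<in>UNIV. \<Sum>k\<in>UNIV. (cmod (z $ j))\<^sup>2 * (cmod (b k))\<^sup>2)
        + (\<Sum>j\<in>UNIV. \<Sum>k\<in>UNIV. (cmod (b j))\<^sup>2 * (cmod (z $ k))\<^sup>2)
        - 2 * Re (\<Sum>j\<in>UNIV. \<Sum>k\<in>UNIV. (cnj (z $ j) * cnj (b j)) * (z $ k * b k))"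
      by (simp add: sum.distrib sum_subtractf sum_distrib_left)
    also have "\<dots> = 2 * (norm z)\<^sup>2 * B"
      unfolding sum_product[symmetric] zb by (simp add: norm_vec_sum B_def)
    finally show ?thesis .
  qed
  have "0 \<le> (\<Sum>j\<in>UNIV. \<Sum>k\<in>UNIV. (cmod (A j k - X j k))\<^sup>2)" by (intro sum_nonneg) simp
  also have "\<dots> = (\<Sum>j\<in>UNIV. \<Sum>k\<in>UNIV. (cmod (A j k))\<^sup>2 + (cmod (X j k))\<^sup>2 - 2 * Re (A j k * cnj (X j k)))"
    by (intro sum.cong refl) (rule cmod_diff_squared)
  also have "\<dots> = (\<Sum>j\<in>UNIV. \<Sum>k\<in>UNIV. (cmod (A j k))\<^sup>2) + (\<Sum>j\<in>UNIV. \<Sum>k\<in>UNIV. (cmod (X j k))\<^sup>2)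
      - 2 * Re (\<Sum>j\<in>UNIV. \<Sum>k\<in>UNIV. A j k * cnj (X j k))"
    by (simp add: sum.distrib sum_subtractf sum_distrib_left)
  finally have "0 \<le> (\<Sum>j\<in>UNIV. \<Sum>k\<in>UNIV. (cmod (A j k))\<^sup>2) + 2 * (norm z)\<^sup>2 * B - 4 * B"
    unfolding AX XX by simp
  moreover have "(norm z)\<^sup>2 * B \<le> 1 * B"
    using radial_pos[OF z] B0 by (intro mult_right_mono) (auto simp: radial_def)
  ultimately show ?thesis by (simp add: B_def b_def)
qed

lemma Re_pointwise_inner_nonneg:
  fixes u :: "'n::{finite, linorder} form"
  assumes "p \<le> 2" "formal p u" "z \<in> ball 0 1"
  shows "0 \<le> Re (pointwise_inner u u z)"
proof -
  consider "p = 0" | "p = 1" | "p = 2" using assms(1) by linarith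
  then show ?thesis
  proof cases
    case 1
    then show ?thesis using assms by (simp add: pointwise_inner_0)
  next
    case 2
    have "0 \<le> (radial z)\<^sup>2 * (\<Sum>j\<in>UNIV. (cmod (u {j} z))\<^sup>2)" by (simp add: sum_nonneg)
    also have "\<dots> \<le> Re (pointwise_inner u u z)"
      using 2 assms by (intro Re_pointwise_inner_1_ge) auto
    finally show ?thesis .
  next
    case 3
    have "Re (pointwise_inner u u z) = (radial z)\<^sup>2 *
      ((\<Sum>j\<in>UNIV. \<Sum>k\<in>UNIV. (cmod (anti u z j k))\<^sup>2) / 2 - (\<Sum>k\<in>UNIV. (cmod (contr z (anti u z) k))\<^sup>2))"
      using assms unfolding 3 pointwise_inner_2[OF assms(2)[unfolded 3] assms(2)[unfolded 3] assms(3)] complex_norm_square[symmetric]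
      by (simp flip: of_real_power of_real_sum of_real_diff of_real_mult)
    moreover have "(\<Sum>j\<in>UNIV. \<Sum>k\<in>UNIV. (cmod (anti u z j k))\<^sup>2) / 2 - (\<Sum>k\<in>UNIV. (cmod (contr z (anti u z) k))\<^sup>2) \<ge> 0"
      using contr_anti_bound[of "anti u z", OF anti_swap assms(3)] by simp
    ultimately show ?thesis by simp
  qed
qed

section \<open>Rotation invariance, continuity and boundedness of the weighted metric\<close>

lemma gram_rotate:
  assumes "cmod c = 1" "z \<in> ball 0 1"
  shows "gram (c *s z) J K = gram z J K"
proof -
  have "c *s z \<in> ball 0 1" "norm (c *s z) = norm z" using assms by (simp_all add: norm_vector_scale)
  moreover have "c * x * (cnj c * y) = x * y" for x y
  proof -
    have "c * cnj c = 1" using assms(1) by (simp add: complex_norm_square[symmetric])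
    then show ?thesis by (metis mult.assoc mult.commute mult.left_neutral)
  qed
  ultimately have "hyp_cometric (c *s z) $ a $ b = hyp_cometric z $ a $ b" for a b
    using assms(2) by (simp add: hyp_cometric_explicit)
  then show ?thesis by (simp add: gram_def)
qed

lemma continuous_on_gram: "continuous_on (ball 0 1) (\<lambda>z :: complex^'n::{finite,linorder}. gram z J K)"
proof -
  have "continuous_on (ball 0 1) (\<lambda>z :: complex^'n::{finite,linorder}. hyp_cometric z $ j $ k)" for j k
  proof (rule continuous_on_eq)
    show "continuous_on (ball 0 1) (\<lambda>z :: complex^'n::{finite,linorder}. complex_of_real (1 - (norm z)\<^sup>2) * ((if j = k then 1 else 0) - (z $ j) * cnj (z $ k)))"
      by (intro continuous_intros)
  qed (rule hyp_cometric_explicit[symmetric])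
  note c = this
  show ?thesis
    unfolding gram_def by (intro continuous_on_sum continuous_on_mult continuous_on_const continuous_on_prod c)
qed

text \<open>A crude count suffices: entries of the cometric have modulus at most \<open>2\<close>,
  and the determinant has at most \<open>fact CARD('n)\<close> terms with at most
  \<open>CARD('n)\<close> factors each.\<close>

lemma gram_bound:
  fixes z :: "complex^'n::{finite, linorder}"
  assumes z: "z \<in> ball 0 1"
  shows "cmod (gram z J K) \<le> fact CARD('n) * 2 ^ CARD('n)"
proof -
  have r: "0 \<le> 1 - (norm z)\<^sup>2" "1 - (norm z)\<^sup>2 \<le> 1" using radial_pos[OF z] by (auto simp: radial_def)
  have h: "cmod (hyp_cometric z $ j $ k) \<le> 2" for j k
  proof -
    have "cmod (z $ j * cnj (z $ k)) \<le> 1 * 1"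
      unfolding norm_mult using z Finite_Cartesian_Product.norm_nth_le[of z]
      by (intro mult_mono) (auto intro: order_trans[OF Finite_Cartesian_Product.norm_nth_le])
    then have "cmod ((if j = k then 1 else 0) - z $ j * cnj (z $ k)) \<le> 1 + 1"
      by (intro order_trans[OF norm_triangle_ineq4] add_mono) auto
    then have "cmod (complex_of_real (1 - (norm z)\<^sup>2)) * cmod ((if j = k then 1 else 0) - z $ j * cnj (z $ k)) \<le> 1 * 2"
      using r by (intro mult_mono) (auto simp del: of_real_diff)
    then show ?thesis unfolding hyp_cometric_explicit[OF z] norm_mult by simp
  qed
  have c: "card J \<le> CARD('n)" by (rule card_mono) auto
  have "cmod (gram z J K) \<le> (\<Sum>\<sigma> | \<sigma> permutes {..<card J}. (2 :: real) ^ card J)"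
    unfolding gram_def
  proof (rule sum_norm_le)
    fix \<sigma>
    have "(\<Prod>a<card J. cmod (hyp_cometric z $ (sorted_list_of_set J ! a) $ (sorted_list_of_set K ! \<sigma> a))) \<le> (\<Prod>a<card J. 2)"
      by (intro prod_mono) (simp add: h)
    then show "cmod (of_int (sign \<sigma>) * (\<Prod>a<card J. hyp_cometric z $ (sorted_list_of_set J ! a) $ (sorted_list_of_set K ! \<sigma> a))) \<le> 2 ^ card J"
      by (simp add: norm_mult prod_norm[symmetric] sign_def)
  qed
  also have "\<dots> = fact (card J) * 2 ^ card J"
    by (simp add: card_permutations)
  also have "\<dots> \<le> fact CARD('n) * 2 ^ CARD('n)"
    using c by (intro mult_mono fact_mono power_increasing) auto
  finally show ?thesis .
qed

lemma weight_bump: "z \<in> ball 0 1 \<Longrightarrow> weight \<alpha> (z :: complex^'n::finite) = bump \<alpha> (CARD('n) + 1) (radial z)"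
  using radial_pos[of z] by (simp add: weight_def bump_def radial_def)

lemma weight_pos: "z \<in> ball 0 1 \<Longrightarrow> weight \<alpha> z > 0"
  using radial_pos[of z] by (simp add: weight_def radial_def)

lemma continuous_on_radial [continuous_intros]: "continuous_on S radial"
  unfolding radial_def[abs_def] by (intro continuous_intros)

lemma continuous_on_weight: "\<alpha> > 0 \<Longrightarrow> continuous_on (ball 0 1) (weight \<alpha>)"
  by (rule continuous_on_eq[OF continuous_on_bump[OF _ continuous_on_radial]]) (simp_all add: weight_bump)

lemma weight_gram_bound:
  assumes "\<alpha> > 0"
  shows "\<exists>C\<ge>0. \<forall>J K. \<forall>z\<in>ball 0 1. cmod (of_real (weight \<alpha> z) * gram (z :: complex^'n::{finite, linorder}) J K) \<le> C"
proof (intro exI[of _ "fact (CARD('n) + 1) / \<alpha> ^ (CARD('n) + 1) * (fact CARD('n) * 2 ^ CARD('n))"] conjI allI ballI)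
  fix J K and z :: "complex^'n::{finite,linorder}" assume z: "z \<in> ball 0 1"
  show "cmod (of_real (weight \<alpha> z) * gram z J K) \<le> fact (CARD('n) + 1) / \<alpha> ^ (CARD('n) + 1) * (fact CARD('n) * 2 ^ CARD('n))"
    unfolding norm_mult
  proof (rule mult_mono)
    show "norm (complex_of_real (weight \<alpha> z)) \<le> fact (CARD('n) + 1) / \<alpha> ^ (CARD('n) + 1)"
      using bump_bounded[OF assms] bump_nonneg by (simp only: weight_bump[OF z] norm_of_real abs_of_nonneg)
  qed (use assms gram_bound[OF z] in auto)
qed (use assms in auto)

section \<open>Parseval's identity for holomorphic forms\<close>

text \<open>Integrability is left out so that parts, contractions and multipliers can be formed
  first; membership in \<open>A2\<close> is then decided by summing norms of parts.\<close>

definition holform :: "nat \<Rightarrow> 'n::{finite,linorder} form \<Rightarrow> bool" where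
  "holform p u \<longleftrightarrow> formal p u \<and> (\<forall>J. holomorphic_cn (u J) (ball 0 1))"

definition hform :: "nat \<Rightarrow> 'n::{finite,linorder} form \<Rightarrow> 'n form" where
  "hform m u = (\<lambda>J z. if z \<in> ball 0 1 then hpart m (u J) z else 0)"

definition dens :: "real \<Rightarrow> 'n::{finite,linorder} form \<Rightarrow> 'n form \<Rightarrow> complex^'n::{finite,linorder} \<Rightarrow> complex" where
  "dens \<alpha> u v z = of_real (weight \<alpha> z) * pointwise_inner u v z"

text \<open>Integration over a smaller ball: for \<open>r < 1\<close> every holomorphic form is
  integrable there, so Parseval's identity can be proved before integrability on the unit ball is
  known.\<close>

definition finner :: "real \<Rightarrow> real \<Rightarrow> 'n::{finite,linorder} form \<Rightarrow> 'n form \<Rightarrow> complex" where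
  "finner \<alpha> r u v = (LINT z:ball 0 r|lborel. dens \<alpha> u v z)"

lemma form_inner_finner: "form_inner \<alpha> u v = finner \<alpha> 1 u v"
  by (simp add: form_inner_def finner_def dens_def)

lemma A2_iff: "u \<in> A2 \<alpha> p \<longleftrightarrow> holform p u \<and> set_integrable lborel (ball 0 1) (dens \<alpha> u u)"
  by (simp add: A2_def holform_def formal_def dens_def[abs_def])

lemma holform_zero_coeff: "holform p u \<Longrightarrow> card J \<noteq> p \<Longrightarrow> u J = (\<lambda>z. 0)"
  by (auto simp: holform_def formal_def)

lemma hpart_truncate: "hpart m (\<lambda>z. if z \<in> ball 0 1 then f z else 0) = hpart m f"
  by (rule hpart_cong) simp

lemma holomorphic_truncate:
  "holomorphic_cn (\<lambda>z. if z \<in> ball 0 1 then f z else 0) (ball 0 1) \<longleftrightarrow> holomorphic_cn f (ball 0 1)"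
  by (rule holomorphic_cn_cong[OF open_ball]) simp

lemma holform_hform:
  assumes "holform p u"
  shows "holform p (hform m u)"
proof -
  have "hpart m (u J) = (\<lambda>z. 0)" if "card J \<noteq> p" for J
    by (simp only: holform_zero_coeff[OF assms that] hpart_zero)
  then have "formal p (hform m u)" by (auto simp: formal_def hform_def)
  moreover have "holomorphic_cn (hform m u J) (ball 0 1)" for J
    unfolding hform_def holomorphic_truncate by (rule hpart_holomorphic)
  ultimately show ?thesis by (simp add: holform_def)
qed

lemma hform_hform:
  "hform m (hform l u) = (if m = l then hform l u else (\<lambda>J z. 0))"
proof -
  have "hpart m (hform l u J) = (if m = l then hpart l (u J) else (\<lambda>z. 0))" for J
    unfolding hform_def hpart_truncate by (rule hpart_of_hpoly[OF hpart_hpoly])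
  note h = this
  show ?thesis
    by (simp only: hform_def[of m "hform l u"] h) (simp add: hform_def fun_eq_iff)
qed

lemma continuous_on_form: "holform p u \<Longrightarrow> continuous_on (ball 0 1) (u J)"
  unfolding holform_def by (blast intro: holomorphic_cn_imp_continuous_on)

lemma continuous_on_dens:
  assumes "\<alpha> > 0" "holform p u" "holform q v"
  shows "continuous_on (ball 0 1) (dens \<alpha> u v)"
  unfolding dens_def[abs_def] pointwise_inner_def
  by (intro continuous_on_mult continuous_on_sum continuous_on_gram continuous_on_cnj continuous_on_of_real
      continuous_on_weight continuous_on_form[OF assms(2)] continuous_on_form[OF assms(3)] assms(1))

lemma pointwise_inner_add_left: "pointwise_inner (u + v) w z = pointwise_inner u w z + pointwise_inner v w z"
  by (simp add: pointwise_inner_def algebra_simps sum.distrib)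

lemma pointwise_inner_add_right: "pointwise_inner w (u + v) z = pointwise_inner w u z + pointwise_inner w v z"
  by (simp add: pointwise_inner_def algebra_simps sum.distrib)

lemma pointwise_inner_scale_left: "pointwise_inner (form_scale c u) w z = c * pointwise_inner u w z"
  by (simp add: pointwise_inner_def form_scale_def sum_distrib_left mult_ac)

lemma pointwise_inner_scale_right: "pointwise_inner w (form_scale c u) z = cnj c * pointwise_inner w u z"
  by (simp add: pointwise_inner_def form_scale_def sum_distrib_left mult_ac)

lemma dens_add_left: "dens \<alpha> (u + v) w z = dens \<alpha> u w z + dens \<alpha> v w z"
  by (simp add: dens_def pointwise_inner_add_left algebra_simps)

lemma dens_add_right: "dens \<alpha> w (u + v) z = dens \<alpha> w u z + dens \<alpha> w v z"
  by (simp add: dens_def pointwise_inner_add_right algebra_simps)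

lemma dens_scale_left: "dens \<alpha> (form_scale c u) w z = c * dens \<alpha> u w z"
  by (simp add: dens_def pointwise_inner_scale_left)

lemma dens_scale_right: "dens \<alpha> w (form_scale c u) z = cnj c * dens \<alpha> w u z"
  by (simp add: dens_def pointwise_inner_scale_right)

lemmas dens_linear = dens_add_left dens_add_right dens_scale_left dens_scale_right

lemma dens_zero_left: "dens \<alpha> (\<lambda>J z. 0) w z = 0"
  by (simp add: dens_def pointwise_inner_def)

lemma dens_sum_left: "dens \<alpha> (\<lambda>J z. \<Sum>i\<in>I. f i J z) w z = (\<Sum>i\<in>I. dens \<alpha> (f i) w z)"
proof (induction I rule: infinite_finite_induct)
  case (insert i I)
  have "(\<lambda>J z. \<Sum>i\<in>insert i I. f i J z) = f i + (\<lambda>J z. \<Sum>i\<in>I. f i J z)"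
    using insert by (auto simp: fun_eq_iff)
  then show ?case using insert by (simp add: dens_add_left)
qed (simp_all add: dens_zero_left)

lemma dens_sum_right: "dens \<alpha> w (\<lambda>J z. \<Sum>i\<in>I. f i J z) z = (\<Sum>i\<in>I. dens \<alpha> w (f i) z)"
proof (induction I rule: infinite_finite_induct)
  case (insert i I)
  have "(\<lambda>J z. \<Sum>i\<in>insert i I. f i J z) = f i + (\<lambda>J z. \<Sum>i\<in>I. f i J z)"
    using insert by (auto simp: fun_eq_iff)
  then show ?case using insert by (simp add: dens_add_right)
qed (simp_all add: dens_def pointwise_inner_def)

lemma dens_cnj:
  "p \<le> 2 \<Longrightarrow> holform p u \<Longrightarrow> holform p v \<Longrightarrow> z \<in> ball 0 1 \<Longrightarrow> cnj (dens \<alpha> u v z) = dens \<alpha> v u z"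
  by (simp add: dens_def holform_def pointwise_inner_cnj)

lemma dens_real:
  assumes "p \<le> 2" "holform p u" "z \<in> ball 0 1"
  shows "dens \<alpha> u u z = of_real (Re (dens \<alpha> u u z))"
  using dens_cnj[OF assms(1,2,2,3), of \<alpha>] by (simp add: complex_eq_iff)

lemma dens_nonneg:
  assumes "p \<le> 2" "holform p u" "z \<in> ball 0 1"
  shows "0 \<le> Re (dens \<alpha> u u z)"
  using Re_pointwise_inner_nonneg[of p u z] assms weight_pos[of z \<alpha>] by (simp add: dens_def holform_def)

lemma dens_bound:
  assumes "\<alpha> > 0"
  shows "\<exists>C\<ge>0. \<forall>(u :: 'n::{finite,linorder} form) v. \<forall>z\<in>ball 0 1. \<forall>M N. (\<forall>J. cmod (u J z) \<le> M) \<longrightarrow> (\<forall>J. cmod (v J z) \<le> N) \<longrightarrow>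
     cmod (dens \<alpha> u v z) \<le> C * M * N"
proof -
  obtain C where C: "C \<ge> 0" "\<And>J K z. z \<in> ball 0 1 \<Longrightarrow> cmod (of_real (weight \<alpha> z) * gram (z :: complex^'n::{finite, linorder}) J K) \<le> C"
    using weight_gram_bound[OF assms] by blast
  let ?n = "real (card (UNIV :: 'n set set))"
  show ?thesis
  proof (intro exI[of _ "?n * ?n * C"] conjI allI ballI impI)
    fix u v :: "'n form" and z :: "complex^'n::{finite, linorder}" and M N
    assume z: "z \<in> ball 0 1" and u: "\<forall>J. cmod (u J z) \<le> M" and v: "\<forall>J. cmod (v J z) \<le> N"
    have M0: "0 \<le> M" and N0: "0 \<le> N" using u v order_trans[OF norm_ge_zero] by blast+
    have "dens \<alpha> u v z = (\<Sum>J\<in>UNIV. \<Sum>K | card K = card J. (of_real (weight \<alpha> z) * gram z J K) * u J z * cnj (v K z))"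
      by (simp add: dens_def pointwise_inner_def sum_distrib_left mult_ac)
    also have "cmod \<dots> \<le> (\<Sum>J\<in>(UNIV :: 'n set set). \<Sum>K\<in>(UNIV :: 'n set set). C * M * N)"
    proof (intro sum_norm_le order_trans[OF sum_norm_le sum_mono2])
      fix J K :: "'n set"
      show "cmod (complex_of_real (weight \<alpha> z) * gram z J K * u J z * cnj (v K z)) \<le> C * M * N"
        unfolding norm_mult[of _ "cnj (v K z)"] norm_mult[of _ "u J z"] complex_mod_cnj
        using C(2)[OF z, of J K] C(1) u v M0 N0 by (intro mult_mono) auto
    qed (use C M0 N0 in auto)
    also have "\<dots> = ?n * ?n * C * M * N" by simp
    finally show "cmod (dens \<alpha> u v z) \<le> ?n * ?n * C * M * N" .
  qed (use C in auto)
qed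

lemma set_borel_dens:
  assumes "\<alpha> > 0" "holform p u" "holform q v" "r \<le> 1"
  shows "set_borel_measurable lborel (ball 0 r) (dens \<alpha> u v)"
  unfolding set_borel_measurable_def
  using continuous_on_subset[OF continuous_on_dens[OF assms(1-3)], of "ball 0 r"] assms(4)
  by (simp add: borel_measurable_continuous_on_indicator subset_ball)

lemma set_integrable_bounded_ball:
  fixes f :: "'a::euclidean_space \<Rightarrow> 'b::{banach, second_countable_topology}"
  assumes "set_borel_measurable lborel (ball 0 r) f" "\<And>z. z \<in> ball 0 r \<Longrightarrow> norm (f z) \<le> B"
  shows "set_integrable lborel (ball 0 r) f"
  unfolding set_integrable_def
proof (rule integrableI_bounded_set[of "ball 0 r" _ _ B])
  show "(\<lambda>x. indicat_real (ball 0 r) x *\<^sub>R f x) \<in> borel_measurable lborel"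
    using assms(1) by (simp add: set_borel_measurable_def)
  show "emeasure lborel (ball (0::'a) r) < \<infinity>" by (rule emeasure_lborel_ball_finite)
qed (use assms in auto)

lemma dens_integrable_bounded:
  fixes u v :: "'n::{finite,linorder} form"
  assumes "\<alpha> > 0" "holform p u" "holform q v" "r \<le> 1"
    and u: "\<And>J z. z \<in> ball 0 r \<Longrightarrow> cmod (u J z) \<le> M" and v: "\<And>J z. z \<in> ball 0 r \<Longrightarrow> cmod (v J z) \<le> N"
  shows "set_integrable lborel (ball 0 r) (dens \<alpha> u v)"
proof -
  obtain C where C: "\<And>(u :: 'n form) v z M N. z \<in> ball 0 1 \<Longrightarrow> (\<And>J. cmod (u J z) \<le> M) \<Longrightarrow> (\<And>J. cmod (v J z) \<le> N) \<Longrightarrow>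
     cmod (dens \<alpha> u v z) \<le> C * M * N"
    using dens_bound[OF assms(1)] by blast
  show ?thesis
    using assms(4)
    by (intro set_integrable_bounded_ball[where B = "C * M * N"] set_borel_dens[OF assms(1-4)] C u v) auto
qed

lemma hpoly_bounded_ball:
  assumes "hpoly m F"
  shows "\<exists>M. \<forall>z\<in>cball 0 1. cmod (F z) \<le> M"
proof -
  have "compact (F ` cball 0 1)"
    by (intro compact_continuous_image hpoly_continuous[OF assms] compact_cball)
  from compact_imp_bounded[OF this] show ?thesis by (auto simp: bounded_iff)
qed

lemma finite_family_bound:
  fixes f :: "'i::finite \<Rightarrow> 'a \<Rightarrow> complex"
  assumes "\<And>i. \<exists>M. \<forall>x\<in>X. cmod (f i x) \<le> M"
  shows "\<exists>M\<ge>0. \<forall>i. \<forall>x\<in>X. cmod (f i x) \<le> M"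
proof -
  from assms obtain M where M: "\<And>i x. x \<in> X \<Longrightarrow> cmod (f i x) \<le> M i" by metis
  have "cmod (f i x) \<le> (\<Sum>i\<in>UNIV. \<bar>M i\<bar>)" if "x \<in> X" for i x
    using M[OF that, of i] member_le_sum[of i UNIV "\<lambda>i. \<bar>M i\<bar>"] by auto
  then show ?thesis by (intro exI[of _ "\<Sum>i\<in>UNIV. \<bar>M i\<bar>"]) (auto intro: sum_nonneg)
qed

lemma hform_bounded: "\<exists>M\<ge>0. \<forall>J. \<forall>z\<in>UNIV. cmod (hform m u J z) \<le> M"
proof (rule finite_family_bound)
  fix J
  obtain M where M: "\<And>z. z \<in> cball 0 1 \<Longrightarrow> cmod (hpart m (u J) z) \<le> M"
    using hpoly_bounded_ball[OF hpart_hpoly] by blast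
  show "\<exists>M. \<forall>z\<in>UNIV. cmod (hform m u J z) \<le> M"
    using M order_trans[OF norm_ge_zero M[of 0]] by (intro exI[of _ M]) (simp add: hform_def)
qed

lemma hform_integrable:
  assumes "\<alpha> > 0" "holform p u" "holform q v" "r \<le> 1"
  shows "set_integrable lborel (ball 0 r) (dens \<alpha> (hform m u) (hform l v))"
proof -
  obtain M N where "\<And>J z. cmod (hform m u J z) \<le> M" "\<And>J z. cmod (hform l v J z) \<le> N"
    using hform_bounded[of m u] hform_bounded[of l v] by blast
  then show ?thesis
    by (intro dens_integrable_bounded[OF assms(1) holform_hform[OF assms(2)] holform_hform[OF assms(3)] assms(4)]) auto
qed

lemma hform_A2: "\<alpha> > 0 \<Longrightarrow> holform p u \<Longrightarrow> hform m u \<in> A2 \<alpha> p"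
  using hform_integrable[of \<alpha> p u p u 1 m m] by (simp add: A2_iff holform_hform)

lemma weight_rotate: "cmod c = 1 \<Longrightarrow> weight \<alpha> (c *s z) = weight \<alpha> z"
  by (simp add: weight_def norm_vector_scale)

text \<open>One rotation is enough: by the angle \<open>pi / (m - l)\<close> it changes the sign of
  the density, while the integral is rotation invariant.\<close>

lemma finner_orthogonal:
  assumes "\<alpha> > 0" "holform p u" "holform q v" "r \<le> 1" "m \<noteq> l"
  shows "finner \<alpha> r (hform m u) (hform l v) = 0"
proof -
  define \<theta> where "\<theta> = pi / (real m - real l)"
  define c where "c = cis \<theta>"
  have c: "cmod c = 1" by (simp add: c_def)
  have "c ^ m * cnj (c ^ l) = cis (real m * \<theta>) * cis (- (real l * \<theta>))"
    by (simp only: c_def Complex.DeMoivre cis_cnj)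
  also have "\<dots> = cis ((real m - real l) * \<theta>)" by (simp add: cis_mult algebra_simps)
  also have "(real m - real l) * \<theta> = pi" using assms(5) by (simp add: \<theta>_def)
  finally have cc: "c ^ m * cnj (c ^ l) = - 1" by simp
  have h: "hform k w J (c *s z) = c ^ k * hform k w J z" for k w J z
    using c by (simp add: hform_def hpoly_scale[OF hpart_hpoly] norm_vector_scale)
  have "dens \<alpha> (hform m u) (hform l v) (c *s z) = - dens \<alpha> (hform m u) (hform l v) z" if "z \<in> ball 0 r" for z
  proof -
    have z: "z \<in> ball 0 1" using that assms(4) by auto
    have "gram (c *s z) J K * hform m u J (c *s z) * cnj (hform l v K (c *s z))
      = (c ^ m * cnj (c ^ l)) * (gram z J K * hform m u J z * cnj (hform l v K z))" for J K
      by (simp add: h gram_rotate[OF c z] mult_ac)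
    note this[unfolded cc]
    then show ?thesis
      by (simp add: dens_def pointwise_inner_def weight_rotate[OF c] sum_negf)
  qed
  then have "(LINT z:ball 0 r|lborel. dens \<alpha> (hform m u) (hform l v) (c *s z))
      = (LINT z:ball 0 r|lborel. - dens \<alpha> (hform m u) (hform l v) z)"
    by (intro set_lebesgue_integral_cong) auto
  moreover have c': "continuous_on (ball 0 r) (dens \<alpha> (hform m u) (hform l v))"
    by (rule continuous_on_subset[OF continuous_on_dens[OF assms(1) holform_hform[OF assms(2)] holform_hform[OF assms(3)]]])
       (use assms(4) in auto)
  ultimately have "finner \<alpha> r (hform m u) (hform l v) = - finner \<alpha> r (hform m u) (hform l v)"
    using set_lebesgue_integral_rotate[OF c c'] by (simp add: finner_def set_lebesgue_integral_def)
  then show ?thesis by simp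
qed

text \<open>Geometric decay makes the bound independent of the number of terms; it is the majorant
  for dominated convergence in \<open>finner_sums\<close>. The pair of \<open>N\<close> and
  \<open>z\<close> is treated as one point so that \<open>finite_family_bound\<close>
  applies.\<close>

lemma hform_partial_sums:
  assumes "holform p u" and r: "0 \<le> r" "r < 1"
  shows "\<exists>M\<ge>0. \<forall>J. \<forall>x\<in>UNIV \<times> ball 0 r. cmod ((case x of (N, z) \<Rightarrow> \<Sum>m<N. hform m u J z)) \<le> M"
proof (rule finite_family_bound)
  fix J
  have "holomorphic_cn (u J) (ball 0 1)" using assms(1) by (simp add: holform_def)
  from hpart_geometric[OF this r] obtain C q where C: "0 \<le> C" "0 \<le> q" "q < 1"
    "\<And>m z. z \<in> cball 0 r \<Longrightarrow> cmod (hpart m (u J) z) \<le> C * q ^ m" by blast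
  have "cmod (\<Sum>m<N. hform m u J z) \<le> C * (1 / (1 - q))" if "z \<in> ball 0 r" for N z
  proof -
    have "cmod (\<Sum>m<N. hform m u J z) \<le> (\<Sum>m<N. C * q ^ m)"
      using that C r by (intro sum_norm_le) (auto simp: hform_def)
    also have "\<dots> = C * (\<Sum>m<N. q ^ m)" by (simp add: sum_distrib_left)
    also have "\<dots> \<le> C * (\<Sum>m. q ^ m)"
      using C by (intro mult_left_mono sum_le_suminf summable_geometric) auto
    finally show ?thesis using C by (simp add: suminf_geometric)
  qed
  then show "\<exists>M. \<forall>x\<in>UNIV \<times> ball 0 r. cmod ((case x of (N, z) \<Rightarrow> \<Sum>m<N. hform m u J z)) \<le> M"
    by (intro exI[of _ "C * (1 / (1 - q))"]) auto
qed

lemma holform_partial_sum: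
  assumes "holform p u"
  shows "holform p (\<lambda>J z. \<Sum>m<N. hform m u J z)"
  using holform_hform[OF assms] unfolding holform_def formal_def
  by (auto intro!: holomorphic_cn_sum sum.neutral)

text \<open>Orthogonality makes the inner product of partial sums diagonal, and uniform boundedness
  of the partial sums on the smaller ball allows passage to the limit.\<close>

lemma finner_sums:
  fixes u v :: "'n::{finite,linorder} form"
  assumes \<alpha>: "\<alpha> > 0" and u: "holform p u" and v: "holform q v" and r: "0 \<le> r" "r < 1"
  shows "(\<lambda>m. finner \<alpha> r (hform m u) (hform m v)) sums finner \<alpha> r u v"
proof -
  define U where "U N = (\<lambda>J z. \<Sum>m<N. hform m u J z)" for N :: nat
  define V where "V N = (\<lambda>J z. \<Sum>m<N. hform m v J z)" for N :: nat
  have hU: "holform p (U N)" "holform q (V N)" for N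
    unfolding U_def V_def by (intro holform_partial_sum u v)+
  have UV: "finner \<alpha> r (U N) (V N) = (\<Sum>m<N. finner \<alpha> r (hform m u) (hform m v))" for N
  proof -
    have int: "integrable lborel (\<lambda>z. indicat_real (ball 0 r) z *\<^sub>R dens \<alpha> (hform m u) (hform l v) z)" for m l
      using hform_integrable[OF \<alpha> u v, of r m l] r by (simp add: set_integrable_def)
    have "finner \<alpha> r (U N) (V N) = (\<Sum>m<N. \<Sum>l<N. finner \<alpha> r (hform m u) (hform l v))"
      unfolding finner_def set_lebesgue_integral_def U_def V_def dens_sum_left dens_sum_right scaleR_sum_right
      by (simp only: Bochner_Integration.integral_sum Bochner_Integration.integrable_sum int)
    also have "\<dots> = (\<Sum>m<N. \<Sum>l<N. if l = m then finner \<alpha> r (hform m u) (hform m v) else 0)"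
      using r by (intro sum.cong refl) (auto simp: finner_orthogonal[OF \<alpha> u v])
    finally show ?thesis by simp
  qed
  obtain M where M: "\<And>J N z. z \<in> ball 0 r \<Longrightarrow> cmod (U N J z) \<le> M"
    using hform_partial_sums[OF u r] unfolding U_def by fastforce
  obtain M' where M': "\<And>J N z. z \<in> ball 0 r \<Longrightarrow> cmod (V N J z) \<le> M'"
    using hform_partial_sums[OF v r] unfolding V_def by fastforce
  obtain C where C: "\<And>(u :: 'n form) v z M N. z \<in> ball 0 1 \<Longrightarrow> (\<And>J. cmod (u J z) \<le> M) \<Longrightarrow> (\<And>J. cmod (v J z) \<le> N) \<Longrightarrow>
     cmod (dens \<alpha> u v z) \<le> C * M * N"
    using dens_bound[OF \<alpha>] by blast
  have "(\<lambda>N. finner \<alpha> r (U N) (V N)) \<longlonglongrightarrow> finner \<alpha> r u v"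
    unfolding finner_def set_lebesgue_integral_def
  proof (rule integral_dominated_convergence[where w = "\<lambda>z. indicator (ball 0 r) z *\<^sub>R (C * M * M')"])
    show "(\<lambda>z. indicat_real (ball 0 r) z *\<^sub>R dens \<alpha> u v z) \<in> borel_measurable lborel"
      "(\<lambda>z. indicat_real (ball 0 r) z *\<^sub>R dens \<alpha> (U N) (V N) z) \<in> borel_measurable lborel" for N
      using set_borel_dens[OF \<alpha> u v, of r] set_borel_dens[OF \<alpha> hU, of r] r by (auto simp: set_borel_measurable_def)
    have "emeasure lborel (ball (0 :: complex^'n::{finite,linorder}) r) < \<infinity>" by (rule emeasure_lborel_ball_finite)
    then show "integrable lborel (\<lambda>z :: complex^'n::{finite,linorder}. indicator (ball 0 r) z *\<^sub>R (C * M * M'))"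
      by (intro integrable_scaleR_left) (simp add: integrable_indicator_iff)
    show "AE z in lborel. norm (indicat_real (ball 0 r) z *\<^sub>R dens \<alpha> (U N) (V N) z) \<le> indicator (ball 0 r) z *\<^sub>R (C * M * M')" for N
      using r by (intro AE_I2) (auto simp: indicator_def intro!: C M M')
    have "(\<lambda>N. dens \<alpha> (U N) (V N) z) \<longlonglongrightarrow> dens \<alpha> u v z" if "z \<in> ball 0 r" for z
    proof -
      have z: "z \<in> ball 0 1" using that r by auto
      have "(\<lambda>N. U N J z) \<longlonglongrightarrow> u J z" "(\<lambda>N. V N J z) \<longlonglongrightarrow> v J z" for J
        using hpart_sums[of "u J" z] hpart_sums[of "v J" z] u v z
        by (auto simp: U_def V_def hform_def holform_def sums_def)
      then show ?thesis unfolding dens_def pointwise_inner_def by (intro tendsto_intros)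
    qed
    then show "AE z in lborel. (\<lambda>N. indicat_real (ball 0 r) z *\<^sub>R dens \<alpha> (U N) (V N) z) \<longlonglongrightarrow> indicat_real (ball 0 r) z *\<^sub>R dens \<alpha> u v z"
      by (intro AE_I2) (auto simp: indicator_def)
  qed
  then show ?thesis unfolding sums_def UV .
qed

section \<open>Exhaustion by smaller balls and Parseval's identity on the unit ball\<close>

definition rseq :: "nat \<Rightarrow> real" where
  "rseq i = 1 - 1 / real (i + 2)"

lemma rseq: "0 \<le> rseq i" "rseq i < 1" "rseq i \<le> rseq (Suc i)"
  by (auto simp: rseq_def field_simps)

lemma rseq_tendsto: "rseq \<longlonglongrightarrow> 1"
proof -
  have "(\<lambda>i. 1 / real (i + 2)) \<longlonglongrightarrow> 0"
    by (rule LIMSEQ_ignore_initial_segment[OF lim_1_over_n])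
  then have "(\<lambda>i. 1 - 1 / real (i + 2)) \<longlonglongrightarrow> 1 - 0"
    by (intro tendsto_diff tendsto_const)
  then show ?thesis by (simp add: rseq_def[abs_def])
qed

lemma rseq_indicator:
  fixes F :: "'a::real_normed_vector \<Rightarrow> 'b::real_normed_vector"
  shows "(\<lambda>i. indicat_real (ball 0 (rseq i)) z *\<^sub>R F z) \<longlonglongrightarrow> indicat_real (ball 0 1) z *\<^sub>R F z"
proof (cases "norm z < 1")
  case True
  then have "\<forall>\<^sub>F i in sequentially. norm z < rseq i"
    using order_tendstoD(1)[OF rseq_tendsto] by blast
  then have "\<forall>\<^sub>F i in sequentially. indicat_real (ball 0 (rseq i)) z *\<^sub>R F z = indicat_real (ball 0 1) z *\<^sub>R F z"
    by (rule eventually_mono) (use True in auto)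
  then show ?thesis by (rule tendsto_eventually)
next
  case False
  then have "\<not> norm z < rseq i" for i using rseq(2)[of i] by linarith
  then show ?thesis using False by (simp add: indicator_def)
qed

lemma set_integral_rseq:
  fixes F :: "'a::euclidean_space \<Rightarrow> 'b::{banach, second_countable_topology}"
  assumes "set_integrable lborel (ball 0 1) F"
  shows "(\<lambda>i. LINT z:ball 0 (rseq i)|lborel. F z) \<longlonglongrightarrow> (LINT z:ball 0 1|lborel. F z)"
  unfolding set_lebesgue_integral_def
proof (rule integral_dominated_convergence[where w = "\<lambda>z. norm (indicat_real (ball 0 1) z *\<^sub>R F z)"])
  have int: "integrable lborel (\<lambda>z. indicat_real (ball 0 1) z *\<^sub>R F z)"
    using assms by (simp add: set_integrable_def)
  then show "(\<lambda>z. indicat_real (ball 0 1) z *\<^sub>R F z) \<in> borel_measurable lborel" by auto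
  show "(\<lambda>z. indicat_real (ball 0 (rseq i)) z *\<^sub>R F z) \<in> borel_measurable lborel" for i
  proof -
    have "set_integrable lborel (ball 0 (rseq i)) F"
      by (rule set_integrable_subset[OF assms]) (use rseq(2)[of i] in auto)
    then show ?thesis by (auto simp: set_integrable_def)
  qed
  show "integrable lborel (\<lambda>z. norm (indicat_real (ball 0 1) z *\<^sub>R F z))" by (rule integrable_norm[OF int])
  show "AE z in lborel. norm (indicat_real (ball 0 (rseq i)) z *\<^sub>R F z) \<le> norm (indicat_real (ball 0 1) z *\<^sub>R F z)" for i
    using rseq(2)[of i] by (intro AE_I2) (auto simp: indicator_def)
qed (use rseq_indicator in auto)

definition nsq :: "real \<Rightarrow> 'n::{finite,linorder} form \<Rightarrow> real" where
  "nsq \<alpha> u = Re (form_inner \<alpha> u u)"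

lemma Re_finner:
  assumes "set_integrable lborel (ball 0 r) (dens \<alpha> u v)"
  shows "Re (finner \<alpha> r u v) = (LINT z:ball 0 r|lborel. Re (dens \<alpha> u v z))"
    "set_integrable lborel (ball 0 r) (\<lambda>z. Re (dens \<alpha> u v z))"
proof -
  show "Re (finner \<alpha> r u v) = (LINT z:ball 0 r|lborel. Re (dens \<alpha> u v z))"
    using integral_bounded_linear[OF bounded_linear_Re assms[unfolded set_integrable_def]]
    by (simp add: finner_def set_lebesgue_integral_def)
  show "set_integrable lborel (ball 0 r) (\<lambda>z. Re (dens \<alpha> u v z))"
    using integrable_bounded_linear[OF bounded_linear_Re assms[unfolded set_integrable_def]]
    by (simp add: set_integrable_def)
qed

lemma Re_finner_nonneg:
  assumes "p \<le> 2" "holform p u" "set_integrable lborel (ball 0 r) (dens \<alpha> u u)" "r \<le> 1"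
  shows "0 \<le> Re (finner \<alpha> r u u)"
  unfolding Re_finner(1)[OF assms(3)] set_lebesgue_integral_def
  using dens_nonneg[OF assms(1,2)] assms(4) by (intro integral_nonneg_AE AE_I2) (auto simp: indicator_def)

lemma holform_integrable_r:
  assumes "\<alpha> > 0" "holform p u" "holform q v" "r < 1"
  shows "set_integrable lborel (ball 0 r) (dens \<alpha> u v)"
proof -
  have "compact (dens \<alpha> u v ` cball 0 r)"
    by (intro compact_continuous_image compact_cball continuous_on_subset[OF continuous_on_dens[OF assms(1-3)]])
       (use assms(4) in auto)
  then obtain B where "\<And>z. z \<in> cball 0 r \<Longrightarrow> norm (dens \<alpha> u v z) \<le> B"
    using compact_imp_bounded[of "dens \<alpha> u v ` cball 0 r"] unfolding bounded_iff by blast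
  then show ?thesis
    using assms(4) by (intro set_integrable_bounded_ball[where B = B] set_borel_dens[OF assms(1-3)]) auto
qed

lemma nsq_tendsto:
  assumes "u \<in> A2 \<alpha> p"
  shows "(\<lambda>i. Re (finner \<alpha> (rseq i) u u)) \<longlonglongrightarrow> nsq \<alpha> u"
  using tendsto_Re[OF set_integral_rseq[of "dens \<alpha> u u"]] assms
  by (simp add: A2_iff nsq_def form_inner_finner finner_def)

lemma nsq_nonneg: "p \<le> 2 \<Longrightarrow> u \<in> A2 \<alpha> p \<Longrightarrow> 0 \<le> nsq \<alpha> u"
  unfolding nsq_def form_inner_finner by (rule Re_finner_nonneg) (auto simp: A2_iff)

lemma form_inner_nsq:
  assumes "p \<le> 2" "u \<in> A2 \<alpha> p"
  shows "form_inner \<alpha> u u = of_real (nsq \<alpha> u)"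
proof -
  have "form_inner \<alpha> u u = (LINT z:ball 0 1|lborel. complex_of_real (Re (dens \<alpha> u u z)))"
    unfolding form_inner_finner finner_def
    by (rule set_lebesgue_integral_cong) (use assms dens_real in \<open>auto simp: A2_iff\<close>)
  also have "\<dots> = of_real (LINT z:ball 0 1|lborel. Re (dens \<alpha> u u z))"
    by (simp add: set_lebesgue_integral_def of_real_mult[symmetric] scaleR_conv_of_real del: of_real_mult)
  finally show ?thesis by (simp add: nsq_def)
qed

lemma Re_finner_mono:
  assumes "p \<le> 2" "holform p u" "set_integrable lborel (ball 0 r) (dens \<alpha> u u)" "s \<le> r" "r \<le> 1"
  shows "Re (finner \<alpha> s u u) \<le> Re (finner \<alpha> r u u)"
proof -
  have int: "set_integrable lborel (ball 0 s) (dens \<alpha> u u)"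
    by (rule set_integrable_subset[OF assms(3)]) (use assms(4) in auto)
  show ?thesis
    unfolding Re_finner(1)[OF int] Re_finner(1)[OF assms(3)] set_lebesgue_integral_def
    using Re_finner(2)[OF int] Re_finner(2)[OF assms(3)] dens_nonneg[OF assms(1,2)] assms(4,5)
    by (intro integral_mono) (auto simp: set_integrable_def indicator_def)
qed

text \<open>Bessel's inequality: on each smaller ball a finite sum is dominated by the full series,
  whose value increases with the radius; the radii then tend to \<open>1\<close>.\<close>

lemma parseval_le:
  assumes \<alpha>: "\<alpha> > 0" and p: "p \<le> 2" and u: "u \<in> A2 \<alpha> p"
  shows "(\<Sum>m<N. nsq \<alpha> (hform m u)) \<le> nsq \<alpha> u"
proof -
  have hu: "holform p u" and iu: "set_integrable lborel (ball 0 1) (dens \<alpha> u u)" using u by (auto simp: A2_iff)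
  have "(\<Sum>m<N. Re (finner \<alpha> (rseq i) (hform m u) (hform m u))) \<le> nsq \<alpha> u" for i
  proof -
    have s: "(\<lambda>m. Re (finner \<alpha> (rseq i) (hform m u) (hform m u))) sums Re (finner \<alpha> (rseq i) u u)"
      by (intro sums_Re finner_sums[OF \<alpha> hu hu] rseq)
    have "(\<Sum>m<N. Re (finner \<alpha> (rseq i) (hform m u) (hform m u))) \<le> Re (finner \<alpha> (rseq i) u u)"
      unfolding sums_unique[OF s]
    proof (rule sum_le_suminf[OF sums_summable[OF s]])
      show "0 \<le> Re (finner \<alpha> (rseq i) (hform m u) (hform m u))" for m
        using rseq(2)[of i] by (intro Re_finner_nonneg[OF p holform_hform[OF hu]] hform_integrable[OF \<alpha> hu hu]) auto
    qed auto
    also have "\<dots> \<le> Re (finner \<alpha> 1 u u)"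
      using rseq(2)[of i] by (intro Re_finner_mono[OF p hu iu]) auto
    finally show ?thesis by (simp add: nsq_def form_inner_finner)
  qed
  moreover have "(\<lambda>i. \<Sum>m<N. Re (finner \<alpha> (rseq i) (hform m u) (hform m u))) \<longlonglongrightarrow> (\<Sum>m<N. nsq \<alpha> (hform m u))"
    by (intro tendsto_sum nsq_tendsto[OF hform_A2[OF \<alpha> hu]])
  ultimately show ?thesis by (intro LIMSEQ_le_const2) auto
qed

text \<open>Integrals of the nonnegative density over the exhausting balls increase and stay below
  the sum, so monotone convergence yields integrability. This criterion settles the domain questions
  for the Laplacian and its resolvents.\<close>

lemma A2_of_summable:
  assumes \<alpha>: "\<alpha> > 0" and p: "p \<le> 2" and hu: "holform p u" and s: "summable (\<lambda>m. nsq \<alpha> (hform m u))"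
  shows "u \<in> A2 \<alpha> p" "nsq \<alpha> u \<le> (\<Sum>m. nsq \<alpha> (hform m u))"
proof -
  define S where "S = (\<Sum>m. nsq \<alpha> (hform m u))"
  define X where "X i = Re (finner \<alpha> (rseq i) u u)" for i
  have int: "set_integrable lborel (ball 0 (rseq i)) (dens \<alpha> u u)" for i
    by (rule holform_integrable_r[OF \<alpha> hu hu rseq(2)])
  have XS: "X i \<le> S" for i
  proof -
    have f: "(\<lambda>m. Re (finner \<alpha> (rseq i) (hform m u) (hform m u))) sums X i"
      unfolding X_def by (intro sums_Re finner_sums[OF \<alpha> hu hu] rseq)
    have "X i \<le> S"
      unfolding S_def sums_unique[OF f]
    proof (rule suminf_le[OF _ sums_summable[OF f] s])
      show "Re (finner \<alpha> (rseq i) (hform m u) (hform m u)) \<le> nsq \<alpha> (hform m u)" for m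
        unfolding nsq_def form_inner_finner
        using rseq(2)[of i] by (intro Re_finner_mono[OF p holform_hform[OF hu]] hform_integrable[OF \<alpha> hu hu]) auto
    qed
    then show ?thesis .
  qed
  have "incseq X"
    unfolding X_def by (intro incseq_SucI Re_finner_mono[OF p hu int] rseq less_imp_le)
  then obtain L where L: "X \<longlonglongrightarrow> L" "\<And>i. X i \<le> L"
    using incseq_convergent[of X S] XS by blast
  have LS: "L \<le> S" by (rule LIMSEQ_le_const2[OF L(1)]) (use XS in auto)
  have m: "(\<lambda>z. indicat_real (ball 0 1) z *\<^sub>R Re (dens \<alpha> u u z)) \<in> borel_measurable lborel"
    using borel_measurable_continuous_on_indicator[OF _ continuous_on_Re[OF continuous_on_dens[OF \<alpha> hu hu]]]
    by simp
  have mono: "AE z in lborel. mono (\<lambda>i. indicat_real (ball 0 (rseq i)) z *\<^sub>R Re (dens \<alpha> u u z))"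
  proof (intro AE_I2 incseq_SucI)
    fix z i
    show "indicat_real (ball 0 (rseq i)) z *\<^sub>R Re (dens \<alpha> u u z) \<le> indicat_real (ball 0 (rseq (Suc i))) z *\<^sub>R Re (dens \<alpha> u u z)"
      using rseq(3)[of i] rseq(2)[of "Suc i"] dens_nonneg[OF p hu, of z \<alpha>] by (auto simp: indicator_def)
  qed
  have mc: "integrable lborel (\<lambda>z. indicat_real (ball 0 (rseq i)) z *\<^sub>R Re (dens \<alpha> u u z))" for i
    using Re_finner(2)[OF int] by (simp add: set_integrable_def)
  have lim: "(\<lambda>i. integral\<^sup>L lborel (\<lambda>z. indicat_real (ball 0 (rseq i)) z *\<^sub>R Re (dens \<alpha> u u z))) \<longlonglongrightarrow> L"
    using L(1) unfolding X_def Re_finner(1)[OF int] set_lebesgue_integral_def .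
  have ae: "AE z in lborel. (\<lambda>i. indicat_real (ball 0 (rseq i)) z *\<^sub>R Re (dens \<alpha> u u z)) \<longlonglongrightarrow> indicat_real (ball 0 1) z *\<^sub>R Re (dens \<alpha> u u z)"
    by (rule AE_I2) (rule rseq_indicator)
  have "integrable lborel (\<lambda>z. indicat_real (ball 0 1) z *\<^sub>R Re (dens \<alpha> u u z))"
    by (rule integrable_monotone_convergence[OF mc mono ae lim m])
  then have "integrable lborel (\<lambda>z. complex_of_real (indicat_real (ball 0 1) z *\<^sub>R Re (dens \<alpha> u u z)))"
    by (rule integrable_of_real)
  also have "(\<lambda>z. complex_of_real (indicat_real (ball 0 1) z *\<^sub>R Re (dens \<alpha> u u z))) = (\<lambda>z. indicat_real (ball 0 1) z *\<^sub>R dens \<alpha> u u z)"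
    using dens_real[OF p hu, of _ \<alpha>] by (auto simp: fun_eq_iff indicator_def)
  finally show A: "u \<in> A2 \<alpha> p" using hu by (simp add: A2_iff set_integrable_def)
  have "nsq \<alpha> u = L" using LIMSEQ_unique[OF nsq_tendsto[OF A]] L(1) unfolding X_def by blast
  then show "nsq \<alpha> u \<le> (\<Sum>m. nsq \<alpha> (hform m u))" using LS by (simp add: S_def)
qed

lemma parseval:
  assumes \<alpha>: "\<alpha> > 0" and p: "p \<le> 2" and u: "u \<in> A2 \<alpha> p"
  shows "(\<lambda>m. nsq \<alpha> (hform m u)) sums nsq \<alpha> u"
proof -
  have hu: "holform p u" using u by (simp add: A2_iff)
  have nn: "0 \<le> nsq \<alpha> (hform m u)" for m by (rule nsq_nonneg[OF p hform_A2[OF \<alpha> hu]])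
  have s: "summable (\<lambda>m. nsq \<alpha> (hform m u))"
    by (rule summableI_nonneg_bounded[OF nn parseval_le[OF assms]])
  have "(\<Sum>m. nsq \<alpha> (hform m u)) \<le> nsq \<alpha> u"
    by (rule suminf_le_const[OF s parseval_le[OF assms]])
  with A2_of_summable(2)[OF \<alpha> p hu s] s show ?thesis by (simp add: sums_iff)
qed

section \<open>The Hilbert space structure\<close>

lemma holform_add: "holform p u \<Longrightarrow> holform p v \<Longrightarrow> holform p (u + v)"
  by (auto simp: holform_def formal_def plus_fun_def intro: holomorphic_cn_add)

lemma holform_scale: "holform p u \<Longrightarrow> holform p (form_scale c u)"
  by (auto simp: holform_def formal_def form_scale_def intro: holomorphic_cn_cmult)

lemma holform_0: "holform p 0"
  by (auto simp: holform_def formal_def zero_fun_def intro: holomorphic_cn_const)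

lemma form_diff: "u - v = u + form_scale (- 1) (v :: 'n::finite form)"
  by (simp add: fun_eq_iff form_scale_def)

lemma hform_add: "holform p u \<Longrightarrow> holform p v \<Longrightarrow> hform m (u + v) = hform m u + hform m v"
  by (auto simp: hform_def fun_eq_iff holform_def plus_fun_def hpart_add)

lemma hform_scale: "holform p u \<Longrightarrow> hform m (form_scale c u) = form_scale c (hform m u)"
  by (auto simp: hform_def fun_eq_iff holform_def form_scale_def hpart_cmult)

lemma hform_0: "hform m 0 = 0"
  by (auto simp: hform_def fun_eq_iff zero_fun_def hpart_zero)

text \<open>Operator identities can therefore be checked one degree at a time, where they are
  identities between scalar multiples of polynomial forms.\<close>

lemma holform_eqI:
  assumes "holform p u" "holform p v" "\<And>m. hform m u = hform m v"
  shows "u = v"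
proof (intro ext)
  fix J z
  show "u J z = v J z"
  proof (cases "z \<in> ball 0 1")
    case True
    have eq: "hpart m (u J) z = hpart m (v J) z" for m
      using fun_cong[OF fun_cong[OF assms(3)[of m], of J], of z] True by (simp add: hform_def)
    show ?thesis
      using assms(1,2) True hpart_sums[of "u J" z] hpart_sums[of "v J" z]
      unfolding eq holform_def by (auto intro: sums_unique2)
  next
    case False
    then show ?thesis using assms(1,2) by (simp add: holform_def formal_def)
  qed
qed

lemma A2_holform: "u \<in> A2 \<alpha> p \<Longrightarrow> holform p u"
  by (simp add: A2_iff)

lemma A2_scale: "u \<in> A2 \<alpha> p \<Longrightarrow> form_scale c u \<in> A2 \<alpha> p"
proof -
  have "dens \<alpha> (form_scale c u) (form_scale c u) = (\<lambda>z. (c * cnj c) * dens \<alpha> u u z)"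
    by (simp add: fun_eq_iff dens_linear)
  then show "u \<in> A2 \<alpha> p \<Longrightarrow> form_scale c u \<in> A2 \<alpha> p"
    by (simp add: A2_iff holform_scale)
qed

lemma A2_0: "(0 :: 'n::{finite,linorder} form) \<in> A2 \<alpha> p"
proof -
  have "dens \<alpha> (0 :: 'n form) 0 = (\<lambda>z. 0)" by (simp add: fun_eq_iff dens_def pointwise_inner_def)
  then show ?thesis by (simp add: A2_iff holform_0 set_integrable_def)
qed

text \<open>The pointwise parallelogram law with the density of \<open>u - v\<close> dropped: the
  density of the sum is at most twice the sum of the densities.\<close>

lemma A2_add:
  assumes \<alpha>: "\<alpha> > 0" and p: "p \<le> 2" and u: "u \<in> A2 \<alpha> p" and v: "v \<in> A2 \<alpha> p"
  shows "u + v \<in> A2 \<alpha> p"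
proof -
  have hu: "holform p u" and hv: "holform p v" using u v by (auto simp: A2_iff)
  have huv: "holform p (u + v)" by (rule holform_add[OF hu hv])
  have int: "integrable lborel (\<lambda>z. 2 * norm (indicat_real (ball 0 1) z *\<^sub>R dens \<alpha> u u z) + 2 * norm (indicat_real (ball 0 1) z *\<^sub>R dens \<alpha> v v z))"
    using u v unfolding A2_iff set_integrable_def
    by (intro Bochner_Integration.integrable_add integrable_mult_right integrable_norm) auto
  have "norm (dens \<alpha> (u + v) (u + v) z) \<le> 2 * norm (dens \<alpha> u u z) + 2 * norm (dens \<alpha> v v z)" if z: "z \<in> ball 0 1" for z
  proof -
    let ?w = "u + form_scale (- 1) v"
    have hw: "holform p ?w" by (intro holform_add holform_scale hu hv)
    have n: "norm (dens \<alpha> x x z) = Re (dens \<alpha> x x z)" if "holform p x" for x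
      using dens_nonneg[OF p that z, of \<alpha>] by (subst dens_real[OF p that z]) simp
    have "dens \<alpha> (u + v) (u + v) z + dens \<alpha> ?w ?w z = 2 * dens \<alpha> u u z + 2 * dens \<alpha> v v z"
      by (simp add: dens_linear)
    then have "Re (dens \<alpha> (u + v) (u + v) z) + Re (dens \<alpha> ?w ?w z) = 2 * Re (dens \<alpha> u u z) + 2 * Re (dens \<alpha> v v z)"
      by (metis Re_complex_of_real plus_complex.sel(1) mult_2)
    then show ?thesis using dens_nonneg[OF p hw z, of \<alpha>] by (simp add: n huv hu hv)
  qed
  then have "integrable lborel (\<lambda>z. indicat_real (ball 0 1) z *\<^sub>R dens \<alpha> (u + v) (u + v) z)"
    using set_borel_dens[OF \<alpha> huv huv order_refl]
    by (intro Bochner_Integration.integrable_bound[OF int]) (auto simp: set_borel_measurable_def indicator_def)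
  then show ?thesis using huv by (simp add: A2_iff set_integrable_def)
qed

lemma A2_diff: "\<alpha> > 0 \<Longrightarrow> p \<le> 2 \<Longrightarrow> u \<in> A2 \<alpha> p \<Longrightarrow> v \<in> A2 \<alpha> p \<Longrightarrow> u - v \<in> A2 \<alpha> p"
  unfolding form_diff by (intro A2_add A2_scale)

section \<open>Polarisation and the sesquilinear form of Parseval's identity\<close>

text \<open>These four combinations express mixed densities by diagonal ones, so that integrability
  and Parseval's identity pass from norms to inner products.\<close>

definition polar :: "'n::{finite,linorder} form \<Rightarrow> 'n form \<Rightarrow> nat \<Rightarrow> 'n form" where
  "polar u v k = u + form_scale (\<i> ^ k) v"

lemma dens_polarization: "dens \<alpha> u v z = (\<Sum>k<4. \<i> ^ k * dens \<alpha> (polar u v k) (polar u v k) z) / 4"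
proof -
  have "{..<4::nat} = {0, 1, 2, 3}" by auto
  then show ?thesis
    by (simp add: polar_def dens_linear power2_eq_square power3_eq_cube algebra_simps)
qed

lemma polar_A2: "\<alpha> > 0 \<Longrightarrow> p \<le> 2 \<Longrightarrow> u \<in> A2 \<alpha> p \<Longrightarrow> v \<in> A2 \<alpha> p \<Longrightarrow> polar u v k \<in> A2 \<alpha> p"
  unfolding polar_def by (intro A2_add A2_scale)

lemma dens_integrable:
  assumes "\<alpha> > 0" "p \<le> 2" "u \<in> A2 \<alpha> p" "v \<in> A2 \<alpha> p"
  shows "integrable lborel (\<lambda>z. indicat_real (ball 0 1) z *\<^sub>R dens \<alpha> u v z)"
proof -
  have "integrable lborel (\<lambda>z. (\<Sum>k<4. \<i> ^ k * (indicat_real (ball 0 1) z *\<^sub>R dens \<alpha> (polar u v k) (polar u v k) z)) / 4)"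
    using polar_A2[OF assms]
    by (intro integrable_divide_zero Bochner_Integration.integrable_sum integrable_mult_right) (auto simp: A2_iff set_integrable_def)
  also have "(\<lambda>z. (\<Sum>k<4. \<i> ^ k * (indicat_real (ball 0 1) z *\<^sub>R dens \<alpha> (polar u v k) (polar u v k) z)) / 4)
      = (\<lambda>z. indicat_real (ball 0 1) z *\<^sub>R dens \<alpha> u v z)"
    by (subst (2) dens_polarization) (simp add: fun_eq_iff scaleR_conv_of_real sum_distrib_left mult_ac)
  finally show ?thesis .
qed

lemma form_inner_eq: "form_inner \<alpha> u v = integral\<^sup>L lborel (\<lambda>z. indicat_real (ball 0 1) z *\<^sub>R dens \<alpha> u v z)"
  by (simp add: form_inner_finner finner_def set_lebesgue_integral_def)

lemma form_inner_polarization: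
  assumes "\<alpha> > 0" "p \<le> 2" "u \<in> A2 \<alpha> p" "v \<in> A2 \<alpha> p"
  shows "form_inner \<alpha> u v = (\<Sum>k<4. \<i> ^ k * of_real (nsq \<alpha> (polar u v k))) / 4"
proof -
  have int: "integrable lborel (\<lambda>z. indicat_real (ball 0 1) z *\<^sub>R dens \<alpha> (polar u v k) (polar u v k) z)" for k
    using polar_A2[OF assms] by (auto simp: A2_iff set_integrable_def)
  have "form_inner \<alpha> u v = integral\<^sup>L lborel (\<lambda>z. (\<Sum>k<4. \<i> ^ k * (indicat_real (ball 0 1) z *\<^sub>R dens \<alpha> (polar u v k) (polar u v k) z)) / 4)"
    unfolding form_inner_eq
    by (subst dens_polarization) (simp add: scaleR_conv_of_real sum_distrib_left mult_ac)
  also have "\<dots> = (\<Sum>k<4. \<i> ^ k * form_inner \<alpha> (polar u v k) (polar u v k)) / 4"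
    unfolding form_inner_eq
    by (simp only: integral_divide_zero Bochner_Integration.integral_sum integral_mult_right_zero integrable_mult_right int)
  finally show ?thesis by (simp add: form_inner_nsq[OF assms(2) polar_A2[OF assms]])
qed

lemma form_inner_add_left:
  "\<alpha> > 0 \<Longrightarrow> p \<le> 2 \<Longrightarrow> u \<in> A2 \<alpha> p \<Longrightarrow> v \<in> A2 \<alpha> p \<Longrightarrow> w \<in> A2 \<alpha> p \<Longrightarrow>
    form_inner \<alpha> (u + v) w = form_inner \<alpha> u w + form_inner \<alpha> v w"
  by (simp add: form_inner_eq dens_linear scaleR_add_right dens_integrable)

lemma form_inner_add_right:
  "\<alpha> > 0 \<Longrightarrow> p \<le> 2 \<Longrightarrow> u \<in> A2 \<alpha> p \<Longrightarrow> v \<in> A2 \<alpha> p \<Longrightarrow> w \<in> A2 \<alpha> p \<Longrightarrow>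
    form_inner \<alpha> w (u + v) = form_inner \<alpha> w u + form_inner \<alpha> w v"
  by (simp add: form_inner_eq dens_linear scaleR_add_right dens_integrable)

lemma form_inner_scale_left: "form_inner \<alpha> (form_scale c u) w = c * form_inner \<alpha> u w"
  by (simp add: form_inner_eq dens_linear mult_scaleR_right[symmetric] del: mult_scaleR_right)

lemma form_inner_scale_right: "form_inner \<alpha> w (form_scale c u) = cnj c * form_inner \<alpha> w u"
  by (simp add: form_inner_eq dens_linear mult_scaleR_right[symmetric] del: mult_scaleR_right)

lemma form_inner_cnj:
  assumes "p \<le> 2" "holform p u" "holform p v"
  shows "cnj (form_inner \<alpha> u v) = form_inner \<alpha> v u"
proof -
  have "cnj (indicat_real (ball 0 1) z *\<^sub>R dens \<alpha> u v z) = indicat_real (ball 0 1) z *\<^sub>R dens \<alpha> v u z" for z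
    using dens_cnj[OF assms, of z \<alpha>] by (cases "z \<in> ball 0 1") auto
  note h = this
  show ?thesis
    unfolding form_inner_eq Bochner_Integration.integral_cnj[symmetric] h ..
qed

lemma nsq_scale: "nsq \<alpha> (form_scale c u) = (cmod c)\<^sup>2 * nsq \<alpha> u"
proof -
  have "form_inner \<alpha> (form_scale c u) (form_scale c u) = of_real ((cmod c)\<^sup>2) * form_inner \<alpha> u u"
    by (simp only: form_inner_scale_left form_inner_scale_right complex_norm_square mult_ac)
  then show ?thesis by (simp add: nsq_def del: of_real_power)
qed

lemma form_norm_nsq: "form_norm \<alpha> u = sqrt (nsq \<alpha> u)"
  by (simp add: form_norm_def nsq_def)

lemma hform_polar: "holform p u \<Longrightarrow> holform p v \<Longrightarrow> hform m (polar u v k) = polar (hform m u) (hform m v) k"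
  by (simp add: polar_def hform_add holform_scale hform_scale)

lemma parseval_inner:
  assumes \<alpha>: "\<alpha> > 0" and p: "p \<le> 2" and u: "u \<in> A2 \<alpha> p" and v: "v \<in> A2 \<alpha> p"
  shows "(\<lambda>m. form_inner \<alpha> (hform m u) (hform m v)) sums form_inner \<alpha> u v"
proof -
  have hu: "holform p u" and hv: "holform p v" using u v by (auto simp: A2_iff)
  have "(\<lambda>m. (\<Sum>k<4. \<i> ^ k * of_real (nsq \<alpha> (hform m (polar u v k)))) / 4) sums ((\<Sum>k<4. \<i> ^ k * of_real (nsq \<alpha> (polar u v k))) / 4)"
    by (intro sums_divide sums_sum sums_mult sums_of_real parseval[OF \<alpha> p polar_A2[OF assms]])
  then show ?thesis
    by (simp add: form_inner_polarization[OF \<alpha> p u v] hform_polar[OF hu hv]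
        form_inner_polarization[OF \<alpha> p hform_A2[OF \<alpha> hu] hform_A2[OF \<alpha> hv]])
qed

text \<open>Parseval's identity with a single nonzero term: pairing with a homogeneous form sees
  only the part of the same degree.\<close>

lemma form_inner_hform:
  assumes \<alpha>: "\<alpha> > 0" and p: "p \<le> 2" and u: "holform p u" and v: "v \<in> A2 \<alpha> p"
  shows "form_inner \<alpha> (hform m u) v = form_inner \<alpha> (hform m u) (hform m v)"
proof -
  have eq: "form_inner \<alpha> (hform l (hform m u)) (hform l v) = (if l = m then form_inner \<alpha> (hform m u) (hform m v) else 0)" for l
    by (simp add: hform_hform) (simp add: form_inner_eq dens_zero_left)
  show ?thesis
    using parseval_inner[OF \<alpha> p hform_A2[OF \<alpha> u, of m] v] sums_single[of m "\<lambda>_. form_inner \<alpha> (hform m u) (hform m v)"]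
    unfolding eq by (rule sums_unique2)
qed

lemma set_integral_zero_imp_zero:
  fixes g :: "'a::euclidean_space \<Rightarrow> real"
  assumes c: "continuous_on (ball 0 1) g" and nn: "\<And>z. z \<in> ball 0 1 \<Longrightarrow> 0 \<le> g z"
    and int: "integrable lborel (\<lambda>z. indicat_real (ball 0 1) z *\<^sub>R g z)"
    and zero: "integral\<^sup>L lborel (\<lambda>z. indicat_real (ball 0 1) z *\<^sub>R g z) = 0"
    and z: "z \<in> ball 0 1"
  shows "g z = 0"
proof (rule ccontr)
  assume "g z \<noteq> 0"
  then have pos: "0 < g z" using nn[OF z] by simp
  have "AE x in lborel. indicat_real (ball 0 1) x *\<^sub>R g x = 0"
    using integral_nonneg_eq_0_iff_AE[OF int] nn zero by (auto simp: indicator_def)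
  then have AE: "AE x in lborel. x \<in> ball 0 1 \<longrightarrow> g x = 0"
    by (rule AE_mp) (auto simp: indicator_def)
  have "open (ball 0 1 \<inter> g -` {0<..})"
    using c by (intro continuous_open_preimage) auto
  then obtain e where e: "e > 0" "ball z e \<subseteq> ball 0 1 \<inter> g -` {0<..}"
    using pos z by (auto elim!: openE)
  have "AE x in lborel. x \<notin> ball z e"
    by (rule AE_mp[OF AE], rule AE_I2) (use e(2) in force)
  then have "emeasure lborel (ball z e) = 0"
    using AE_iff_measurable[of "ball z e" lborel "\<lambda>x. x \<notin> ball z e"] by (simp del: mem_ball)
  then show False using e(1) unit_ball_vol_pos[of "real DIM('a)"] by (simp add: emeasure_ball less_le)
qed

text \<open>A continuous nonnegative density with zero integral vanishes at every point. In degree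
  \<open>1\<close> the lower bound for the cometric then kills the coefficients. Degrees
  \<open>0\<close> and \<open>1\<close> are those in which the adjoints take their values.\<close>

lemma nsq_eq_0:
  fixes u :: "'n::{finite,linorder} form"
  assumes \<alpha>: "\<alpha> > 0" and p: "p \<le> 1" and u: "u \<in> A2 \<alpha> p" and "nsq \<alpha> u = 0"
  shows "u = 0"
proof -
  have hu: "holform p u" and fu: "formal p u" using u by (auto simp: A2_iff holform_def)
  have p2: "p \<le> 2" using p by simp
  have int: "integrable lborel (\<lambda>z. indicat_real (ball 0 1) z *\<^sub>R Re (dens \<alpha> u u z))"
    using Re_finner(2)[of 1 \<alpha> u u] u by (simp add: A2_iff set_integrable_def)
  have "integral\<^sup>L lborel (\<lambda>z. indicat_real (ball 0 1) z *\<^sub>R Re (dens \<alpha> u u z)) = 0"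
    using Re_finner(1)[of 1 \<alpha> u u] u assms(4)
    by (simp add: A2_iff nsq_def form_inner_finner set_lebesgue_integral_def)
  then have d0: "Re (dens \<alpha> u u z) = 0" if "z \<in> ball 0 1" for z
    using that int by (intro set_integral_zero_imp_zero[where g = "\<lambda>z. Re (dens \<alpha> u u z)"]
        continuous_on_Re continuous_on_dens[OF \<alpha> hu hu] dens_nonneg[OF p2 hu]) auto
  have pi0: "Re (pointwise_inner u u z) = 0" if "z \<in> ball 0 1" for z
    using d0[OF that] weight_pos[OF that, of \<alpha>] by (simp add: dens_def)
  have "u J z = 0" for J z
  proof (cases "card J = p \<and> z \<in> ball 0 1")
    case False
    then show ?thesis using fu by (auto simp: formal_def)
  next
    case True
    then have J: "card J = p" and z: "z \<in> ball 0 1" by auto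
    show ?thesis
    proof (cases "p = 0")
      case True
      then show ?thesis using pi0[OF z] fu J by (simp add: pointwise_inner_0 complex_norm_square[symmetric] del: of_real_power)
    next
      case False
      then have p1: "p = 1" using p by simp
      then obtain j where j: "J = {j}" using J by (auto simp: card_1_singleton_iff)
      have "(radial z)\<^sup>2 * (\<Sum>j\<in>UNIV. (cmod (u {j} z))\<^sup>2) \<le> 0"
        using Re_pointwise_inner_1_ge[of u z] fu p1 z pi0[OF z] by simp
      then have "(\<Sum>j\<in>UNIV. (cmod (u {j} z))\<^sup>2) \<le> 0"
        using radial_pos[OF z] by (simp add: mult_le_0_iff)
      then have "(\<Sum>j\<in>UNIV. (cmod (u {j} z))\<^sup>2) = 0" by (simp add: sum_nonneg antisym)
      then show ?thesis unfolding j by (simp add: sum_nonneg_eq_0_iff)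
    qed
  qed
  then show ?thesis by (auto simp: fun_eq_iff)
qed

section \<open>Exterior derivative and contraction with the Euler field\<close>

text \<open>The sign is that of moving the factor with index \<open>j\<close> to the front of the
  increasing product over \<open>insert j K\<close>, matching the sign convention of
  \<open>del\<close>.\<close>

definition iota :: "'n::{finite,linorder} form \<Rightarrow> 'n form" where
  "iota u = (\<lambda>K z. if z \<in> ball 0 1
     then \<Sum>j\<in>- K. (- 1) ^ card {i \<in> K. i < j} * (z $ j * u (insert j K) z) else 0)"

lemma holform_del:
  assumes "holform p u"
  shows "holform (Suc p) (del u)"
proof -
  have "dz j (u (K - {j})) z = 0" if "card K \<noteq> Suc p" "j \<in> K" for j z and K :: "'a set"
  proof -
    have "card (K - {j}) \<noteq> p"
      using that by (metis card.remove finite)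
    then show ?thesis by (simp add: holform_zero_coeff[OF assms] dz_const)
  qed
  then have "formal (Suc p) (del u)" by (auto simp: formal_def del_def)
  moreover have "holomorphic_cn (del u K) (ball 0 1)" for K
    unfolding del_def holomorphic_truncate
    using assms by (intro holomorphic_cn_sum holomorphic_cn_cmult holomorphic_cn_dz_holomorphic) (auto simp: holform_def)
  ultimately show ?thesis by (simp add: holform_def)
qed

lemma holform_iota:
  assumes "holform (Suc p) u"
  shows "holform p (iota u)"
proof -
  have "u (insert j K) z = 0" if "card K \<noteq> p" "j \<notin> K" for j z and K :: "'a set"
    using that by (simp add: holform_zero_coeff[OF assms])
  then have "formal p (iota u)" by (auto simp: formal_def iota_def intro!: sum.neutral)
  moreover have "holomorphic_cn (iota u K) (ball 0 1)" for K
    unfolding iota_def holomorphic_truncate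
    using assms by (intro holomorphic_cn_sum holomorphic_cn_cmult holomorphic_cn_mult holomorphic_cn_nth) (auto simp: holform_def)
  ultimately show ?thesis by (simp add: holform_def)
qed

lemma hform_del:
  assumes "holform p u"
  shows "hform m (del u) = del (hform (Suc m) u)"
proof (intro ext)
  fix K z
  show "hform m (del u) K z = del (hform (Suc m) u) K z"
  proof (cases "z \<in> ball 0 1")
    case True
    have hol: "holomorphic_cn (u J) (ball 0 1)" for J using assms by (simp add: holform_def)
    have hol': "holomorphic_cn (dz j (u J)) (ball 0 1)" for j J by (rule holomorphic_cn_dz_holomorphic[OF hol open_ball])
    have "hpart m (del u K) z = (\<Sum>j\<in>K. (- 1) ^ card {i \<in> K. i < j} * hpart m (dz j (u (K - {j}))) z)"
      unfolding del_def hpart_truncate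
      by (subst hpart_sum) (simp_all add: hpart_cmult hol' holomorphic_cn_cmult)
    also have "\<dots> = (\<Sum>j\<in>K. (- 1) ^ card {i \<in> K. i < j} * dz j (hform (Suc m) u (K - {j})) z)"
    proof (intro sum.cong refl arg_cong2[where f = "(*)"])
      fix j
      show "hpart m (dz j (u (K - {j}))) z = dz j (hform (Suc m) u (K - {j})) z"
        unfolding dz_hpart[OF hol, symmetric]
        by (rule dz_cong_ball[OF open_ball True]) (simp add: hform_def del: hpart.simps)
    qed
    finally show ?thesis using True by (simp add: hform_def del_def del: hpart.simps)
  qed (simp add: hform_def del_def)
qed

lemma del_hform_0: "del (hform 0 u) = 0"
proof -
  have "dz j (hform 0 u J) z = 0" if "z \<in> ball 0 1" for j J z
    by (subst dz_cong_ball[OF open_ball that, where g = "\<lambda>_. u J 0"]) (auto simp: hform_def dz_const)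
  then show ?thesis by (auto simp: del_def fun_eq_iff)
qed

text \<open>Contraction multiplies coefficients by a coordinate and so raises the polynomial degree
  by one, whereas \<open>del\<close> lowers it. The compositions of the two preserve it, which is
  why the Laplacian acts on each part separately.\<close>

lemma hform_iota:
  assumes "holform (Suc p) u"
  shows "hform m (iota u) = (case m of 0 \<Rightarrow> 0 | Suc k \<Rightarrow> iota (hform k u))"
proof (intro ext)
  fix K z
  show "hform m (iota u) K z = (case m of 0 \<Rightarrow> 0 | Suc k \<Rightarrow> iota (hform k u)) K z"
  proof (cases "z \<in> ball 0 1")
    case True
    have hol: "holomorphic_cn (u J) (ball 0 1)" for J using assms by (simp add: holform_def)
    have "hpart m (iota u K) z = (\<Sum>j\<in>- K. (- 1) ^ card {i \<in> K. i < j} * hpart m (\<lambda>z. z $ j * u (insert j K) z) z)"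
      unfolding iota_def hpart_truncate
      by (subst hpart_sum) (simp_all add: hpart_cmult hol holomorphic_cn_cmult holomorphic_cn_mult holomorphic_cn_nth)
    also have "\<dots> = (case m of 0 \<Rightarrow> 0 | Suc k \<Rightarrow> iota (hform k u)) K z"
      using True by (auto simp: hpart_times_nth[OF hol] hform_def iota_def split: nat.split)
    finally show ?thesis using True by (simp add: hform_def)
  qed (auto simp: hform_def iota_def split: nat.split)
qed

lemma del_scale: "holform p u \<Longrightarrow> del (form_scale c u) = form_scale c (del u)"
  by (auto simp: del_def fun_eq_iff holform_def form_scale_def dz_cmult[where S = "ball 0 1"] sum_distrib_left mult_ac)

lemma del_0_apply: "z \<in> ball 0 1 \<Longrightarrow> del f {j} z = dz j (f {}) z"
proof -
  have "{i. i = j \<and> i < j} = {}" by auto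
  note s = this
  show "z \<in> ball 0 1 \<Longrightarrow> del f {j} z = dz j (f {}) z" by (simp add: del_def s)
qed

lemma iota_1_apply: "z \<in> ball 0 1 \<Longrightarrow> iota u {} z = (\<Sum>j\<in>UNIV. z $ j * u {j} z)"
  by (simp add: iota_def)

lemma anti_del:
  assumes "z \<in> ball 0 1"
  shows "anti (del u) z j k = dz j (u {k}) z - dz k (u {j}) z"
proof -
  have *: "del u {a, b} z = dz a (u {b}) z - dz b (u {a}) z" if "a < b" for a b
  proof -
    have s: "{i. (i = a \<or> i = b) \<and> i < a} = {}" "{i. (i = a \<or> i = b) \<and> i < b} = {a}" "{a, b} - {a} = {b}" "{a, b} - {b} = {a}"
      using that by auto
    show ?thesis using assms that by (simp add: del_def s)
  qed
  show ?thesis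
    using *[of j k] *[of k j] by (auto simp: anti_def insert_commute)
qed

lemma iota_2_apply:
  assumes "z \<in> ball 0 1"
  shows "iota w {k} z = contr z (anti w z) k"
proof -
  have s: "{i. i = k \<and> i < j} = (if k < j then {k} else {})" for j by auto
  have "iota w {k} z = (\<Sum>j\<in>- {k}. z $ j * anti w z j k)"
  proof -
    have "(- 1) ^ card {i \<in> {k}. i < j} * (z $ j * w (insert j {k}) z) = z $ j * anti w z j k" if "j \<in> - {k}" for j
      using that by (cases j k rule: linorder_cases) (auto simp: anti_def s insert_commute)
    then have "(\<Sum>j\<in>- {k}. (- 1) ^ card {i \<in> {k}. i < j} * (z $ j * w (insert j {k}) z)) = (\<Sum>j\<in>- {k}. z $ j * anti w z j k)"
      by (rule sum.cong[OF refl])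
    then show ?thesis using assms by (simp add: iota_def)
  qed
  also have "\<dots> = contr z (anti w z) k"
    unfolding contr_def by (rule sum.mono_neutral_left) (auto simp: anti_diag)
  finally show ?thesis .
qed

section \<open>The adjoint of the exterior derivative on polynomial forms\<close>

lemma wint_sum_left:
  fixes f :: "'i \<Rightarrow> complex^'n::finite \<Rightarrow> complex"
  assumes "\<alpha> > 0" "\<And>i. i \<in> I \<Longrightarrow> continuous_on UNIV (f i)" "continuous_on UNIV g"
  shows "wint \<alpha> m (\<lambda>z. \<Sum>i\<in>I. f i z) g = (\<Sum>i\<in>I. wint \<alpha> m (f i) g)"
  unfolding wint_def sum_distrib_right
  by (rule Bochner_Integration.integral_sum) (intro wint_integrable assms)

lemma wint_sum_right:
  fixes g :: "'i \<Rightarrow> complex^'n::finite \<Rightarrow> complex"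
  assumes "\<alpha> > 0" "continuous_on UNIV f" "\<And>i. i \<in> I \<Longrightarrow> continuous_on UNIV (g i)"
  shows "wint \<alpha> m f (\<lambda>z. \<Sum>i\<in>I. g i z) = (\<Sum>i\<in>I. wint \<alpha> m f (g i))"
  unfolding wint_def cnj_sum sum_distrib_right sum_distrib_left
  by (rule Bochner_Integration.integral_sum) (intro wint_integrable assms)

lemma wint_diff_left:
  fixes f :: "complex^'n::finite \<Rightarrow> complex"
  assumes "\<alpha> > 0" "continuous_on UNIV f" "continuous_on UNIV f'" "continuous_on UNIV g"
  shows "wint \<alpha> m (\<lambda>z. f z - f' z) g = wint \<alpha> m f g - wint \<alpha> m f' g"
  unfolding wint_def left_diff_distrib
  by (rule Bochner_Integration.integral_diff) (intro wint_integrable assms)+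

lemma wint_zero_right: "wint \<alpha> m f (\<lambda>z. 0) = 0"
  by (simp add: wint_def)

section \<open>Inner products of polynomial forms as weighted integrals\<close>

lemma bump_outside: "z \<notin> ball 0 1 \<Longrightarrow> bump \<alpha> m (radial z) = 0"
  by (simp add: bump_def radial_def abs_square_less_1)

lemma wint_radial: "wint \<alpha> m f g = (LINT z|lborel. f z * cnj (g z) * of_real (bump \<alpha> m (radial z)))"
  by (simp add: wint_def radial_def)

lemma form_inner_wint_0:
  fixes u v :: "'n::{finite,linorder} form"
  assumes "formal 0 u" "formal 0 v" and F: "\<And>z. z \<in> ball 0 1 \<Longrightarrow> u {} z = F z" and G: "\<And>z. z \<in> ball 0 1 \<Longrightarrow> v {} z = G z"
  shows "form_inner \<alpha> u v = wint \<alpha> (CARD('n) + 1) F G"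
  unfolding form_inner_eq wint_radial
proof (rule Bochner_Integration.integral_cong[OF refl])
  fix z :: "complex^'n::{finite,linorder}"
  show "indicat_real (ball 0 1) z *\<^sub>R dens \<alpha> u v z = F z * cnj (G z) * of_real (bump \<alpha> (CARD('n) + 1) (radial z))"
  proof (cases "z \<in> ball 0 1")
    case True
    then show ?thesis by (simp add: dens_def pointwise_inner_0[OF assms(1,2)] F G weight_bump del: mem_ball mem_ball_0)
  qed (simp add: bump_outside del: mem_ball mem_ball_0)
qed

text \<open>The factor \<open>radial z\<close> of the cometric cancels one power of the weight.
  \<open>F\<close> and \<open>G\<close> stand for globally continuous representatives, since the
  coefficients of the forms are cut off at the sphere.\<close>

lemma form_inner_wint_1:
  fixes u v :: "'n::{finite,linorder} form"
  assumes \<alpha>: "\<alpha> > 0" and "formal 1 u" "formal 1 v"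
    and F: "\<And>z j. z \<in> ball 0 1 \<Longrightarrow> u {j} z = F j z" and G: "\<And>z j. z \<in> ball 0 1 \<Longrightarrow> v {j} z = G j z"
    and c: "\<And>j. continuous_on UNIV (F j)" "\<And>j. continuous_on UNIV (G j)"
  shows "form_inner \<alpha> u v = (\<Sum>j\<in>UNIV. wint \<alpha> CARD('n) (F j) (G j))
    - wint \<alpha> CARD('n) (\<lambda>z. \<Sum>j\<in>UNIV. z $ j * F j z) (\<lambda>z. \<Sum>j\<in>UNIV. z $ j * G j z)"
proof -
  let ?b = "\<lambda>z :: complex^'n::{finite,linorder}. complex_of_real (bump \<alpha> CARD('n) (1 - (norm z)\<^sup>2))"
  have "form_inner \<alpha> u v = integral\<^sup>L lborel (\<lambda>z. (\<Sum>j\<in>UNIV. F j z * cnj (G j z) * ?b z)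
      - (\<Sum>j\<in>UNIV. z $ j * F j z) * cnj (\<Sum>j\<in>UNIV. z $ j * G j z) * ?b z)"
    unfolding form_inner_eq
  proof (rule Bochner_Integration.integral_cong[OF refl])
    fix z :: "complex^'n::{finite,linorder}"
    show "indicat_real (ball 0 1) z *\<^sub>R dens \<alpha> u v z = (\<Sum>j\<in>UNIV. F j z * cnj (G j z) * ?b z)
      - (\<Sum>j\<in>UNIV. z $ j * F j z) * cnj (\<Sum>j\<in>UNIV. z $ j * G j z) * ?b z"
    proof (cases "z \<in> ball 0 1")
      case True
      have "weight \<alpha> z * radial z = bump \<alpha> CARD('n) (radial z)"
        using weight_bump[OF True, of \<alpha>] bump_Suc[of "radial z" \<alpha> "CARD('n)"] by (simp add: mult.commute)
      then have "of_real (weight \<alpha> z) * of_real (radial z) = ?b z"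
        by (simp only: of_real_mult[symmetric] radial_def)
      then have "dens \<alpha> u v z = ?b z * ((\<Sum>j\<in>UNIV. F j z * cnj (G j z))
         - (\<Sum>j\<in>UNIV. z $ j * F j z) * cnj (\<Sum>j\<in>UNIV. z $ j * G j z))"
        by (simp only: dens_def pointwise_inner_1[OF assms(2,3) True] F[OF True] G[OF True] mult.assoc[symmetric])
      then show ?thesis using True
        by (simp only: right_diff_distrib sum_distrib_left) (simp add: mult_ac)
    qed (use bump_outside[of z \<alpha>] in \<open>simp add: radial_def\<close>)
  qed
  also have "\<dots> = (\<Sum>j\<in>UNIV. wint \<alpha> CARD('n) (F j) (G j))
    - wint \<alpha> CARD('n) (\<lambda>z. \<Sum>j\<in>UNIV. z $ j * F j z) (\<lambda>z. \<Sum>j\<in>UNIV. z $ j * G j z)"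
    unfolding wint_def
    by (subst Bochner_Integration.integral_diff, intro Bochner_Integration.integrable_sum wint_integrable \<alpha> c,
        intro wint_integrable continuous_intros \<alpha> c,
        subst Bochner_Integration.integral_sum, intro wint_integrable \<alpha> c, rule refl)
  finally show ?thesis .
qed

text \<open>Two factors \<open>radial z\<close> lower the exponent from \<open>CARD('n) + 1\<close>
  to \<open>N\<close>; naming \<open>N\<close> avoids truncated subtraction.\<close>

lemma form_inner_wint_2:
  fixes u v :: "'n::{finite,linorder} form"
  assumes \<alpha>: "\<alpha> > 0" and "formal 2 u" "formal 2 v"
    and A: "\<And>z j k. z \<in> ball 0 1 \<Longrightarrow> anti u z j k = A j k z" and B: "\<And>z j k. z \<in> ball 0 1 \<Longrightarrow> anti v z j k = B j k z"
    and c: "\<And>j k. continuous_on UNIV (A j k)" "\<And>j k. continuous_on UNIV (B j k)"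
    and N: "CARD('n) = Suc N"
  shows "form_inner \<alpha> u v = (\<Sum>j\<in>UNIV. \<Sum>k\<in>UNIV. wint \<alpha> N (A j k) (B j k)) / 2
    - (\<Sum>k\<in>UNIV. wint \<alpha> N (\<lambda>z. \<Sum>j\<in>UNIV. z $ j * A j k z) (\<lambda>z. \<Sum>j\<in>UNIV. z $ j * B j k z))"
proof -
  let ?b = "\<lambda>z :: complex^'n::{finite,linorder}. complex_of_real (bump \<alpha> N (1 - (norm z)\<^sup>2))"
  have "form_inner \<alpha> u v = integral\<^sup>L lborel (\<lambda>z. (\<Sum>j\<in>UNIV. \<Sum>k\<in>UNIV. A j k z * cnj (B j k z) * ?b z) / 2
      - (\<Sum>k\<in>UNIV. (\<Sum>j\<in>UNIV. z $ j * A j k z) * cnj (\<Sum>j\<in>UNIV. z $ j * B j k z) * ?b z))"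
    unfolding form_inner_eq
  proof (rule Bochner_Integration.integral_cong[OF refl])
    fix z :: "complex^'n::{finite,linorder}"
    show "indicat_real (ball 0 1) z *\<^sub>R dens \<alpha> u v z = (\<Sum>j\<in>UNIV. \<Sum>k\<in>UNIV. A j k z * cnj (B j k z) * ?b z) / 2
      - (\<Sum>k\<in>UNIV. (\<Sum>j\<in>UNIV. z $ j * A j k z) * cnj (\<Sum>j\<in>UNIV. z $ j * B j k z) * ?b z)"
    proof (cases "z \<in> ball 0 1")
      case True
      have "weight \<alpha> z * (radial z)\<^sup>2 = bump \<alpha> N (radial z)"
        using weight_bump[OF True, of \<alpha>] bump_Suc[of "radial z" \<alpha> N] bump_Suc[of "radial z" \<alpha> "Suc N"]
        by (simp add: power2_eq_square N mult_ac)
      then have w: "of_real (weight \<alpha> z) * of_real ((radial z)\<^sup>2) = ?b z"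
        by (simp only: of_real_mult[symmetric] radial_def)
      have "dens \<alpha> u v z = ?b z * ((\<Sum>j\<in>UNIV. \<Sum>k\<in>UNIV. A j k z * cnj (B j k z)) / 2
         - (\<Sum>k\<in>UNIV. (\<Sum>j\<in>UNIV. z $ j * A j k z) * cnj (\<Sum>j\<in>UNIV. z $ j * B j k z)))"
        by (simp only: dens_def pointwise_inner_2[OF assms(2,3) True] contr_def A[OF True] B[OF True] mult.assoc[symmetric] w)
      then show ?thesis using True
        by (simp only: right_diff_distrib sum_distrib_left times_divide_eq_right) (simp add: mult_ac)
    qed (use bump_outside[of z \<alpha>] in \<open>simp add: radial_def\<close>)
  qed
  also have "\<dots> = (\<Sum>j\<in>UNIV. \<Sum>k\<in>UNIV. wint \<alpha> N (A j k) (B j k)) / 2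
    - (\<Sum>k\<in>UNIV. wint \<alpha> N (\<lambda>z. \<Sum>j\<in>UNIV. z $ j * A j k z) (\<lambda>z. \<Sum>j\<in>UNIV. z $ j * B j k z))"
  proof -
    have 1: "integrable lborel (\<lambda>z. A j k z * cnj (B j k z) * ?b z)" for j k
      by (intro wint_integrable \<alpha> c)
    have 2: "integrable lborel (\<lambda>z. (\<Sum>j\<in>UNIV. z $ j * A j k z) * cnj (\<Sum>j\<in>UNIV. z $ j * B j k z) * ?b z)" for k
      by (intro wint_integrable continuous_intros \<alpha> c)
    show ?thesis
      unfolding wint_def
      by (simp only: Bochner_Integration.integral_diff Bochner_Integration.integral_sum integral_divide_zero
          Bochner_Integration.integrable_sum integrable_divide_zero 1 2)
  qed
  finally show ?thesis .
qed

section \<open>Integration by parts for polynomial forms\<close>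

lemma wint_dz_sum:
  fixes F :: "complex^'n::finite \<Rightarrow> complex"
  assumes \<alpha>: "\<alpha> > 0" and F: "holomorphic_cn F UNIV" and V: "\<And>j. holomorphic_cn (V j) UNIV"
  shows "(\<Sum>j\<in>UNIV. wint \<alpha> m (dz j F) (V j))
    = \<alpha> * wint \<alpha> (m + 2) F (\<lambda>z. \<Sum>j\<in>UNIV. z $ j * V j z) - of_nat m * wint \<alpha> (m + 1) F (\<lambda>z. \<Sum>j\<in>UNIV. z $ j * V j z)"
proof -
  have c: "continuous_on UNIV F" "\<And>j. continuous_on UNIV (\<lambda>z. z $ j * V j z)"
    using F V by (auto intro!: holomorphic_cn_imp_continuous_on holomorphic_cn_mult holomorphic_cn_nth)
  show ?thesis
    by (simp add: wint_by_parts[OF \<alpha> F V] wint_sum_right[OF \<alpha> c] sum_subtractf sum_distrib_left)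
qed

text \<open>Each \<open>z $ j * dz j F\<close> is rewritten as the derivative of
  \<open>z $ j * F\<close> minus \<open>F\<close>. Integration by parts puts a factor
  \<open>z $ j\<close> on both sides, \<open>wint_sum_nth\<close> evaluates the sums, and the
  subtracted copies of \<open>F\<close> account for the term with \<open>CARD('n)\<close>.\<close>

lemma wint_euler:
  fixes F G :: "complex^'n::finite \<Rightarrow> complex"
  assumes \<alpha>: "\<alpha> > 0" and F: "holomorphic_cn F UNIV" and G: "holomorphic_cn G UNIV"
  shows "wint \<alpha> m (\<lambda>z. \<Sum>j\<in>UNIV. z $ j * dz j F z) G
    = \<alpha> * (wint \<alpha> (m + 2) F G - wint \<alpha> (m + 1) F G) - of_nat m * (wint \<alpha> (m + 1) F G - wint \<alpha> m F G)
      - of_nat CARD('n) * wint \<alpha> m F G"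
proof -
  have dzF: "holomorphic_cn (dz j F) UNIV" for j by (rule holomorphic_cn_dz_holomorphic[OF F]) simp
  have zF: "holomorphic_cn (\<lambda>z. z $ j * F z) UNIV" for j by (intro holomorphic_cn_mult holomorphic_cn_nth F)
  have dzzF: "holomorphic_cn (dz j (\<lambda>z. z $ j * F z)) UNIV" for j by (rule holomorphic_cn_dz_holomorphic[OF zF]) simp
  note c = holomorphic_cn_imp_continuous_on
  have cj: "continuous_on UNIV (\<lambda>z. z $ j * dz j F z)" for j
    by (intro c holomorphic_cn_mult holomorphic_cn_nth dzF)
  have eq: "(\<lambda>z. z $ j * dz j F z) = (\<lambda>z. dz j (\<lambda>z. z $ j * F z) z - F z)" for j
    by (simp add: fun_eq_iff dz_mult[OF holomorphic_cn_nth F] dz_nth)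
  have "wint \<alpha> m (\<lambda>z. \<Sum>j\<in>UNIV. z $ j * dz j F z) G = (\<Sum>j\<in>UNIV. wint \<alpha> m (\<lambda>z. z $ j * dz j F z) G)"
    by (rule wint_sum_left[OF \<alpha> cj c[OF G]])
  also have "\<dots> = (\<Sum>j\<in>UNIV. wint \<alpha> m (dz j (\<lambda>z. z $ j * F z)) G - wint \<alpha> m F G)"
    unfolding eq by (intro sum.cong refl wint_diff_left \<alpha> c F G dzzF)
  also have "\<dots> = (\<Sum>j\<in>UNIV. \<alpha> * wint \<alpha> (Suc (m + 1)) (\<lambda>z. z $ j * F z) (\<lambda>z. z $ j * G z)
      - of_nat m * wint \<alpha> (Suc m) (\<lambda>z. z $ j * F z) (\<lambda>z. z $ j * G z) - wint \<alpha> m F G)"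
    by (simp add: wint_by_parts[OF \<alpha> zF G])
  also have "\<dots> = \<alpha> * (wint \<alpha> (Suc (m + 1)) F G - wint \<alpha> (m + 1) F G) - of_nat m * (wint \<alpha> (Suc m) F G - wint \<alpha> m F G)
      - of_nat CARD('n) * wint \<alpha> m F G"
    by (simp only: sum_subtractf sum_distrib_left[symmetric] wint_sum_nth[OF \<alpha> c[OF F] c[OF G]]) simp
  finally show ?thesis by simp
qed

lemma dz_hform:
  "z \<in> ball 0 1 \<Longrightarrow> dz j (hform m u J) z = dz j (hpart m (u J)) z"
  by (rule dz_cong_ball[OF open_ball, of z 0 1]) (simp_all add: hform_def)

text \<open>The two parts of the cometric give \<open>wint_dz_sum\<close> minus
  \<open>wint_euler\<close>. Since the exponent for 1-forms equals the dimension, all terms cancel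
  except \<open>\<alpha>\<close> times the pairing with exponent \<open>CARD('n) + 1\<close>, which
  is the inner product of functions.\<close>

lemma adjoint_hform_0:
  fixes f v :: "'n::{finite,linorder} form"
  assumes \<alpha>: "\<alpha> > 0" and f: "holform 0 f" and v: "holform 1 v"
  shows "form_inner \<alpha> (del (hform m f)) (hform l v) = \<alpha> * form_inner \<alpha> (hform m f) (iota (hform l v))"
proof -
  define F where "F = hpart m (f {})"
  define V where "V j = hpart l (v {j})" for j
  define Z where "Z z = (\<Sum>j\<in>UNIV. z $ j * V j z)" for z
  have hF: "holomorphic_cn F UNIV" unfolding F_def by (rule hpart_holomorphic)
  have hV: "holomorphic_cn (V j) UNIV" for j unfolding V_def by (rule hpart_holomorphic)
  have hZ: "holomorphic_cn Z UNIV" unfolding Z_def[abs_def] by (intro holomorphic_cn_sum holomorphic_cn_mult holomorphic_cn_nth hV)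
  have hform: "holform 0 (hform m f)" "holform 1 (hform l v)" "holform 1 (del (hform m f))" "holform 0 (iota (hform l v))"
    using holform_hform[OF f, of m] holform_hform[OF v, of l] holform_del[of 0 "hform m f"] holform_iota[of 0 "hform l v"] by simp_all
  have "form_inner \<alpha> (del (hform m f)) (hform l v) = (\<Sum>j\<in>UNIV. wint \<alpha> CARD('n) (dz j F) (V j))
     - wint \<alpha> CARD('n) (\<lambda>z. \<Sum>j\<in>UNIV. z $ j * dz j F z) (\<lambda>z. \<Sum>j\<in>UNIV. z $ j * V j z)"
  proof (rule form_inner_wint_1[OF \<alpha>])
    show "del (hform m f) {j} z = dz j F z" if "z \<in> ball 0 1" for z j
      using that by (simp only: del_0_apply dz_hform F_def)
    show "hform l v {j} z = V j z" if "z \<in> ball 0 1" for z j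
      using that by (simp add: hform_def V_def)
  qed (use hform hF hV in \<open>auto simp: holform_def intro!: holomorphic_cn_imp_continuous_on holomorphic_cn_dz_holomorphic\<close>)
  also have "(\<Sum>j\<in>UNIV. wint \<alpha> CARD('n) (dz j F) (V j)) = \<alpha> * wint \<alpha> (CARD('n) + 2) F Z - of_nat CARD('n) * wint \<alpha> (CARD('n) + 1) F Z"
    unfolding Z_def[abs_def] by (rule wint_dz_sum[OF \<alpha> hF hV])
  also have "wint \<alpha> CARD('n) (\<lambda>z. \<Sum>j\<in>UNIV. z $ j * dz j F z) (\<lambda>z. \<Sum>j\<in>UNIV. z $ j * V j z)
      = \<alpha> * (wint \<alpha> (CARD('n) + 2) F Z - wint \<alpha> (CARD('n) + 1) F Z)
       - of_nat CARD('n) * (wint \<alpha> (CARD('n) + 1) F Z - wint \<alpha> CARD('n) F Z) - of_nat CARD('n) * wint \<alpha> CARD('n) F Z"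
    using wint_euler[OF \<alpha> hF hZ, of "CARD('n)"] unfolding Z_def[abs_def] .
  also have "\<alpha> * wint \<alpha> (CARD('n) + 2) F Z - of_nat CARD('n) * wint \<alpha> (CARD('n) + 1) F Z - (\<alpha> * (wint \<alpha> (CARD('n) + 2) F Z - wint \<alpha> (CARD('n) + 1) F Z)
       - of_nat CARD('n) * (wint \<alpha> (CARD('n) + 1) F Z - wint \<alpha> CARD('n) F Z) - of_nat CARD('n) * wint \<alpha> CARD('n) F Z)
     = \<alpha> * wint \<alpha> (CARD('n) + 1) F Z"
    by (simp add: algebra_simps)
  also have "wint \<alpha> (CARD('n) + 1) F Z = form_inner \<alpha> (hform m f) (iota (hform l v))"
  proof (rule form_inner_wint_0[symmetric])
    show "hform m f {} z = F z" if "z \<in> ball 0 1" for z using that by (simp add: hform_def F_def)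
    show "iota (hform l v) {} z = Z z" if "z \<in> ball 0 1" for z
      using that by (simp add: iota_1_apply hform_def V_def Z_def)
  qed (use hform in \<open>auto simp: holform_def\<close>)
  finally show ?thesis .
qed

text \<open>The exponent is now \<open>N\<close>, one below the dimension, and the cancellation seen
  for functions would leave one pairing over. It is compensated by the extra \<open>V k\<close> that
  appears when the exterior derivative is contracted with the Euler field.\<close>

lemma adjoint_hform_1:
  fixes v w :: "'n::{finite,linorder} form"
  assumes \<alpha>: "\<alpha> > 0" and v: "holform 1 v" and w: "holform 2 w"
  shows "form_inner \<alpha> (del (hform m v)) (hform l w) = \<alpha> * form_inner \<alpha> (hform m v) (iota (hform l w))"
proof -
  obtain N where N: "CARD('n) = Suc N" using zero_less_card_finite[where 'a='n] gr0_implies_Suc by blast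
  define V where "V j = hpart m (v {j})" for j
  define B where "B j k = (if j < k then hpart l (w {j, k}) else if k < j then (\<lambda>z. - hpart l (w {j, k}) z) else (\<lambda>z. 0))" for j k
  define A where "A j k z = dz j (V k) z - dz k (V j) z" for j k z
  define Z where "Z k z = (\<Sum>j\<in>UNIV. z $ j * B j k z)" for k z
  define S where "S z = (\<Sum>j\<in>UNIV. z $ j * V j z)" for z
  have hV: "holomorphic_cn (V j) UNIV" for j unfolding V_def by (rule hpart_holomorphic)
  have hdV: "holomorphic_cn (dz k (V j)) UNIV" for j k by (rule holomorphic_cn_dz_holomorphic[OF hV open_UNIV])
  have hB: "holomorphic_cn (B j k) UNIV" for j k
    using holomorphic_cn_cmult[OF hpart_holomorphic, of "-1"]
    by (auto simp: B_def intro!: hpart_holomorphic holomorphic_cn_const)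
  have hA: "holomorphic_cn (A j k) UNIV" for j k unfolding A_def[abs_def] by (intro holomorphic_cn_diff hdV)
  have hZ: "holomorphic_cn (Z k) UNIV" for k unfolding Z_def[abs_def] by (intro holomorphic_cn_sum holomorphic_cn_mult holomorphic_cn_nth hB)
  have hS: "holomorphic_cn S UNIV" unfolding S_def[abs_def] by (intro holomorphic_cn_sum holomorphic_cn_mult holomorphic_cn_nth hV)
  note c = holomorphic_cn_imp_continuous_on
  have Banti: "B k j z = - B j k z" for j k z by (auto simp: B_def insert_commute)
  have ZZ: "(\<Sum>k\<in>UNIV. z $ k * Z k z) = 0" for z
    using contr_contr[of "\<lambda>j k. B j k z" z, OF Banti] by (simp add: contr_def Z_def)
  have hform: "holform 1 (hform m v)" "holform 2 (hform l w)" "holform 2 (del (hform m v))" "holform 1 (iota (hform l w))"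
    using holform_hform[OF v, of m] holform_hform[OF w, of l] holform_del[of 1 "hform m v"] holform_iota[of 1 "hform l w"]
    by (simp_all add: numeral_2_eq_2)
  have antiB: "anti (hform l w) z j k = B j k z" if "z \<in> ball 0 1" for z j k
    using that by (auto simp: anti_def hform_def B_def)
  have "form_inner \<alpha> (del (hform m v)) (hform l w) = (\<Sum>j\<in>UNIV. \<Sum>k\<in>UNIV. wint \<alpha> N (A j k) (B j k)) / 2
    - (\<Sum>k\<in>UNIV. wint \<alpha> N (\<lambda>z. \<Sum>j\<in>UNIV. z $ j * A j k z) (\<lambda>z. \<Sum>j\<in>UNIV. z $ j * B j k z))"
  proof (rule form_inner_wint_2[OF \<alpha> _ _ _ _ _ _ N])
    show "anti (del (hform m v)) z j k = A j k z" if "z \<in> ball 0 1" for z j k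
      using that by (simp only: anti_del dz_hform A_def V_def)
  qed (use hform hA hB antiB in \<open>auto simp: holform_def intro!: c\<close>)
  also have "(\<Sum>j\<in>UNIV. \<Sum>k\<in>UNIV. wint \<alpha> N (A j k) (B j k)) = 2 * (\<Sum>k\<in>UNIV. \<Sum>j\<in>UNIV. wint \<alpha> N (dz j (V k)) (B j k))"
  proof -
    have neg: "wint \<alpha> N f (B k j) = - wint \<alpha> N f (B j k)" for f j k
      by (simp add: wint_def Banti[of k j])
    have "(\<Sum>j\<in>UNIV. \<Sum>k\<in>UNIV. wint \<alpha> N (A j k) (B j k))
      = (\<Sum>j\<in>UNIV. \<Sum>k\<in>UNIV. wint \<alpha> N (dz j (V k)) (B j k)) + (\<Sum>j\<in>UNIV. \<Sum>k\<in>UNIV. wint \<alpha> N (dz k (V j)) (B k j))"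
    proof -
      have "wint \<alpha> N (A j k) (B j k) = wint \<alpha> N (dz j (V k)) (B j k) + wint \<alpha> N (dz k (V j)) (B k j)" for j k
        unfolding A_def[abs_def] wint_diff_left[OF \<alpha> c[OF hdV] c[OF hdV] c[OF hB]] neg[of "dz k (V j)" k j] by simp
      then show ?thesis by (simp add: sum.distrib)
    qed
    then show ?thesis
      using sum.swap[where g = "\<lambda>j k. wint \<alpha> N (dz j (V k)) (B j k)" and A = UNIV and B = UNIV] by simp
  qed
  also have "(\<Sum>k\<in>UNIV. \<Sum>j\<in>UNIV. wint \<alpha> N (dz j (V k)) (B j k))
      = (\<Sum>k\<in>UNIV. \<alpha> * wint \<alpha> (N + 2) (V k) (Z k) - of_nat N * wint \<alpha> (N + 1) (V k) (Z k))"
    unfolding Z_def[abs_def] by (intro sum.cong refl wint_dz_sum \<alpha> hV hB)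
  also have "(\<Sum>k\<in>UNIV. wint \<alpha> N (\<lambda>z. \<Sum>j\<in>UNIV. z $ j * A j k z) (\<lambda>z. \<Sum>j\<in>UNIV. z $ j * B j k z))
     = (\<Sum>k\<in>UNIV. (\<alpha> * (wint \<alpha> (N + 2) (V k) (Z k) - wint \<alpha> (N + 1) (V k) (Z k)) - of_nat N * (wint \<alpha> (N + 1) (V k) (Z k) - wint \<alpha> N (V k) (Z k))
      - of_nat (Suc N) * wint \<alpha> N (V k) (Z k)) + wint \<alpha> N (V k) (Z k))"
  proof -
    \<comment> \<open>Cartan's formula at the level of coefficients: the contraction of the exterior
      derivative is the Euler derivative of \<open>V k\<close> minus the part of
      \<open>dz k S\<close> in which the derivative does not hit a coordinate.\<close>
    have zA: "(\<Sum>j\<in>UNIV. z $ j * A j k z) = (\<Sum>j\<in>UNIV. z $ j * dz j (V k) z) - (dz k S z - V k z)" for k z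
    proof -
      have "dz k S z = (\<Sum>j\<in>UNIV. dz k (\<lambda>z. z $ j * V j z) z)"
        unfolding S_def[abs_def] by (rule dz_sum[where S = UNIV]) (auto intro: holomorphic_cn_mult holomorphic_cn_nth hV)
      also have "\<dots> = (\<Sum>j\<in>UNIV. (if k = j then V j z else 0) + z $ j * dz k (V j) z)"
        by (intro sum.cong refl) (simp add: dz_mult[OF holomorphic_cn_nth hV] dz_nth)
      finally have "dz k S z = V k z + (\<Sum>j\<in>UNIV. z $ j * dz k (V j) z)" by (simp add: sum.distrib)
      then show ?thesis by (simp add: A_def right_diff_distrib sum_subtractf)
    qed
    have hE: "holomorphic_cn (\<lambda>z. \<Sum>j\<in>UNIV. z $ j * dz j (V k) z) UNIV" for k
      by (intro holomorphic_cn_sum holomorphic_cn_mult holomorphic_cn_nth hdV)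
    have hdS: "holomorphic_cn (dz k S) UNIV" for k by (rule holomorphic_cn_dz_holomorphic[OF hS open_UNIV])
    have Zk: "(\<lambda>z. \<Sum>j\<in>UNIV. z $ j * B j k z) = Z k" for k by (simp add: Z_def fun_eq_iff)
    have 1: "wint \<alpha> N (\<lambda>z. \<Sum>j\<in>UNIV. z $ j * A j k z) (Z k)
       = wint \<alpha> N (\<lambda>z. \<Sum>j\<in>UNIV. z $ j * dz j (V k) z) (Z k) - (wint \<alpha> N (dz k S) (Z k) - wint \<alpha> N (V k) (Z k))" for k
      unfolding zA
      by (subst wint_diff_left, intro \<alpha>, intro c hE, intro c holomorphic_cn_diff hdS hV, intro c hZ,
          subst wint_diff_left, intro \<alpha>, intro c hdS, intro c hV, intro c hZ, rule refl)
    \<comment> \<open>After integration by parts the gradient of \<open>S\<close> is paired with the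
      contraction of \<open>Z\<close>, which vanishes because \<open>Z\<close> is itself a
      contraction.\<close>
    have 2: "(\<Sum>k\<in>UNIV. wint \<alpha> N (dz k S) (Z k)) = 0"
      unfolding wint_dz_sum[OF \<alpha> hS hZ] ZZ wint_zero_right by simp
    have 3: "wint \<alpha> N (\<lambda>z. \<Sum>j\<in>UNIV. z $ j * dz j (V k) z) (Z k)
        = \<alpha> * (wint \<alpha> (N + 2) (V k) (Z k) - wint \<alpha> (N + 1) (V k) (Z k)) - of_nat N * (wint \<alpha> (N + 1) (V k) (Z k) - wint \<alpha> N (V k) (Z k))
          - of_nat (Suc N) * wint \<alpha> N (V k) (Z k)" for k
      unfolding wint_euler[OF \<alpha> hV hZ] N ..
    have 4: "(\<Sum>k\<in>UNIV. E k - (X k - Y k)) = (\<Sum>k\<in>UNIV. E k + Y k)" if "(\<Sum>k\<in>UNIV. X k) = 0" for E X Y :: "'n \<Rightarrow> complex"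
      using that by (simp add: sum.distrib sum_subtractf)
    show ?thesis
      unfolding Zk 1 3 by (rule 4[OF 2])
  qed
  also have "2 * (\<Sum>k\<in>UNIV. \<alpha> * wint \<alpha> (N + 2) (V k) (Z k) - of_nat N * wint \<alpha> (N + 1) (V k) (Z k)) / 2
     - (\<Sum>k\<in>UNIV. (\<alpha> * (wint \<alpha> (N + 2) (V k) (Z k) - wint \<alpha> (N + 1) (V k) (Z k)) - of_nat N * (wint \<alpha> (N + 1) (V k) (Z k) - wint \<alpha> N (V k) (Z k))
      - of_nat (Suc N) * wint \<alpha> N (V k) (Z k)) + wint \<alpha> N (V k) (Z k))
     = (\<Sum>k\<in>UNIV. \<alpha> * wint \<alpha> (N + 1) (V k) (Z k))"
    by (simp add: sum_subtractf[symmetric] algebra_simps)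
  \<comment> \<open>The subtracted pairing is zero by \<open>ZZ\<close>; it is inserted to match the
    shape of \<open>form_inner_wint_1\<close>.\<close>
  also have "\<dots> = \<alpha> * ((\<Sum>k\<in>UNIV. wint \<alpha> CARD('n) (V k) (Z k))
    - wint \<alpha> CARD('n) (\<lambda>z. \<Sum>j\<in>UNIV. z $ j * V j z) (\<lambda>z. \<Sum>j\<in>UNIV. z $ j * Z j z))"
    unfolding ZZ wint_zero_right by (simp add: N sum_distrib_left)
  also have "(\<Sum>k\<in>UNIV. wint \<alpha> CARD('n) (V k) (Z k))
    - wint \<alpha> CARD('n) (\<lambda>z. \<Sum>j\<in>UNIV. z $ j * V j z) (\<lambda>z. \<Sum>j\<in>UNIV. z $ j * Z j z) = form_inner \<alpha> (hform m v) (iota (hform l w))"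
  proof (rule form_inner_wint_1[OF \<alpha>, symmetric])
    show "hform m v {j} z = V j z" if "z \<in> ball 0 1" for z j using that by (simp add: hform_def V_def)
    show "iota (hform l w) {j} z = Z j z" if "z \<in> ball 0 1" for z j
      using that by (simp only: iota_2_apply contr_def antiB Z_def)
  qed (use hform hV hZ in \<open>auto simp: holform_def intro!: c\<close>)
  finally show ?thesis .
qed

section \<open>The adjoint and the complex Laplacian\<close>

lemma adjoint_hform:
  assumes "\<alpha> > 0" "p \<le> 1" "holform p u" "holform (Suc p) v"
  shows "form_inner \<alpha> (del (hform m u)) (hform l v) = \<alpha> * form_inner \<alpha> (hform m u) (iota (hform l v))"
proof -
  have "p = 0 \<or> p = 1" using assms(2) by auto
  then show ?thesis
    using adjoint_hform_0[OF assms(1), of u v] adjoint_hform_1[OF assms(1), of u v] assms(3,4) by (auto simp: numeral_2_eq_2)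
qed

lemma form_inner_zero_left: "form_inner \<alpha> 0 v = 0"
  by (simp add: form_inner_eq dens_def pointwise_inner_def)

lemma form_inner_zero_right: "form_inner \<alpha> v 0 = 0"
  by (simp add: form_inner_eq dens_def pointwise_inner_def)

lemma nsq_zero: "nsq \<alpha> 0 = 0"
  by (simp add: nsq_def form_inner_zero_left)

lemma iota_zero: "iota 0 = 0"
  by (simp add: iota_def fun_eq_iff)

lemma del_hform: "holform p u \<Longrightarrow> del (hform m u) = (case m of 0 \<Rightarrow> 0 | Suc k \<Rightarrow> hform k (del u))"
  by (cases m) (simp_all add: del_hform_0 hform_del)

lemma iota_hform: "holform (Suc p) u \<Longrightarrow> iota (hform m u) = hform (Suc m) (iota u)"
  by (simp add: hform_iota)

lemma del_hform_A2: "\<alpha> > 0 \<Longrightarrow> holform p u \<Longrightarrow> del (hform m u) \<in> A2 \<alpha> (Suc p)"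
  by (auto simp: del_hform A2_0 hform_A2 holform_del split: nat.split)

lemma iota_hform_A2: "\<alpha> > 0 \<Longrightarrow> holform (Suc p) u \<Longrightarrow> iota (hform m u) \<in> A2 \<alpha> p"
  by (simp add: iota_hform hform_A2 holform_iota)

lemma hform_dom_del: "\<alpha> > 0 \<Longrightarrow> holform p u \<Longrightarrow> hform m u \<in> dom_del \<alpha> p"
  by (simp add: dom_del_def hform_A2 del_hform_A2)

text \<open>Parseval's identity sums the adjointness of homogeneous parts. Degree \<open>m\<close>
  of \<open>del u\<close> meets degree \<open>Suc m\<close> of \<open>u\<close>, and the missing
  initial term is zero because \<open>iota v\<close> has no part of degree \<open>0\<close>.\<close>

lemma del_adjoint_iota:
  assumes \<alpha>: "\<alpha> > 0" and p: "p \<le> 1" and u: "u \<in> dom_del \<alpha> p" and v: "v \<in> A2 \<alpha> (Suc p)" and iv: "iota v \<in> A2 \<alpha> p"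
  shows "form_inner \<alpha> (del u) v = form_inner \<alpha> u (form_scale \<alpha> (iota v))"
proof -
  have uA: "u \<in> A2 \<alpha> p" "del u \<in> A2 \<alpha> (Suc p)" using u by (auto simp: dom_del_def)
  have hu: "holform p u" and hv: "holform (Suc p) v" using uA v by (auto simp: A2_iff)
  have eq: "form_inner \<alpha> (hform m (del u)) (hform m v) = \<alpha> * form_inner \<alpha> (hform (Suc m) u) (hform (Suc m) (iota v))" for m
    unfolding hform_del[OF hu] adjoint_hform[OF \<alpha> p hu hv] iota_hform[OF hv] ..
  have "(\<lambda>m. \<alpha> * form_inner \<alpha> (hform (Suc m) u) (hform (Suc m) (iota v))) sums form_inner \<alpha> (del u) v"
    using parseval_inner[OF \<alpha> _ uA(2) v] p unfolding eq by simp
  moreover have "(\<lambda>m. \<alpha> * form_inner \<alpha> (hform (Suc m) u) (hform (Suc m) (iota v))) sums (\<alpha> * form_inner \<alpha> u (iota v))"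
  proof (rule sums_mult)
    have "(\<lambda>m. form_inner \<alpha> (hform m u) (hform m (iota v))) sums form_inner \<alpha> u (iota v)"
      using p by (intro parseval_inner[OF \<alpha> _ uA(1) iv]) simp
    then show "(\<lambda>m. form_inner \<alpha> (hform (Suc m) u) (hform (Suc m) (iota v))) sums form_inner \<alpha> u (iota v)"
      by (subst sums_Suc_iff) (simp add: hform_iota[OF hv] form_inner_zero_right)
  qed
  ultimately have "form_inner \<alpha> (del u) v = \<alpha> * form_inner \<alpha> u (iota v)" by (rule sums_unique2)
  then show ?thesis by (simp add: form_inner_scale_right)
qed

text \<open>The adjoint relation is tested on the homogeneous parts of the difference
  \<open>x\<close>. These lie in the domain of \<open>del\<close> even though \<open>iota v\<close>
  is not assumed to be in \<open>A2\<close>; square integrability of \<open>iota v\<close> thus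
  comes out as a consequence.\<close>

lemma adjoint_unique:
  assumes \<alpha>: "\<alpha> > 0" and p: "p \<le> 1" and v: "v \<in> A2 \<alpha> (Suc p)" and w: "w \<in> A2 \<alpha> p"
    and adj: "\<And>u. u \<in> dom_del \<alpha> p \<Longrightarrow> form_inner \<alpha> (del u) v = form_inner \<alpha> u w"
  shows "w = form_scale \<alpha> (iota v)"
proof -
  have hv: "holform (Suc p) v" and hw: "holform p w" using v w by (auto simp: A2_iff)
  have hi: "holform p (iota v)" by (rule holform_iota[OF hv])
  define x where "x = w + form_scale (- \<alpha>) (iota v)"
  have hx: "holform p x" unfolding x_def by (intro holform_add holform_scale hw hi)
  have p2: "p \<le> 2" "Suc p \<le> 2" using p by auto
  have "hform m x = 0" for m
  proof -
    have 1: "form_inner \<alpha> (hform m x) w = form_inner \<alpha> (del (hform m x)) v"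
      by (rule adj[OF hform_dom_del[OF \<alpha> hx], symmetric])
    have 2: "form_inner \<alpha> (del (hform m x)) v = \<alpha> * form_inner \<alpha> (hform m x) (hform m (iota v))"
    proof (cases m)
      case 0
      then show ?thesis by (simp add: del_hform_0 form_inner_zero_left hform_iota[OF hv] form_inner_zero_right)
    next
      case (Suc k)
      have "form_inner \<alpha> (del (hform m x)) v = form_inner \<alpha> (hform k (del x)) (hform k v)"
        unfolding Suc del_hform[OF hx] by (simp add: form_inner_hform[OF \<alpha> p2(2) holform_del[OF hx] v])
      also have "\<dots> = \<alpha> * form_inner \<alpha> (hform m x) (hform m (iota v))"
        unfolding hform_del[OF hx] adjoint_hform[OF \<alpha> p hx hv] iota_hform[OF hv] Suc ..
      finally show ?thesis .
    qed
    have "form_inner \<alpha> (hform m x) (hform m x) = form_inner \<alpha> (hform m x) (hform m w) + form_inner \<alpha> (hform m x) (form_scale (- \<alpha>) (hform m (iota v)))"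
      unfolding x_def hform_add[OF hw holform_scale[OF hi]] hform_scale[OF hi]
      by (rule form_inner_add_right[OF \<alpha> p2(1)]) 
         (intro A2_add A2_scale hform_A2 \<alpha> p2 hw hi)+
    also have "\<dots> = 0"
      using 1 2 by (simp add: form_inner_scale_right form_inner_hform[OF \<alpha> p2(1) hx w])
    finally have "nsq \<alpha> (hform m x) = 0" by (simp add: nsq_def)
    then show "hform m x = 0" by (rule nsq_eq_0[OF \<alpha> p hform_A2[OF \<alpha> hx]])
  qed
  then have "x = 0" by (intro holform_eqI[OF hx holform_0]) (simp add: hform_0)
  then show ?thesis by (auto simp: x_def fun_eq_iff form_scale_def)
qed

lemma dom_del_adj_iff:
  assumes \<alpha>: "\<alpha> > 0" and p: "p \<le> 1"
  shows "v \<in> dom_del_adj \<alpha> p \<longleftrightarrow> v \<in> A2 \<alpha> (Suc p) \<and> iota v \<in> A2 \<alpha> p"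
proof
  assume "v \<in> dom_del_adj \<alpha> p"
  then obtain w where v: "v \<in> A2 \<alpha> (Suc p)" and w: "w \<in> A2 \<alpha> p"
    "\<And>u. u \<in> dom_del \<alpha> p \<Longrightarrow> form_inner \<alpha> (del u) v = form_inner \<alpha> u w"
    by (auto simp: dom_del_adj_def adjoint_dom_def)
  from adjoint_unique[OF \<alpha> p v w] have "iota v = form_scale (1 / \<alpha>) w"
    using \<alpha> by (simp add: fun_eq_iff form_scale_def)
  then show "v \<in> A2 \<alpha> (Suc p) \<and> iota v \<in> A2 \<alpha> p" using v A2_scale[OF w(1)] by simp
next
  assume v: "v \<in> A2 \<alpha> (Suc p) \<and> iota v \<in> A2 \<alpha> p"
  then show "v \<in> dom_del_adj \<alpha> p"
    using del_adjoint_iota[OF \<alpha> p, of _ v] A2_scale[of "iota v" \<alpha> p "of_real \<alpha>"]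
    by (auto simp: dom_del_adj_def adjoint_dom_def)
qed

lemma del_adj_eq:
  assumes \<alpha>: "\<alpha> > 0" and p: "p \<le> 1" and v: "v \<in> dom_del_adj \<alpha> p"
  shows "del_adj \<alpha> p v = form_scale \<alpha> (iota v)"
  unfolding del_adj_def adjoint_def
proof (rule the_equality)
  have v': "v \<in> A2 \<alpha> (Suc p)" "iota v \<in> A2 \<alpha> p" using v by (simp_all add: dom_del_adj_iff[OF \<alpha> p])
  then show "form_scale \<alpha> (iota v) \<in> A2 \<alpha> p \<and> (\<forall>u\<in>dom_del \<alpha> p. form_inner \<alpha> (del u) v = form_inner \<alpha> u (form_scale \<alpha> (iota v)))"
    using del_adjoint_iota[OF \<alpha> p _ v'] A2_scale[OF v'(2)] by blast
  show "w = form_scale \<alpha> (iota v)" if "w \<in> A2 \<alpha> p \<and> (\<forall>u\<in>dom_del \<alpha> p. form_inner \<alpha> (del u) v = form_inner \<alpha> u w)" for w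
    using that by (intro adjoint_unique[OF \<alpha> p v'(1)]) auto
qed

section \<open>Euler's identity and Cartan's formula on homogeneous parts\<close>

lemma formal_1_ext:
  assumes "formal 1 u" "formal 1 v" "\<And>k z. z \<in> ball 0 1 \<Longrightarrow> u {k} z = v {k} z"
  shows "u = v"
proof (intro ext)
  fix J z show "u J z = v J z"
    using assms by (cases "card J = 1 \<and> z \<in> ball 0 1") (auto simp: formal_def card_1_singleton_iff)
qed

lemma formal_0_ext:
  assumes "formal 0 u" "formal 0 v" "\<And>z. z \<in> ball 0 1 \<Longrightarrow> u {} z = v {} z"
  shows "u = v"
proof (intro ext)
  fix J z show "u J z = v J z"
    using assms by (cases "card J = 0 \<and> z \<in> ball 0 1") (auto simp: formal_def)
qed

lemma euler_hform:
  assumes "holform p u" "z \<in> ball 0 1"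
  shows "(\<Sum>j\<in>UNIV. z $ j * dz j (hform m u J) z) = of_nat m * hform m u J z"
  using euler_hpart[of "u J" z m] assms by (simp add: dz_hform holform_def) (simp add: hform_def)

lemma euler_0:
  assumes "holform 0 f"
  shows "iota (del (hform m f)) = form_scale (of_nat m) (hform m f)"
proof (rule formal_0_ext)
  have h: "holform 0 (hform m f)" by (rule holform_hform[OF assms])
  show "formal 0 (iota (del (hform m f)))" "formal 0 (form_scale (of_nat m) (hform m f))"
    using holform_iota[OF holform_del[OF h]] holform_scale[OF h] by (simp_all add: holform_def)
  show "iota (del (hform m f)) {} z = form_scale (of_nat m) (hform m f) {} z" if "z \<in> ball 0 1" for z
    using euler_hform[OF assms that, of m "{}"] that
    by (simp only: iota_1_apply del_0_apply form_scale_def)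
qed

text \<open>The left-hand side is the Lie derivative along the Euler field: the coefficients contribute
  \<open>m\<close> to the factor and the \<open>dz\<^sup>j\<close> contribute \<open>1\<close>.\<close>

lemma cartan_1:
  fixes u :: "'n::{finite,linorder} form"
  assumes u: "holform 1 u"
  shows "del (iota (hform m u)) + iota (del (hform m u)) = form_scale (of_nat (Suc m)) (hform m u)"
proof (rule formal_1_ext)
  have h: "holform 1 (hform m u)" by (rule holform_hform[OF u])
  have h1: "holform 1 (del (iota (hform m u)))" "holform 1 (iota (del (hform m u)))"
    using holform_iota[of 0 "hform m u"] holform_del[of 0 "iota (hform m u)"] holform_del[of 1 "hform m u"] holform_iota[of 1 "del (hform m u)"] h
    by simp_all
  show "formal 1 (del (iota (hform m u)) + iota (del (hform m u)))" "formal 1 (form_scale (of_nat (Suc m)) (hform m u))"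
    using holform_add[OF h1] holform_scale[OF h] by (simp_all add: holform_def)
  fix k and z :: "complex^'n::{finite,linorder}" assume z: "z \<in> ball 0 1"
  let ?u = "\<lambda>j. hform m u {j}"
  have hol: "holomorphic_cn (?u j) (ball 0 1)" for j using h by (simp add: holform_def)
  have "dz k (iota (hform m u) {}) z = dz k (\<lambda>z. \<Sum>j\<in>UNIV. z $ j * ?u j z) z"
    by (rule dz_cong_ball[OF open_ball z]) (rule iota_1_apply)
  also have "\<dots> = (\<Sum>j\<in>UNIV. dz k (\<lambda>z. z $ j * ?u j z) z)"
    by (rule dz_sum[OF _ z]) (intro holomorphic_cn_mult holomorphic_cn_nth hol)
  also have "\<dots> = (\<Sum>j\<in>UNIV. (if k = j then ?u j z else 0) + z $ j * dz k (?u j) z)"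
    by (intro sum.cong refl) (simp add: dz_mult[OF holomorphic_cn_nth hol z] dz_nth)
  also have "\<dots> = ?u k z + (\<Sum>j\<in>UNIV. z $ j * dz k (?u j) z)" by (simp add: sum.distrib)
  finally have 1: "del (iota (hform m u)) {k} z = ?u k z + (\<Sum>j\<in>UNIV. z $ j * dz k (?u j) z)"
    by (simp only: del_0_apply[OF z])
  have "iota (del (hform m u)) {k} z = (\<Sum>j\<in>UNIV. z $ j * dz j (?u k) z) - (\<Sum>j\<in>UNIV. z $ j * dz k (?u j) z)"
    unfolding iota_2_apply[OF z] contr_def anti_del[OF z] by (simp add: right_diff_distrib sum_subtractf)
  also have "(\<Sum>j\<in>UNIV. z $ j * dz j (?u k) z) = of_nat m * ?u k z" by (rule euler_hform[OF u z])
  finally show "(del (iota (hform m u)) + iota (del (hform m u))) {k} z = form_scale (of_nat (Suc m)) (hform m u) {k} z"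
    by (simp add: 1 form_scale_def algebra_simps)
qed

lemma hform_iota_del: "holform p u \<Longrightarrow> hform m (iota (del u)) = iota (del (hform m u))"
  by (simp add: hform_iota[OF holform_del] del_hform iota_zero split: nat.split)

lemma hform_del_iota: "holform (Suc p) u \<Longrightarrow> hform m (del (iota u)) = del (iota (hform m u))"
  by (simp add: hform_del[OF holform_iota] iota_hform)

text \<open>Adjointness moves \<open>del\<close> to the other side as \<open>\<alpha>\<close> times
  contraction, and contracting the differential of a homogeneous function multiplies it by its
  degree.\<close>

lemma nsq_del_hform_0:
  assumes \<alpha>: "\<alpha> > 0" and f: "holform 0 f"
  shows "nsq \<alpha> (del (hform m f)) = \<alpha> * real m * nsq \<alpha> (hform m f)"
proof (cases m)
  case 0
  then show ?thesis by (simp add: del_hform_0 nsq_zero)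
next
  case (Suc k)
  have "form_inner \<alpha> (del (hform m f)) (del (hform m f)) = \<alpha> * form_inner \<alpha> (hform m f) (iota (del (hform m f)))"
    using adjoint_hform[OF \<alpha> _ f holform_del[OF f], of m k] by (simp add: Suc hform_del[OF f])
  also have "\<dots> = of_real (\<alpha> * real m) * form_inner \<alpha> (hform m f) (hform m f)"
    by (simp add: euler_0[OF f] form_inner_scale_right)
  finally show ?thesis by (simp add: nsq_def)
qed

text \<open>The quadratic form of the Laplacian on one part, with \<open>\<alpha>\<^sup>2\<close>
  from the adjoint. Both summands on the left are nonnegative, so each is bounded by the right-hand
  side; these are the growth bounds behind \<open>dom_box1_of_summable\<close>.\<close>

lemma nsq_box_hform:
  fixes u :: "'n::{finite,linorder} form"
  assumes \<alpha>: "\<alpha> > 0" and u: "holform 1 u"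
  shows "nsq \<alpha> (del (hform m u)) + \<alpha>\<^sup>2 * nsq \<alpha> (iota (hform m u)) = \<alpha> * real (Suc m) * nsq \<alpha> (hform m u)"
proof -
  let ?g = "hform m u"
  have h: "holform (Suc 0) u" "holform 1 ?g" using u holform_hform[OF u] by auto
  have hi: "holform 0 (iota u)" by (rule holform_iota[OF h(1)])
  have hd: "holform 2 (del u)" using holform_del[OF u] by (simp add: numeral_2_eq_2)
  have A: "?g \<in> A2 \<alpha> 1" "del (iota ?g) \<in> A2 \<alpha> 1" "iota (del ?g) \<in> A2 \<alpha> 1"
    using hform_A2[OF \<alpha> u] hform_A2[OF \<alpha> holform_del[OF hi], of m] hform_A2[OF \<alpha> holform_iota[of 1 "del u"], of m] hd
    by (simp_all add: hform_del_iota[OF h(1)] hform_iota_del[OF u] numeral_2_eq_2)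
  have 1: "form_inner \<alpha> (del ?g) (del ?g) = \<alpha> * form_inner \<alpha> ?g (iota (del ?g))"
  proof (cases m)
    case 0
    then show ?thesis by (simp add: del_hform_0 iota_zero form_inner_zero_left form_inner_zero_right)
  next
    case (Suc k)
    then show ?thesis
      using adjoint_hform[OF \<alpha> _ u, of "del u" m k] hd by (simp add: hform_del[OF u] numeral_2_eq_2)
  qed
  have 2: "form_inner \<alpha> (del (iota ?g)) ?g = \<alpha> * form_inner \<alpha> (iota ?g) (iota ?g)"
    using adjoint_hform[OF \<alpha> _ hi h(1), of "Suc m" m] by (simp add: iota_hform[OF h(1)])
  have "cnj (form_inner \<alpha> (del (iota ?g)) ?g) = form_inner \<alpha> ?g (del (iota ?g))"
    using A by (intro form_inner_cnj[of 1]) (auto simp: A2_iff)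
  then have "Re (form_inner \<alpha> (del (iota ?g)) ?g) = Re (form_inner \<alpha> ?g (del (iota ?g)))"
    by (metis complex_cnj(1) cnj.simps(1))
  then have 3: "Re (form_inner \<alpha> ?g (del (iota ?g))) = \<alpha> * nsq \<alpha> (iota ?g)"
    by (simp add: 2 nsq_def)
  have "form_inner \<alpha> ?g (del (iota ?g)) + form_inner \<alpha> ?g (iota (del ?g)) = of_real (real (Suc m)) * form_inner \<alpha> ?g ?g"
    using form_inner_add_right[OF \<alpha> _ A(2,3,1)] by (simp add: cartan_1[OF u] form_inner_scale_right)
  then have "Re (form_inner \<alpha> ?g (del (iota ?g))) + Re (form_inner \<alpha> ?g (iota (del ?g))) = real (Suc m) * nsq \<alpha> ?g"
    unfolding nsq_def by (drule_tac arg_cong[where f = Re]) simp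
  then have 4: "\<alpha> * nsq \<alpha> (iota ?g) + Re (form_inner \<alpha> ?g (iota (del ?g))) = real (Suc m) * nsq \<alpha> ?g"
    unfolding 3 .
  have "nsq \<alpha> (del ?g) = \<alpha> * Re (form_inner \<alpha> ?g (iota (del ?g)))"
    by (simp add: nsq_def 1)
  then have "nsq \<alpha> (del ?g) + \<alpha>\<^sup>2 * nsq \<alpha> (iota ?g) = \<alpha> * (\<alpha> * nsq \<alpha> (iota ?g) + Re (form_inner \<alpha> ?g (iota (del ?g))))"
    by (simp add: power2_eq_square algebra_simps)
  then show ?thesis unfolding 4 by (simp only: mult.assoc)
qed

lemma nsq_add_le:
  assumes \<alpha>: "\<alpha> > 0" and p: "p \<le> 2" and u: "u \<in> A2 \<alpha> p" and v: "v \<in> A2 \<alpha> p"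
  shows "nsq \<alpha> (u + v) \<le> 2 * nsq \<alpha> u + 2 * nsq \<alpha> v"
proof -
  let ?w = "u + form_scale (- 1) v"
  have A: "form_scale (- 1) v \<in> A2 \<alpha> p" "?w \<in> A2 \<alpha> p" "u + v \<in> A2 \<alpha> p"
    by (intro A2_add A2_scale \<alpha> p u v)+
  have "form_inner \<alpha> (u + v) (u + v) + form_inner \<alpha> ?w ?w = 2 * form_inner \<alpha> u u + 2 * form_inner \<alpha> v v"
    using u v A by (simp add: form_inner_add_left[OF \<alpha> p] form_inner_add_right[OF \<alpha> p] form_inner_scale_left form_inner_scale_right)
  then have "nsq \<alpha> (u + v) + nsq \<alpha> ?w = 2 * nsq \<alpha> u + 2 * nsq \<alpha> v"
    unfolding form_inner_nsq[OF p u] form_inner_nsq[OF p v] form_inner_nsq[OF p A(2)] form_inner_nsq[OF p A(3)]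
    by (drule_tac arg_cong[where f = Re]) simp
  then show ?thesis using nsq_nonneg[OF p A(2)] by linarith
qed

section \<open>The domain of the Laplacian and its action on parts\<close>

text \<open>As \<open>\<alpha>\<close> is nonzero, the scalar in front of each contraction can be
  removed from the conditions that define the domain.\<close>

lemma dom_box1_iff:
  fixes u :: "'n::{finite,linorder} form"
  assumes \<alpha>: "\<alpha> > 0"
  shows "u \<in> dom_box1 \<alpha> \<longleftrightarrow> u \<in> A2 \<alpha> 1 \<and> iota u \<in> A2 \<alpha> 0 \<and> del u \<in> A2 \<alpha> 2 \<and> del (iota u) \<in> A2 \<alpha> 1 \<and> iota (del u) \<in> A2 \<alpha> 1"
proof -
  have inv: "v \<in> A2 \<alpha> p" if "form_scale (of_real \<alpha>) v \<in> A2 \<alpha> p" for p and v :: "'n form"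
  proof -
    have "form_scale (1 / \<alpha>) (form_scale (of_real \<alpha>) v) = v" using \<alpha> by (simp add: form_scale_def fun_eq_iff)
    then show ?thesis using A2_scale[OF that, of "of_real (1 / \<alpha>)"] by simp
  qed
  have d: "form_scale (of_real \<alpha>) (iota u) \<in> dom_del \<alpha> 0 \<longleftrightarrow> iota u \<in> A2 \<alpha> 0 \<and> del (iota u) \<in> A2 \<alpha> 1"
    if "u \<in> A2 \<alpha> 1" "iota u \<in> A2 \<alpha> 0"
    using that inv[of "del (iota u)" 1] by (auto simp: dom_del_def A2_scale del_scale[OF A2_holform[OF that(2)]])
  show ?thesis
    using del_adj_eq[OF \<alpha>, of 0 u] d
    by (auto simp: dom_box1_def dom_del_adj_iff[OF \<alpha>] dom_del_def[of \<alpha> "Suc 0"] numeral_2_eq_2)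
qed

lemma box1_eq:
  assumes \<alpha>: "\<alpha> > 0" and u: "u \<in> dom_box1 \<alpha>"
  shows "box1 \<alpha> u = form_scale \<alpha> (del (iota u) + iota (del u))"
proof -
  have u': "u \<in> dom_del_adj \<alpha> 0" "del u \<in> dom_del_adj \<alpha> 1" using u by (auto simp: dom_box1_def)
  then have "iota u \<in> A2 \<alpha> 0" by (simp add: dom_del_adj_iff[OF \<alpha>])
  then have "holform 0 (iota u)" by (rule A2_holform)
  then show ?thesis
    unfolding box1_def using u'
    by (simp add: del_adj_eq[OF \<alpha>] del_scale) (simp add: fun_eq_iff form_scale_def distrib_left)
qed

lemma hform_box1:
  assumes \<alpha>: "\<alpha> > 0" and u: "u \<in> dom_box1 \<alpha>"
  shows "hform m (box1 \<alpha> u) = form_scale (of_real (\<alpha> * real (Suc m))) (hform m u)"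
proof -
  have A: "u \<in> A2 \<alpha> 1" "del (iota u) \<in> A2 \<alpha> 1" "iota (del u) \<in> A2 \<alpha> 1" using u by (auto simp: dom_box1_iff[OF \<alpha>])
  have h: "holform 1 u" "holform (Suc 0) u" "holform 1 (del (iota u))" "holform 1 (iota (del u))" using A by (auto simp: A2_iff)
  have "hform m (box1 \<alpha> u) = form_scale \<alpha> (del (iota (hform m u)) + iota (del (hform m u)))"
    unfolding box1_eq[OF assms] hform_scale[OF holform_add[OF h(3,4)]] hform_add[OF h(3,4)]
      hform_del_iota[OF h(2)] hform_iota_del[OF h(1)] ..
  then show ?thesis unfolding cartan_1[OF h(1)] by (simp add: form_scale_def fun_eq_iff)
qed

lemma box1_A2: "\<alpha> > 0 \<Longrightarrow> u \<in> dom_box1 \<alpha> \<Longrightarrow> box1 \<alpha> u \<in> A2 \<alpha> 1"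
  by (simp add: box1_eq dom_box1_iff A2_scale A2_add)

text \<open>On degree \<open>m\<close> the squared norms of \<open>del\<close> and
  \<open>iota\<close> grow at most linearly in \<open>Suc m\<close>, those of the two compositions
  at most quadratically. The second moment therefore dominates all five conditions of
  \<open>dom_box1_iff\<close>.\<close>

lemma dom_box1_of_summable:
  fixes u :: "'n::{finite,linorder} form"
  assumes \<alpha>: "\<alpha> > 0" and u: "holform 1 u" and s: "summable (\<lambda>m. (real (Suc m))\<^sup>2 * nsq \<alpha> (hform m u))"
  shows "u \<in> dom_box1 \<alpha>"
proof -
  have h: "holform (Suc 0) u" "holform 0 (iota u)" "holform 2 (del u)" "holform 1 (del (iota u))" "holform 1 (iota (del u))"
    using u holform_iota[of 0 u] holform_del[OF u] holform_del[of 0 "iota u"] holform_iota[of 1 "del u"]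
    by (simp_all add: numeral_2_eq_2)
  have nn: "0 \<le> nsq \<alpha> (hform m v)" if "holform p v" "p \<le> 2" for m v and p
    by (rule nsq_nonneg[OF that(2) hform_A2[OF \<alpha> that(1)]])
  have nn1: "0 \<le> nsq \<alpha> (hform m u)" for m using u by (rule nn) simp
  have le: "real (Suc m) * nsq \<alpha> (hform m u) \<le> (real (Suc m))\<^sup>2 * nsq \<alpha> (hform m u)" for m
    by (intro mult_right_mono nn1) (simp add: power2_eq_square)
  have le1: "nsq \<alpha> (hform m u) \<le> (real (Suc m))\<^sup>2 * nsq \<alpha> (hform m u)" for m
    using mult_right_mono[OF _ nn1[of m], of 1 "(real (Suc m))\<^sup>2"] by simp
  have dg: "nsq \<alpha> (del (hform m u)) \<le> \<alpha> * ((real (Suc m))\<^sup>2 * nsq \<alpha> (hform m u))"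
    and ig: "nsq \<alpha> (iota (hform m u)) \<le> 1 / \<alpha> * ((real (Suc m)) * nsq \<alpha> (hform m u))" for m
  proof -
    have d0: "0 \<le> nsq \<alpha> (del (hform m u))"
      by (rule nsq_nonneg[of 2]) (use del_hform_A2[OF \<alpha> u] in \<open>simp_all add: numeral_2_eq_2\<close>)
    have i0: "0 \<le> nsq \<alpha> (iota (hform m u))"
      by (rule nsq_nonneg[of 0]) (use iota_hform_A2[OF \<alpha> h(1)] in simp_all)
    have "nsq \<alpha> (del (hform m u)) \<le> \<alpha> * (real (Suc m) * nsq \<alpha> (hform m u))"
      using nsq_box_hform[OF \<alpha> u, of m] mult_nonneg_nonneg[OF zero_le_power2[of \<alpha>] i0]
      unfolding mult.assoc[symmetric] by linarith
    also have "\<dots> \<le> \<alpha> * ((real (Suc m))\<^sup>2 * nsq \<alpha> (hform m u))" using \<alpha> le by (intro mult_left_mono) auto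
    finally show "nsq \<alpha> (del (hform m u)) \<le> \<alpha> * ((real (Suc m))\<^sup>2 * nsq \<alpha> (hform m u))" .
    have "\<alpha> * (\<alpha> * nsq \<alpha> (iota (hform m u))) \<le> \<alpha> * (real (Suc m) * nsq \<alpha> (hform m u))"
      using nsq_box_hform[OF \<alpha> u, of m] d0 by (simp add: power2_eq_square mult.assoc)
    then have "\<alpha> * nsq \<alpha> (iota (hform m u)) \<le> real (Suc m) * nsq \<alpha> (hform m u)"
      using \<alpha> by (simp only: mult_le_cancel_left_pos)
    then show "nsq \<alpha> (iota (hform m u)) \<le> 1 / \<alpha> * ((real (Suc m)) * nsq \<alpha> (hform m u))"
      using \<alpha> by (simp add: field_simps)
  qed
  have A: "u \<in> A2 \<alpha> 1"
  proof (rule A2_of_summable(1)[OF \<alpha> _ u])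
    show "summable (\<lambda>m. nsq \<alpha> (hform m u))"
      by (rule summable_comparison_test'[OF s, of 0]) (use le1 nn1 in simp)
  qed simp
  have B: "del u \<in> A2 \<alpha> 2"
  proof (rule A2_of_summable(1)[OF \<alpha> order_refl h(3)])
    have "summable (\<lambda>m. \<alpha> * ((real (Suc (Suc m)))\<^sup>2 * nsq \<alpha> (hform (Suc m) u)))"
      by (intro summable_mult summable_Suc_iff[THEN iffD2, OF s])
    then show "summable (\<lambda>m. nsq \<alpha> (hform m (del u)))"
      by (rule summable_comparison_test'[of _ 0]) (use dg nn[OF h(3)] in \<open>simp add: hform_del[OF u] del: of_nat_Suc\<close>)
  qed
  have C: "iota u \<in> A2 \<alpha> 0"
  proof (rule A2_of_summable(1)[OF \<alpha> _ h(2)])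
    have "summable (\<lambda>m. nsq \<alpha> (iota (hform m u)))"
    proof (rule summable_comparison_test'[OF summable_mult[OF s, of "1 / \<alpha>"], of 0])
      fix m
      have "0 \<le> nsq \<alpha> (iota (hform m u))" using nn[OF h(2), of "Suc m"] by (simp add: iota_hform[OF h(1)])
      moreover have "1 / \<alpha> * ((real (Suc m)) * nsq \<alpha> (hform m u)) \<le> 1 / \<alpha> * ((real (Suc m))\<^sup>2 * nsq \<alpha> (hform m u))"
        using \<alpha> le by (intro mult_left_mono) auto
      ultimately show "norm (nsq \<alpha> (iota (hform m u))) \<le> 1 / \<alpha> * ((real (Suc m))\<^sup>2 * nsq \<alpha> (hform m u))"
        using ig[of m] by simp
    qed
    then show "summable (\<lambda>m. nsq \<alpha> (hform m (iota u)))"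
      by (subst summable_Suc_iff[symmetric]) (simp add: iota_hform[OF h(1)])
  qed simp
  \<comment> \<open>The contraction is a homogeneous function of degree \<open>Suc m\<close>, so
    \<open>del\<close> contributes \<open>\<alpha> * Suc m\<close>; the \<open>\<alpha>\<close>
    cancels against the \<open>1 / \<alpha>\<close> of \<open>ig\<close>.\<close>
  have di: "nsq \<alpha> (del (iota (hform m u))) \<le> (real (Suc m))\<^sup>2 * nsq \<alpha> (hform m u)" for m
  proof -
    have "nsq \<alpha> (del (iota (hform m u))) = \<alpha> * real (Suc m) * nsq \<alpha> (iota (hform m u))"
      unfolding iota_hform[OF h(1)] by (rule nsq_del_hform_0[OF \<alpha> h(2)])
    also have "\<dots> \<le> \<alpha> * real (Suc m) * (1 / \<alpha> * ((real (Suc m)) * nsq \<alpha> (hform m u)))"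
      using \<alpha> ig[of m] by (intro mult_left_mono) auto
    also have "\<dots> = (real (Suc m))\<^sup>2 * nsq \<alpha> (hform m u)"
      using \<alpha> by (simp add: power2_eq_square del: of_nat_Suc)
    finally show ?thesis .
  qed
  have D: "del (iota u) \<in> A2 \<alpha> 1"
  proof (rule A2_of_summable(1)[OF \<alpha> _ h(4)])
    show "summable (\<lambda>m. nsq \<alpha> (hform m (del (iota u))))"
      by (rule summable_comparison_test'[OF s, of 0]) (use di nn[OF h(4)] in \<open>simp add: hform_del_iota[OF h(1)]\<close>)
  qed simp
  have E: "iota (del u) \<in> A2 \<alpha> 1"
  proof (rule A2_of_summable(1)[OF \<alpha> _ h(5)])
    show "summable (\<lambda>m. nsq \<alpha> (hform m (iota (del u))))"
    proof (rule summable_comparison_test'[OF summable_mult[OF s, of 4], of 0])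
      fix m
      let ?g = "hform m u"
      \<comment> \<open>Cartan's formula reduces this composition to the one already estimated. The
        constant \<open>4\<close> is two summands of weight \<open>2\<close> from the parallelogram
        inequality.\<close>
      have eq: "iota (del ?g) = form_scale (of_nat (Suc m)) ?g + form_scale (- 1) (del (iota ?g))"
        unfolding cartan_1[OF u, symmetric] by (simp add: fun_eq_iff form_scale_def)
      have "nsq \<alpha> (iota (del ?g)) \<le> 2 * nsq \<alpha> (form_scale (of_nat (Suc m)) ?g) + 2 * nsq \<alpha> (form_scale (- 1) (del (iota ?g)))"
        unfolding eq
      proof (rule nsq_add_le[OF \<alpha>, of 1])
        show "form_scale (of_nat (Suc m)) ?g \<in> A2 \<alpha> 1" by (intro A2_scale hform_A2 \<alpha> u)
        show "form_scale (- 1) (del (iota ?g)) \<in> A2 \<alpha> 1"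
          unfolding hform_del_iota[OF h(1), symmetric] by (intro A2_scale hform_A2 \<alpha> h)
      qed simp
      also have "\<dots> \<le> 4 * ((real (Suc m))\<^sup>2 * nsq \<alpha> ?g)"
        using di[of m] by (simp add: nsq_scale norm_of_nat mult.commute del: of_nat_Suc)
      finally show "norm (nsq \<alpha> (hform m (iota (del u)))) \<le> 4 * ((real (Suc m))\<^sup>2 * nsq \<alpha> (hform m u))"
        using nn[OF h(5), of m] by (simp add: hform_iota_del[OF u])
    qed
  qed simp
  show ?thesis using A B C D E by (simp add: dom_box1_iff[OF \<alpha>])
qed

section \<open>Spectral multipliers and resolvents\<close>

definition smult_form :: "(nat \<Rightarrow> complex) \<Rightarrow> 'n::{finite,linorder} form \<Rightarrow> 'n form" where
  "smult_form c u = (\<lambda>J z. if z \<in> ball 0 1 then \<Sum>m. c m * hpart m (u J) z else 0)"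

text \<open>A bounded factor preserves geometric decay on smaller balls, so the modified parts can
  be reassembled.\<close>

lemma smult_form:
  fixes u :: "'n::{finite,linorder} form"
  assumes u: "holform p u" and c: "\<And>m. cmod (c m) \<le> K"
  shows "holform p (smult_form c u)" "hform m (smult_form c u) = form_scale (c m) (hform m u)"
proof -
  have K: "0 \<le> K" using c[of 0] order_trans[OF norm_ge_zero] by blast
  have hol: "holomorphic_cn (u J) (ball 0 1)" for J using u by (simp add: holform_def)
  have hp: "hpoly m (\<lambda>z. c m * hpart m (u J) z)" for m J by (intro hpoly_cmult hpart_hpoly)
  have bd: "\<exists>C q. 0 \<le> q \<and> q < 1 \<and> (\<forall>m. \<forall>z\<in>cball 0 r. cmod (c m * hpart m (u J) z) \<le> C * q ^ m)" if r: "0 \<le> r" "r < 1" for r J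
  proof -
    obtain C q where C: "0 \<le> q" "q < 1" "\<And>m z. z \<in> cball 0 r \<Longrightarrow> cmod (hpart m (u J) z) \<le> C * q ^ m"
      using hpart_geometric[OF hol r] by blast
    have "cmod (c m * hpart m (u J) z) \<le> (K * C) * q ^ m" if "z \<in> cball 0 r" for m z
      using mult_mono[OF c C(3)[OF that] K norm_ge_zero, of m m] by (simp add: norm_mult mult_ac)
    then show ?thesis using C by blast
  qed
  note asm = hpoly_assemble[of "\<lambda>m z. c m * hpart m (u J) z" for J, OF hp bd]
  have "formal p (smult_form c u)"
    by (auto simp: formal_def smult_form_def holform_zero_coeff[OF u] hpart_zero)
  then show "holform p (smult_form c u)"
    unfolding holform_def smult_form_def holomorphic_truncate using asm(1) by blast
  have "hpart m (smult_form c u J) = (\<lambda>z. c m * hpart m (u J) z)" for J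
    unfolding smult_form_def hpart_truncate by (rule asm(2))
  note h = this
  show "hform m (smult_form c u) = form_scale (c m) (hform m u)"
    unfolding hform_def h by (auto simp: form_scale_def fun_eq_iff)
qed

lemma nsq_smult_form:
  assumes \<alpha>: "\<alpha> > 0" and p: "p \<le> 2" and u: "u \<in> A2 \<alpha> p" and c: "\<And>m. cmod (c m) \<le> K"
  shows "smult_form c u \<in> A2 \<alpha> p"
    and "(\<lambda>m. (cmod (c m))\<^sup>2 * nsq \<alpha> (hform m u)) sums nsq \<alpha> (smult_form c u)"
    and "nsq \<alpha> (smult_form c u) \<le> K\<^sup>2 * nsq \<alpha> u"
proof -
  have hu: "holform p u" using u by (simp add: A2_iff)
  have nn: "0 \<le> nsq \<alpha> (hform m u)" for m by (rule nsq_nonneg[OF p hform_A2[OF \<alpha> hu]])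
  have le: "(cmod (c m))\<^sup>2 * nsq \<alpha> (hform m u) \<le> K\<^sup>2 * nsq \<alpha> (hform m u)" for m
    using c by (intro mult_right_mono nn power_mono) auto
  have K: "(\<lambda>m. K\<^sup>2 * nsq \<alpha> (hform m u)) sums (K\<^sup>2 * nsq \<alpha> u)"
    by (intro sums_mult parseval[OF \<alpha> p u])
  have eq: "nsq \<alpha> (hform m (smult_form c u)) = (cmod (c m))\<^sup>2 * nsq \<alpha> (hform m u)" for m
    by (simp add: smult_form(2)[OF hu c] nsq_scale)
  have "summable (\<lambda>m. nsq \<alpha> (hform m (smult_form c u)))"
    by (rule summable_comparison_test'[OF sums_summable[OF K], of 0]) (use le nn in \<open>simp add: eq\<close>)
  then show A: "smult_form c u \<in> A2 \<alpha> p"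
    by (rule A2_of_summable(1)[OF \<alpha> p smult_form(1)[OF hu c]])
  show s: "(\<lambda>m. (cmod (c m))\<^sup>2 * nsq \<alpha> (hform m u)) sums nsq \<alpha> (smult_form c u)"
    using parseval[OF \<alpha> p A] unfolding eq .
  show "nsq \<alpha> (smult_form c u) \<le> K\<^sup>2 * nsq \<alpha> u"
    by (rule sums_le[OF le s K])
qed

lemma smult_form_add:
  assumes "\<And>m. cmod (c m) \<le> K" "holform p u" "holform p v"
  shows "smult_form c (u + v) = smult_form c u + smult_form c v"
proof (rule holform_eqI)
  note s = smult_form[OF _ assms(1)]
  show "holform p (smult_form c (u + v))" "holform p (smult_form c u + smult_form c v)"
    by (intro s holform_add assms)+
  show "hform m (smult_form c (u + v)) = hform m (smult_form c u + smult_form c v)" for m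
    unfolding s(2)[OF holform_add[OF assms(2,3)]] hform_add[OF assms(2,3)] hform_add[OF s(1)[OF assms(2)] s(1)[OF assms(3)]]
      s(2)[OF assms(2)] s(2)[OF assms(3)]
    by (simp add: fun_eq_iff form_scale_def distrib_left)
qed

lemma smult_form_scale:
  assumes "\<And>m. cmod (c m) \<le> K" "holform p u"
  shows "smult_form c (form_scale a u) = form_scale a (smult_form c u)"
proof (rule holform_eqI)
  note s = smult_form[OF _ assms(1)]
  show "holform p (smult_form c (form_scale a u))" "holform p (form_scale a (smult_form c u))"
    by (intro s holform_scale assms)+
  show "hform m (smult_form c (form_scale a u)) = hform m (form_scale a (smult_form c u))" for m
    unfolding s(2)[OF holform_scale[OF assms(2)]] hform_scale[OF assms(2)] hform_scale[OF s(1)[OF assms(2)]] s(2)[OF assms(2)]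
    by (simp add: fun_eq_iff form_scale_def)
qed

section \<open>Explicit resolvents of the Laplacian\<close>

text \<open>\<open>\<delta>\<close> is a lower bound for the distance of \<open>\<mu>\<close> from
  the numbers \<open>\<alpha> * Suc m\<close>. The locale serves every resolvent point, and with
  \<open>\<mu> = 0\<close> and \<open>\<delta> = \<alpha>\<close> the operator
  \<open>N1\<close>.\<close>

locale box1_resolvent =
  fixes \<alpha> :: real and \<mu> :: complex and \<delta> :: real
  assumes \<alpha>: "\<alpha> > 0" and \<delta>: "\<delta> > 0" and gap: "\<And>m. \<delta> \<le> cmod (of_real (\<alpha> * real (Suc m)) - \<mu>)"
begin

definition coef :: "nat \<Rightarrow> complex" where
  "coef m = 1 / (of_real (\<alpha> * real (Suc m)) - \<mu>)"

lemma coef_ne: "of_real (\<alpha> * real (Suc m)) - \<mu> \<noteq> 0"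
  using gap[of m] \<delta> by auto

lemma coef_bound: "cmod (coef m) \<le> 1 / \<delta>"
  using gap[of m] \<delta> by (simp add: coef_def norm_divide frac_le del: of_real_mult of_nat_Suc)

text \<open>The product \<open>\<alpha> * Suc m * coef m\<close> equals
  \<open>1 + \<mu> * coef m\<close>, hence is bounded. This decay of \<open>coef\<close> compensates
  the eigenvalues and places resolvent images in the domain.\<close>

lemma coef_growth: "real (Suc m) * cmod (coef m) \<le> (1 + cmod \<mu> / \<delta>) / \<alpha>"
proof -
  let ?d = "of_real (\<alpha> * real (Suc m)) - \<mu>"
  have "\<alpha> * real (Suc m) = cmod (?d + \<mu>)"
    using \<alpha> by (simp add: norm_mult del: of_nat_Suc)
  also have "\<dots> \<le> cmod ?d + cmod \<mu>" by (rule norm_triangle_ineq)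
  finally have "\<alpha> * real (Suc m) * cmod (coef m) \<le> (cmod ?d + cmod \<mu>) * cmod (coef m)"
    by (rule mult_right_mono) simp
  also have "\<dots> = cmod (?d * coef m) + cmod \<mu> * cmod (coef m)" by (simp only: norm_mult distrib_right)
  also have "\<dots> = 1 + cmod \<mu> * cmod (coef m)" using coef_ne[of m] by (simp add: coef_def)
  also have "\<dots> \<le> 1 + cmod \<mu> * (1 / \<delta>)" by (intro add_left_mono mult_left_mono coef_bound) simp
  finally show ?thesis using \<alpha> by (simp add: field_simps)
qed

lemma resolvent_dom:
  assumes "\<eta> \<in> A2 \<alpha> 1"
  shows "smult_form coef \<eta> \<in> dom_box1 \<alpha>"
proof (rule dom_box1_of_summable[OF \<alpha>])
  have h: "holform 1 \<eta>" using assms by (simp add: A2_iff)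
  show "holform 1 (smult_form coef \<eta>)" by (rule smult_form(1)[OF h coef_bound])
  let ?K = "(1 + cmod \<mu> / \<delta>) / \<alpha>"
  have nn: "0 \<le> nsq \<alpha> (hform m \<eta>)" for m by (rule nsq_nonneg[OF _ hform_A2[OF \<alpha> h]]) simp
  have "summable (\<lambda>m. ?K\<^sup>2 * nsq \<alpha> (hform m \<eta>))"
    using parseval[OF \<alpha> _ assms] by (intro summable_mult) (auto simp: sums_iff)
  then show "summable (\<lambda>m. (real (Suc m))\<^sup>2 * nsq \<alpha> (hform m (smult_form coef \<eta>)))"
  proof (rule summable_comparison_test'[of _ 0])
    fix m
    have "(real (Suc m) * cmod (coef m))\<^sup>2 * nsq \<alpha> (hform m \<eta>) \<le> ?K\<^sup>2 * nsq \<alpha> (hform m \<eta>)"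
      by (intro mult_right_mono nn power_mono coef_growth) simp
    then show "norm ((real (Suc m))\<^sup>2 * nsq \<alpha> (hform m (smult_form coef \<eta>))) \<le> ?K\<^sup>2 * nsq \<alpha> (hform m \<eta>)"
      using nn[of m] by (simp add: smult_form(2)[OF h coef_bound] nsq_scale power_mult_distrib mult.assoc del: of_nat_Suc)
  qed
qed

lemma shift_A2:
  assumes "u \<in> dom_box1 \<alpha>"
  shows "box1 \<alpha> u - form_scale \<mu> u \<in> A2 \<alpha> 1"
  using assms by (intro A2_diff \<alpha> box1_A2 A2_scale) (auto simp: dom_box1_iff[OF \<alpha>])

lemma hform_shift:
  assumes "u \<in> dom_box1 \<alpha>"
  shows "hform m (box1 \<alpha> u - form_scale \<mu> u) = form_scale (of_real (\<alpha> * real (Suc m)) - \<mu>) (hform m u)"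
proof -
  have h: "holform 1 u" "holform 1 (box1 \<alpha> u)"
    using assms box1_A2[OF \<alpha> assms] by (auto simp: dom_box1_iff[OF \<alpha>] A2_iff)
  have "hform m (box1 \<alpha> u - form_scale \<mu> u) = hform m (box1 \<alpha> u) + form_scale (- 1) (form_scale \<mu> (hform m u))"
    unfolding form_diff by (simp add: hform_add[OF h(2) holform_scale[OF holform_scale[OF h(1)]]] hform_scale[OF holform_scale[OF h(1)]] hform_scale[OF h(1)])
  then show ?thesis
    unfolding hform_box1[OF \<alpha> assms] by (simp add: fun_eq_iff form_scale_def left_diff_distrib)
qed

lemma resolvent_left:
  assumes "u \<in> dom_box1 \<alpha>"
  shows "smult_form coef (box1 \<alpha> u - form_scale \<mu> u) = u"
proof (rule holform_eqI)
  have h: "holform 1 (box1 \<alpha> u - form_scale \<mu> u)" using shift_A2[OF assms] by (simp add: A2_iff)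
  show "holform 1 (smult_form coef (box1 \<alpha> u - form_scale \<mu> u))" by (rule smult_form(1)[OF h coef_bound])
  show "holform 1 u" using assms by (auto simp: dom_box1_iff[OF \<alpha>] A2_iff)
  show "hform m (smult_form coef (box1 \<alpha> u - form_scale \<mu> u)) = hform m u" for m
    unfolding smult_form(2)[OF h coef_bound] hform_shift[OF assms]
    using coef_ne[of m] by (simp add: fun_eq_iff form_scale_def coef_def)
qed

lemma resolvent_right:
  assumes "\<eta> \<in> A2 \<alpha> 1"
  shows "box1 \<alpha> (smult_form coef \<eta>) - form_scale \<mu> (smult_form coef \<eta>) = \<eta>"
proof (rule holform_eqI)
  have h: "holform 1 \<eta>" using assms by (simp add: A2_iff)
  show "holform 1 (box1 \<alpha> (smult_form coef \<eta>) - form_scale \<mu> (smult_form coef \<eta>))"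
    using shift_A2[OF resolvent_dom[OF assms]] by (simp add: A2_iff)
  show "holform 1 \<eta>" by (rule h)
  show "hform m (box1 \<alpha> (smult_form coef \<eta>) - form_scale \<mu> (smult_form coef \<eta>)) = hform m \<eta>" for m
    unfolding hform_shift[OF resolvent_dom[OF assms]] smult_form(2)[OF h coef_bound]
    using coef_ne[of m] by (simp add: fun_eq_iff form_scale_def coef_def)
qed

lemma resolvent_bij: "bij_betw (\<lambda>u. box1 \<alpha> u - form_scale \<mu> u) (dom_box1 \<alpha> :: 'n::{finite,linorder} form set) (A2 \<alpha> 1)"
  by (rule bij_betw_byWitness[where f' = "smult_form coef"])
     (auto simp: resolvent_left resolvent_right shift_A2 resolvent_dom simp del: One_nat_def)

lemma resolvent_inverse:
  assumes "\<eta> \<in> A2 \<alpha> 1"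
  shows "the_inv_into (dom_box1 \<alpha>) (\<lambda>u. box1 \<alpha> u - form_scale \<mu> u) \<eta> = smult_form coef \<eta>"
  using resolvent_bij resolvent_right[OF assms] resolvent_dom[OF assms]
  by (intro the_inv_into_f_eq) (auto simp: bij_betw_def)

lemma smult_norm:
  assumes "u \<in> A2 \<alpha> 1"
  shows "form_norm \<alpha> (smult_form coef u) \<le> 1 / \<delta> * form_norm \<alpha> u"
proof -
  have "sqrt (nsq \<alpha> (smult_form coef u)) \<le> sqrt ((1 / \<delta>)\<^sup>2 * nsq \<alpha> u)"
    by (intro real_sqrt_le_mono nsq_smult_form(3)[OF \<alpha> _ assms coef_bound]) simp
  then show ?thesis using \<delta> by (simp add: form_norm_nsq real_sqrt_mult)
qed

lemma resolvent_bounded: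
  "bounded_operator_on \<alpha> (A2 \<alpha> 1) (the_inv_into (dom_box1 \<alpha> :: 'n::{finite,linorder} form set) (\<lambda>u. box1 \<alpha> u - form_scale \<mu> u))"
  unfolding bounded_operator_on_def
proof (intro conjI ballI allI exI[of _ "1 / \<delta>"])
  fix u v :: "'n form" and c assume u: "u \<in> A2 \<alpha> 1"
  let ?R = "the_inv_into (dom_box1 \<alpha> :: 'n::{finite,linorder} form set) (\<lambda>u. box1 \<alpha> u - form_scale \<mu> u)"
  show "?R u \<in> A2 \<alpha> 1"
    unfolding resolvent_inverse[OF u] by (rule nsq_smult_form(1)[OF \<alpha> _ u coef_bound]) simp
  show "?R (form_scale c u) = form_scale c (?R u)"
    unfolding resolvent_inverse[OF u] resolvent_inverse[OF A2_scale[OF u]] using u by (intro smult_form_scale[OF coef_bound, of 1]) (simp add: A2_iff)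
  show "form_norm \<alpha> (?R u) \<le> 1 / \<delta> * form_norm \<alpha> u"
    unfolding resolvent_inverse[OF u] by (rule smult_norm[OF u])
  assume v: "v \<in> A2 \<alpha> 1"
  have uv: "u + v \<in> A2 \<alpha> 1" by (rule A2_add[OF \<alpha> _ u v]) simp
  show "?R (u + v) = ?R u + ?R v"
    unfolding resolvent_inverse[OF u] resolvent_inverse[OF v] resolvent_inverse[OF uv]
    using u v by (intro smult_form_add[OF coef_bound, of 1]) (auto simp: A2_iff)
qed

end

text \<open>The eigenvalues tend to infinity: beyond \<open>M\<close> their distance from
  \<open>\<mu>\<close> is at least \<open>1\<close>, and only finitely many positive distances
  remain for the minimum.\<close>

lemma resolvent_gap:
  assumes \<alpha>: "\<alpha> > 0" and \<mu>: "\<And>m. \<mu> \<noteq> complex_of_real (\<alpha> * real (Suc m))"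
  shows "\<exists>\<delta>>0. \<forall>m. \<delta> \<le> cmod (of_real (\<alpha> * real (Suc m)) - \<mu>)"
proof -
  obtain M :: nat where M: "(cmod \<mu> + 1) / \<alpha> < real M" using reals_Archimedean2 by blast
  define \<delta> where "\<delta> = Min (insert 1 ((\<lambda>m. cmod (of_real (\<alpha> * real (Suc m)) - \<mu>)) ` {..M}))"
  have pos: "0 < cmod (of_real (\<alpha> * real (Suc m)) - \<mu>)" for m
    unfolding zero_less_norm_iff right_minus_eq using \<mu>[of m] by (rule not_sym)
  have "\<delta> \<in> insert 1 ((\<lambda>m. cmod (of_real (\<alpha> * real (Suc m)) - \<mu>)) ` {..M})"
    unfolding \<delta>_def by (rule Min_in) auto
  then have "\<delta> > 0" using pos by (elim insertE imageE) simp_all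
  moreover have "\<delta> \<le> cmod (of_real (\<alpha> * real (Suc m)) - \<mu>)" for m
  proof (cases "m \<le> M")
    case True
    then show ?thesis unfolding \<delta>_def by (intro Min_le) auto
  next
    case False
    have "cmod \<mu> + 1 < \<alpha> * real M" using M \<alpha> by (simp add: field_simps)
    also have "\<dots> \<le> \<alpha> * real (Suc m)" using False \<alpha> by (intro mult_left_mono) auto
    also have "\<dots> = cmod (of_real (\<alpha> * real (Suc m)))" using \<alpha> by (simp del: of_nat_Suc of_real_mult)
    finally have "1 \<le> cmod (of_real (\<alpha> * real (Suc m)) - \<mu>)"
      using norm_triangle_ineq2[of "of_real (\<alpha> * real (Suc m))" \<mu>] by linarith
    moreover have "\<delta> \<le> 1" unfolding \<delta>_def by (intro Min_le) auto
    ultimately show ?thesis by linarith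
  qed
  ultimately show ?thesis by blast
qed

section \<open>Eigenspaces\<close>

definition bform :: "('n::{finite,linorder} \<Rightarrow> nat) \<times> 'n \<Rightarrow> 'n form" where
  "bform x = (\<lambda>J z. if J = {snd x} \<and> z \<in> ball 0 1 then cmonom (fst x) z else 0)"

lemma sum_form_apply: "(\<Sum>x\<in>X. F x) J z = (\<Sum>x\<in>X. F x J z :: complex)"
  by (induction X rule: infinite_finite_induct) auto

lemma bform_sum:
  assumes "z \<in> ball 0 1"
  shows "(\<Sum>x\<in>multi m \<times> UNIV. form_scale (c x) (bform x)) {j} z = (\<Sum>\<beta>\<in>multi m. c (\<beta>, j) * cmonom \<beta> z)"
proof -
  have "(\<Sum>x\<in>multi m \<times> UNIV. form_scale (c x) (bform x)) {j} z
      = (\<Sum>\<beta>\<in>multi m. \<Sum>i\<in>UNIV. if j = i then c (\<beta>, i) * cmonom \<beta> z else 0)"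
    unfolding sum_form_apply sum.cartesian_product using assms
    by (intro sum.cong refl) (auto simp: form_scale_def bform_def)
  then show ?thesis by simp
qed

text \<open>\<open>hpoly_coeff_bound\<close> with bound zero, on the ball of radius
  \<open>1/2\<close> where forms agree with their polynomials.\<close>

lemma bform_coeff_zero:
  fixes c :: "('n::{finite,linorder} \<Rightarrow> nat) \<times> 'n \<Rightarrow> complex"
  assumes "(\<Sum>x\<in>multi m \<times> UNIV. form_scale (c x) (bform x)) = 0" "x \<in> multi m \<times> UNIV"
  shows "c x = 0"
proof -
  obtain \<beta> j where x: "x = (\<beta>, j)" "\<beta> \<in> multi m" using assms(2) by auto
  obtain K where K: "\<And>(c :: ('n \<Rightarrow> nat) \<Rightarrow> complex) M. (\<forall>z\<in>cball 0 (1/2). cmod (\<Sum>\<beta>\<in>multi m. c \<beta> * cmonom \<beta> z) \<le> M) \<Longrightarrow> (\<forall>\<beta>\<in>multi m. cmod (c \<beta>) \<le> K * M)"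
    using hpoly_coeff_bound[of "1/2" m] by auto
  have "(\<Sum>\<beta>\<in>multi m. c (\<beta>, j) * cmonom \<beta> z) = 0" if "z \<in> cball 0 (1/2)" for z
    using bform_sum[of z c m j] that unfolding assms(1) by auto
  then have "\<forall>\<beta>\<in>multi m. cmod (c (\<beta>, j)) \<le> K * 0" by (intro K) auto
  then show ?thesis using x by auto
qed

lemma bform_inj: "inj_on (bform :: _ \<Rightarrow> 'n::{finite,linorder} form) (multi m \<times> UNIV)"
proof (rule inj_onI, rule ccontr)
  fix x y :: "('n \<Rightarrow> nat) \<times> 'n"
  assume x: "x \<in> multi m \<times> UNIV" and y: "y \<in> multi m \<times> UNIV" and eq: "bform x = bform y" and ne: "x \<noteq> y"
  \<comment> \<open>Two equal basis forms with different indices would give a linear relation with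
    coefficients \<open>1\<close> and \<open>- 1\<close>.\<close>
  define c where "c w = (if w = x then 1 else if w = y then - 1 else (0 :: complex))" for w
  have "(\<Sum>w\<in>multi m \<times> UNIV. form_scale (c w) (bform w)) = (\<Sum>w\<in>{x, y}. form_scale (c w) (bform w))"
    using x y by (intro sum.mono_neutral_right) (auto simp: finite_multi c_def form_scale_def fun_eq_iff)
  also have "\<dots> = 0" using ne eq by (simp add: c_def) (simp add: form_scale_def fun_eq_iff)
  finally have "c x = 0" using x by (rule bform_coeff_zero)
  then show False by (simp add: c_def)
qed

text \<open>Degree \<open>l\<close> is multiplied by \<open>\<alpha> * Suc l\<close>, and these
  numbers are distinct, so an eigenform lives in one degree. Conversely a single homogeneous part is
  trivially summable and so lies in the domain.\<close>

lemma eigenspace_iff: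
  fixes u :: "'n::{finite,linorder} form"
  assumes \<alpha>: "\<alpha> > 0"
  shows "u \<in> eigenspace (dom_box1 \<alpha>) (box1 \<alpha>) (of_real (\<alpha> * real (Suc m))) \<longleftrightarrow> holform 1 u \<and> u = hform m u"
proof
  assume "u \<in> eigenspace (dom_box1 \<alpha>) (box1 \<alpha>) (of_real (\<alpha> * real (Suc m)))"
  then have d: "u \<in> dom_box1 \<alpha>" and e: "box1 \<alpha> u = form_scale (of_real (\<alpha> * real (Suc m))) u"
    by (auto simp: eigenspace_def)
  have h: "holform 1 u" using d by (auto simp: dom_box1_iff[OF \<alpha>] A2_iff)
  have "hform l u = hform l (hform m u)" for l
  proof (cases "l = m")
    case False
    have "form_scale (of_real (\<alpha> * real (Suc l))) (hform l u) = form_scale (of_real (\<alpha> * real (Suc m))) (hform l u)"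
      using hform_box1[OF \<alpha> d, of l] unfolding e hform_scale[OF h] by simp
    then have "of_real (\<alpha> * real (Suc l)) * hform l u J z = of_real (\<alpha> * real (Suc m)) * hform l u J z" for J z
      by (simp only: form_scale_def fun_eq_iff)
    moreover have "\<alpha> * real (Suc l) \<noteq> \<alpha> * real (Suc m)" using False \<alpha> by simp
    ultimately have "hform l u J z = 0" for J z
      by (metis mult_cancel_right of_real_eq_iff)
    then show ?thesis using False by (simp add: hform_hform fun_eq_iff)
  qed (simp add: hform_hform)
  then show "holform 1 u \<and> u = hform m u"
    using h holform_eqI[OF h holform_hform[OF h]] by blast
next
  assume "holform 1 u \<and> u = hform m u"
  then have h: "holform 1 u" and u: "u = hform m u" by auto
  have hl: "hform l u = (if l = m then u else 0)" for l
    using hform_hform[of l m u] u by (auto simp: fun_eq_iff)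
  have d: "u \<in> dom_box1 \<alpha>"
  proof (rule dom_box1_of_summable[OF \<alpha> h])
    show "summable (\<lambda>l. (real (Suc l))\<^sup>2 * nsq \<alpha> (hform l u))"
      by (rule summable_finite[of "{m}"]) (auto simp: hl nsq_zero)
  qed
  have "box1 \<alpha> u = form_scale (of_real (\<alpha> * real (Suc m))) u"
  proof (rule holform_eqI)
    show "holform 1 (box1 \<alpha> u)" using box1_A2[OF \<alpha> d] by (simp add: A2_iff)
    show "holform 1 (form_scale (of_real (\<alpha> * real (Suc m))) u)" by (rule holform_scale[OF h])
    show "hform l (box1 \<alpha> u) = hform l (form_scale (of_real (\<alpha> * real (Suc m))) u)" for l
      unfolding hform_box1[OF \<alpha> d] hform_scale[OF h] hl by (auto simp: form_scale_def fun_eq_iff)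
  qed
  then show "u \<in> eigenspace (dom_box1 \<alpha>) (box1 \<alpha>) (of_real (\<alpha> * real (Suc m)))"
    using d by (simp add: eigenspace_def)
qed

lemma bform_hform:
  assumes "x \<in> multi m \<times> UNIV"
  shows "holform 1 (bform x)" "hform m (bform x) = bform x"
proof -
  have hp: "hpoly m (cmonom (fst x))" using assms by (auto intro: hpoly_cmonom)
  have b: "bform x J = (if J = {snd x} then (\<lambda>z. if z \<in> ball 0 1 then cmonom (fst x) z else 0) else (\<lambda>z. 0))" for J
    by (auto simp: bform_def fun_eq_iff)
  have "holomorphic_cn (bform x J) (ball 0 1)" for J
    unfolding b by (auto simp del: mem_ball mem_ball_0 simp: holomorphic_truncate holomorphic_cn_cmonom holomorphic_cn_const)
  moreover have "formal 1 (bform x)" by (auto simp: formal_def bform_def)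
  ultimately show "holform 1 (bform x)" by (simp add: holform_def)
  have "hpart m (bform x J) = (if J = {snd x} then cmonom (fst x) else (\<lambda>z. 0))" for J
    unfolding b by (simp del: mem_ball mem_ball_0 add: hpart_truncate hpart_zero hpart_of_hpoly[OF hp])
  note h = this
  show "hform m (bform x) = bform x"
    unfolding hform_def h by (auto simp: bform_def fun_eq_iff)
qed

lemma dim_eigenspace:
  assumes \<alpha>: "\<alpha> > 0"
  shows "vector_space.dim form_scale (eigenspace (dom_box1 \<alpha> :: 'n::{finite,linorder} form set) (box1 \<alpha>) (of_real (\<alpha> * real (Suc m))))
    = CARD('n) * ((CARD('n) + m - 1) choose (CARD('n) - 1))"
proof -
  interpret vector_space "form_scale :: complex \<Rightarrow> 'n form \<Rightarrow> 'n form" by (rule vector_space_form_scale)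
  let ?X = "multi m \<times> (UNIV :: 'n set)"
  let ?E = "eigenspace (dom_box1 \<alpha> :: 'n form set) (box1 \<alpha>) (of_real (\<alpha> * real (Suc m)))"
  show ?thesis
  proof (rule dim_unique[of "bform ` ?X"])
    show "bform ` ?X \<subseteq> ?E"
      unfolding image_subset_iff eigenspace_iff[OF \<alpha>] using bform_hform by metis
    show "?E \<subseteq> span (bform ` ?X)"
    proof
      fix u :: "'n form" assume "u \<in> ?E"
      then have "holform 1 u \<and> u = hform m u" unfolding eigenspace_iff[OF \<alpha>] .
      then have h: "holform 1 u" and u: "u = hform m u" by blast+
      have "\<exists>c. \<forall>z. hpart m (u {j}) z = (\<Sum>\<beta>\<in>multi m. c \<beta> * cmonom \<beta> z)" for j
        using hpart_hpoly[of m "u {j}"] by (simp add: hpoly_def)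
      then obtain c where c: "\<And>j z. hpart m (u {j}) z = (\<Sum>\<beta>\<in>multi m. c j \<beta> * cmonom \<beta> z)" by metis
      define d where "d x = c (snd x) (fst x)" for x
      have span: "(\<Sum>x\<in>?X. form_scale (d x) (bform x)) \<in> span (bform ` ?X)"
        by (intro span_sum span_scale span_base) auto
      have "formal 1 (\<Sum>x\<in>?X. form_scale (d x) (bform x))"
        unfolding formal_def sum_form_apply by (auto simp: form_scale_def bform_def intro!: sum.neutral)
      moreover have "formal 1 u" using h by (simp add: holform_def)
      moreover have "u {k} z = (\<Sum>x\<in>?X. form_scale (d x) (bform x)) {k} z" if "z \<in> ball 0 1" for k z
        unfolding bform_sum[OF that] using fun_cong[OF fun_cong[OF u, of "{k}"], of z] that by (simp add: hform_def c d_def)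
      ultimately have "u = (\<Sum>x\<in>?X. form_scale (d x) (bform x))" by (intro formal_1_ext) auto
      with span show "u \<in> span (bform ` ?X)" by simp
    qed
    show "independent (bform ` ?X)"
    proof (rule independent_if_scalars_zero)
      show "finite (bform ` ?X)" by (simp add: finite_multi)
      fix f x assume f: "(\<Sum>x\<in>bform ` ?X. form_scale (f x) x) = 0" and x: "x \<in> bform ` ?X"
      have "(\<Sum>x\<in>?X. form_scale (f (bform x)) (bform x)) = 0"
        using f unfolding sum.reindex[OF bform_inj] by (simp add: o_def)
      then show "f x = 0" using bform_coeff_zero[of "\<lambda>x. f (bform x)" m] x by auto
    qed
    show "card (bform ` ?X) = CARD('n) * ((CARD('n) + m - 1) choose (CARD('n) - 1))"
      by (subst card_image[OF bform_inj]) (simp add: card_cartesian_product card_multi mult.commute)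
  qed
qed

lemma spectrum_box1:
  assumes \<alpha>: "\<alpha> > 0"
  shows "op_spectrum \<alpha> (A2 \<alpha> 1) (dom_box1 \<alpha> :: 'n::{finite,linorder} form set) (box1 \<alpha>)
    = {complex_of_real (\<alpha> * real k) | k. k \<ge> 1}"
proof -
  have "\<mu> \<in> resolvent_set \<alpha> (A2 \<alpha> 1) (dom_box1 \<alpha> :: 'n form set) (box1 \<alpha>) \<longleftrightarrow> (\<forall>m. \<mu> \<noteq> of_real (\<alpha> * real (Suc m)))" for \<mu>
  proof
    assume "\<forall>m. \<mu> \<noteq> of_real (\<alpha> * real (Suc m))"
    with resolvent_gap[OF \<alpha>, of \<mu>] obtain \<delta> where "\<delta> > 0" "\<And>m. \<delta> \<le> cmod (of_real (\<alpha> * real (Suc m)) - \<mu>)" by blast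
    then interpret box1_resolvent \<alpha> \<mu> \<delta> using \<alpha> by unfold_locales
    show "\<mu> \<in> resolvent_set \<alpha> (A2 \<alpha> 1) (dom_box1 \<alpha> :: 'n form set) (box1 \<alpha>)"
      unfolding resolvent_set_def using resolvent_bij resolvent_bounded by blast
  next
    assume r: "\<mu> \<in> resolvent_set \<alpha> (A2 \<alpha> 1) (dom_box1 \<alpha> :: 'n form set) (box1 \<alpha>)"
    show "\<forall>m. \<mu> \<noteq> of_real (\<alpha> * real (Suc m))"
    proof (intro allI notI)
      fix m assume \<mu>: "\<mu> = of_real (\<alpha> * real (Suc m))"
      have inj: "inj_on (\<lambda>u. box1 \<alpha> u - form_scale \<mu> u) (dom_box1 \<alpha> :: 'n form set)"
        using r by (auto simp: resolvent_set_def bij_betw_def)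
      obtain j :: 'n where "True" by blast
      have "(\<Sum>i\<in>UNIV. ((\<lambda>_. 0)(j := m)) i) = m" by (simp add: fun_upd_def)
      then have x: "((\<lambda>_. 0)(j := m), j) \<in> multi m \<times> UNIV" by (simp add: multi_def)
      \<comment> \<open>The eigenform \<open>(z $ j) ^ m\<close> times the differential of the
        coordinate \<open>j\<close>; injectivity at \<open>\<mu>\<close> would force it to
        vanish.\<close>
      let ?b = "bform ((\<lambda>_. 0)(j := m), j) :: 'n form"
      have b: "?b \<in> eigenspace (dom_box1 \<alpha>) (box1 \<alpha>) \<mu>" "0 \<in> eigenspace (dom_box1 \<alpha> :: 'n form set) (box1 \<alpha>) \<mu>"
        unfolding \<mu> eigenspace_iff[OF \<alpha>] using bform_hform[OF x] by (simp_all add: holform_0 hform_0)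
      have "box1 \<alpha> ?b - form_scale \<mu> ?b = box1 \<alpha> 0 - form_scale \<mu> 0"
        using b by (simp only: eigenspace_def mem_Collect_eq diff_self)
      then have "?b = 0"
        by (rule inj_onD[OF inj]) (use b in \<open>simp_all only: eigenspace_def mem_Collect_eq\<close>)
      then have "(\<Sum>y\<in>multi m \<times> UNIV. form_scale (if y = ((\<lambda>_. 0)(j := m), j) then 1 else 0) (bform y :: 'n form)) = 0"
        by (intro sum.neutral ballI) (auto simp: form_scale_def fun_eq_iff)
      from bform_coeff_zero[OF this x] show False by simp
    qed
  qed
  moreover have "(\<forall>m. \<mu> \<noteq> complex_of_real (\<alpha> * real (Suc m))) \<longleftrightarrow> \<not> (\<exists>k\<ge>1. \<mu> = complex_of_real (\<alpha> * real k))" for \<mu>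
  proof -
    have "(\<exists>k\<ge>1. \<mu> = complex_of_real (\<alpha> * real k)) \<longleftrightarrow> (\<exists>m. \<mu> = complex_of_real (\<alpha> * real (Suc m)))"
    proof
      assume "\<exists>k\<ge>1. \<mu> = complex_of_real (\<alpha> * real k)"
      then obtain k where "k \<ge> 1" "\<mu> = complex_of_real (\<alpha> * real k)" by blast
      then show "\<exists>m. \<mu> = complex_of_real (\<alpha> * real (Suc m))" by (intro exI[of _ "k - 1"]) simp
    next
      assume "\<exists>m. \<mu> = complex_of_real (\<alpha> * real (Suc m))"
      then obtain m where "\<mu> = complex_of_real (\<alpha> * real (Suc m))" by blast
      then show "\<exists>k\<ge>1. \<mu> = complex_of_real (\<alpha> * real k)" by (intro exI[of _ "Suc m"]) simp
    qed
    then show ?thesis by blast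
  qed
  ultimately show ?thesis
    unfolding op_spectrum_def by blast
qed

section \<open>Local bounds and compactness\<close>

text \<open>The constant is the same for all forms; this turns convergence of finitely many Taylor
  coefficients in one degree into norm convergence of that part.\<close>

lemma nsq_sup_bound:
  assumes \<alpha>: "\<alpha> > 0"
  shows "\<exists>C\<ge>0. \<forall>p (u :: 'n::{finite,linorder} form) M. holform p u \<longrightarrow> (\<forall>J. \<forall>z\<in>ball 0 1. cmod (u J z) \<le> M) \<longrightarrow> nsq \<alpha> u \<le> C * M\<^sup>2"
proof -
  obtain C where C: "C \<ge> 0" "\<And>(u :: 'n form) v z M N. z \<in> ball 0 1 \<Longrightarrow> (\<And>J. cmod (u J z) \<le> M) \<Longrightarrow> (\<And>J. cmod (v J z) \<le> N) \<Longrightarrow>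
     cmod (dens \<alpha> u v z) \<le> C * M * N"
    using dens_bound[OF \<alpha>] by blast
  let ?V = "measure lborel (ball 0 1 :: (complex^'n::{finite,linorder}) set)"
  have fin: "emeasure lborel (ball 0 1 :: (complex^'n::{finite,linorder}) set) < \<infinity>" by (rule emeasure_lborel_ball_finite)
  show ?thesis
  proof (intro exI[of _ "C * ?V"] conjI allI impI)
    fix p and u :: "'n form" and M assume u: "holform p u" and M: "\<forall>J. \<forall>z\<in>ball 0 1. cmod (u J z) \<le> M"
    have "Re (form_inner \<alpha> u u) \<le> norm (form_inner \<alpha> u u)" by (rule complex_Re_le_cmod)
    also have "\<dots> \<le> integral\<^sup>L lborel (\<lambda>z :: complex^'n::{finite,linorder}. indicat_real (ball 0 1) z *\<^sub>R (C * M * M))"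
      unfolding form_inner_eq
    proof (rule Bochner_Integration.integral_norm_bound_integral)
      show "integrable lborel (\<lambda>z. indicat_real (ball 0 1) z *\<^sub>R dens \<alpha> u u z)"
        using dens_integrable_bounded[OF \<alpha> u u order_refl, of M M] M by (simp add: set_integrable_def)
      show "integrable lborel (\<lambda>z :: complex^'n::{finite,linorder}. indicat_real (ball 0 1) z *\<^sub>R (C * M * M))"
        using fin by (intro integrable_scaleR_left) (simp add: integrable_indicator_iff)
      show "norm (indicat_real (ball 0 1) z *\<^sub>R dens \<alpha> u u z) \<le> indicat_real (ball 0 1) z *\<^sub>R (C * M * M)" for z
        using C(2)[of z u M u M] M by (cases "z \<in> ball 0 1") auto
    qed
    also have "\<dots> = C * ?V * M\<^sup>2"
      using fin by (simp add: power2_eq_square)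
    finally show "nsq \<alpha> u \<le> C * ?V * M\<^sup>2" by (simp add: nsq_def)
  qed (use C in auto)
qed

lemma lborel_integral_affine:
  fixes F :: "'a::euclidean_space \<Rightarrow> real"
  assumes [measurable]: "F \<in> borel_measurable borel" and c: "c > 0"
  shows "integral\<^sup>L lborel F = c ^ DIM('a) * integral\<^sup>L lborel (\<lambda>x. F (t + c *\<^sub>R x))"
proof -
  have T [measurable]: "(\<lambda>x :: 'a. t + c *\<^sub>R x) \<in> borel_measurable borel" by simp
  have "integral\<^sup>L lborel F = integral\<^sup>L (density (distr lborel borel (\<lambda>x. t + c *\<^sub>R x)) (\<lambda>_. ennreal (c ^ DIM('a)))) F"
    using lborel_affine[of c t] c by (simp add: ennreal_power)
  also have "\<dots> = integral\<^sup>L (distr lborel borel (\<lambda>x. t + c *\<^sub>R x)) (\<lambda>x. c ^ DIM('a) *\<^sub>R F x)"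
    by (rule integral_density) (use c in auto)
  also have "\<dots> = integral\<^sup>L lborel (\<lambda>x. c ^ DIM('a) *\<^sub>R F (t + c *\<^sub>R x))"
    by (rule integral_distr) auto
  finally show ?thesis by simp
qed

text \<open>The value at the centre of a small ball is the degree-zero part of the rescaled function, so
  Parseval's identity gives the sub-mean value property.\<close>

lemma local_bound:
  assumes \<alpha>: "\<alpha> > 0" and r: "0 \<le> r" "r < 1"
  shows "\<exists>C\<ge>0. \<forall>u\<in>A2 \<alpha> 1. \<forall>j :: 'n::{finite,linorder}. \<forall>z\<in>cball 0 r. (cmod (u {j} z))\<^sup>2 \<le> C * nsq \<alpha> u"
proof -
  let ?D = "DIM(complex^'n::{finite,linorder})"
  define d where "d = (1 - r) / 2"
  define R where "R = (1 + r) / 2"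
  have d: "0 < d" "0 \<le> R" "R < 1" "r + d = R" using r by (auto simp: d_def R_def field_simps)
  define one :: "'n form" where "one = (\<lambda>J z. if J = {} \<and> z \<in> ball 0 1 then 1 else 0)"
  have oneJ: "one J = (\<lambda>z. if z \<in> ball 0 1 then (if J = {} then 1 else 0) else 0)" for J
    by (auto simp: one_def fun_eq_iff)
  have h1: "holform 0 one"
    unfolding holform_def formal_def
  proof (intro conjI allI)
    show "holomorphic_cn (one J) (ball 0 1)" for J
      unfolding oneJ holomorphic_truncate by (rule holomorphic_cn_const)
  qed (auto simp: one_def)
  have one: "hform 0 one = one" by (auto simp: hform_def one_def fun_eq_iff)
  have A1: "one \<in> A2 \<alpha> 0" using hform_A2[OF \<alpha> h1, of 0] by (simp add: one)
  define W where "W = nsq \<alpha> one"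
  have "one {} 0 \<noteq> 0" by (simp add: one_def)
  then have "one \<noteq> 0" by auto
  then have W: "0 < W"
    using nsq_eq_0[OF \<alpha> _ A1] nsq_nonneg[OF _ A1] by (force simp: W_def less_le)
  define Cw where "Cw = fact (CARD('n) + 1) / \<alpha> ^ (CARD('n) + 1)"
  have Cw: "weight \<alpha> z \<le> Cw" if "z \<in> ball 0 1" for z :: "complex^'n::{finite,linorder}"
    unfolding weight_bump[OF that] Cw_def by (rule bump_bounded[OF \<alpha>])
  have Cw0: "0 \<le> Cw" using \<alpha> by (simp add: Cw_def)
  have cR: "cball (0 :: complex^'n::{finite,linorder}) R \<subseteq> ball 0 1" using d by auto
  have cont: "continuous_on (cball (0 :: complex^'n::{finite,linorder}) R) (\<lambda>z. weight \<alpha> z * (radial z)\<^sup>2)"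
    by (intro continuous_intros continuous_on_subset[OF continuous_on_weight[OF \<alpha>] cR])
  have "cball (0 :: complex^'n::{finite,linorder}) R \<noteq> {}" using d by (simp add: cball_eq_empty)
  from continuous_attains_inf[OF compact_cball this cont]
obtain z0 :: "complex^'n::{finite,linorder}" where z0: "z0 \<in> cball 0 R"
    "\<forall>z\<in>cball (0 :: complex^'n::{finite,linorder}) R. weight \<alpha> z0 * (radial z0)\<^sup>2 \<le> weight \<alpha> z * (radial z)\<^sup>2" ..
  \<comment> \<open>On the ball of radius \<open>R\<close> the density of a 1-form is at least
    \<open>\<kappa>\<close> times the sum of squares of its coefficients; compactness makes
    \<open>\<kappa>\<close> positive.\<close>
  define \<kappa> where "\<kappa> = weight \<alpha> z0 * (radial z0)\<^sup>2"
  have \<kappa>: "0 < \<kappa>" using weight_pos[of z0 \<alpha>] radial_pos[of z0] z0(1) cR by (auto simp: \<kappa>_def)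
  \<comment> \<open>\<open>Cw\<close> bounds the weight for the rescaled function,
    \<open>d ^ ?D\<close> is the Jacobian of the rescaling, \<open>\<kappa>\<close> compares
    coefficient and form, and \<open>W\<close> is the squared norm of the constant \<open>1\<close>
    against which the value at the centre is measured.\<close>
  define C where "C = Cw / d ^ ?D / \<kappa> / W"
  have C: "0 \<le> C" using Cw0 d \<kappa> W by (simp add: C_def)
  have "(cmod (u {j} z))\<^sup>2 \<le> C * nsq \<alpha> u" if u: "u \<in> A2 \<alpha> 1" and z: "z \<in> cball 0 r" for u :: "'n form" and j z
  proof -
    define f where "f = u {j}"
    have hu: "holform 1 u" and fu: "formal 1 u" using u by (auto simp: A2_iff holform_def)
    have hf: "holomorphic_cn f (ball 0 1)" using hu by (simp add: holform_def f_def)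
    define g where "g w = f (z + d *\<^sub>R w)" for w
    have inR: "z + d *\<^sub>R w \<in> ball 0 R" if "w \<in> ball 0 1" for w
    proof -
      have "norm (z + d *\<^sub>R w) \<le> norm z + d * norm w" using norm_triangle_ineq[of z "d *\<^sub>R w"] d by simp
      also have "\<dots> < r + d * 1" using z that d by (intro add_le_less_mono mult_strict_left_mono) auto
      finally show ?thesis using d by simp
    qed
    have in1: "z + d *\<^sub>R w \<in> ball 0 1" if "w \<in> ball 0 1" for w using inR[OF that] d by auto
    have hg: "holomorphic_cn g (ball 0 1)"
    proof (rule holomorphic_cnI)
      fix w :: "complex^'n::{finite,linorder}" assume w: "w \<in> ball 0 1"
      have "((\<lambda>w. z + d *\<^sub>R w) has_derivative (\<lambda>v. d *\<^sub>R v)) (at w)" by (auto intro!: derivative_eq_intros)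
      from has_derivative_compose[OF this holomorphic_cn_dz[OF hf in1[OF w]]]
      show "(g has_derivative (\<lambda>v. \<Sum>i\<in>UNIV. (of_real d * dz i f (z + d *\<^sub>R w)) * v $ i)) (at w)"
        unfolding g_def by (rule has_derivative_eq_rhs) (simp add: fun_eq_iff scaleR_conv_of_real[where 'a = complex] mult_ac)
    qed
    define G :: "'n form" where "G = (\<lambda>J w. if J = {} \<and> w \<in> ball 0 1 then g w else 0)"
    have GJ: "G J = (\<lambda>w. if w \<in> ball 0 1 then (if J = {} then g w else 0) else 0)" for J
      by (auto simp: G_def fun_eq_iff)
    have fG: "formal 0 G" by (auto simp: formal_def G_def)
    have hG: "holform 0 G"
      unfolding holform_def
    proof (intro conjI allI fG)
      show "holomorphic_cn (G J) (ball 0 1)" for J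
        unfolding GJ holomorphic_truncate by (cases "J = {}") (simp_all add: hg holomorphic_cn_const)
    qed
    have "compact (f ` cball 0 R)"
      by (intro compact_continuous_image compact_cball continuous_on_subset[OF holomorphic_cn_imp_continuous_on[OF hf] cR])
    then obtain B where B: "\<And>x. x \<in> cball 0 R \<Longrightarrow> cmod (f x) \<le> B"
      using compact_imp_bounded[of "f ` cball 0 R"] unfolding bounded_iff by blast
    have B0: "0 \<le> B" using B[of 0] d order_trans[OF norm_ge_zero] by auto
    have "cmod (G J w) \<le> B" for J w
      using B[of "z + d *\<^sub>R w"] inR[of w] B0 by (auto simp: G_def g_def)
    then have AG: "G \<in> A2 \<alpha> 0"
      using dens_integrable_bounded[OF \<alpha> hG hG order_refl, of B B] hG by (simp add: A2_iff)
    have "hform 0 G = form_scale (f z) one"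
      by (auto simp: hform_def G_def one_def form_scale_def fun_eq_iff g_def)
    then have "(cmod (f z))\<^sup>2 * W = nsq \<alpha> (hform 0 G)" by (simp add: nsq_scale W_def)
    also have "\<dots> \<le> nsq \<alpha> G" using parseval_le[OF \<alpha> _ AG, of 1] by simp
    finally have 1: "(cmod (f z))\<^sup>2 * W \<le> nsq \<alpha> G" .
    define F where "F x = indicat_real (ball z d) x * (cmod (f x))\<^sup>2" for x
    have zdR: "ball z d \<subseteq> ball 0 R"
    proof
      fix x assume "x \<in> ball z d"
      then show "x \<in> ball 0 R" using z d norm_triangle_ineq[of z "x - z"] by (simp add: dist_norm norm_minus_commute)
    qed
    have cf: "continuous_on (ball z d) (\<lambda>x. (cmod (f x))\<^sup>2)"
      using subset_trans[OF zdR subset_trans[OF ball_subset_cball cR]]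
      by (intro continuous_intros continuous_on_subset[OF holomorphic_cn_imp_continuous_on[OF hf]])
    have Fm: "F \<in> borel_measurable borel"
      unfolding F_def[abs_def] using borel_measurable_continuous_on_indicator[OF _ cf] by simp
    have intu: "integrable lborel (\<lambda>x. indicat_real (ball 0 1) x *\<^sub>R Re (dens \<alpha> u u x))"
      using Re_finner(2)[of 1 \<alpha> u u] u by (simp add: A2_iff set_integrable_def)
    have nsqu: "integral\<^sup>L lborel (\<lambda>x. indicat_real (ball 0 1) x *\<^sub>R Re (dens \<alpha> u u x)) = nsq \<alpha> u"
      using Re_finner(1)[of 1 \<alpha> u u] u by (simp add: A2_iff nsq_def form_inner_finner set_lebesgue_integral_def)
    have Fle: "F x \<le> 1 / \<kappa> * (indicat_real (ball 0 1) x *\<^sub>R Re (dens \<alpha> u u x))" for x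
    proof (cases "x \<in> ball z d")
      case True
      then have xR: "x \<in> cball 0 R" and x1: "x \<in> ball 0 1"
        using subsetD[OF zdR True] subsetD[OF subset_trans[OF zdR subset_trans[OF ball_subset_cball cR]] True] by auto
      have "\<kappa> * (cmod (f x))\<^sup>2 \<le> weight \<alpha> x * (radial x)\<^sup>2 * (cmod (f x))\<^sup>2"
        unfolding \<kappa>_def by (intro mult_right_mono bspec[OF z0(2)] xR) simp
      also have "\<dots> \<le> weight \<alpha> x * ((radial x)\<^sup>2 * (\<Sum>i\<in>UNIV. (cmod (u {i} x))\<^sup>2))"
        unfolding mult.assoc f_def using weight_pos[OF x1, of \<alpha>]
        by (intro mult_left_mono member_le_sum[of j UNIV "\<lambda>i. (cmod (u {i} x))\<^sup>2"]) auto
      also have "\<dots> \<le> weight \<alpha> x * Re (pointwise_inner u u x)"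
        using weight_pos[OF x1, of \<alpha>] by (intro mult_left_mono Re_pointwise_inner_1_ge[OF fu x1]) simp
      also have "\<dots> = Re (dens \<alpha> u u x)" by (simp add: dens_def)
      finally show ?thesis using True x1 \<kappa> by (simp add: F_def field_simps)
    next
      case False
      then show ?thesis using dens_nonneg[OF _ hu, of x \<alpha>] \<kappa> by (auto simp: F_def indicator_def)
    qed
    have Fnn: "0 \<le> F x" for x by (simp add: F_def)
    have intF: "integrable lborel F"
    proof (rule Bochner_Integration.integrable_bound[OF integrable_mult_right[OF intu, of "1 / \<kappa>"]])
      have "norm (F x) \<le> norm (1 / \<kappa> * (indicat_real (ball 0 1) x *\<^sub>R Re (dens \<alpha> u u x)))" for x
        using Fle[of x] Fnn[of x] by (simp only: real_norm_def)
      then show "AE x in lborel. norm (F x) \<le> norm (1 / \<kappa> * (indicat_real (ball 0 1) x *\<^sub>R Re (dens \<alpha> u u x)))" by simp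
    qed (use Fm in simp)
    have "integral\<^sup>L lborel F \<le> integral\<^sup>L lborel (\<lambda>x. 1 / \<kappa> * (indicat_real (ball 0 1) x *\<^sub>R Re (dens \<alpha> u u x)))"
      by (rule integral_mono[OF intF integrable_mult_right[OF intu] Fle])
    also have "\<dots> = 1 / \<kappa> * nsq \<alpha> u" unfolding integral_mult_right_zero nsqu ..
    finally have 2: "integral\<^sup>L lborel F \<le> 1 / \<kappa> * nsq \<alpha> u" .
    have F_affine: "F (z + d *\<^sub>R w) = indicat_real (ball 0 1) w * (cmod (g w))\<^sup>2" for w
      using d by (simp add: F_def g_def indicator_def dist_norm)
    have 3: "integral\<^sup>L lborel (\<lambda>w. indicat_real (ball 0 1) w * (cmod (g w))\<^sup>2) = integral\<^sup>L lborel F / d ^ ?D"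
      using lborel_integral_affine[OF Fm d(1), of z] d by (simp add: F_affine)
    have intG: "integrable lborel (\<lambda>w. indicat_real (ball 0 1) w *\<^sub>R Re (dens \<alpha> G G w))"
      using Re_finner(2)[of 1 \<alpha> G G] AG by (simp add: A2_iff set_integrable_def)
    have cg: "continuous_on (ball 0 1) (\<lambda>w. (cmod (g w))\<^sup>2)"
      by (intro continuous_intros holomorphic_cn_imp_continuous_on[OF hg])
    have intg: "integrable lborel (\<lambda>w. indicat_real (ball 0 1) w * (cmod (g w))\<^sup>2)"
    proof -
      have "set_integrable lborel (ball 0 1) (\<lambda>w. (cmod (g w))\<^sup>2)"
      proof (rule set_integrable_bounded_ball[where B = "B\<^sup>2"])
        show "set_borel_measurable lborel (ball 0 1) (\<lambda>w. (cmod (g w))\<^sup>2)"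
          unfolding set_borel_measurable_def using borel_measurable_continuous_on_indicator[OF _ cg] by simp
        show "norm ((cmod (g w))\<^sup>2) \<le> B\<^sup>2" if "w \<in> ball 0 1" for w
          using B[of "z + d *\<^sub>R w"] inR[OF that] by (auto simp: g_def intro!: power_mono)
      qed
      then show ?thesis by (simp add: set_integrable_def)
    qed
    have "nsq \<alpha> G = integral\<^sup>L lborel (\<lambda>w. indicat_real (ball 0 1) w *\<^sub>R Re (dens \<alpha> G G w))"
      using Re_finner(1)[of 1 \<alpha> G G] AG by (simp add: A2_iff nsq_def form_inner_finner set_lebesgue_integral_def)
    also have "\<dots> \<le> integral\<^sup>L lborel (\<lambda>w. Cw * (indicat_real (ball 0 1) w * (cmod (g w))\<^sup>2))"
    proof (rule integral_mono[OF intG integrable_mult_right[OF intg]])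
      fix w :: "complex^'n::{finite,linorder}"
      show "indicat_real (ball 0 1) w *\<^sub>R Re (dens \<alpha> G G w) \<le> Cw * (indicat_real (ball 0 1) w * (cmod (g w))\<^sup>2)"
      proof (cases "w \<in> ball 0 1")
        case True
        have "Re (dens \<alpha> G G w) = weight \<alpha> w * (cmod (g w))\<^sup>2"
          using True unfolding dens_def pointwise_inner_0[OF fG fG] complex_norm_square[symmetric] by (simp add: G_def del: of_real_power)
        also have "\<dots> \<le> Cw * (cmod (g w))\<^sup>2" by (intro mult_right_mono Cw True) simp
        finally show ?thesis using True by simp
      qed simp
    qed
    also have "\<dots> = Cw * (integral\<^sup>L lborel F / d ^ ?D)" by (simp add: 3)
    also have "\<dots> \<le> Cw * ((1 / \<kappa> * nsq \<alpha> u) / d ^ ?D)"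
      using Cw0 d by (intro mult_left_mono divide_right_mono 2) auto
    finally have "(cmod (f z))\<^sup>2 * W \<le> Cw * ((1 / \<kappa> * nsq \<alpha> u) / d ^ ?D)" using 1 by linarith
    then have "(cmod (f z))\<^sup>2 \<le> Cw * ((1 / \<kappa> * nsq \<alpha> u) / d ^ ?D) / W"
      using W by (simp only: pos_le_divide_eq)
    also have "\<dots> = C * nsq \<alpha> u" by (simp add: C_def)
    finally show ?thesis by (simp add: f_def)
  qed
  then show ?thesis using C by blast
qed

lemma cmonom_le_1: "z \<in> ball 0 1 \<Longrightarrow> cmod (cmonom \<beta> z) \<le> 1"
  unfolding cmonom_def prod_norm[symmetric]
  using order_trans[OF Finite_Cartesian_Product.norm_nth_le[of z]]
  by (intro prod_le_1) (auto simp: norm_power intro!: power_le_one)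

text \<open>The sum is split at a degree \<open>L\<close> beyond which the multiplier is small: the
  finitely many low parts tend to zero individually, and the tail is a small multiple of the bound
  \<open>B\<close>.\<close>

lemma smult_form_tendsto:
  fixes x :: "nat \<Rightarrow> 'n::{finite,linorder} form"
  assumes \<alpha>: "\<alpha> > 0" and p: "p \<le> 2" and x: "\<And>i. x i \<in> A2 \<alpha> p" and B: "\<And>i. nsq \<alpha> (x i) \<le> B"
    and lim: "\<And>m. (\<lambda>i. nsq \<alpha> (hform m (x i))) \<longlonglongrightarrow> 0" and c: "c \<longlonglongrightarrow> 0" and K: "\<And>m. cmod (c m) \<le> K"
  shows "(\<lambda>i. nsq \<alpha> (smult_form c (x i))) \<longlonglongrightarrow> 0"
proof (rule LIMSEQ_I)
  fix e :: real assume e: "0 < e"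
  have B0: "0 \<le> B" using nsq_nonneg[OF p x] B order_trans by blast
  have nn: "0 \<le> nsq \<alpha> (hform m (x i))" for m i
    using x by (intro nsq_nonneg[OF p hform_A2[OF \<alpha>]]) (auto simp: A2_iff)
  \<comment> \<open>Dividing by \<open>B + 1\<close> instead of \<open>B\<close> covers
    \<open>B = 0\<close> and makes the tail strictly less than \<open>e / 2\<close>.\<close>
  define \<epsilon> where "\<epsilon> = e / (2 * (B + 1))"
  have \<epsilon>: "0 < \<epsilon>" "\<epsilon> * B < e / 2" using e B0 by (auto simp: \<epsilon>_def field_simps)
  have "(\<lambda>m. (cmod (c m))\<^sup>2) \<longlonglongrightarrow> 0"
    using tendsto_power[OF tendsto_norm_zero[OF c], of 2] by simp
  then have "\<forall>\<^sub>F m in sequentially. (cmod (c m))\<^sup>2 < \<epsilon>" using \<epsilon>(1) by (rule order_tendstoD(2))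
  then obtain L where L: "\<And>m. m \<ge> L \<Longrightarrow> (cmod (c m))\<^sup>2 < \<epsilon>" by (auto simp: eventually_sequentially)
  have le: "nsq \<alpha> (smult_form c (x i)) \<le> (\<Sum>m<L. K\<^sup>2 * nsq \<alpha> (hform m (x i))) + \<epsilon> * B" for i
  proof -
    have s1: "(\<lambda>m. (cmod (c m))\<^sup>2 * nsq \<alpha> (hform m (x i))) sums nsq \<alpha> (smult_form c (x i))"
      by (rule nsq_smult_form(2)[OF \<alpha> p x K])
    have s2: "(\<lambda>m. (if m \<in> {..<L} then K\<^sup>2 * nsq \<alpha> (hform m (x i)) else 0) + \<epsilon> * nsq \<alpha> (hform m (x i))) sums
        ((\<Sum>m<L. K\<^sup>2 * nsq \<alpha> (hform m (x i))) + \<epsilon> * nsq \<alpha> (x i))"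
      by (intro sums_add sums_If_finite_set sums_mult parseval[OF \<alpha> p x]) simp
    have "nsq \<alpha> (smult_form c (x i)) \<le> (\<Sum>m<L. K\<^sup>2 * nsq \<alpha> (hform m (x i))) + \<epsilon> * nsq \<alpha> (x i)"
    proof (rule sums_le[OF _ s1 s2])
      fix m
      show "(cmod (c m))\<^sup>2 * nsq \<alpha> (hform m (x i)) \<le> (if m \<in> {..<L} then K\<^sup>2 * nsq \<alpha> (hform m (x i)) else 0) + \<epsilon> * nsq \<alpha> (hform m (x i))"
      proof (cases "m < L")
        case True
        have "(cmod (c m))\<^sup>2 * nsq \<alpha> (hform m (x i)) \<le> K\<^sup>2 * nsq \<alpha> (hform m (x i))"
          using K by (intro mult_right_mono nn power_mono) auto
        then show ?thesis using True by (simp add: add_increasing2 nn \<epsilon>(1) less_imp_le)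
      next
        case False
        then show ?thesis using mult_right_mono[OF less_imp_le[OF L[of m]] nn[of m i]] by simp
      qed
    qed
    also have "\<dots> \<le> (\<Sum>m<L. K\<^sup>2 * nsq \<alpha> (hform m (x i))) + \<epsilon> * B"
      using \<epsilon> B by (intro add_left_mono mult_left_mono) auto
    finally show ?thesis .
  qed
  have "(\<lambda>i. \<Sum>m<L. K\<^sup>2 * nsq \<alpha> (hform m (x i))) \<longlonglongrightarrow> (\<Sum>m<L. K\<^sup>2 * 0)"
    by (intro tendsto_intros lim)
  then have "\<forall>\<^sub>F i in sequentially. (\<Sum>m<L. K\<^sup>2 * nsq \<alpha> (hform m (x i))) < e / 2"
    using e by (intro order_tendstoD(2)) auto
  then obtain I where I: "\<And>i. i \<ge> I \<Longrightarrow> (\<Sum>m<L. K\<^sup>2 * nsq \<alpha> (hform m (x i))) < e / 2"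
    by (auto simp: eventually_sequentially)
  show "\<exists>no. \<forall>i\<ge>no. norm (nsq \<alpha> (smult_form c (x i)) - 0) < e"
  proof (intro exI[of _ I] allI impI)
    fix i assume "I \<le> i"
    then show "norm (nsq \<alpha> (smult_form c (x i)) - 0) < e"
      using I[of i] le[of i] \<epsilon>(2) nsq_nonneg[OF p nsq_smult_form(1)[OF \<alpha> p x[of i] K]] by simp
  qed
qed

text \<open>A diagonal subsequence along which every Taylor coefficient converges.\<close>

lemma weakly_convergent_subsequence:
  fixes U :: "nat \<Rightarrow> 'n::{finite,linorder} form"
  assumes \<alpha>: "\<alpha> > 0" and U: "\<And>i. U i \<in> A2 \<alpha> 1" and B: "\<And>i. nsq \<alpha> (U i) \<le> B"
  shows "\<exists>k w. strict_mono (k :: nat \<Rightarrow> nat) \<and> w \<in> A2 \<alpha> 1 \<and> nsq \<alpha> w \<le> 2 * B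
    \<and> (\<forall>m. (\<lambda>i. nsq \<alpha> (hform m (U (k i) - w))) \<longlonglongrightarrow> 0)"
proof -
  have hU: "holform 1 (U i)" for i using U by (simp add: A2_iff)
  have holU: "holomorphic_cn (U i J) (ball 0 1)" for i J using hU by (simp add: holform_def)
  have loc: "\<exists>M. \<forall>i j. \<forall>z\<in>cball 0 r. cmod (U i {j} z) \<le> M" if r: "0 \<le> r" "r < 1" for r
  proof -
    from local_bound[OF \<alpha> r] obtain C where C: "C \<ge> 0"
      "\<forall>u\<in>A2 \<alpha> 1. \<forall>j :: 'n. \<forall>z\<in>cball 0 r. (cmod (u {j} z))\<^sup>2 \<le> C * nsq \<alpha> u" by (elim exE conjE)
    have "cmod (U i {j} z) \<le> sqrt (C * B)" if "z \<in> cball 0 r" for i j z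
    proof (rule real_le_rsqrt)
      have "(cmod (U i {j} z))\<^sup>2 \<le> C * nsq \<alpha> (U i)" using C(2) U that by (elim ballE allE) auto
      also have "\<dots> \<le> C * B" by (intro mult_left_mono B C)
      finally show "(cmod (U i {j} z))\<^sup>2 \<le> C * B" .
    qed
    then show ?thesis by blast
  qed
  have geo: "\<exists>C q. 0 \<le> q \<and> q < 1 \<and> (\<forall>i j m. \<forall>z\<in>cball 0 r. cmod (hpart m (U i {j}) z) \<le> C * q ^ m)" if r: "0 \<le> r" "r < 1" for r
  proof -
    define \<rho> where "\<rho> = (1 + r) / 2"
    have \<rho>: "0 < \<rho>" "\<rho> < 1" "r < \<rho>" using r by (auto simp: \<rho>_def)
    from loc[of \<rho>] \<rho> obtain M where "\<forall>i j. \<forall>z\<in>cball 0 \<rho>. cmod (U i {j} z) \<le> M" by auto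
    then have M: "\<And>i j z. z \<in> cball 0 \<rho> \<Longrightarrow> cmod (U i {j} z) \<le> M" by (elim allE ballE) auto
    have M0: "0 \<le> M" using M[of 0] \<rho> order_trans[OF norm_ge_zero] by auto
    have "cmod (hpart m (U i {j}) z) \<le> M * (r / \<rho>) ^ m" if "z \<in> cball 0 r" for i j m z
    proof -
      have "cmod (hpart m (U i {j}) z) \<le> M * (norm z / \<rho>) ^ m"
        by (rule hpart_bound[OF holU \<rho>(1,2) M])
      also have "\<dots> \<le> M * (r / \<rho>) ^ m"
        using that M0 \<rho> by (intro mult_left_mono power_mono divide_right_mono) auto
      finally show ?thesis .
    qed
    then show ?thesis using \<rho> r by (intro exI[of _ M] exI[of _ "r / \<rho>"]) auto
  qed
  have "\<exists>c. \<forall>z. hpart m (U i {j}) z = (\<Sum>\<beta>\<in>multi m. c \<beta> * cmonom \<beta> z)" for i m j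
    using hpart_hpoly[of m "U i {j}"] by (simp add: hpoly_def)
  note ex = this
  \<comment> \<open>\<open>hpoly\<close> asserts only that coefficients exist; one family is fixed
    so that coefficient sequences can be extracted.\<close>
  define a where "a i m j = (SOME c. \<forall>z. hpart m (U i {j}) z = (\<Sum>\<beta>\<in>multi m. c \<beta> * cmonom \<beta> z))" for i m j
  have a: "hpart m (U i {j}) z = (\<Sum>\<beta>\<in>multi m. a i m j \<beta> * cmonom \<beta> z)" for i m j z
    unfolding a_def using someI_ex[OF ex[of m i j]] by (rule spec)
  have "\<exists>b>0. \<forall>i j. \<forall>\<beta>\<in>multi m. cmod (a i m j \<beta>) \<le> b" for m
  proof -
    obtain K where K: "\<And>(c :: ('n \<Rightarrow> nat) \<Rightarrow> complex) M. (\<forall>z\<in>cball 0 (1/2). cmod (\<Sum>\<beta>\<in>multi m. c \<beta> * cmonom \<beta> z) \<le> M) \<Longrightarrow> (\<forall>\<beta>\<in>multi m. cmod (c \<beta>) \<le> K * M)"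
      using hpoly_coeff_bound[of "1/2" m] by auto
    from geo[of "1/2"] obtain C q where
      C: "\<forall>i j m. \<forall>z\<in>cball 0 (1/2). cmod (hpart m (U i {j}) z) \<le> C * q ^ m" by auto
    have "\<forall>\<beta>\<in>multi m. cmod (a i m j \<beta>) \<le> K * (C * q ^ m)" for i j
      by (intro K, unfold a[symmetric]) (use C in blast)
    then show ?thesis by (intro exI[of _ "\<bar>K * (C * q ^ m)\<bar> + 1"]) (force intro: order_trans)
  qed
  then obtain b where b: "\<And>m. b m > 0" "\<And>i j m \<beta>. \<beta> \<in> multi m \<Longrightarrow> cmod (a i m j \<beta>) \<le> b m" by metis
  define S :: "(nat \<times> 'n \<times> ('n \<Rightarrow> nat)) set" where "S = (SIGMA m : UNIV. UNIV \<times> multi m)"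
  have "countable S"
    unfolding S_def by (intro countable_SIGMA) (auto intro: countable_finite finite_multi finite_cartesian_product)
  then obtain k :: "nat \<Rightarrow> nat" where k: "strict_mono k"
    "\<And>x. x \<in> S \<Longrightarrow> \<exists>l. (\<lambda>i. (\<lambda>(m, j, \<beta>). a (k i) m j \<beta> / of_real (b m)) x) \<longlonglongrightarrow> l"
  \<comment> \<open>The coefficients are bounded by \<open>b m\<close>, which depends on the degree,
    whereas the diagonal extraction is applied with one bound for all indices. Dividing by the
    positive \<open>b m\<close> makes that bound \<open>1\<close>.\<close>
  proof (rule function_convergent_subsequence[where f = "\<lambda>i (m, j, \<beta>). a i m j \<beta> / of_real (b m)" and M = 1])
    show "norm (case x of (m, j, \<beta>) \<Rightarrow> a i m j \<beta> / of_real (b m)) \<le> 1" if "x \<in> S" for i x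
      using that b by (auto simp: S_def norm_divide divide_le_eq_1 less_imp_le)
  qed blast
  define l where "l m j \<beta> = lim (\<lambda>i. a (k i) m j \<beta>)" for m j \<beta>
  have l: "(\<lambda>i. a (k i) m j \<beta>) \<longlonglongrightarrow> l m j \<beta>" if "\<beta> \<in> multi m" for m j \<beta>
  proof -
    from that have "(m, j, \<beta>) \<in> S" by (simp add: S_def)
    from k(2)[OF this] obtain l where "(\<lambda>i. a (k i) m j \<beta> / of_real (b m)) \<longlonglongrightarrow> l" by auto
    from tendsto_mult_right[OF this, of "of_real (b m)"] have "(\<lambda>i. a (k i) m j \<beta>) \<longlonglongrightarrow> l * of_real (b m)"
      using b(1)[of m] by simp
    then show ?thesis unfolding l_def by (intro convergent_LIMSEQ_iff[THEN iffD1]) (auto simp: convergent_def)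
  qed
  define V where "V j m z = (\<Sum>\<beta>\<in>multi m. l m j \<beta> * cmonom \<beta> z)" for j m and z :: "complex^'n::{finite,linorder}"
  have hV: "hpoly m (V j m)" for j m by (auto simp: hpoly_def V_def)
  have limV: "(\<lambda>i. hpart m (U (k i) {j}) z) \<longlonglongrightarrow> V j m z" for m j z
    unfolding a V_def by (intro tendsto_intros l)
  have bdV: "\<exists>C q. 0 \<le> q \<and> q < 1 \<and> (\<forall>m. \<forall>z\<in>cball 0 r. cmod (V j m z) \<le> C * q ^ m)" if r: "0 \<le> r" "r < 1" for r j
  proof -
    obtain C q where C: "0 \<le> q" "q < 1" "\<And>i j m z. z \<in> cball 0 r \<Longrightarrow> cmod (hpart m (U i {j}) z) \<le> C * q ^ m"
      using geo[OF r] by blast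
    have "cmod (V j m z) \<le> C * q ^ m" if "z \<in> cball 0 r" for m z
      by (rule LIMSEQ_le_const2[OF tendsto_norm[OF limV]]) (use C(3)[OF that] in auto)
    then show ?thesis using C by blast
  qed
  note asm = hpoly_assemble[of "V j" for j, OF hV bdV]
  define w :: "'n form" where "w = (\<lambda>J z. if z \<in> ball 0 1 then (if card J = 1 then \<Sum>m. V (the_elem J) m z else 0) else 0)"
  have hw: "holform 1 w"
    unfolding holform_def
  proof (intro conjI allI)
    show "formal 1 w" by (auto simp: formal_def w_def)
    show "holomorphic_cn (w J) (ball 0 1)" for J
      unfolding w_def holomorphic_truncate by (cases "card J = 1") (simp_all add: asm(1) holomorphic_cn_const)
  qed
  have pw: "hpart m (w {j}) = V j m" for j m
    unfolding w_def hpart_truncate by (simp add: asm(2))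
  have hx: "holform 1 (U i - w)" for i unfolding form_diff by (intro holform_add holform_scale hU hw)
  define E where "E i m = (\<Sum>j\<in>UNIV. \<Sum>\<beta>\<in>multi m. cmod (a (k i) m j \<beta> - l m j \<beta>))" for i m
  have xE: "cmod (hform m (U (k i) - w) J z) \<le> E i m" if z: "z \<in> ball 0 1" for i m J z
  proof -
    have E0: "0 \<le> E i m" unfolding E_def by (intro sum_nonneg) auto
    have hd: "hform m (U (k i) - w) = hform m (U (k i)) + form_scale (- 1) (hform m w)"
      unfolding form_diff hform_add[OF hU holform_scale[OF hw]] hform_scale[OF hw] ..
    show ?thesis
    proof (cases "card J = 1")
      case True
      then obtain j where J: "J = {j}" by (auto simp: card_1_singleton_iff)
      have "hform m (U (k i) - w) J z = (\<Sum>\<beta>\<in>multi m. (a (k i) m j \<beta> - l m j \<beta>) * cmonom \<beta> z)"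
        unfolding hd J using z by (simp add: hform_def form_scale_def pw a V_def left_diff_distrib sum_subtractf)
      also have "cmod \<dots> \<le> (\<Sum>\<beta>\<in>multi m. cmod (a (k i) m j \<beta> - l m j \<beta>))"
        using cmonom_le_1[OF z] by (intro sum_norm_le) (simp add: norm_mult mult_left_le)
      also have "\<dots> \<le> E i m"
        unfolding E_def by (rule member_le_sum[of j UNIV "\<lambda>j. \<Sum>\<beta>\<in>multi m. cmod (a (k i) m j \<beta> - l m j \<beta>)"]) (auto intro: sum_nonneg)
      finally show ?thesis .
    next
      case False
      then have "hform m (U (k i) - w) J z = 0"
        using holform_hform[OF hx, of m "k i"] by (simp add: holform_def formal_def)
      then show ?thesis using E0 by simp
    qed
  qed
  obtain C1 where C1: "\<And>u M. holform 1 u \<Longrightarrow> (\<And>J z. z \<in> ball 0 1 \<Longrightarrow> cmod (u J z) \<le> M) \<Longrightarrow> nsq \<alpha> (u :: 'n form) \<le> C1 * M\<^sup>2"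
    using nsq_sup_bound[OF \<alpha>] by blast
  have lim0: "(\<lambda>i. nsq \<alpha> (hform m (U (k i) - w))) \<longlonglongrightarrow> 0" for m
  proof (rule tendsto_sandwich[OF _ _ tendsto_const])
    have "(\<lambda>i. E i m) \<longlonglongrightarrow> (\<Sum>j\<in>(UNIV :: 'n set). \<Sum>\<beta>\<in>(multi m :: ('n \<Rightarrow> nat) set). 0)"
      unfolding E_def by (intro tendsto_sum tendsto_norm_zero LIM_zero l)
    then have "(\<lambda>i. C1 * (E i m)\<^sup>2) \<longlonglongrightarrow> C1 * 0\<^sup>2" by (intro tendsto_intros) simp
    then show "(\<lambda>i. C1 * (E i m)\<^sup>2) \<longlonglongrightarrow> 0" by simp
    show "\<forall>\<^sub>F i in sequentially. nsq \<alpha> (hform m (U (k i) - w)) \<le> C1 * (E i m)\<^sup>2"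
      by (intro always_eventually allI C1 holform_hform hx xE)
    show "\<forall>\<^sub>F i in sequentially. 0 \<le> nsq \<alpha> (hform m (U (k i) - w))"
      by (intro always_eventually allI nsq_nonneg[OF _ hform_A2[OF \<alpha> hx]]) simp
  qed
  \<comment> \<open>Each part of \<open>w\<close> is that of \<open>U (k i)\<close> minus that of
    the difference, and the latter tends to zero on finitely many degrees. The factor
    \<open>2\<close> comes from the parallelogram inequality and is harmless, since only boundedness
    is used.\<close>
  have sumw: "(\<Sum>m<L. nsq \<alpha> (hform m w)) \<le> 2 * B" for L
  proof -
    have le: "(\<Sum>m<L. nsq \<alpha> (hform m w)) \<le> 2 * B + 2 * (\<Sum>m<L. nsq \<alpha> (hform m (U (k i) - w)))" for i
    proof -
      have "(\<Sum>m<L. nsq \<alpha> (hform m w)) \<le> (\<Sum>m<L. 2 * nsq \<alpha> (hform m (U (k i))) + 2 * nsq \<alpha> (hform m (U (k i) - w)))"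
      proof (rule sum_mono)
        fix m
        have "hform m w = hform m (U (k i)) + form_scale (- 1) (hform m (U (k i) - w))"
          unfolding form_diff hform_add[OF hU holform_scale[OF hw]] hform_scale[OF hw] by (simp add: fun_eq_iff form_scale_def)
        then have "nsq \<alpha> (hform m w) \<le> 2 * nsq \<alpha> (hform m (U (k i))) + 2 * nsq \<alpha> (form_scale (- 1) (hform m (U (k i) - w)))"
          using nsq_add_le[OF \<alpha>, of 1 "hform m (U (k i))" "form_scale (- 1) (hform m (U (k i) - w))"]
            hform_A2[OF \<alpha> hU, of m] A2_scale[OF hform_A2[OF \<alpha> hx]] by simp
        then show "nsq \<alpha> (hform m w) \<le> 2 * nsq \<alpha> (hform m (U (k i))) + 2 * nsq \<alpha> (hform m (U (k i) - w))"
          by (simp add: nsq_scale)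
      qed
      also have "\<dots> = 2 * (\<Sum>m<L. nsq \<alpha> (hform m (U (k i)))) + 2 * (\<Sum>m<L. nsq \<alpha> (hform m (U (k i) - w)))"
        by (simp add: sum.distrib sum_distrib_left)
      also have "\<dots> \<le> 2 * B + 2 * (\<Sum>m<L. nsq \<alpha> (hform m (U (k i) - w)))"
        using parseval_le[OF \<alpha> _ U[of "k i"], of L] B[of "k i"] by simp
      finally show ?thesis .
    qed
    have "(\<lambda>i. 2 * B + 2 * (\<Sum>m<L. nsq \<alpha> (hform m (U (k i) - w)))) \<longlonglongrightarrow> 2 * B + 2 * (\<Sum>m<L. 0)"
      by (intro tendsto_intros lim0)
    then have "(\<lambda>i. 2 * B + 2 * (\<Sum>m<L. nsq \<alpha> (hform m (U (k i) - w)))) \<longlonglongrightarrow> 2 * B" by simp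
    then show ?thesis by (rule LIMSEQ_le_const) (use le in auto)
  qed
  have "0 \<le> nsq \<alpha> (hform m w)" for m by (rule nsq_nonneg[OF _ hform_A2[OF \<alpha> hw]]) simp
  then have s: "summable (\<lambda>m. nsq \<alpha> (hform m w))" by (rule summableI_nonneg_bounded[OF _ sumw])
  have "w \<in> A2 \<alpha> 1" "nsq \<alpha> w \<le> 2 * B"
    using A2_of_summable[OF \<alpha> _ hw s] suminf_le_const[OF s sumw] by auto
  then show ?thesis using k(1) lim0 by blast
qed

lemma smult_form_compact:
  fixes U :: "nat \<Rightarrow> 'n::{finite,linorder} form"
  assumes \<alpha>: "\<alpha> > 0" and U: "\<And>i. U i \<in> A2 \<alpha> 1" and B: "\<And>i. nsq \<alpha> (U i) \<le> B"
    and c: "c \<longlonglongrightarrow> 0" and K: "\<And>m. cmod (c m) \<le> K"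
  shows "\<exists>v\<in>A2 \<alpha> 1. \<exists>k. strict_mono (k :: nat \<Rightarrow> nat) \<and> (\<lambda>i. form_norm \<alpha> (smult_form c (U (k i)) - v)) \<longlonglongrightarrow> 0"
proof -
  obtain k w where k: "strict_mono k" and w: "w \<in> A2 \<alpha> 1" "nsq \<alpha> w \<le> 2 * B"
    and lim: "\<And>m. (\<lambda>i. nsq \<alpha> (hform m (U (k i) - w))) \<longlonglongrightarrow> 0"
    using weakly_convergent_subsequence[of \<alpha> U B, OF \<alpha> U B] by blast
  have h: "holform 1 (U i)" "holform 1 w" for i using U w by (auto simp: A2_iff)
  have x: "U (k i) - w \<in> A2 \<alpha> 1" for i by (intro A2_diff \<alpha> U w) simp
  \<comment> \<open>The constant is \<open>2 * B\<close> from \<open>U (k i)\<close> and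
    \<open>2 * (2 * B)\<close> from \<open>w\<close>.\<close>
  have "nsq \<alpha> (U (k i) - w) \<le> 6 * B" for i
  proof -
    have "nsq \<alpha> (U (k i) - w) \<le> 2 * nsq \<alpha> (U (k i)) + 2 * nsq \<alpha> (form_scale (- 1) w)"
      unfolding form_diff by (rule nsq_add_le[OF \<alpha> _ U A2_scale[OF w(1)]]) simp
    then show ?thesis using B[of "k i"] w(2) by (simp add: nsq_scale)
  qed
  from smult_form_tendsto[OF \<alpha> _ x this lim c K]
  have "(\<lambda>i. sqrt (nsq \<alpha> (smult_form c (U (k i) - w)))) \<longlonglongrightarrow> sqrt 0" by (intro tendsto_real_sqrt) simp
  moreover have "smult_form c (U (k i) - w) = smult_form c (U (k i)) - smult_form c w" for i
    unfolding form_diff smult_form_add[OF K h(1) holform_scale[OF h(2)]] smult_form_scale[OF K h(2)] ..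
  ultimately have "(\<lambda>i. form_norm \<alpha> (smult_form c (U (k i)) - smult_form c w)) \<longlonglongrightarrow> 0"
    by (simp add: form_norm_nsq)
  moreover have "smult_form c w \<in> A2 \<alpha> 1" by (rule nsq_smult_form(1)[OF \<alpha> _ w(1) K]) simp
  ultimately show ?thesis using k by blast
qed

section \<open>The canonical solution operator\<close>

lemma nsq_function_integral:
  fixes f :: "'n::{finite,linorder} form"
  assumes f: "f \<in> A2 \<alpha> 0"
  shows "(LINT z:ball 0 1|lborel. (cmod (f {} z))\<^sup>2 / (1 - (norm z)\<^sup>2) ^ (CARD('n) + 1) * exp (- (\<alpha> / (1 - (norm z)\<^sup>2)))) = nsq \<alpha> f"
proof -
  have "formal 0 f" using f by (simp add: A2_iff holform_def)
  then have "Re (dens \<alpha> f f z) = (cmod (f {} z))\<^sup>2 / (1 - (norm z)\<^sup>2) ^ (CARD('n) + 1) * exp (- (\<alpha> / (1 - (norm z)\<^sup>2)))" for z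
    by (simp add: dens_def pointwise_inner_0 weight_def complex_mult_cnj cmod_power2 del: power_Suc)
  then show ?thesis
    using Re_finner(1)[of 1 \<alpha> f f] f by (simp add: A2_iff nsq_def form_inner_finner)
qed

text \<open>The bracket is the cometric pairing without its factor \<open>1 - |z|^2\<close>; that
  factor lowers the exponent of the volume density from \<open>CARD('n) + 1\<close> to
  \<open>CARD('n)\<close>.\<close>

lemma nsq_1_form_integral:
  fixes \<eta> :: "'n::{finite,linorder} form"
  assumes \<eta>: "\<eta> \<in> A2 \<alpha> 1"
  shows "(LINT z:ball 0 1|lborel. ((\<Sum>j\<in>UNIV. (cmod (\<eta> {j} z))\<^sup>2)
      - Re (\<Sum>j\<in>UNIV. \<Sum>k\<in>UNIV. \<eta> {j} z * cnj (\<eta> {k} z) * z $ j * cnj (z $ k)))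
      / (1 - (norm z)\<^sup>2) ^ CARD('n) * exp (- (\<alpha> / (1 - (norm z)\<^sup>2)))) = nsq \<alpha> \<eta>"
proof -
  have f: "formal 1 \<eta>" using \<eta> by (simp add: A2_iff holform_def)
  have eq: "((\<Sum>j\<in>UNIV. (cmod (\<eta> {j} z))\<^sup>2)
      - Re (\<Sum>j\<in>UNIV. \<Sum>k\<in>UNIV. \<eta> {j} z * cnj (\<eta> {k} z) * z $ j * cnj (z $ k)))
      / (1 - (norm z)\<^sup>2) ^ CARD('n) * exp (- (\<alpha> / (1 - (norm z)\<^sup>2))) = Re (dens \<alpha> \<eta> \<eta> z)"
    if z: "z \<in> ball 0 1" for z :: "complex^'n::{finite,linorder}"
  proof -
    have s: "(\<Sum>j\<in>UNIV. \<Sum>k\<in>UNIV. \<eta> {j} z * cnj (\<eta> {k} z) * z $ j * cnj (z $ k))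
        = (\<Sum>j\<in>UNIV. z $ j * \<eta> {j} z) * cnj (\<Sum>j\<in>UNIV. z $ j * \<eta> {j} z)"
      by (simp add: sum_product mult_ac)
    have "Re (\<Sum>j\<in>UNIV. \<eta> {j} z * cnj (\<eta> {j} z)) = (\<Sum>j\<in>UNIV. (cmod (\<eta> {j} z))\<^sup>2)"
      by (simp only: complex_norm_square[symmetric] Re_sum Re_complex_of_real)
    then have p: "Re (pointwise_inner \<eta> \<eta> z) = radial z * ((\<Sum>j\<in>UNIV. (cmod (\<eta> {j} z))\<^sup>2)
      - Re (\<Sum>j\<in>UNIV. \<Sum>k\<in>UNIV. \<eta> {j} z * cnj (\<eta> {k} z) * z $ j * cnj (z $ k)))"
      unfolding pointwise_inner_1[OF f f z] s by simp
    have w: "weight \<alpha> z * radial z = exp (- (\<alpha> / (1 - (norm z)\<^sup>2))) / (1 - (norm z)\<^sup>2) ^ CARD('n)"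
      using radial_pos[OF z] by (simp add: weight_def radial_def)
    have "Re (dens \<alpha> \<eta> \<eta> z) = weight \<alpha> z * Re (pointwise_inner \<eta> \<eta> z)" by (simp add: dens_def)
    then show ?thesis unfolding p mult.assoc[symmetric] w by simp
  qed
  have "(LINT z:ball 0 1|lborel. Re (dens \<alpha> \<eta> \<eta> z)) = nsq \<alpha> \<eta>"
    using Re_finner(1)[of 1 \<alpha> \<eta> \<eta>] \<eta> by (simp add: A2_iff nsq_def form_inner_finner)
  moreover have "(LINT z:ball 0 1|lborel. ((\<Sum>j\<in>UNIV. (cmod (\<eta> {j} z))\<^sup>2)
      - Re (\<Sum>j\<in>UNIV. \<Sum>k\<in>UNIV. \<eta> {j} z * cnj (\<eta> {k} z) * z $ j * cnj (z $ k)))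
      / (1 - (norm z)\<^sup>2) ^ CARD('n) * exp (- (\<alpha> / (1 - (norm z)\<^sup>2)))) = (LINT z:ball 0 1|lborel. Re (dens \<alpha> \<eta> \<eta> z))"
    by (rule set_lebesgue_integral_cong) (use eq in auto)
  ultimately show ?thesis by (rule trans[rotated])
qed

lemma constant_coefficients_iff:
  fixes \<eta> :: "'n::{finite,linorder} form"
  assumes \<eta>: "holform 1 \<eta>"
  shows "(\<forall>m. m \<noteq> 0 \<longrightarrow> hform m \<eta> = 0) \<longleftrightarrow> (\<forall>j. \<exists>c. \<forall>z\<in>ball 0 1. \<eta> {j} z = c)"
proof (intro iffI allI impI)
  fix j assume h: "\<forall>m. m \<noteq> 0 \<longrightarrow> hform m \<eta> = 0"
  have "\<eta> {j} z = \<eta> {j} 0" if z: "z \<in> ball 0 1" for z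
  proof -
    have "hpart m (\<eta> {j}) z = (if m = 0 then hpart m (\<eta> {j}) z else 0)" for m
    proof (cases "m = 0")
      case False
      then have "hform m \<eta> {j} z = 0" using h by simp
      then show ?thesis using z False by (simp add: hform_def)
    qed simp
    then have "(\<lambda>m. hpart m (\<eta> {j}) z) = (\<lambda>m. if m = 0 then hpart m (\<eta> {j}) z else 0)" by blast
    then have "(\<lambda>m. hpart m (\<eta> {j}) z) sums hpart 0 (\<eta> {j}) z"
      using sums_single[of 0 "\<lambda>m. hpart m (\<eta> {j}) z"] by simp
    moreover have "(\<lambda>m. hpart m (\<eta> {j}) z) sums \<eta> {j} z"
      using hpart_sums[OF _ z] \<eta> by (simp add: holform_def)
    ultimately have "\<eta> {j} z = hpart 0 (\<eta> {j}) z" by (rule sums_unique2[rotated])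
    then show ?thesis by simp
  qed
  then show "\<exists>c. \<forall>z\<in>ball 0 1. \<eta> {j} z = c" by blast
next
  fix m :: nat assume c: "\<forall>j. \<exists>c. \<forall>z\<in>ball 0 1. \<eta> {j} z = c" and m: "m \<noteq> 0"
  have "hpart m (\<eta> J) = (\<lambda>z. 0)" for J
  proof (cases "card J = 1")
    case True
    then obtain j where J: "J = {j}" by (auto simp: card_1_singleton_iff)
    from c obtain a where "\<forall>z\<in>ball 0 1. \<eta> {j} z = a" by blast
    then have "hpart m (\<eta> {j}) = hpart m (\<lambda>z. a)" by (intro hpart_cong) auto
    then show ?thesis using m hpart_of_hpoly[OF hpoly_const, of m a] by (simp add: J)
  next
    case False
    then show ?thesis by (simp add: holform_zero_coeff[OF \<eta>] hpart_zero)
  qed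
  then show "hform m \<eta> = 0" by (simp add: hform_def fun_eq_iff)
qed

section \<open>The inverse of the Laplacian\<close>

text \<open>The lowest eigenvalue is \<open>\<alpha>\<close>, so the gap at the origin is
  \<open>\<alpha>\<close> and the general resolvent bound \<open>1 / \<delta>\<close> becomes the
  norm bound for \<open>N1\<close>.\<close>

lemma box1_resolvent_0:
  assumes "\<alpha> > 0"
  shows "box1_resolvent \<alpha> 0 \<alpha>"
proof
  show "\<alpha> \<le> cmod (of_real (\<alpha> * real (Suc m)) - 0)" for m
    using assms mult_left_mono[of 1 "real (Suc m)" \<alpha>] by (simp add: norm_mult del: of_nat_Suc)
qed (use assms in auto)

lemma box1_shift_0: "(\<lambda>u. box1 \<alpha> u - form_scale 0 u) = box1 \<alpha>"
  by (simp add: fun_eq_iff form_scale_def)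

context
  fixes \<alpha> :: real
  assumes \<alpha>: "\<alpha> > 0"
begin

interpretation box1_resolvent \<alpha> 0 \<alpha> by (rule box1_resolvent_0[OF \<alpha>])

lemmas box1_bij = resolvent_bij[unfolded box1_shift_0]

lemmas N1_bounded = resolvent_bounded[unfolded box1_shift_0, folded N1_def]

lemma N1_eq: "\<eta> \<in> A2 \<alpha> 1 \<Longrightarrow> N1 \<alpha> \<eta> = smult_form coef \<eta>"
  using resolvent_inverse unfolding box1_shift_0 N1_def by blast

lemma N1_dom: "\<eta> \<in> A2 \<alpha> 1 \<Longrightarrow> N1 \<alpha> \<eta> \<in> dom_box1 \<alpha>"
  using resolvent_dom by (simp add: N1_eq del: One_nat_def)

lemma box1_N1: "\<eta> \<in> A2 \<alpha> 1 \<Longrightarrow> box1 \<alpha> (N1 \<alpha> \<eta>) = \<eta>"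
  using resolvent_right[of \<eta>] fun_cong[OF box1_shift_0[of \<alpha>], of "smult_form coef \<eta>"] by (simp add: N1_eq del: One_nat_def)

lemma N1_norm: "u \<in> A2 \<alpha> 1 \<Longrightarrow> form_norm \<alpha> (N1 \<alpha> u) \<le> 1 / \<alpha> * form_norm \<alpha> u"
  using smult_norm by (simp add: N1_eq del: One_nat_def)

lemma hform_N1: "\<eta> \<in> A2 \<alpha> 1 \<Longrightarrow> hform m (N1 \<alpha> \<eta>) = form_scale (coef m) (hform m \<eta>)"
  using smult_form(2)[OF _ coef_bound, of 1 \<eta> m] by (simp add: N1_eq A2_holform del: One_nat_def)

lemma N1_compact: "compact_operator_on \<alpha> (A2 \<alpha> 1) (N1 \<alpha> :: 'n::{finite,linorder} form \<Rightarrow> 'n form)"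
  unfolding compact_operator_on_def
proof (intro conjI allI impI N1_bounded)
  fix u :: "nat \<Rightarrow> 'n form" assume "(\<forall>i. u i \<in> A2 \<alpha> 1) \<and> (\<exists>C. \<forall>i. form_norm \<alpha> (u i) \<le> C)"
  then obtain C where u: "\<And>i. u i \<in> A2 \<alpha> 1" and C: "\<And>i. form_norm \<alpha> (u i) \<le> C" by blast
  have B: "nsq \<alpha> (u i) \<le> C\<^sup>2" for i
  proof -
    have nn: "0 \<le> nsq \<alpha> (u i)" by (rule nsq_nonneg[OF _ u]) simp
    then have "(sqrt (nsq \<alpha> (u i)))\<^sup>2 \<le> C\<^sup>2" using C[of i] by (intro power_mono) (simp_all add: form_norm_nsq)
    then show ?thesis using nn by simp
  qed
  have "(\<lambda>m. 1 / \<alpha> * inverse (real (Suc m))) \<longlonglongrightarrow> 1 / \<alpha> * 0"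
    by (intro tendsto_intros LIMSEQ_inverse_real_of_nat)
  then have "(\<lambda>m. complex_of_real (1 / \<alpha> * inverse (real (Suc m)))) \<longlonglongrightarrow> of_real (1 / \<alpha> * 0)" by (rule tendsto_of_real)
  moreover have "coef = (\<lambda>m. complex_of_real (1 / \<alpha> * inverse (real (Suc m))))"
    by (simp add: fun_eq_iff coef_def field_simps)
  ultimately have "coef \<longlonglongrightarrow> 0" by simp
  from smult_form_compact[of \<alpha> u "C\<^sup>2", OF \<alpha> u B this coef_bound]
  show "\<exists>v\<in>A2 \<alpha> 1. \<exists>r. strict_mono (r :: nat \<Rightarrow> nat) \<and> (\<lambda>i. form_norm \<alpha> (N1 \<alpha> (u (r i)) - v)) \<longlonglongrightarrow> 0"
    by (simp only: N1_eq[OF u])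
qed

section \<open>The canonical solution for a closed form\<close>

context
  fixes \<eta> f :: "'n::{finite,linorder} form"
  assumes \<eta>: "\<eta> \<in> A2 \<alpha> 1" "del \<eta> = 0"
  defines "f \<equiv> del_adj \<alpha> 0 (N1 \<alpha> \<eta>)"
begin

lemma canonical_solution_eq: "f = form_scale \<alpha> (iota (N1 \<alpha> \<eta>))"
  unfolding f_def by (rule del_adj_eq[OF \<alpha>]) (use N1_dom[OF \<eta>(1)] in \<open>auto simp: dom_box1_def\<close>)

text \<open>\<open>N1\<close> acts on every part by a scalar and \<open>del\<close> respects the
  grading, so closedness is preserved degree by degree.\<close>

lemma del_N1: "del (N1 \<alpha> \<eta>) = 0"
proof -
  have h: "holform 1 (N1 \<alpha> \<eta>)" "holform 1 \<eta>"
    using N1_dom[OF \<eta>(1)] \<eta>(1) by (auto simp: dom_box1_iff[OF \<alpha>] A2_iff)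
  have "hform m (del (N1 \<alpha> \<eta>)) = 0" for m
    unfolding hform_del[OF h(1)] hform_N1[OF \<eta>(1)] del_scale[OF holform_hform[OF h(2)]] del_hform[OF h(2)] \<eta>(2)
    by (simp add: hform_0 form_scale_def fun_eq_iff)
  then show ?thesis by (intro holform_eqI[OF holform_del[OF h(1)] holform_0]) (simp add: hform_0)
qed

text \<open>As \<open>N1 \<alpha> \<eta>\<close> is closed, only the first summand of the Laplacian
  acts on it, and the Laplacian returns \<open>\<eta>\<close>.\<close>

lemma del_canonical_solution: "del f = \<eta>"
proof -
  have i: "holform 0 (iota (N1 \<alpha> \<eta>))" using N1_dom[OF \<eta>(1)] by (simp add: dom_box1_iff[OF \<alpha>] A2_iff)
  have "\<eta> = form_scale \<alpha> (del (iota (N1 \<alpha> \<eta>)))"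
    using box1_eq[OF \<alpha> N1_dom[OF \<eta>(1)]] by (simp add: box1_N1[OF \<eta>(1)] del_N1 iota_zero)
  then show ?thesis unfolding canonical_solution_eq del_scale[OF i] ..
qed

lemma canonical_solution_dom: "f \<in> dom_del \<alpha> 0"
  unfolding dom_del_def mem_Collect_eq del_canonical_solution
  using \<eta>(1) N1_dom[OF \<eta>(1)] by (auto simp: canonical_solution_eq dom_box1_iff[OF \<alpha>] intro: A2_scale)

text \<open>\<open>f\<close> lies in the range of the adjoint, which is orthogonal to the
  kernel.\<close>

lemma canonical_solution_orthogonal:
  assumes g: "g \<in> dom_del \<alpha> 0" "del g = 0"
  shows "form_inner \<alpha> f g = 0"
proof -
  have "form_inner \<alpha> g f = form_inner \<alpha> (del g) (N1 \<alpha> \<eta>)"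
    unfolding canonical_solution_eq
    by (rule del_adjoint_iota[OF \<alpha> _ g(1), symmetric]) (use N1_dom[OF \<eta>(1)] in \<open>auto simp: dom_box1_iff[OF \<alpha>]\<close>)
  also have "\<dots> = 0" unfolding g(2) form_inner_zero_left ..
  finally have "form_inner \<alpha> g f = 0" .
  moreover have "cnj (form_inner \<alpha> g f) = form_inner \<alpha> f g"
    by (rule form_inner_cnj[of 0]) (use g canonical_solution_dom in \<open>auto simp: dom_del_def A2_iff\<close>)
  ultimately show ?thesis by simp
qed

text \<open>The defect of the estimate as a series of nonnegative terms. Degree \<open>m\<close> of
  \<open>\<eta>\<close> is the differential of degree \<open>Suc m\<close> of \<open>f\<close>, so
  \<open>\<alpha>\<close> times the squared norm of the latter is that of the former divided by
  \<open>Suc m\<close>, leaving the fraction \<open>1 - 1 / Suc m\<close>.\<close>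

lemma nsq_canonical_solution:
  "(\<lambda>m. real m / real (Suc m) * nsq \<alpha> (hform m \<eta>)) sums (nsq \<alpha> \<eta> - \<alpha> * nsq \<alpha> f)"
proof -
  have fA: "f \<in> A2 \<alpha> 0" and hf: "holform 0 f" using canonical_solution_dom by (auto simp: dom_del_def A2_iff)
  \<comment> \<open>Constants are closed, so orthogonality to the kernel removes the part of
    \<open>f\<close> of degree zero; no other degree of \<open>f\<close> is missed by its
    differential.\<close>
  have "del (hform 0 f) = 0" unfolding del_hform[OF hf] by simp
  then have "form_inner \<alpha> f (hform 0 f) = 0"
    by (rule canonical_solution_orthogonal[OF hform_dom_del[OF \<alpha> hf]])
  then have "form_inner \<alpha> (hform 0 f) f = 0"
    using form_inner_cnj[OF _ hf holform_hform[OF hf], of \<alpha> 0] by simp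
  then have 0: "nsq \<alpha> (hform 0 f) = 0"
    unfolding nsq_def form_inner_hform[OF \<alpha> _ hf fA, of 0, simplified] by simp
  have step: "nsq \<alpha> (hform m \<eta>) = \<alpha> * real (Suc m) * nsq \<alpha> (hform (Suc m) f)" for m
    using nsq_del_hform_0[OF \<alpha> hf, of "Suc m"] hform_del[OF hf, of m] by (simp only: del_canonical_solution)
  have "(\<lambda>m. nsq \<alpha> (hform (Suc m) f)) sums nsq \<alpha> f"
    using parseval[OF \<alpha> _ fA] sums_Suc_iff[of "\<lambda>m. nsq \<alpha> (hform m f)" "nsq \<alpha> f"] by (simp add: 0)
  then have "(\<lambda>m. nsq \<alpha> (hform m \<eta>) - \<alpha> * nsq \<alpha> (hform (Suc m) f)) sums (nsq \<alpha> \<eta> - \<alpha> * nsq \<alpha> f)"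
    by (intro sums_diff sums_mult parseval[OF \<alpha> _ \<eta>(1)]) simp
  moreover have "nsq \<alpha> (hform m \<eta>) - \<alpha> * nsq \<alpha> (hform (Suc m) f) = real m / real (Suc m) * nsq \<alpha> (hform m \<eta>)" for m
    unfolding step by (simp add: field_simps)
  ultimately show ?thesis by simp
qed

text \<open>The factor \<open>m / Suc m\<close> vanishes only for \<open>m = 0\<close>, so equality
  forces all parts of \<open>\<eta>\<close> of positive degree to be zero.\<close>

lemma canonical_solution_estimate:
  "nsq \<alpha> f \<le> 1 / \<alpha> * nsq \<alpha> \<eta>"
  "nsq \<alpha> f = 1 / \<alpha> * nsq \<alpha> \<eta> \<longleftrightarrow> (\<forall>j. \<exists>c. \<forall>z\<in>ball 0 1. \<eta> {j} z = c)"
proof -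
  have hA: "hform m \<eta> \<in> A2 \<alpha> 1" for m using \<eta>(1) by (intro hform_A2[OF \<alpha>]) (simp add: A2_iff)
  have nn: "0 \<le> real m / real (Suc m) * nsq \<alpha> (hform m \<eta>)" for m
    by (intro mult_nonneg_nonneg nsq_nonneg[OF _ hA]) simp_all
  note s = nsq_canonical_solution
  have "0 \<le> nsq \<alpha> \<eta> - \<alpha> * nsq \<alpha> f" by (rule sums_le[OF nn sums_zero s])
  then show "nsq \<alpha> f \<le> 1 / \<alpha> * nsq \<alpha> \<eta>" using \<alpha> by (simp add: field_simps)
  have "nsq \<alpha> f = 1 / \<alpha> * nsq \<alpha> \<eta> \<longleftrightarrow> nsq \<alpha> \<eta> - \<alpha> * nsq \<alpha> f = 0" using \<alpha> by (auto simp: field_simps)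
  also have "\<dots> \<longleftrightarrow> (\<forall>m. real m / real (Suc m) * nsq \<alpha> (hform m \<eta>) = 0)"
    using suminf_eq_zero_iff[OF sums_summable[OF s] nn] sums_unique[OF s] by simp
  also have "\<dots> \<longleftrightarrow> (\<forall>m. m \<noteq> 0 \<longrightarrow> hform m \<eta> = 0)"
  proof (intro arg_cong[where f = All] ext)
    show "(real m / real (Suc m) * nsq \<alpha> (hform m \<eta>) = 0) = (m \<noteq> 0 \<longrightarrow> hform m \<eta> = 0)" for m
      using nsq_eq_0[OF \<alpha> _ hA[of m]] by (cases "m = 0") (auto simp: nsq_zero)
  qed
  also have "\<dots> \<longleftrightarrow> (\<forall>j. \<exists>c. \<forall>z\<in>ball 0 1. \<eta> {j} z = c)"
    using \<eta>(1) by (intro constant_coefficients_iff) (simp add: A2_iff)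
  finally show "nsq \<alpha> f = 1 / \<alpha> * nsq \<alpha> \<eta> \<longleftrightarrow> (\<forall>j. \<exists>c. \<forall>z\<in>ball 0 1. \<eta> {j} z = c)" .
qed

end

text \<open>The differential of a coordinate has constant coefficients, hence is closed and attains
  equality in the estimate. Its positive norm allows the division that proves sharpness.\<close>

lemma extremal_form:
  "\<exists>\<eta> :: 'n::{finite,linorder} form. \<eta> \<in> A2 \<alpha> 1 \<and> del \<eta> = 0 \<and> 0 < nsq \<alpha> \<eta> \<and> (\<forall>j. \<exists>c. \<forall>z\<in>ball 0 1. \<eta> {j} z = c)"
proof -
  obtain j :: 'n where "True" by blast
  let ?\<eta> = "bform ((\<lambda>_. 0), j) :: 'n form"
  have x: "((\<lambda>_. 0), j) \<in> multi 0 \<times> UNIV" by (simp add: multi_def)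
  note h = bform_hform[OF x]
  have A: "?\<eta> \<in> A2 \<alpha> 1" using hform_A2[OF \<alpha> h(1), of 0] by (simp only: h(2))
  have "del ?\<eta> = 0" using del_hform[OF h(1), of 0] by (simp add: h(2))
  moreover have "?\<eta> {j} 0 \<noteq> 0" by (simp add: bform_def cmonom_def)
  then have "?\<eta> \<noteq> 0" by auto
  then have "0 < nsq \<alpha> ?\<eta>" using nsq_eq_0[OF \<alpha> _ A] nsq_nonneg[OF _ A] by (force simp: less_le)
  moreover have "\<forall>i. \<exists>c. \<forall>z\<in>ball 0 1. ?\<eta> {i} z = c" by (auto simp: bform_def cmonom_def)
  ultimately show ?thesis using A by blast
qed

end

theorem theorem5p2:
  fixes \<alpha> :: real
  assumes "\<alpha> > 0"
  shows
    "let n = CARD('n::{finite,linorder});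
         N = (N1 \<alpha> :: 'n form \<Rightarrow> 'n form);
         lhs = (\<lambda>f :: 'n form. LINT z:ball 0 1|lborel.
           (cmod (f {} z))\<^sup>2 / (1 - (norm z)\<^sup>2) ^ (n + 1) * exp (- (\<alpha> / (1 - (norm z)\<^sup>2))));
         rhs = (\<lambda>\<eta> :: 'n form. LINT z:ball 0 1|lborel.
           ((\<Sum>j\<in>UNIV. (cmod (\<eta> {j} z))\<^sup>2)
             - Re (\<Sum>j\<in>UNIV. \<Sum>k\<in>UNIV. \<eta> {j} z * cnj (\<eta> {k} z) * z $ j * cnj (z $ k)))
           / (1 - (norm z)\<^sup>2) ^ n * exp (- (\<alpha> / (1 - (norm z)\<^sup>2))))
     in bij_betw (box1 \<alpha>) (dom_box1 \<alpha> :: 'n form set) (A2 \<alpha> 1)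
      \<and> bounded_operator_on \<alpha> (A2 \<alpha> 1) N
      \<and> compact_operator_on \<alpha> (A2 \<alpha> 1) N
      \<and> op_spectrum \<alpha> (A2 \<alpha> 1) (dom_box1 \<alpha> :: 'n form set) (box1 \<alpha>)
          = {complex_of_real (\<alpha> * real k) | k. k \<ge> 1}
      \<and> (\<forall>k\<ge>1. vector_space.dim form_scale
            (eigenspace (dom_box1 \<alpha> :: 'n form set) (box1 \<alpha>) (complex_of_real (\<alpha> * real k)))
            = n * ((n + k - 2) choose (n - 1)))
      \<and> (\<forall>u \<in> A2 \<alpha> 1. form_norm \<alpha> (N u) \<le> 1 / \<alpha> * form_norm \<alpha> u)
      \<and> (\<forall>\<eta> \<in> A2 \<alpha> 1. del \<eta> = 0 \<longrightarrow>
           (let f = del_adj \<alpha> 0 (N \<eta>) in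
              f \<in> dom_del \<alpha> 0 \<and> del f = \<eta>
              \<and> (\<forall>g \<in> dom_del \<alpha> 0. del g = 0 \<longrightarrow> form_inner \<alpha> f g = 0)
              \<and> lhs f \<le> 1 / \<alpha> * rhs \<eta>
              \<and> (lhs f = 1 / \<alpha> * rhs \<eta> \<longleftrightarrow>
                   (\<forall>j. \<exists>c. \<forall>z \<in> ball 0 1. \<eta> {j} z = c))))
      \<and> (\<forall>C. (\<forall>\<eta> \<in> A2 \<alpha> 1. del \<eta> = 0 \<longrightarrow> lhs (del_adj \<alpha> 0 (N \<eta>)) \<le> C * rhs \<eta>) \<longrightarrow> 1 / \<alpha> \<le> C)"
proof -
  note \<alpha> = assms
  let ?N = "N1 \<alpha> :: 'n form \<Rightarrow> 'n form"
  let ?f = "\<lambda>\<eta>. del_adj \<alpha> 0 (?N \<eta>)"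
  let ?lhs = "\<lambda>f :: 'n form. LINT z:ball 0 1|lborel.
    (cmod (f {} z))\<^sup>2 / (1 - (norm z)\<^sup>2) ^ (CARD('n) + 1) * exp (- (\<alpha> / (1 - (norm z)\<^sup>2)))"
  let ?rhs = "\<lambda>\<eta> :: 'n form. LINT z:ball 0 1|lborel.
    ((\<Sum>j\<in>UNIV. (cmod (\<eta> {j} z))\<^sup>2)
      - Re (\<Sum>j\<in>UNIV. \<Sum>k\<in>UNIV. \<eta> {j} z * cnj (\<eta> {k} z) * z $ j * cnj (z $ k)))
    / (1 - (norm z)\<^sup>2) ^ CARD('n) * exp (- (\<alpha> / (1 - (norm z)\<^sup>2)))"
  have lhs: "?lhs (?f \<eta>) = nsq \<alpha> (?f \<eta>)" if "\<eta> \<in> A2 \<alpha> 1" "del \<eta> = 0" for \<eta>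
    using canonical_solution_dom[OF \<alpha> that] by (intro nsq_function_integral) (simp add: dom_del_def)
  note rhs = nsq_1_form_integral
  have dim: "vector_space.dim form_scale
      (eigenspace (dom_box1 \<alpha> :: 'n form set) (box1 \<alpha>) (complex_of_real (\<alpha> * real k)))
      = CARD('n) * ((CARD('n) + k - 2) choose (CARD('n) - 1))" if "1 \<le> k" for k
  proof -
    \<comment> \<open>The eigenvalue with index \<open>k\<close> belongs to polynomial degree
      \<open>k - 1\<close>, which turns the count for degree \<open>m\<close> into the binomial
      coefficient with \<open>k - 2\<close>.\<close>
    obtain m where k: "k = Suc m" using \<open>1 \<le> k\<close> by (cases k) auto
    have e: "CARD('n) + Suc m - 2 = CARD('n) + m - 1" by simp
    show ?thesis unfolding k dim_eigenspace[OF \<alpha>] e ..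
  qed
  have estimate: "?lhs (?f \<eta>) \<le> 1 / \<alpha> * ?rhs \<eta>"
    "?lhs (?f \<eta>) = 1 / \<alpha> * ?rhs \<eta> \<longleftrightarrow> (\<forall>j. \<exists>c. \<forall>z\<in>ball 0 1. \<eta> {j} z = c)"
    if \<eta>: "\<eta> \<in> A2 \<alpha> 1" "del \<eta> = 0" for \<eta>
    unfolding lhs[OF \<eta>] rhs[OF \<eta>(1)] by (rule canonical_solution_estimate[OF \<alpha> \<eta>])+
  have sharp: "1 / \<alpha> \<le> C" if C: "\<forall>\<eta>\<in>A2 \<alpha> 1. del \<eta> = 0 \<longrightarrow> ?lhs (?f \<eta>) \<le> C * ?rhs \<eta>" for C
  proof -
    \<comment> \<open>Testing an admissible \<open>C\<close> on a form with equality and nonzero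
      norm gives \<open>1 / \<alpha> \<le> C\<close> after cancelling the norm.\<close>
    obtain \<eta> :: "'n form" where \<eta>: "\<eta> \<in> A2 \<alpha> 1" "del \<eta> = 0" and pos: "0 < nsq \<alpha> \<eta>"
      and const: "\<forall>j. \<exists>c. \<forall>z\<in>ball 0 1. \<eta> {j} z = c"
      using extremal_form[OF \<alpha>, where 'n = 'n] by (elim exE conjE)
    have "1 / \<alpha> * nsq \<alpha> \<eta> = ?lhs (?f \<eta>)" using iffD2[OF estimate(2)[OF \<eta>] const] unfolding rhs[OF \<eta>(1)] by (rule sym)
    also have "\<dots> \<le> C * nsq \<alpha> \<eta>" using bspec[OF C \<eta>(1), THEN mp, OF \<eta>(2)] unfolding rhs[OF \<eta>(1)] .
    finally show ?thesis using pos by (rule mult_right_le_imp_le)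
  qed
  show ?thesis
    unfolding Let_def
    by (intro conjI ballI allI impI)
       (erule (1) estimate canonical_solution_dom[OF \<alpha>] del_canonical_solution[OF \<alpha>] | rule box1_bij[OF \<alpha>] N1_bounded[OF \<alpha>] N1_compact[OF \<alpha>] spectrum_box1[OF \<alpha>]
         N1_norm[OF \<alpha>] canonical_solution_orthogonal[OF \<alpha>] dim sharp | assumption)+
qed

end
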